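(* Let $n\ge 1$, let $1<q\le\infty$ and let $V\in B_q$ on $\mathbb{R}^n$. Then there is $\varepsilon>0$, depending only on $V$, such that for every $p$ with $1<p<q+\varepsilon$ there is a constant $C$ such that for all $u\in C_0^\infty(\mathbb{R}^n)$ $$\|\Delta u\|_{p}+\|Vu\|_{p}\le C\,\|-\Delta u+Vu\|_{p}.$$
   Context: $\|\cdot\|_p$ is the norm of $L^p(\mathbb{R}^n)$. For $1<q\le\infty$, $B_q$ is the class of reverse H\"older weights: $w\in B_q$ if $w\in L^q_{loc}(\mathbb{R}^n)$, $w>0$ almost everywhere, and there is a constant $C$ such that for every cube $Q\subset\mathbb{R}^n$, $\big(\frac1{|Q|}\int_Q w^q\,dx\big)^{1/q}\le \frac{C}{|Q|}\int_Q w\,dx$ (if $q=\infty$ the left side is the essential supremum of $w$ on $Q$). When $q=\infty$, $q+\varepsilon$ means $\infty$. *)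

theory Defs
  imports "HOL-Analysis.Analysis" "HOL-Probability.Essential_Supremum"
begin

text \<open>The extended \<open>L\<^sup>p\<close> norm: infinite exactly when a measurable \<open>f\<close> is not in \<open>L\<^sup>p(M)\<close>.
  It is meant for exponents \<open>1 \<le> p \<le> \<infinity>\<close>.\<close>

definition Lp_norm :: "'a measure \<Rightarrow> ereal \<Rightarrow> ('a \<Rightarrow> 'b::real_normed_vector) \<Rightarrow> ennreal" where
  "Lp_norm M p f =
    (if p = \<infinity> then esssup M (\<lambda>x. ennreal (norm (f x)))
     else let I = (\<integral>\<^sup>+ x. ennreal (norm (f x) powr real_of_ereal p) \<partial>M)
          in if I = \<infinity> then \<infinity> else ennreal (enn2real I powr (1 / real_of_ereal p)))"

definition Lp_loc :: "ereal \<Rightarrow> ('a::euclidean_space \<Rightarrow> real) set" where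
  "Lp_loc p = {f \<in> borel_measurable lebesgue.
     \<forall>K. compact K \<longrightarrow> Lp_norm (restrict_space lebesgue K) p f < \<infinity>}"

text \<open>Nondegenerate cubes with sides parallel to the axes; \<open>One\<close> is the vector all of whose
  coordinates are 1.\<close>

definition is_cube :: "'a::euclidean_space set \<Rightarrow> bool" where
  "is_cube Q \<longleftrightarrow> (\<exists>a l. 0 < l \<and> Q = cbox a (a + l *\<^sub>R One))"

text \<open>Left side of the reverse Hoelder inequality.  The coercion \<open>ennreal\<close> truncates negative
  values of \<open>w\<close>, which is harmless because the weights below are positive almost everywhere.\<close>

definition Lq_mean :: "ereal \<Rightarrow> 'a::euclidean_space set \<Rightarrow> ('a \<Rightarrow> real) \<Rightarrow> ennreal" where
  "Lq_mean q Q w =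
    (if q = \<infinity> then esssup (restrict_space lebesgue Q) (\<lambda>x. ennreal (w x))
     else ennreal ((1 / measure lebesgue Q * (LINT x:Q|lebesgue. w x powr real_of_ereal q))
                     powr (1 / real_of_ereal q)))"

definition reverse_Hoelder :: "ereal \<Rightarrow> ('a::euclidean_space \<Rightarrow> real) set" where
  "reverse_Hoelder q = {w \<in> Lp_loc q.
     (AE x in lebesgue. 0 < w x) \<and>
     (\<exists>C::real. \<forall>Q. is_cube Q \<longrightarrow>
        Lq_mean q Q w \<le> ennreal (C / measure lebesgue Q * (LINT x:Q|lebesgue. w x)))}"

text \<open>The class \<open>C\<^sup>k\<close> on the whole space: a function is \<open>C\<close> of order \<open>k + 1\<close> iff it is differentiable
  and all its directional derivatives are \<open>C\<^sup>k\<close>.\<close>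

primrec Ck :: "nat \<Rightarrow> ('a::euclidean_space \<Rightarrow> 'b::real_normed_vector) \<Rightarrow> bool" where
  "Ck 0 f \<longleftrightarrow> continuous_on UNIV f"
| "Ck (Suc k) f \<longleftrightarrow>
     (\<forall>x. f differentiable (at x)) \<and> (\<forall>v. Ck k (\<lambda>x. frechet_derivative f (at x) v))"

definition test_functions :: "('a::euclidean_space \<Rightarrow> 'b::real_normed_vector) set" where
  "test_functions = {u. (\<forall>k. Ck k u) \<and> compact (closure {x. u x \<noteq> 0})}"

definition laplacian ::
    "('a::euclidean_space \<Rightarrow> 'b::real_normed_vector) \<Rightarrow> 'a \<Rightarrow> 'b" where
  "laplacian f x =
     (\<Sum>b\<in>Basis. frechet_derivative (\<lambda>y. frechet_derivative f (at y) b) (at x) b)"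

end

theory Submission
  imports Defs "HOL-Probability.Distributions"
begin

text \<open>Since \<open>\<Delta>u = V u - f\<close> with \<open>f = -\<Delta>u + V u\<close>, it suffices to bound \<open>\<parallel>V u\<parallel>\<^sub>p\<close> by \<open>\<parallel>f\<parallel>\<^sub>p\<close>. For the Green function
  \<open>\<Gamma>\<close> of \<open>-\<Delta> + V\<close> one has \<open>|u(x)| \<le> \<integral> \<Gamma>(x,y) |f(y)| dy\<close>, so the theorem says that the kernel \<open>V(x) \<Gamma>(x,y)\<close> is
  bounded on \<open>L\<^sup>p\<close>. Two facts about \<open>\<Gamma>\<close> suffice for this. First, \<open>\<integral> \<Gamma>(x,y) V(y) dy \<le> 1\<close>: the potential cannot
  absorb more than the whole mass (\<open>green_mass\<close>). Second, \<open>\<Gamma>(\<cdot>,y)\<close> is subharmonic off its pole, and the reverse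
  Hoelder inequality makes \<open>V\<close> an \<open>A\<^sub>\<infinity>\<close> weight, so \<open>\<Gamma>(\<cdot>,y)\<close> obeys a mean value inequality with respect to \<open>V dx\<close>
  (\<open>weighted_mean_value\<close>, \<open>green_weighted_mean\<close>): for \<open>r\<close> comparable to \<open>|x - y|\<close>, the product of \<open>\<Gamma>(x,y)\<close> and
  the weight of the cube of radius \<open>r\<close> about \<open>x\<close> is at most \<open>K\<close> times the integral of \<open>\<Gamma>(\<cdot>,y) V\<close> over the ball
  of radius \<open>2 r\<close> about \<open>x\<close>.

The Schur test uses as weight \<open>m(x,y)\<close> the mean of \<open>V\<close> over a cube about \<open>x\<close> of size comparable to \<open>|x - y|\<close>.
  Inserting the mean value inequality and exchanging integrals, the mass bound gives \<open>\<integral> \<Gamma>(x,y) m(x,y) dy \<le> c\<^sub>1\<close>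
  (\<open>schur_first\<close>) and, with the reverse Hoelder inequality of exponent \<open>p\<close>, \<open>\<integral> \<Gamma>(x,y) V(x)\<^sup>p m(x,y)\<^sup>1\<^sup>-\<^sup>p dx \<le>
  c\<^sub>2\<close> (\<open>schur_second\<close>). Hoelder's inequality then yields \<open>bounded_potential_estimate\<close>.

The Green function itself is constructed for bounded \<open>V\<close> and with a small positive constant added, as the
  Neumann series of \<open>(k + d - \<Delta>) - (k - V)\<close>. Its terms are nonnegative, so it is handled entirely in \<open>ennreal\<close>,
  and its sub-mean value property comes from testing against explicit polynomial bumps. The constants depend on
  \<open>V\<close> only through its reverse Hoelder constant; the truncations \<open>min V k\<close> share one such constant
  (\<open>RH_truncate\<close>), and the general case is the limit in \<open>unbounded_potential_estimate\<close>.

Exponents \<open>p \<le> q\<close> are admissible because a reverse Hoelder inequality passes to smaller exponents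
  (\<open>RH_lower_exponent\<close>); those slightly above \<open>q\<close> by Gehring's lemma (\<open>RH_self_improvement\<close>), which is proved by
  a dyadic stopping time argument.\<close>

section \<open>Integration by parts and the heat kernel\<close>

lemma nn_integral_lborel_affine:
  fixes f :: "'a::euclidean_space \<Rightarrow> ennreal"
  assumes [measurable]: "f \<in> borel_measurable borel" and c: "c \<noteq> 0"
  shows "(\<integral>\<^sup>+x. f x \<partial>lborel) = ennreal (\<bar>c\<bar> ^ DIM('a)) * (\<integral>\<^sup>+x. f (t + c *\<^sub>R x) \<partial>lborel)"
  by (subst lborel_affine[OF c, of t])
     (simp add: nn_integral_density nn_integral_distr nn_integral_cmult)

lemma nn_integral_lborel_reflect:
  fixes f :: "'a::euclidean_space \<Rightarrow> ennreal"
  assumes [measurable]: "f \<in> borel_measurable borel"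
  shows "(\<integral>\<^sup>+x. f (t - x) \<partial>lborel) = (\<integral>\<^sup>+x. f x \<partial>lborel)"
  using nn_integral_lborel_affine[OF assms, of "-1" t] by simp

lemma integral_lborel_affine:
  fixes f :: "'a::euclidean_space \<Rightarrow> 'b::{banach, second_countable_topology}"
  assumes [measurable]: "f \<in> borel_measurable borel" and c: "c \<noteq> 0"
  shows "(\<integral>x. f x \<partial>lborel) = \<bar>c\<bar> ^ DIM('a) *\<^sub>R (\<integral>x. f (t + c *\<^sub>R x) \<partial>lborel)"
  by (subst lborel_affine[OF c, of t])
     (simp add: integral_density integral_distr)

text \<open>The difference quotients of \<open>F\<close> integrate to zero by translation invariance of Lebesgue measure. They are
  bounded by the maximum of \<open>F'\<close> and live on a fixed compact set, so dominated convergence passes to the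
  derivative.\<close>

lemma integral_directional_derivative_eq_0:
  fixes F F' :: "'a::euclidean_space \<Rightarrow> 'b::{banach, second_countable_topology}"
  assumes K: "compact K" "\<And>x. x \<notin> K \<Longrightarrow> F x = 0" "\<And>x. x \<notin> K \<Longrightarrow> F' x = 0"
    and der: "\<And>x. ((\<lambda>h. F (x + h *\<^sub>R b)) has_vector_derivative F' x) (at 0)"
    and cont: "continuous_on UNIV F" "continuous_on UNIV F'"
  shows "(\<integral>x. F' x \<partial>lborel) = 0"
proof -
  have [measurable]: "F \<in> borel_measurable borel" "F' \<in> borel_measurable borel"
    using cont by (auto intro: borel_measurable_continuous_onI)
  have "\<exists>M>0. \<forall>x\<in>K. norm (F' x) \<le> M"
    using compact_imp_bounded[OF compact_continuous_image[OF continuous_on_subset[OF cont(2)] K(1)]]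
    by (auto simp: bounded_pos)
  then obtain M where M: "0 < M" "\<And>x. norm (F' x) \<le> M"
    using K(3) by (metis norm_zero less_imp_le)
  have der': "((\<lambda>h. F (x + h *\<^sub>R b)) has_vector_derivative F' (x + h *\<^sub>R b)) (at h within S)" for x h S
  proof -
    have "((\<lambda>k. F ((x + h *\<^sub>R b) + k *\<^sub>R b)) \<circ> (\<lambda>k. k - h) has_vector_derivative 1 *\<^sub>R F' (x + h *\<^sub>R b)) (at h)"
      by (rule vector_diff_chain_at) (auto intro!: derivative_eq_intros simp: der)
    then have "((\<lambda>h. F (x + h *\<^sub>R b)) has_vector_derivative F' (x + h *\<^sub>R b)) (at h)"
      by (simp add: o_def algebra_simps)
    then show ?thesis by (rule has_vector_derivative_at_within)
  qed
  have lip: "norm (F (x + h *\<^sub>R b) - F x) \<le> M * h" if "h > 0" for x h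
  proof -
    have "norm (F (x + h *\<^sub>R b) - F (x + 0 *\<^sub>R b)) \<le> M * norm (h - 0)"
    proof (rule differentiable_bound[where S="{0..h}" and f="\<lambda>h. F (x + h *\<^sub>R b)"])
      fix k assume "k \<in> {0..h}"
      show "((\<lambda>h. F (x + h *\<^sub>R b)) has_derivative (\<lambda>d. d *\<^sub>R F' (x + k *\<^sub>R b))) (at k within {0..h})"
        using der' unfolding has_vector_derivative_def .
      show "onorm (\<lambda>d. d *\<^sub>R F' (x + k *\<^sub>R b)) \<le> M"
        using M by (intro onorm_bound) (auto simp: mult.commute[of M] intro!: mult_left_mono)
    qed (use that in auto)
    then show ?thesis using that by simp
  qed
  define h where "h i = inverse (real (Suc i))" for i
  have h: "h i > 0" "h i \<le> 1" for i by (auto simp: h_def field_simps)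
  have h0: "h \<longlonglongrightarrow> 0" unfolding h_def by (rule LIMSEQ_inverse_real_of_nat)
  define D where "D i x = (1 / h i) *\<^sub>R (F (x + h i *\<^sub>R b) - F x)" for i x
  define K' where "K' = {x + y |x y. x \<in> K \<and> y \<in> cball 0 (norm b)}"
  have K': "compact K'" unfolding K'_def using compact_sums[OF K(1) compact_cball] by blast
  have intF: "integrable lborel F"
  proof -
    have "integrable lborel (\<lambda>x. indicator K x *\<^sub>R F x)"
      by (rule borel_integrable_compact[OF K(1)]) (rule continuous_on_subset[OF cont(1)], simp)
    also have "(\<lambda>x. indicator K x *\<^sub>R F x) = F" using K by (auto simp: indicator_def fun_eq_iff)
    finally show ?thesis .
  qed
  have trans: "integrable lborel (\<lambda>x. F (x + t))" "(\<integral>x. F (x + t) \<partial>lborel) = (\<integral>x. F x \<partial>lborel)" for t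
  proof -
    have "integrable (distr lborel borel ((+) t)) F" by (simp add: lborel_distr_plus intF)
    then show "integrable lborel (\<lambda>x. F (x + t))" by (simp add: integrable_distr_eq add.commute)
    show "(\<integral>x. F (x + t) \<partial>lborel) = (\<integral>x. F x \<partial>lborel)"
      using integral_lborel_affine[of F 1 t] by (simp add: add.commute)
  qed
  have D0: "(\<integral>x. D i x \<partial>lborel) = 0" for i
    unfolding D_def using trans intF by simp
  have "(\<lambda>i. \<integral>x. D i x \<partial>lborel) \<longlonglongrightarrow> (\<integral>x. F' x \<partial>lborel)"
  proof (rule integral_dominated_convergence[where w="\<lambda>x. indicator K' x * M"])
    show "integrable lborel (\<lambda>x. indicator K' x * M)"
      using K' by (auto intro!: emeasure_compact_finite borel_compact integrable_mult_left)
    show "AE x in lborel. (\<lambda>i. D i x) \<longlonglongrightarrow> F' x"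
    proof (rule AE_I2)
      fix x
      have "((\<lambda>k. norm (F (x + k *\<^sub>R b) - F x - k *\<^sub>R F' x) / norm k) \<longlongrightarrow> 0) (at 0)"
        using der[of x] by (simp add: has_vector_derivative_def has_derivative_at)
      moreover have "filterlim h (at 0) sequentially"
        using h0 h(1) by (auto simp: filterlim_at intro!: always_eventually less_imp_neq[symmetric])
      ultimately have "(\<lambda>i. norm (F (x + h i *\<^sub>R b) - F x - h i *\<^sub>R F' x) / norm (h i)) \<longlonglongrightarrow> 0"
        by (rule filterlim_compose)
      moreover have "norm (F (x + h i *\<^sub>R b) - F x - h i *\<^sub>R F' x) / norm (h i) = norm (D i x - F' x)" for i
      proof -
        have "D i x - F' x = (1 / h i) *\<^sub>R (F (x + h i *\<^sub>R b) - F x - h i *\<^sub>R F' x)"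
          using h(1)[of i] by (simp add: D_def algebra_simps)
        then show ?thesis by simp
      qed
      ultimately have "(\<lambda>i. norm (D i x - F' x)) \<longlonglongrightarrow> 0" by simp
      then show "(\<lambda>i. D i x) \<longlonglongrightarrow> F' x"
        by (rule Lim_null[THEN iffD2, OF tendsto_norm_zero_cancel])
    qed
    show "AE x in lborel. norm (D i x) \<le> indicator K' x * M" for i
    proof (rule AE_I2)
      fix x
      show "norm (D i x) \<le> indicator K' x * M"
      proof (cases "x \<in> K'")
        case True
        have "norm (D i x) = norm (F (x + h i *\<^sub>R b) - F x) / h i"
            unfolding D_def using h(1)[of i] by simp
          then show ?thesis using lip[OF h(1)[of i], of x] h(1)[of i] True by (simp add: divide_le_eq)
      next
        case False
        have "x \<notin> K"
        proof
          assume *: "x \<in> K"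
          moreover have "x = x + 0" "0 \<in> cball 0 (norm b)" by auto
          ultimately show False using False unfolding K'_def by blast
        qed
        moreover have "x + h i *\<^sub>R b \<notin> K"
        proof
          assume *: "x + h i *\<^sub>R b \<in> K"
          have "x = (x + h i *\<^sub>R b) + (- h i *\<^sub>R b)" by simp
          moreover have "- h i *\<^sub>R b \<in> cball 0 (norm b)" using h[of i] by (simp add: mult_left_le_one_le)
          ultimately show False using False * unfolding K'_def by blast
        qed
        ultimately show ?thesis using K(2) False by (simp add: D_def)
      qed
    qed
  qed (auto simp: D_def)
  then show ?thesis by (simp add: D0 LIMSEQ_const_iff)
qed

text \<open>Explicit derivatives along the coordinate axes are exactly the data that enter the Laplacian; carrying them as
  arguments lets test functions, heat kernels and powers of paraboloids be treated alike.\<close>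

definition C2_with :: "('a::euclidean_space \<Rightarrow> 'b::real_normed_vector) \<Rightarrow> ('a \<Rightarrow> 'a \<Rightarrow> 'b) \<Rightarrow> ('a \<Rightarrow> 'a \<Rightarrow> 'b) \<Rightarrow> bool" where
  "C2_with u D1 D2 \<longleftrightarrow> continuous_on UNIV u \<and>
     (\<forall>b\<in>Basis. continuous_on UNIV (D1 b) \<and> continuous_on UNIV (D2 b) \<and>
        (\<forall>x. ((\<lambda>h. u (x + h *\<^sub>R b)) has_vector_derivative D1 b x) (at 0)) \<and>
        (\<forall>x. ((\<lambda>h. D1 b (x + h *\<^sub>R b)) has_vector_derivative D2 b x) (at 0)))"

lemma directional_derivative_outside_support:
  fixes u :: "'a::euclidean_space \<Rightarrow> 'b::real_normed_vector"
  assumes K: "compact K" "\<And>x. x \<notin> K \<Longrightarrow> u x = 0"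
    and der: "((\<lambda>h. u (x + h *\<^sub>R b)) has_vector_derivative d) (at 0)" and x: "x \<notin> K"
  shows "d = 0"
proof -
  have op: "open ((\<lambda>h. x + h *\<^sub>R b) -` (- K))"
    using compact_imp_closed[OF K(1)] by (intro open_vimage open_Compl) (auto intro!: continuous_intros)
  have "((\<lambda>h. 0) has_vector_derivative d) (at (0::real))"
    using has_vector_derivative_transform_within_open[OF der op, of "\<lambda>_. 0"] x K(2) by auto
  then show "d = 0"
    using vector_derivative_unique_at has_vector_derivative_const by blast
qed

lemma C2_with_support:
  assumes "C2_with u D1 D2" "compact K" "\<And>x. x \<notin> K \<Longrightarrow> u x = 0" "b \<in> Basis" "x \<notin> K"
  shows "D1 b x = 0" "D2 b x = 0"
proof -
  have D1: "D1 b x = 0" if "x \<notin> K" for x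
  proof (rule directional_derivative_outside_support[where u=u and K=K and b=b])
    show "((\<lambda>h. u (x + h *\<^sub>R b)) has_vector_derivative D1 b x) (at 0)"
      using assms(1,4) unfolding C2_with_def by blast
  qed (use assms that in auto)
  show "D1 b x = 0" by (rule D1) fact
  show "D2 b x = 0"
  proof (rule directional_derivative_outside_support[where u="D1 b" and K=K and b=b])
    show "((\<lambda>h. D1 b (x + h *\<^sub>R b)) has_vector_derivative D2 b x) (at 0)"
      using assms(1,4) unfolding C2_with_def by blast
  qed (use assms D1 in auto)
qed

lemma integrable_continuous_compact_support:
  fixes f :: "'a::euclidean_space \<Rightarrow> 'b::{banach, second_countable_topology}"
  assumes "continuous_on UNIV f" "compact K" "\<And>x. x \<notin> K \<Longrightarrow> f x = 0"
  shows "integrable lborel f"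
proof -
  have "integrable lborel (\<lambda>x. indicator K x *\<^sub>R f x)"
    by (rule borel_integrable_compact[OF assms(2)]) (rule continuous_on_subset[OF assms(1)], simp)
  also have "(\<lambda>x. indicator K x *\<^sub>R f x) = f" using assms by (auto simp: indicator_def fun_eq_iff)
  finally show ?thesis .
qed

text \<open>Along each axis the integrand of the difference is the derivative of \<open>p \<partial>u - u \<partial>p\<close>, which has compact support
  because \<open>u\<close> has. No decay of \<open>p\<close> is assumed, so \<open>p\<close> may be a heat kernel.\<close>

lemma green_identity:
  fixes u :: "'a::euclidean_space \<Rightarrow> 'b::{banach, second_countable_topology}" and p :: "'a \<Rightarrow> real"
  assumes u: "C2_with u D1 D2" and p: "C2_with p P1 P2"
    and K: "compact K" "\<And>x. x \<notin> K \<Longrightarrow> u x = 0"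
  shows "(\<integral>x. p x *\<^sub>R (\<Sum>b\<in>Basis. D2 b x) \<partial>lborel) = (\<integral>x. (\<Sum>b\<in>Basis. P2 b x) *\<^sub>R u x \<partial>lborel)"
proof -
  have c: "continuous_on UNIV u" "continuous_on UNIV p"
    "\<And>b. b \<in> Basis \<Longrightarrow> continuous_on UNIV (D1 b)" "\<And>b. b \<in> Basis \<Longrightarrow> continuous_on UNIV (D2 b)"
    "\<And>b. b \<in> Basis \<Longrightarrow> continuous_on UNIV (P1 b)" "\<And>b. b \<in> Basis \<Longrightarrow> continuous_on UNIV (P2 b)"
    using u p by (auto simp: C2_with_def)
  note s = C2_with_support[OF u K]
  have int: "integrable lborel (\<lambda>x. p x *\<^sub>R D2 b x)" "integrable lborel (\<lambda>x. P2 b x *\<^sub>R u x)" if "b \<in> Basis" for b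
    by (rule integrable_continuous_compact_support[OF _ K(1)];
      use that s K(2) in \<open>simp add: continuous_on_scaleR c\<close>)+
  have "(\<integral>x. p x *\<^sub>R D2 b x \<partial>lborel) = (\<integral>x. P2 b x *\<^sub>R u x \<partial>lborel)" if b: "b \<in> Basis" for b
  proof -
    have "(\<integral>x. (p x *\<^sub>R D2 b x - P2 b x *\<^sub>R u x) \<partial>lborel) = 0"
    proof (rule integral_directional_derivative_eq_0[OF K(1), where F="\<lambda>x. p x *\<^sub>R D1 b x - P1 b x *\<^sub>R u x" and b=b])
      fix x
      have "((\<lambda>h. p (x + h *\<^sub>R b) *\<^sub>R D1 b (x + h *\<^sub>R b) - P1 b (x + h *\<^sub>R b) *\<^sub>R u (x + h *\<^sub>R b)) has_vector_derivative
         (p (x + 0 *\<^sub>R b) *\<^sub>R D2 b x + P1 b x *\<^sub>R D1 b (x + 0 *\<^sub>R b)) - (P1 b (x + 0 *\<^sub>R b) *\<^sub>R D1 b x + P2 b x *\<^sub>R u (x + 0 *\<^sub>R b))) (at 0)"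
        using u p b by (intro has_vector_derivative_diff has_vector_derivative_scaleR)
          (auto simp: C2_with_def has_real_derivative_iff_has_vector_derivative)
      then show "((\<lambda>h. p (x + h *\<^sub>R b) *\<^sub>R D1 b (x + h *\<^sub>R b) - P1 b (x + h *\<^sub>R b) *\<^sub>R u (x + h *\<^sub>R b)) has_vector_derivative
         p x *\<^sub>R D2 b x - P2 b x *\<^sub>R u x) (at 0)" by (simp add: algebra_simps)
    qed (use b s K(2) in \<open>simp_all add: continuous_on_scaleR continuous_on_diff c\<close>)
    then show ?thesis using int[OF b] by simp
  qed
  then show ?thesis
    using int by (simp add: scaleR_sum_right scaleR_sum_left Bochner_Integration.integral_sum)
qed

definition heat_kernel :: "real \<Rightarrow> 'a::euclidean_space \<Rightarrow> real" where
  "heat_kernel t z = (4 * pi * t) powr (- real DIM('a) / 2) * exp (- (norm z)\<^sup>2 / (4 * t))"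

lemma heat_kernel_nonneg [simp]: "0 \<le> heat_kernel t z"
  by (simp add: heat_kernel_def)

lemma continuous_heat_kernel: "continuous_on UNIV (heat_kernel t :: 'a::euclidean_space \<Rightarrow> real)"
proof -
  have "heat_kernel t = (\<lambda>z::'a. (4 * pi * t) powr (- real DIM('a) / 2) * exp ((norm z)\<^sup>2 * (- 1 / (4 * t))))"
    by (simp add: heat_kernel_def fun_eq_iff)
  then show ?thesis by (simp only:) (intro continuous_intros)
qed

lemma continuous_heat_kernel_pair:
  "continuous_on ({0<..} \<times> UNIV) (\<lambda>(t, z). heat_kernel t z)"
  unfolding heat_kernel_def case_prod_unfold
  by (intro continuous_on_mult continuous_on_powr continuous_on_exp continuous_on_divide continuous_on_minus
      continuous_on_power continuous_on_norm continuous_on_fst continuous_on_snd continuous_on_id continuous_on_const) auto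

lemma measurable_heat_kernel [measurable]:
  "(\<lambda>(t, z). heat_kernel t z) \<in> borel_measurable (borel \<Otimes>\<^sub>M borel)"
  unfolding heat_kernel_def case_prod_unfold by measurable

lemma heat_kernel_minus [simp]: "heat_kernel t (- z) = heat_kernel t z"
  by (simp add: heat_kernel_def)

lemma norm_sq_shift:
  fixes z b :: "'a::euclidean_space"
  assumes "b \<in> Basis"
  shows "(norm (z + h *\<^sub>R b))\<^sup>2 = (norm z)\<^sup>2 + 2 * h * (z \<bullet> b) + h\<^sup>2"
  unfolding power2_norm_eq_inner using assms by (simp add: algebra_simps inner_commute power2_eq_square)

lemma sum_inner_Basis_sq: "(\<Sum>b\<in>Basis. (z \<bullet> b)\<^sup>2) = (norm (z::'a::euclidean_space))\<^sup>2"
  unfolding power2_norm_eq_inner by (subst euclidean_inner) (simp add: power2_eq_square)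

lemma C2_heat_kernel:
  fixes x :: "'a::euclidean_space"
  assumes t: "0 < t"
  shows "C2_with (\<lambda>z. heat_kernel t (x - z))
    (\<lambda>b z. ((x - z) \<bullet> b) / (2 * t) * heat_kernel t (x - z))
    (\<lambda>b z. (((x - z) \<bullet> b)\<^sup>2 / (4 * t\<^sup>2) - 1 / (2 * t)) * heat_kernel t (x - z))"
proof -
  have cont: "continuous_on UNIV (\<lambda>z. heat_kernel t (x - z))"
    by (intro continuous_on_compose2[OF continuous_heat_kernel] continuous_intros) auto
  define c where "c = (4 * pi * t) powr (- real DIM('a) / 2)"
  have hk: "heat_kernel t (x - (z + h *\<^sub>R b)) = c * exp (- ((norm (x - z))\<^sup>2 - 2 * h * ((x - z) \<bullet> b) + h\<^sup>2) / (4 * t))"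
    if "b \<in> Basis" for z b h
  proof -
    have "norm (x - (z + h *\<^sub>R b)) = norm ((x - z) + (- h) *\<^sub>R b)" by (simp add: algebra_simps)
    then show ?thesis unfolding heat_kernel_def c_def using norm_sq_shift[OF that, of "x - z" "-h"] by simp
  qed
  have d1: "((\<lambda>h. heat_kernel t (x - (z + h *\<^sub>R b))) has_real_derivative
      ((x - z) \<bullet> b) / (2 * t) * heat_kernel t (x - z)) (at 0)" if b: "b \<in> Basis" for b z
  proof -
    have "((\<lambda>h. c * exp (- ((norm (x - z))\<^sup>2 - 2 * h * ((x - z) \<bullet> b) + h\<^sup>2) / (4 * t))) has_real_derivative
      c * (exp (- ((norm (x - z))\<^sup>2 - 2 * 0 * ((x - z) \<bullet> b) + 0\<^sup>2) / (4 * t)) * (2 * ((x - z) \<bullet> b) / (4 * t)))) (at 0)"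
      using t by (auto intro!: derivative_eq_intros)
    then show ?thesis unfolding hk[OF b] by (simp add: heat_kernel_def c_def mult_ac)
  qed
  have d2: "((\<lambda>h. ((x - (z + h *\<^sub>R b)) \<bullet> b) / (2 * t) * heat_kernel t (x - (z + h *\<^sub>R b))) has_real_derivative
      (((x - z) \<bullet> b)\<^sup>2 / (4 * t\<^sup>2) - 1 / (2 * t)) * heat_kernel t (x - z)) (at 0)" if b: "b \<in> Basis" for b z
  proof -
    have eq: "(x - (z + h *\<^sub>R b)) \<bullet> b = (x - z) \<bullet> b - h" for h
      using b by (simp add: inner_diff_left inner_add_left)
    have "((\<lambda>h. (((x - z) \<bullet> b - h) / (2 * t)) * heat_kernel t (x - (z + h *\<^sub>R b))) has_real_derivative
      (((x - z) \<bullet> b - 0) / (2 * t)) * (((x - z) \<bullet> b) / (2 * t) * heat_kernel t (x - z)) + (- 1 / (2 * t)) * heat_kernel t (x - (z + 0 *\<^sub>R b))) (at 0)"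
      by (intro DERIV_mult' d1 b) (use t in \<open>auto intro!: derivative_eq_intros\<close>)
    moreover have "(((x - z) \<bullet> b - 0) / (2 * t)) * (((x - z) \<bullet> b) / (2 * t) * heat_kernel t (x - z)) + (- 1 / (2 * t)) * heat_kernel t (x - (z + 0 *\<^sub>R b))
      = (((x - z) \<bullet> b)\<^sup>2 / (4 * t\<^sup>2) - 1 / (2 * t)) * heat_kernel t (x - z)"
    proof -
      have "(a - 0) / (2 * t) * (a / (2 * t) * k) + - 1 / (2 * t) * k = (a\<^sup>2 / (4 * t\<^sup>2) - 1 / (2 * t)) * k" for a k
        by (simp add: power2_eq_square algebra_simps)
      then show ?thesis by simp
    qed
    ultimately show ?thesis unfolding eq by simp
  qed
  show ?thesis
    unfolding C2_with_def using d1 d2 t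
    by (auto simp: has_real_derivative_iff_has_vector_derivative[symmetric] intro!: continuous_intros cont t)
qed

text \<open>The sum on the right is the Laplacian read off from \<open>C2_heat_kernel\<close>: this is the heat equation.\<close>

lemma heat_kernel_time_derivative:
  fixes z :: "'a::euclidean_space"
  assumes t: "0 < t"
  shows "((\<lambda>t. heat_kernel t z) has_real_derivative
    (\<Sum>b\<in>Basis. ((z \<bullet> b)\<^sup>2 / (4 * t\<^sup>2) - 1 / (2 * t)) * heat_kernel t z)) (at t)"
proof -
  let ?n = "real DIM('a)"
  have p: "(4 * pi * t) powr (- ?n / 2 - 1) = (4 * pi * t) powr (- ?n / 2) / (4 * pi * t)"
    using t by (simp add: powr_diff)
  have 1: "((\<lambda>t. (4 * pi * t) powr (- ?n / 2)) has_real_derivative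
      - ?n / (2 * t) * (4 * pi * t) powr (- ?n / 2)) (at t)"
  proof -
    have "((\<lambda>t. (4 * pi * t) powr (- ?n / 2)) has_real_derivative
      ((- ?n / 2) * (4 * pi * t) powr (- ?n / 2 - 1)) * (4 * pi)) (at t)"
      using t by (intro DERIV_chain'[where g="\<lambda>s. s powr (- ?n / 2)" and f="\<lambda>t. 4 * pi * t"] has_real_derivative_powr)
        (auto intro!: derivative_eq_intros)
    also have "((- ?n / 2) * (4 * pi * t) powr (- ?n / 2 - 1)) * (4 * pi) = - ?n / (2 * t) * (4 * pi * t) powr (- ?n / 2)"
      unfolding p using t by simp
    finally show ?thesis .
  qed
  have 2: "((\<lambda>t. exp (- (norm z)\<^sup>2 / (4 * t))) has_real_derivative
      exp (- (norm z)\<^sup>2 / (4 * t)) * ((norm z)\<^sup>2 / (4 * t\<^sup>2))) (at t)"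
    using t by (auto intro!: derivative_eq_intros simp: power2_eq_square)
  have 3: "(- ?n / (2 * t) * P) * E + (E * Q) * P = (Q - ?n / (2 * t)) * (P * E)" for P E Q
    by (simp add: algebra_simps)
  have "((\<lambda>t. heat_kernel t z) has_real_derivative ((norm z)\<^sup>2 / (4 * t\<^sup>2) - ?n / (2 * t)) * heat_kernel t z) (at t)"
    using DERIV_mult[OF 1 2] unfolding heat_kernel_def 3 .
  also have "((norm z)\<^sup>2 / (4 * t\<^sup>2) - ?n / (2 * t)) * heat_kernel t z
     = (\<Sum>b\<in>Basis. ((z \<bullet> b)\<^sup>2 / (4 * t\<^sup>2) - 1 / (2 * t)) * heat_kernel t z)"
  proof -
    have "(\<Sum>b\<in>Basis. (z \<bullet> b)\<^sup>2 / (4 * t\<^sup>2)) = (norm z)\<^sup>2 / (4 * t\<^sup>2)"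
      by (simp add: sum_inner_Basis_sq[of z, symmetric] sum_divide_distrib)
    then have "(\<Sum>b\<in>Basis. (z \<bullet> b)\<^sup>2 / (4 * t\<^sup>2) - 1 / (2 * t)) = (norm z)\<^sup>2 / (4 * t\<^sup>2) - ?n / (2 * t)"
      by (simp add: sum_subtractf)
    then show ?thesis using sum_distrib_right[of "\<lambda>b. (z \<bullet> b)\<^sup>2 / (4 * t\<^sup>2) - 1 / (2 * t)" Basis "heat_kernel t z"] by simp
  qed
  finally show ?thesis .
qed

text \<open>The variance of the factors is \<open>2 * t\<close> because the heat equation is \<open>\<partial>\<^sub>t = \<Delta>\<close>, without the factor one half of
  Brownian motion.\<close>

lemma heat_kernel_eq_prod_normal_density:
  assumes t: "0 < t"
  shows "heat_kernel t z = (\<Prod>b\<in>Basis. normal_density 0 (sqrt (2 * t)) (z \<bullet> b))"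
proof -
  have s: "(sqrt (2 * t))\<^sup>2 = 2 * t" using t by simp
  have "(\<Prod>b\<in>Basis. normal_density 0 (sqrt (2 * t)) (z \<bullet> b))
     = (1 / sqrt (4 * pi * t)) ^ DIM('a) * exp (\<Sum>b\<in>Basis. - (z \<bullet> b)\<^sup>2 / (4 * t))"
    unfolding normal_density_def s by (simp add: prod.distrib exp_sum prod_dividef power_divide algebra_simps)
  also have "(\<Sum>b\<in>Basis. - (z \<bullet> b)\<^sup>2 / (4 * t)) = - (norm z)\<^sup>2 / (4 * t)"
    by (simp add: sum_inner_Basis_sq[of z, symmetric] sum_divide_distrib sum_negf)
  also have "(1 / sqrt (4 * pi * t)) ^ DIM('a) = (4 * pi * t) powr (- real DIM('a) / 2)"
  proof -
    have "1 / sqrt (4 * pi * t) = (4 * pi * t) powr (- (1 / 2))"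
      unfolding powr_minus_divide using t by (subst powr_half_sqrt) auto
    then have "(1 / sqrt (4 * pi * t)) ^ DIM('a) = ((4 * pi * t) powr (- (1 / 2))) powr real DIM('a)"
      using t by (subst powr_realpow) auto
    also have "\<dots> = (4 * pi * t) powr (- real DIM('a) / 2)" unfolding powr_powr by simp
    finally show ?thesis .
  qed
  finally show ?thesis by (simp add: heat_kernel_def)
qed

lemma nn_integral_heat_kernel:
  assumes t: "0 < t"
  shows "(\<integral>\<^sup>+z. ennreal (heat_kernel t (z::'a::euclidean_space)) \<partial>lborel) = 1"
proof -
  have 1: "(\<integral>\<^sup>+x. ennreal (normal_density 0 (sqrt (2 * t)) x) \<partial>lborel) = 1"
    using t by (subst nn_integral_eq_integral) auto
  have "(\<integral>\<^sup>+z. ennreal (heat_kernel t (z::'a)) \<partial>lborel)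
      = (\<integral>\<^sup>+z. (\<Prod>b\<in>Basis. ennreal (normal_density 0 (sqrt (2 * t)) (z \<bullet> b))) \<partial>(lborel :: 'a measure))"
    by (intro nn_integral_cong) (simp add: heat_kernel_eq_prod_normal_density[OF t] prod_ennreal)
  also have "\<dots> = 1" by (subst nn_integral_lborel_prod) (auto simp: 1)
  finally show ?thesis .
qed

lemma measurable_heat_kernel_comp [measurable (raw)]:
  assumes "f \<in> borel_measurable M" "g \<in> borel_measurable M"
  shows "(\<lambda>x. heat_kernel (f x) (g x :: 'a::euclidean_space)) \<in> borel_measurable M"
proof -
  have "(\<lambda>x. (\<lambda>(t, z::'a). heat_kernel t z) (f x, g x)) \<in> borel_measurable M"
    using assms by measurable
  then show ?thesis by simp
qed

definition heat_avg :: "real \<Rightarrow> ('a::euclidean_space \<Rightarrow> 'b::{banach, second_countable_topology}) \<Rightarrow> 'a \<Rightarrow> 'b" where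
  "heat_avg t u x = (\<integral>z. heat_kernel t (x - z) *\<^sub>R u z \<partial>lborel)"

lemma integrable_heat_kernel:
  assumes t: "0 < t" shows "integrable lborel (heat_kernel t :: 'a::euclidean_space \<Rightarrow> real)"
  using nn_integral_heat_kernel[OF t, where 'a='a]
  by (intro integrableI_nonneg) (auto intro!: borel_measurable_continuous_onI continuous_heat_kernel)

lemma heat_kernel_scale:
  assumes "0 < t"
  shows "sqrt t ^ DIM('a) * heat_kernel t (sqrt t *\<^sub>R z) = heat_kernel 1 (z :: 'a::euclidean_space)"
proof -
  have "sqrt t ^ DIM('a) = t powr (real DIM('a) / 2)"
  proof -
    have "sqrt t ^ DIM('a) = (t powr (1/2)) powr real DIM('a)"
      using assms by (subst powr_realpow) (auto simp: powr_half_sqrt)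
    then show ?thesis by (simp add: powr_powr)
  qed
  then have "sqrt t ^ DIM('a) * (4 * pi * t) powr (- real DIM('a) / 2) = (4 * pi) powr (- real DIM('a) / 2)"
    using assms unfolding powr_mult by (simp add: powr_minus)
  moreover have E: "- (norm (sqrt t *\<^sub>R z))\<^sup>2 / (4 * t) = - (norm z)\<^sup>2 / (4 * 1)"
    using assms by (simp add: power_mult_distrib)
  ultimately show ?thesis unfolding heat_kernel_def E by (simp add: mult.assoc[symmetric])
qed

text \<open>After parabolic scaling the time appears only inside the argument of \<open>u\<close>, so that dominated convergence applies
  as \<open>t\<close> tends to \<open>0\<close>.\<close>

lemma heat_avg_eq:
  fixes u :: "'a::euclidean_space \<Rightarrow> 'b::{banach, second_countable_topology}"
  assumes u [measurable]: "u \<in> borel_measurable borel" and t: "0 < t"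
  shows "heat_avg t u x = (\<integral>y. heat_kernel 1 y *\<^sub>R u (x - sqrt t *\<^sub>R y) \<partial>lborel)"
proof -
  have "heat_avg t u x = \<bar>- sqrt t\<bar> ^ DIM('a) *\<^sub>R (\<integral>y. heat_kernel t (x - (x + (- sqrt t) *\<^sub>R y)) *\<^sub>R u (x + (- sqrt t) *\<^sub>R y) \<partial>lborel)"
    unfolding heat_avg_def by (rule integral_lborel_affine) (use t in auto)
  also have "\<dots> = (\<integral>y. (sqrt t ^ DIM('a) * heat_kernel t (sqrt t *\<^sub>R y)) *\<^sub>R u (x - sqrt t *\<^sub>R y) \<partial>lborel)"
    using t by (simp add: power_abs flip: scaleR_scaleR)
  finally show ?thesis unfolding heat_kernel_scale[OF t] .
qed

lemma norm_heat_avg_le: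
  fixes u :: "'a::euclidean_space \<Rightarrow> 'b::{banach, second_countable_topology}"
  assumes "\<And>x. norm (u x) \<le> M" and [measurable]: "u \<in> borel_measurable borel" and t: "0 < t"
  shows "norm (heat_avg t u x) \<le> M"
proof -
  have i: "integrable lborel (\<lambda>z. heat_kernel t (x - z))" "(\<integral>z. heat_kernel t (x - z) \<partial>lborel) = 1"
  proof -
    have *: "(\<integral>\<^sup>+z. ennreal (heat_kernel t (x - z)) \<partial>lborel) = 1"
      using nn_integral_lborel_reflect[of "\<lambda>z. ennreal (heat_kernel t z)" x] nn_integral_heat_kernel[OF t, where 'a='a] by simp
    then show "integrable lborel (\<lambda>z. heat_kernel t (x - z))" by (intro integrableI_nonneg) auto
    show "(\<integral>z. heat_kernel t (x - z) \<partial>lborel) = 1"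
      by (subst integral_eq_nn_integral) (auto simp: *)
  qed
  have "norm (heat_avg t u x) \<le> (\<integral>z. heat_kernel t (x - z) * M \<partial>lborel)"
    unfolding heat_avg_def
  proof (rule order_trans[OF integral_norm_bound integral_mono])
    show "integrable lborel (\<lambda>z. norm (heat_kernel t (x - z) *\<^sub>R u z))"
      by (intro integrable_norm, rule Bochner_Integration.integrable_bound[where f="\<lambda>z. heat_kernel t (x - z) * M"])
        (use i assms(1) order_trans[OF norm_ge_zero assms(1)] in \<open>auto intro!: mult_left_mono\<close>)
    show "integrable lborel (\<lambda>z. heat_kernel t (x - z) * M)" using i by simp
  qed (auto intro!: mult_left_mono assms)
  then show ?thesis using i by simp
qed

lemma heat_avg_tendsto:
  fixes u :: "'a::euclidean_space \<Rightarrow> 'b::{banach, second_countable_topology}"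
  assumes u: "continuous_on UNIV u" "\<And>x. norm (u x) \<le> M"
    and t: "\<And>i. 0 < t i" "t \<longlonglongrightarrow> 0"
  shows "(\<lambda>i. heat_avg (t i) u x) \<longlonglongrightarrow> u x"
proof -
  have m [measurable]: "u \<in> borel_measurable borel" using u(1) by (rule borel_measurable_continuous_onI)
  have i1: "integrable lborel (heat_kernel 1 :: 'a \<Rightarrow> real)" by (rule integrable_heat_kernel) simp
  have "(\<lambda>i. \<integral>y. heat_kernel 1 y *\<^sub>R u (x - sqrt (t i) *\<^sub>R y) \<partial>lborel) \<longlonglongrightarrow> (\<integral>y. heat_kernel 1 y *\<^sub>R u x \<partial>(lborel :: 'a measure))"
  proof (rule integral_dominated_convergence[where w="\<lambda>y::'a. heat_kernel 1 y * M"
      and s="\<lambda>i y. heat_kernel 1 y *\<^sub>R u (x - sqrt (t i) *\<^sub>R y)" and f="\<lambda>y. heat_kernel 1 y *\<^sub>R u x"])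
    show "integrable lborel (\<lambda>y::'a. heat_kernel 1 y * M)" using i1 by simp
    show "AE y in lborel. (\<lambda>i. heat_kernel 1 y *\<^sub>R u (x - sqrt (t i) *\<^sub>R y)) \<longlonglongrightarrow> heat_kernel 1 y *\<^sub>R u x"
    proof (intro AE_I2 tendsto_intros)
      fix y
      have "(\<lambda>i. x - sqrt (t i) *\<^sub>R y) \<longlonglongrightarrow> x - sqrt 0 *\<^sub>R y" by (intro tendsto_intros t)
      then show "(\<lambda>i. u (x - sqrt (t i) *\<^sub>R y)) \<longlonglongrightarrow> u x"
        using u(1) by (intro continuous_on_tendsto_compose[OF u(1)]) auto
    qed
  qed (auto intro!: mult_left_mono u)
  moreover have "(\<integral>y. heat_kernel 1 y \<partial>(lborel :: 'a measure)) = 1"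
    by (subst integral_eq_nn_integral) (auto simp: nn_integral_heat_kernel)
  ultimately show ?thesis using i1 by (simp add: heat_avg_eq t)
qed

section \<open>The resolvent of the Laplacian\<close>

lemma fubini_compact:
  fixes f :: "real \<Rightarrow> 'a::euclidean_space \<Rightarrow> 'b::{banach, second_countable_topology}"
  assumes K: "compact K" and c: "continuous_on ({a..b} \<times> K) (\<lambda>(t, z). f t z)"
  shows "(\<integral>t. indicator {a..b} t *\<^sub>R (\<integral>z. indicator K z *\<^sub>R f t z \<partial>lborel) \<partial>lborel)
       = (\<integral>z. indicator K z *\<^sub>R (\<integral>t. indicator {a..b} t *\<^sub>R f t z \<partial>lborel) \<partial>lborel)"
proof -
  have "integrable (lborel :: (real \<times> 'a) measure) (\<lambda>x. indicator ({a..b} \<times> K) x *\<^sub>R (case x of (t, z) \<Rightarrow> f t z))"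
    by (rule borel_integrable_compact[OF _ c]) (intro compact_Times K compact_Icc)
  also have "(\<lambda>x. indicator ({a..b} \<times> K) x *\<^sub>R (case x of (t, z) \<Rightarrow> f t z))
     = (\<lambda>(t, z). indicator {a..b} t *\<^sub>R indicator K z *\<^sub>R f t z)"
    by (auto simp: fun_eq_iff indicator_def)
  finally have "integrable (lborel \<Otimes>\<^sub>M lborel) (\<lambda>(t, z). indicator {a..b} t *\<^sub>R indicator K z *\<^sub>R f t z)"
    by (simp only: lborel_prod)
  from lborel_pair.Fubini_integral[OF this]
  have F: "(\<integral>z. \<integral>t. indicator {a..b} t *\<^sub>R indicator K z *\<^sub>R f t z \<partial>lborel \<partial>lborel)
     = (\<integral>t. \<integral>z. indicator {a..b} t *\<^sub>R indicator K z *\<^sub>R f t z \<partial>lborel \<partial>lborel)" .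
  have "(\<integral>t. indicator {a..b} t *\<^sub>R (\<integral>z. indicator K z *\<^sub>R f t z \<partial>lborel) \<partial>lborel)
     = (\<integral>t. \<integral>z. indicator {a..b} t *\<^sub>R indicator K z *\<^sub>R f t z \<partial>lborel \<partial>lborel)"
    by (simp only: integral_scaleR_right)
  also have "\<dots> = (\<integral>z. \<integral>t. indicator K z *\<^sub>R indicator {a..b} t *\<^sub>R f t z \<partial>lborel \<partial>lborel)"
    unfolding F[symmetric] by (simp only: scaleR_left_commute[of "indicator {a..b} _" "indicator K _"])
  also have "\<dots> = (\<integral>z. indicator K z *\<^sub>R (\<integral>t. indicator {a..b} t *\<^sub>R f t z \<partial>lborel) \<partial>lborel)"
    by (simp only: integral_scaleR_right)
  finally show ?thesis .
qed

lemma C2_with_support_sum: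
  assumes "C2_with u D1 D2" "compact K" "\<And>x. x \<notin> K \<Longrightarrow> u x = 0" "x \<notin> K"
  shows "(\<Sum>b\<in>Basis. D2 b x) = 0"
  using C2_with_support(2)[OF assms(1,2,3) _ assms(4)] by (auto intro!: sum.neutral)

text \<open>With \<open>p\<^sub>t\<close> the heat kernel and \<open>*\<close> for convolution, \<open>d/dt (e\<^sup>-\<^sup>l\<^sup>t p\<^sub>t * u) = - e\<^sup>-\<^sup>l\<^sup>t p\<^sub>t * (l u - \<Delta>u)\<close>:
  Green's identity moves the Laplacian onto the kernel, where it becomes a time derivative. Integrating over a
  compact time interval keeps every integrand continuous with compact support.\<close>

lemma truncated_resolvent:
  fixes u :: "'a::euclidean_space \<Rightarrow> 'b::{banach, second_countable_topology}"
  assumes u: "C2_with u D1 D2" and K: "compact K" "\<And>x. x \<notin> K \<Longrightarrow> u x = 0"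
    and e: "0 < e" "e \<le> T"
  shows "(\<integral>z. (\<integral>t. indicator {e..T} t * (exp (- l * t) * heat_kernel t (x - z)) \<partial>lborel)
             *\<^sub>R (l *\<^sub>R u z - (\<Sum>b\<in>Basis. D2 b z)) \<partial>lborel)
    = exp (- l * e) *\<^sub>R heat_avg e u x - exp (- l * T) *\<^sub>R heat_avg T u x"
proof -
  define q where "q t z = exp (- l * t) * heat_kernel t (x - z)" for t z
  \<comment> \<open>The time derivative of \<open>q\<close>, with the Laplacian of the heat kernel in place of its time derivative.\<close>
  define q' where "q' t z = exp (- l * t) * (\<Sum>b\<in>Basis. (((x - z) \<bullet> b)\<^sup>2 / (4 * t\<^sup>2) - 1 / (2 * t)) * heat_kernel t (x - z)) - l * q t z" for t z
  define th where "th z = l *\<^sub>R u z - (\<Sum>b\<in>Basis. D2 b z)" for z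
  have cu: "continuous_on UNIV u" and cD: "\<And>b. b \<in> Basis \<Longrightarrow> continuous_on UNIV (D2 b)"
    using u by (auto simp: C2_with_def)
  have cth: "continuous_on UNIV th"
    unfolding th_def by (intro continuous_intros cu cD)
  have th0: "th z = 0" if "z \<notin> K" for z
    unfolding th_def using C2_with_support_sum[OF u K that] K(2)[OF that] by simp
  have dq: "((\<lambda>t. q t z) has_real_derivative q' t z) (at t)" if "0 < t" for t z
    unfolding q_def q'_def
    by (rule DERIV_cong[OF DERIV_mult[OF _ heat_kernel_time_derivative[OF that]], of _ "- l * exp (- l * t)"])
      (auto intro!: derivative_eq_intros)
  have chk: "continuous_on ({e..T} \<times> UNIV) (\<lambda>(t, z). heat_kernel t (x - z))"
    unfolding case_prod_unfold using e
    by (intro continuous_on_compose2[OF continuous_heat_kernel_pair[unfolded case_prod_unfold], of _ "\<lambda>p. (fst p, x - snd p)", simplified])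
       (auto intro!: continuous_intros)
  have cq: "continuous_on ({e..T} \<times> UNIV) (\<lambda>(t, z). q t z)"
    unfolding q_def case_prod_unfold
    by (intro continuous_intros chk[unfolded case_prod_unfold])
  have cq': "continuous_on ({e..T} \<times> UNIV) (\<lambda>(t, z). q' t z)"
    unfolding q'_def case_prod_unfold using e
    by (intro continuous_intros chk[unfolded case_prod_unfold] cq[unfolded case_prod_unfold]) auto
  have sub: "{e..T} \<times> K \<subseteq> {e..T} \<times> UNIV" by auto
  have c1: "continuous_on ({e..T} \<times> K) (\<lambda>(t, z). q t z *\<^sub>R th z)"
    unfolding case_prod_unfold
    by (intro continuous_intros continuous_on_subset[OF cq[unfolded case_prod_unfold] sub] continuous_on_compose2[OF cth]) auto
  have c2: "continuous_on ({e..T} \<times> K) (\<lambda>(t, z). (- q' t z) *\<^sub>R u z)"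
    unfolding case_prod_unfold
    by (intro continuous_intros continuous_on_subset[OF cq'[unfolded case_prod_unfold] sub] continuous_on_compose2[OF cu]) auto
  have cqz: "continuous_on UNIV (q t)" for t
    unfolding q_def by (intro continuous_intros continuous_on_compose2[OF continuous_heat_kernel]) auto
  have space: "(\<integral>z. indicator K z *\<^sub>R q t z *\<^sub>R th z \<partial>lborel) = (\<integral>z. indicator K z *\<^sub>R (- q' t z) *\<^sub>R u z \<partial>lborel)"
    if t: "e \<le> t" for t
  proof -
    have t0: "0 < t" using e t by simp
    have iq: "integrable lborel (\<lambda>z. q t z *\<^sub>R (l *\<^sub>R u z))" "integrable lborel (\<lambda>z. q t z *\<^sub>R (\<Sum>b\<in>Basis. D2 b z))"
      by (rule integrable_continuous_compact_support[OF _ K(1)],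
          use K(2) C2_with_support_sum[OF u K] in \<open>auto intro!: continuous_intros cqz cu cD\<close>)+
    define L where "L z = (\<Sum>b\<in>Basis. (((x - z) \<bullet> b)\<^sup>2 / (4 * t\<^sup>2) - 1 / (2 * t)) * heat_kernel t (x - z))" for z
    have q'_eq: "q' t z = exp (- l * t) * L z - l * q t z" for z
      by (simp add: q'_def L_def)
    have cL: "continuous_on UNIV L"
      unfolding L_def using t0 by (intro continuous_intros continuous_on_compose2[OF continuous_heat_kernel]) auto
    have iL: "integrable lborel (\<lambda>z. (exp (- l * t) * L z) *\<^sub>R u z)"
      by (rule integrable_continuous_compact_support[OF _ K(1)]) (use K(2) in \<open>auto intro!: continuous_intros cL cu\<close>)
    have "(\<integral>z. indicator K z *\<^sub>R q t z *\<^sub>R th z \<partial>lborel) = (\<integral>z. q t z *\<^sub>R (l *\<^sub>R u z) - q t z *\<^sub>R (\<Sum>b\<in>Basis. D2 b z) \<partial>lborel)"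
      by (intro Bochner_Integration.integral_cong refl) (use K(2) C2_with_support_sum[OF u K] in \<open>auto simp: indicator_def th_def scaleR_diff_right\<close>)
    also have "\<dots> = (\<integral>z. q t z *\<^sub>R (l *\<^sub>R u z) \<partial>lborel) - (\<integral>z. q t z *\<^sub>R (\<Sum>b\<in>Basis. D2 b z) \<partial>lborel)"
      using iq by simp
    also have "(\<integral>z. q t z *\<^sub>R (\<Sum>b\<in>Basis. D2 b z) \<partial>lborel) = exp (- l * t) *\<^sub>R (\<integral>z. heat_kernel t (x - z) *\<^sub>R (\<Sum>b\<in>Basis. D2 b z) \<partial>lborel)"
      unfolding q_def by (simp flip: scaleR_scaleR)
    also have "(\<integral>z. heat_kernel t (x - z) *\<^sub>R (\<Sum>b\<in>Basis. D2 b z) \<partial>lborel) = (\<integral>z. L z *\<^sub>R u z \<partial>lborel)"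
      unfolding L_def by (rule green_identity[OF u C2_heat_kernel[OF t0] K])
    also have "exp (- l * t) *\<^sub>R \<dots> = (\<integral>z. (exp (- l * t) * L z) *\<^sub>R u z \<partial>lborel)"
      by (simp flip: scaleR_scaleR)
    also have "(\<integral>z. q t z *\<^sub>R (l *\<^sub>R u z) \<partial>lborel) - \<dots> = (\<integral>z. q t z *\<^sub>R (l *\<^sub>R u z) - (exp (- l * t) * L z) *\<^sub>R u z \<partial>lborel)"
      using iq iL by simp
    also have "\<dots> = (\<integral>z. indicator K z *\<^sub>R (- q' t z) *\<^sub>R u z \<partial>lborel)"
      by (intro Bochner_Integration.integral_cong refl) (use K(2) in \<open>auto simp: indicator_def q'_eq algebra_simps\<close>)
    finally show ?thesis .
  qed
  have time: "(\<integral>t. indicator {e..T} t *\<^sub>R ((- q' t z) *\<^sub>R u z) \<partial>lborel) = q e z *\<^sub>R u z - q T z *\<^sub>R u z" for z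
  proof -
    have "(\<integral>t. indicator {e..T} t *\<^sub>R (- q' t z) \<partial>lborel) = (- q T z) - (- q e z)"
    proof (rule integral_FTC_Icc[OF e(2)])
      fix t assume "e \<le> t" "t \<le> T"
      then show "((\<lambda>t. - q t z) has_vector_derivative - q' t z) (at t within {e..T})"
        using DERIV_minus[OF dq[of t z]] e
        by (auto simp: has_real_derivative_iff_has_vector_derivative intro: has_vector_derivative_at_within)
    next
      show "continuous_on {e..T} (\<lambda>t. - q' t z)"
        by (intro continuous_on_minus continuous_on_compose2[OF cq', of "{e..T}" "\<lambda>t. (t, z)", simplified]) (auto intro!: continuous_intros)
    qed
    moreover have "(\<lambda>t. indicator {e..T} t *\<^sub>R ((- q' t z) *\<^sub>R u z)) = (\<lambda>t. (indicator {e..T} t *\<^sub>R (- q' t z)) *\<^sub>R u z)"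
      by (simp add: fun_eq_iff)
    moreover have "integrable lborel (\<lambda>t. indicator {e..T} t *\<^sub>R (- q' t z))"
      by (rule borel_integrable_compact) (auto intro!: continuous_intros continuous_on_compose2[OF cq', of "{e..T}" "\<lambda>t. (t, z)", simplified])
    ultimately show ?thesis
      by (simp only: integral_scaleR_left) (simp add: algebra_simps)
  qed
  have "(\<integral>z. (\<integral>t. indicator {e..T} t * (exp (- l * t) * heat_kernel t (x - z)) \<partial>lborel) *\<^sub>R th z \<partial>lborel)
      = (\<integral>z. indicator K z *\<^sub>R (\<integral>t. indicator {e..T} t *\<^sub>R (q t z *\<^sub>R th z) \<partial>lborel) \<partial>lborel)"
  proof (intro Bochner_Integration.integral_cong refl)
    fix z
    have "integrable lborel (\<lambda>t. indicator {e..T} t *\<^sub>R q t z)"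
      by (rule borel_integrable_compact) (auto intro!: continuous_on_compose2[OF cq, of "{e..T}" "\<lambda>t. (t, z)", simplified] continuous_intros)
    then have "(\<integral>t. (indicator {e..T} t *\<^sub>R q t z) *\<^sub>R th z \<partial>lborel) = (\<integral>t. indicator {e..T} t *\<^sub>R q t z \<partial>lborel) *\<^sub>R th z"
      by (rule integral_scaleR_left)
    then show "(\<integral>t. indicator {e..T} t * (exp (- l * t) * heat_kernel t (x - z)) \<partial>lborel) *\<^sub>R th z
        = indicator K z *\<^sub>R (\<integral>t. indicator {e..T} t *\<^sub>R (q t z *\<^sub>R th z) \<partial>lborel)"
      using th0[of z] by (auto simp: q_def indicator_def)
  qed
  also have "\<dots> = (\<integral>t. indicator {e..T} t *\<^sub>R (\<integral>z. indicator K z *\<^sub>R (q t z *\<^sub>R th z) \<partial>lborel) \<partial>lborel)"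
    by (rule fubini_compact[OF K(1) c1, symmetric])
  also have "\<dots> = (\<integral>t. indicator {e..T} t *\<^sub>R (\<integral>z. indicator K z *\<^sub>R ((- q' t z) *\<^sub>R u z) \<partial>lborel) \<partial>lborel)"
    by (intro Bochner_Integration.integral_cong refl) (use space in \<open>auto simp: indicator_def\<close>)
  also have "\<dots> = (\<integral>z. indicator K z *\<^sub>R (\<integral>t. indicator {e..T} t *\<^sub>R ((- q' t z) *\<^sub>R u z) \<partial>lborel) \<partial>lborel)"
    by (rule fubini_compact[OF K(1) c2])
  also have "\<dots> = (\<integral>z. q e z *\<^sub>R u z - q T z *\<^sub>R u z \<partial>lborel)"
  proof (intro Bochner_Integration.integral_cong refl)
    fix z
    show "indicator K z *\<^sub>R (\<integral>t. indicator {e..T} t *\<^sub>R ((- q' t z) *\<^sub>R u z) \<partial>lborel) = q e z *\<^sub>R u z - q T z *\<^sub>R u z"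
      unfolding time using K(2)[of z] by (cases "z \<in> K") auto
  qed
  also have "\<dots> = (\<integral>z. q e z *\<^sub>R u z \<partial>lborel) - (\<integral>z. q T z *\<^sub>R u z \<partial>lborel)"
    by (rule Bochner_Integration.integral_diff; rule integrable_continuous_compact_support[OF _ K(1)])
      (use K(2) in \<open>auto intro!: continuous_intros cqz cu\<close>)
  also have "\<dots> = exp (- l * e) *\<^sub>R heat_avg e u x - exp (- l * T) *\<^sub>R heat_avg T u x"
    unfolding q_def heat_avg_def by (simp flip: scaleR_scaleR)
  finally show ?thesis unfolding th_def .
qed

text \<open>The Laplace transform of the heat kernel, which is the kernel of the inverse of \<open>l - \<Delta>\<close>. From dimension two on
  it is infinite at the origin, whence the type \<open>ennreal\<close>.\<close>

definition resolvent_kernel :: "real \<Rightarrow> 'a::euclidean_space \<Rightarrow> ennreal" where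
  "resolvent_kernel l z = (\<integral>\<^sup>+t. indicator {0<..} t * ennreal (exp (- l * t) * heat_kernel t z) \<partial>lborel)"

lemma measurable_resolvent_kernel [measurable]: "resolvent_kernel l \<in> borel_measurable borel"
  unfolding resolvent_kernel_def by measurable

lemma resolvent_kernel_minus: "resolvent_kernel l (x - y) = resolvent_kernel l (y - x)"
proof -
  have "heat_kernel t (x - y) = heat_kernel t (y - x)" for t
    by (metis heat_kernel_minus minus_diff_eq)
  then show ?thesis unfolding resolvent_kernel_def by simp
qed

lemma nn_integral_resolvent_kernel:
  assumes l: "0 < l"
  shows "(\<integral>\<^sup>+z. resolvent_kernel l (z::'a::euclidean_space) \<partial>lborel) = ennreal (1 / l)"
proof -
  have "(\<integral>\<^sup>+z. resolvent_kernel l (z::'a) \<partial>lborel)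
     = (\<integral>\<^sup>+t. \<integral>\<^sup>+z. indicator {0<..} t * ennreal (exp (- l * t) * heat_kernel t (z::'a)) \<partial>lborel \<partial>lborel)"
    unfolding resolvent_kernel_def by (rule lborel_pair.Fubini') measurable
  also have "\<dots> = (\<integral>\<^sup>+t. indicator {0<..} t * ennreal (exp (- l * t)) \<partial>lborel)"
  proof (intro nn_integral_cong)
    fix t :: real
    show "(\<integral>\<^sup>+z. indicator {0<..} t * ennreal (exp (- l * t) * heat_kernel t (z::'a)) \<partial>lborel)
       = indicator {0<..} t * ennreal (exp (- l * t))"
      by (cases "0 < t") (auto simp: ennreal_mult nn_integral_cmult nn_integral_heat_kernel)
  qed
  also have "\<dots> = (\<integral>\<^sup>+t. ennreal (exp (- l * t)) * indicator {0..} t \<partial>lborel)"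
    by (intro nn_integral_cong_AE AE_I[where N="{0}"]) (auto simp: indicator_def)
  also have "\<dots> = ennreal (0 - (- exp (- l * 0) / l))"
  proof (rule nn_integral_FTC_atLeast)
    show "((\<lambda>t. - exp (- l * t) / l) \<longlongrightarrow> 0) at_top"
    proof -
      have "((\<lambda>t. exp (- l * t)) \<longlongrightarrow> 0) at_top"
        using l by real_asymp
      then have "((\<lambda>t. - exp (- l * t) / l) \<longlongrightarrow> - 0 / l) at_top"
        by (intro tendsto_intros) (use l in auto)
      then show ?thesis by simp
    qed
  qed (use l in \<open>auto intro!: derivative_eq_intros\<close>)
  finally show ?thesis by simp
qed

lemma nn_integral_resolvent_kernel_shift:
  assumes l: "0 < l"
  shows "(\<integral>\<^sup>+z. resolvent_kernel l (x - z) \<partial>lborel) = ennreal (1 / l)"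
    and "(\<integral>\<^sup>+z. resolvent_kernel l (z - x) \<partial>lborel) = ennreal (1 / l)"
  using nn_integral_lborel_reflect[of "resolvent_kernel l" x] nn_integral_resolvent_kernel[OF l, where 'a='a]
  by (auto simp: resolvent_kernel_minus[of l _ x])

text \<open>Fatou's lemma, applied to the continuous heat kernels, gives semicontinuity at every point, the pole included.\<close>

lemma resolvent_kernel_lsc:
  fixes z :: "'a::euclidean_space"
  assumes "y \<longlonglongrightarrow> z"
  shows "resolvent_kernel l z \<le> liminf (\<lambda>i. resolvent_kernel l (y i))"
proof -
  have "(\<lambda>i. heat_kernel t (y i)) \<longlonglongrightarrow> heat_kernel t z" for t
    by (rule continuous_on_tendsto_compose[OF continuous_heat_kernel assms]) auto
  then have "(\<lambda>i. indicator {0<..} t * ennreal (exp (- l * t) * heat_kernel t (y i)))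
      \<longlonglongrightarrow> indicator {0<..} t * ennreal (exp (- l * t) * heat_kernel t z)" for t
    by (cases "0 < t") (auto intro!: tendsto_ennrealI tendsto_intros)
  then have "resolvent_kernel l z = (\<integral>\<^sup>+t. liminf (\<lambda>i. indicator {0<..} t * ennreal (exp (- l * t) * heat_kernel t (y i))) \<partial>lborel)"
    unfolding resolvent_kernel_def
    by (intro nn_integral_cong lim_imp_Liminf[symmetric]) auto
  also have "\<dots> \<le> liminf (\<lambda>i. resolvent_kernel l (y i))"
    unfolding resolvent_kernel_def by (rule nn_integral_liminf) measurable
  finally show ?thesis .
qed

text \<open>Restricting the Laplace transform to a compact time interval makes \<open>truncated_resolvent\<close> applicable and the
  kernel real valued.\<close>

definition trunc_kernel :: "real \<Rightarrow> nat \<Rightarrow> 'a::euclidean_space \<Rightarrow> real" where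
  "trunc_kernel l i z = (\<integral>t. indicator {1 / real (Suc i)..real (Suc i)} t * (exp (- l * t) * heat_kernel t z) \<partial>lborel)"

lemma trunc_kernel_nonneg [simp]: "0 \<le> trunc_kernel l i z"
  unfolding trunc_kernel_def by (intro integral_nonneg_AE) auto

lemma trunc_kernel_eq_nn:
  "ennreal (trunc_kernel l i z) =
    (\<integral>\<^sup>+t. indicator {1 / real (Suc i)..real (Suc i)} t * ennreal (exp (- l * t) * heat_kernel t z) \<partial>lborel)"
proof -
  have pos: "0 < 1 / real (Suc i)" by simp
  have "integrable lborel (\<lambda>t. indicator {1 / real (Suc i)..real (Suc i)} t *\<^sub>R (exp (- l * t) * heat_kernel t z))"
  proof (rule borel_integrable_compact)
    show "continuous_on {1 / real (Suc i)..real (Suc i)} (\<lambda>t. exp (- l * t) * heat_kernel t z)"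
      by (intro continuous_intros continuous_on_compose2[OF continuous_heat_kernel_pair, of _ "\<lambda>t. (t, z)", simplified])
        (auto intro: less_le_trans[of 0 "1 / (1 + real i)"])
  qed simp
  then have "ennreal (trunc_kernel l i z) = (\<integral>\<^sup>+t. ennreal (indicator {1 / real (Suc i)..real (Suc i)} t * (exp (- l * t) * heat_kernel t z)) \<partial>lborel)"
    unfolding trunc_kernel_def by (subst nn_integral_eq_integral) auto
  then show ?thesis by (simp add: ennreal_mult' ennreal_indicator)
qed

lemma measurable_trunc_kernel [measurable]: "trunc_kernel l i \<in> borel_measurable borel"
  unfolding trunc_kernel_def by measurable

lemma trunc_kernel_le: "ennreal (trunc_kernel l i z) \<le> resolvent_kernel l z"
proof -
  show ?thesis unfolding trunc_kernel_eq_nn resolvent_kernel_def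
    by (intro nn_integral_mono mult_right_mono) (auto simp: indicator_def intro: less_le_trans[of 0 "1 / (1 + real i)"])
qed

lemma resolvent_kernel_le_liminf_trunc:
  "resolvent_kernel l z \<le> liminf (\<lambda>i. ennreal (trunc_kernel l i z))"
proof -
  have "(\<lambda>i. indicator {1 / real (Suc i)..real (Suc i)} t * ennreal (exp (- l * t) * heat_kernel t z))
     \<longlonglongrightarrow> indicator {0<..} t * ennreal (exp (- l * t) * heat_kernel t z)" for t
  proof (cases "0 < t")
    case True
    have "eventually (\<lambda>i. 1 / real (Suc i) < t) sequentially"
      using order_tendstoD(2)[OF LIMSEQ_inverse_real_of_nat True] by (simp add: inverse_eq_divide)
    moreover have "eventually (\<lambda>i. t \<le> real i) sequentially"
      using eventually_ge_at_top[of "nat \<lceil>t\<rceil>"] by eventually_elim (use True in linarith)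
    ultimately have "eventually (\<lambda>i. indicator {1 / real (Suc i)..real (Suc i)} t = (1::ennreal)) sequentially"
      by eventually_elim auto
    then show ?thesis
      using True by (intro tendsto_eventually) (auto elim: eventually_mono)
  next
    case False
    have "0 < 1 / real (Suc i)" for i by simp
    then have "\<not> 1 / real (Suc i) \<le> t" for i using False by (meson less_le_trans)
    then show ?thesis using False by simp
  qed
  then have "resolvent_kernel l z = (\<integral>\<^sup>+t. liminf (\<lambda>i. indicator {1 / real (Suc i)..real (Suc i)} t * ennreal (exp (- l * t) * heat_kernel t z)) \<partial>lborel)"
    unfolding resolvent_kernel_def
    by (intro nn_integral_cong lim_imp_Liminf[symmetric]) auto
  also have "\<dots> \<le> liminf (\<lambda>i. ennreal (trunc_kernel l i z))"
    unfolding trunc_kernel_eq_nn by (rule nn_integral_liminf) measurable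
  finally show ?thesis .
qed

lemma trunc_kernel_tendsto: "(\<lambda>i. ennreal (trunc_kernel l i z)) \<longlonglongrightarrow> resolvent_kernel l z"
proof -
  have "limsup (\<lambda>i. ennreal (trunc_kernel l i z)) \<le> resolvent_kernel l z"
    by (intro Limsup_bounded always_eventually allI trunc_kernel_le)
  moreover have "liminf (\<lambda>i. ennreal (trunc_kernel l i z)) \<le> limsup (\<lambda>i. ennreal (trunc_kernel l i z))"
    by (rule Liminf_le_Limsup) simp
  ultimately show ?thesis
    using resolvent_kernel_le_liminf_trunc[of l z]
    by (subst tendsto_iff_Liminf_eq_Limsup) auto
qed

lemma C2_with_bounded:
  assumes "C2_with u D1 D2" and K: "compact K" "\<And>x. x \<notin> K \<Longrightarrow> u x = 0"
  obtains M where "\<And>x. norm (u x) \<le> M"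
proof -
  have "continuous_on K u" using assms(1) by (auto simp: C2_with_def intro: continuous_on_subset)
  from compact_imp_bounded[OF compact_continuous_image[OF this K(1)]]
  obtain M where "M > 0" "\<And>x. x \<in> K \<Longrightarrow> norm (u x) \<le> M" by (auto simp: bounded_pos)
  then show thesis using K(2) that[of M] by (metis less_imp_le norm_zero)
qed

lemma trunc_resolvent_tendsto:
  fixes u :: "'a::euclidean_space \<Rightarrow> 'b::{banach, second_countable_topology}"
  assumes u: "C2_with u D1 D2" and K: "compact K" "\<And>x. x \<notin> K \<Longrightarrow> u x = 0" and l: "0 < l"
  shows "(\<lambda>i. exp (- l * (1 / real (Suc i))) *\<^sub>R heat_avg (1 / real (Suc i)) u x) \<longlonglongrightarrow> u x"
    and "(\<lambda>i. exp (- l * real (Suc i)) *\<^sub>R heat_avg (real (Suc i)) u x) \<longlonglongrightarrow> 0"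
proof -
  obtain M where M: "\<And>x. norm (u x) \<le> M" using C2_with_bounded[OF u K] by blast
  have cu: "continuous_on UNIV u" using u by (simp add: C2_with_def)
  then have [measurable]: "u \<in> borel_measurable borel" by (rule borel_measurable_continuous_onI)
  have t0: "(\<lambda>i. 1 / real (Suc i)) \<longlonglongrightarrow> 0" using LIMSEQ_inverse_real_of_nat by (simp add: inverse_eq_divide)
  have "(\<lambda>i. exp (- l * (1 / real (Suc i))) *\<^sub>R heat_avg (1 / real (Suc i)) u x) \<longlonglongrightarrow> exp (- l * 0) *\<^sub>R u x"
    by (intro tendsto_intros t0 heat_avg_tendsto[OF cu M]) auto
  then show "(\<lambda>i. exp (- l * (1 / real (Suc i))) *\<^sub>R heat_avg (1 / real (Suc i)) u x) \<longlonglongrightarrow> u x" by simp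
  show "(\<lambda>i. exp (- l * real (Suc i)) *\<^sub>R heat_avg (real (Suc i)) u x) \<longlonglongrightarrow> 0"
  proof (rule Lim_null_comparison)
    show "\<forall>\<^sub>F i in sequentially. norm (exp (- l * real (Suc i)) *\<^sub>R heat_avg (real (Suc i)) u x) \<le> exp (- l * real (Suc i)) * M"
      by (intro always_eventually allI) (auto intro!: mult_left_mono norm_heat_avg_le M)
    have "(\<lambda>i. exp (- l * real (Suc i))) \<longlonglongrightarrow> 0" using l by real_asymp
    then show "(\<lambda>i. exp (- l * real (Suc i)) * M) \<longlonglongrightarrow> 0" by (rule tendsto_mult_left_zero)
  qed
qed

text \<open>In the limit of \<open>truncated_resolvent\<close> the function \<open>u\<close> is the resolvent of \<open>l u - \<Delta>u\<close>.\<close>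

lemma norm_le_resolvent:
  fixes u :: "'a::euclidean_space \<Rightarrow> 'b::{banach, second_countable_topology}"
  assumes u: "C2_with u D1 D2" and K: "compact K" "\<And>x. x \<notin> K \<Longrightarrow> u x = 0" and l: "0 < l"
  shows "ennreal (norm (u x)) \<le> (\<integral>\<^sup>+z. resolvent_kernel l (x - z) * ennreal (norm (l *\<^sub>R u z - (\<Sum>b\<in>Basis. D2 b z))) \<partial>lborel)"
    (is "_ \<le> ?R")
proof (rule LIMSEQ_le_const2)
  define th where "th z = l *\<^sub>R u z - (\<Sum>b\<in>Basis. D2 b z)" for z
  note lim = trunc_resolvent_tendsto[OF u K l, of x]
  show "(\<lambda>i. ennreal (norm (exp (- l * (1 / real (Suc i))) *\<^sub>R heat_avg (1 / real (Suc i)) u x - exp (- l * real (Suc i)) *\<^sub>R heat_avg (real (Suc i)) u x)))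
      \<longlonglongrightarrow> ennreal (norm (u x))"
    using tendsto_diff[OF lim] by (intro tendsto_ennrealI tendsto_norm) simp
  have "ennreal (norm (exp (- l * (1 / real (Suc i))) *\<^sub>R heat_avg (1 / real (Suc i)) u x - exp (- l * real (Suc i)) *\<^sub>R heat_avg (real (Suc i)) u x)) \<le> ?R" for i
  proof -
    have le: "1 / real (Suc i) \<le> real (Suc i)"
      by (rule order_trans[of _ 1]) auto
    have "exp (- l * (1 / real (Suc i))) *\<^sub>R heat_avg (1 / real (Suc i)) u x - exp (- l * real (Suc i)) *\<^sub>R heat_avg (real (Suc i)) u x
      = (\<integral>z. trunc_kernel l i (x - z) *\<^sub>R th z \<partial>lborel)"
      unfolding trunc_kernel_def th_def by (rule truncated_resolvent[OF u K _ le, symmetric]) auto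
    also have "ennreal (norm \<dots>) \<le> (\<integral>\<^sup>+z. ennreal (norm (trunc_kernel l i (x - z) *\<^sub>R th z)) \<partial>lborel)"
    proof (cases "integrable lborel (\<lambda>z. trunc_kernel l i (x - z) *\<^sub>R th z)")
      case True
      then show ?thesis by (rule integral_norm_bound_ennreal)
    next
      case False
      then show ?thesis by (simp add: not_integrable_integral_eq)
    qed
    also have "\<dots> \<le> ?R"
      unfolding th_def[symmetric]
      by (intro nn_integral_mono) (auto simp: ennreal_mult intro!: mult_right_mono trunc_kernel_le)
    finally show ?thesis .
  qed
  then show "\<exists>N. \<forall>i\<ge>N. ennreal (norm (exp (- l * (1 / real (Suc i))) *\<^sub>R heat_avg (1 / real (Suc i)) u x - exp (- l * real (Suc i)) *\<^sub>R heat_avg (real (Suc i)) u x)) \<le> ?R"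
    by blast
qed

text \<open>One half of the identity that the resolvent of \<open>a - c\<close> is \<open>u\<close>, with the two parts of the difference on separate
  sides, where no subtraction of extended numbers is needed.\<close>

lemma resolvent_pos_part_le:
  fixes u a c :: "'a::euclidean_space \<Rightarrow> real"
  assumes u: "C2_with u D1 D2" and K: "compact K" "\<And>x. x \<notin> K \<Longrightarrow> u x = 0" and l: "0 < l"
    and nn: "\<And>z. 0 \<le> u z" "\<And>z. 0 \<le> a z" "\<And>z. 0 \<le> c z"
    and cont: "continuous_on UNIV a" "continuous_on UNIV c"
    and supp: "\<And>x. x \<notin> K \<Longrightarrow> a x = 0" "\<And>x. x \<notin> K \<Longrightarrow> c x = 0"
    and eq: "\<And>z. l * u z - (\<Sum>b\<in>Basis. D2 b z) = a z - c z"
  shows "(\<integral>\<^sup>+z. resolvent_kernel l (x - z) * ennreal (a z) \<partial>lborel)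
    \<le> ennreal (u x) + (\<integral>\<^sup>+z. resolvent_kernel l (x - z) * ennreal (c z) \<partial>lborel)" (is "?A \<le> _ + ?C")
proof -
  have [measurable]: "a \<in> borel_measurable borel" "c \<in> borel_measurable borel"
    using cont by (auto intro: borel_measurable_continuous_onI)
  note lim = trunc_resolvent_tendsto[OF u K l, of x]
  have int: "integrable lborel (\<lambda>z. trunc_kernel l i (x - z) * f z)"
    if f: "continuous_on UNIV f" "\<And>x. x \<notin> K \<Longrightarrow> f x = 0" "\<And>x. 0 \<le> f x" for f i
  proof -
    have [measurable]: "f \<in> borel_measurable borel" using f(1) by (rule borel_measurable_continuous_onI)
    from compact_imp_bounded[OF compact_continuous_image[OF continuous_on_subset[OF f(1)] K(1)]]
    obtain M where "M > 0" "\<And>x. x \<in> K \<Longrightarrow> f x \<le> M" by (auto simp: bounded_pos abs_le_iff)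
    then have M: "f x \<le> M" for x using f(2)[of x] by (cases "x \<in> K") auto
    have "(\<integral>\<^sup>+z. ennreal (trunc_kernel l i (x - z) * f z) \<partial>lborel) \<le> (\<integral>\<^sup>+z. resolvent_kernel l (x - z) * ennreal M \<partial>lborel)"
      using f(3) by (intro nn_integral_mono) (auto simp: ennreal_mult intro!: mult_mono trunc_kernel_le M ennreal_leI)
    also have "\<dots> < \<infinity>"
      using nn_integral_resolvent_kernel_shift[OF l, of x] by (simp add: nn_integral_multc ennreal_mult_less_top)
    finally show ?thesis using f(3) by (intro integrableI_nonneg) auto
  qed
  have step: "(\<integral>\<^sup>+z. ennreal (trunc_kernel l i (x - z) * a z) \<partial>lborel)
      \<le> ennreal (exp (- l * (1 / real (Suc i))) *\<^sub>R heat_avg (1 / real (Suc i)) u x) + ?C" for i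
  proof -
    have le: "1 / real (Suc i) \<le> real (Suc i)"
      by (rule order_trans[of _ 1]) auto
    have nnh: "0 \<le> heat_avg t u x" for t unfolding heat_avg_def by (intro integral_nonneg_AE) (auto simp: nn)
    have ia: "integrable lborel (\<lambda>z. trunc_kernel l i (x - z) * a z)" and ic: "integrable lborel (\<lambda>z. trunc_kernel l i (x - z) * c z)"
      by (rule int; use cont nn supp in auto)+
    have "(\<integral>z. trunc_kernel l i (x - z) * a z \<partial>lborel) - (\<integral>z. trunc_kernel l i (x - z) * c z \<partial>lborel)
       = (\<integral>z. trunc_kernel l i (x - z) *\<^sub>R (l *\<^sub>R u z - (\<Sum>b\<in>Basis. D2 b z)) \<partial>lborel)"
      using ia ic by (simp add: eq right_diff_distrib)
    also have "\<dots> = exp (- l * (1 / real (Suc i))) *\<^sub>R heat_avg (1 / real (Suc i)) u x - exp (- l * real (Suc i)) *\<^sub>R heat_avg (real (Suc i)) u x"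
      unfolding trunc_kernel_def by (rule truncated_resolvent[OF u K _ le]) auto
    also have "\<dots> \<le> exp (- l * (1 / real (Suc i))) *\<^sub>R heat_avg (1 / real (Suc i)) u x"
      using nnh by simp
    finally have "(\<integral>z. trunc_kernel l i (x - z) * a z \<partial>lborel)
       \<le> exp (- l * (1 / real (Suc i))) *\<^sub>R heat_avg (1 / real (Suc i)) u x + (\<integral>z. trunc_kernel l i (x - z) * c z \<partial>lborel)" by simp
    then have "ennreal (\<integral>z. trunc_kernel l i (x - z) * a z \<partial>lborel)
       \<le> ennreal (exp (- l * (1 / real (Suc i))) *\<^sub>R heat_avg (1 / real (Suc i)) u x) + ennreal (\<integral>z. trunc_kernel l i (x - z) * c z \<partial>lborel)"
      by (subst ennreal_plus[symmetric]) (use nnh in \<open>auto intro!: integral_nonneg_AE ennreal_leI simp: nn simp del: ennreal_plus\<close>)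
    also have "ennreal (\<integral>z. trunc_kernel l i (x - z) * c z \<partial>lborel) \<le> ?C"
      using nn ic by (subst nn_integral_eq_integral[symmetric])
        (auto simp: ennreal_mult intro!: nn_integral_mono mult_right_mono trunc_kernel_le)
    also have "ennreal (\<integral>z. trunc_kernel l i (x - z) * a z \<partial>lborel) = (\<integral>\<^sup>+z. ennreal (trunc_kernel l i (x - z) * a z) \<partial>lborel)"
      using nn ia by (subst nn_integral_eq_integral) auto
    finally show ?thesis by (simp add: add_left_mono)
  qed
  have "?A \<le> (\<integral>\<^sup>+z. liminf (\<lambda>i. ennreal (trunc_kernel l i (x - z) * a z)) \<partial>lborel)"
  proof (intro nn_integral_mono)
    fix z
    have "(\<lambda>i. ennreal (a z) * ennreal (trunc_kernel l i (x - z))) \<longlonglongrightarrow> ennreal (a z) * resolvent_kernel l (x - z)"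
      by (intro ennreal_tendsto_cmult trunc_kernel_tendsto) auto
    then have "liminf (\<lambda>i. ennreal (a z) * ennreal (trunc_kernel l i (x - z))) = ennreal (a z) * resolvent_kernel l (x - z)"
      by (intro lim_imp_Liminf) auto
    then show "resolvent_kernel l (x - z) * ennreal (a z) \<le> liminf (\<lambda>i. ennreal (trunc_kernel l i (x - z) * a z))"
      using nn by (simp add: ennreal_mult mult.commute)
  qed
  also have "\<dots> \<le> liminf (\<lambda>i. \<integral>\<^sup>+z. ennreal (trunc_kernel l i (x - z) * a z) \<partial>lborel)"
    by (rule nn_integral_liminf) measurable
  also have "\<dots> \<le> liminf (\<lambda>i. ennreal (exp (- l * (1 / real (Suc i))) *\<^sub>R heat_avg (1 / real (Suc i)) u x) + ?C)"
    by (intro Liminf_mono always_eventually allI step)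
  also have "\<dots> = ennreal (u x) + ?C"
    by (intro lim_imp_Liminf tendsto_add tendsto_const tendsto_ennrealI lim) auto
  finally show ?thesis .
qed

text \<open>The cube of this truncated paraboloid is a compactly supported \<open>C\<^sup>2\<close> function whose Laplacian is a combination
  of the first two powers of the paraboloid, and the square is, up to scaling, a kernel for averages over balls.\<close>

definition tent :: "real \<Rightarrow> 'a::euclidean_space \<Rightarrow> 'a \<Rightarrow> real" where
  "tent r a z = max 0 (r\<^sup>2 - (norm (z - a))\<^sup>2)"

lemma tent_nonneg [simp]: "0 \<le> tent r a z"
  by (simp add: tent_def)

lemma continuous_tent [continuous_intros]: "continuous_on UNIV (tent r a)"
  unfolding tent_def by (intro continuous_intros)

lemma measurable_tent [measurable]: "tent r a \<in> borel_measurable borel"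
  by (intro borel_measurable_continuous_onI continuous_tent)

lemma tent_eq_0:
  assumes "0 \<le> r" "z \<notin> cball a r" shows "tent r a z = 0"
  using assms power_mono[of r "norm (z - a)" 2] by (auto simp: tent_def dist_norm norm_minus_commute)

definition tent_mass :: "'a::euclidean_space itself \<Rightarrow> ennreal" where
  "tent_mass _ = (\<integral>\<^sup>+z. ennreal (tent 1 (0::'a) z ^ 2) \<partial>lborel)"

lemma DERIV_pos_part_power:
  "((\<lambda>s. (max 0 s) ^ Suc (Suc k)) has_real_derivative real (Suc (Suc k)) * (max 0 s) ^ Suc k) (at s)"
proof -
  consider "s < 0" | "s > 0" | "s = 0" by linarith
  then show ?thesis
  proof cases
    case 1
    have "((\<lambda>s. 0) has_real_derivative real (Suc (Suc k)) * (max 0 s) ^ Suc k) (at s)"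
      using 1 by simp
    then show ?thesis
      by (rule has_field_derivative_transform_within_open[where S="{..<0}"]) (use 1 in auto)
  next
    case 2
    have "((\<lambda>s. s ^ Suc (Suc k)) has_real_derivative real (Suc (Suc k)) * s ^ Suc k) (at s)"
      by (rule DERIV_cong[OF DERIV_pow]) simp
    then have "((\<lambda>s. s ^ Suc (Suc k)) has_real_derivative real (Suc (Suc k)) * (max 0 s) ^ Suc k) (at s)"
      using 2 by simp
    then show ?thesis
      by (rule has_field_derivative_transform_within_open[where S="{0<..}"]) (use 2 in auto)
  next
    case 3
    have "((\<lambda>h. (max 0 h) ^ Suc k) \<longlongrightarrow> (max 0 0) ^ Suc k) (at (0::real))"
      by (intro tendsto_intros)
    moreover have "(max 0 h) ^ Suc k = ((max 0 (0 + h)) ^ Suc (Suc k) - (max 0 0) ^ Suc (Suc k)) / h"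
      if "h \<noteq> 0" for h :: real
      using that by (cases "h > 0") (auto simp: max_def)
    ultimately have "((\<lambda>h. ((max 0 (0 + h)) ^ Suc (Suc k) - (max 0 0) ^ Suc (Suc k)) / h) \<longlongrightarrow> 0) (at (0::real))"
      by (subst (asm) LIM_equal[where g="\<lambda>h. ((max 0 (0 + h)) ^ Suc (Suc k) - (max 0 0) ^ Suc (Suc k)) / h"]) auto
    then show ?thesis unfolding 3 by (simp add: DERIV_def)
  qed
qed

lemma tent_shift:
  assumes "b \<in> Basis"
  shows "tent r a (z + h *\<^sub>R b) = max 0 (r\<^sup>2 - ((norm (z - a))\<^sup>2 + 2 * h * ((z - a) \<bullet> b) + h\<^sup>2))"
proof -
  have "z + h *\<^sub>R b - a = (z - a) + h *\<^sub>R b" by simp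
  then show ?thesis unfolding tent_def by (simp only: norm_sq_shift[OF assms])
qed

lemma C2_tent_cube:
  fixes a :: "'a::euclidean_space"
  shows "C2_with (\<lambda>z. tent r a z ^ 3)
    (\<lambda>b z. - 6 * ((z - a) \<bullet> b) * tent r a z ^ 2)
    (\<lambda>b z. - 6 * tent r a z ^ 2 + 24 * ((z - a) \<bullet> b)\<^sup>2 * tent r a z)"
proof -
  have inner: "((\<lambda>h. r\<^sup>2 - ((norm (z - a))\<^sup>2 + 2 * h * ((z - a) \<bullet> b) + h\<^sup>2)) has_real_derivative - 2 * ((z - a) \<bullet> b)) (at 0)" for z b
    by (auto intro!: derivative_eq_intros)
  have pw: "((\<lambda>h. tent r a (z + h *\<^sub>R b) ^ Suc (Suc k)) has_real_derivative
      real (Suc (Suc k)) * tent r a z ^ Suc k * (- 2 * ((z - a) \<bullet> b))) (at 0)" if b: "b \<in> Basis" for z b k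
    using DERIV_chain'[OF inner DERIV_pos_part_power, of z b k] unfolding tent_shift[OF b] by (simp add: tent_def)
  have d1: "((\<lambda>h. tent r a (z + h *\<^sub>R b) ^ 3) has_real_derivative - 6 * ((z - a) \<bullet> b) * tent r a z ^ 2) (at 0)"
    if b: "b \<in> Basis" for z b
    using pw[OF b, of z 1] by (simp add: numeral_3_eq_3 power2_eq_square mult_ac)
  have d2: "((\<lambda>h. - 6 * ((z + h *\<^sub>R b - a) \<bullet> b) * tent r a (z + h *\<^sub>R b) ^ 2) has_real_derivative
      - 6 * tent r a z ^ 2 + 24 * ((z - a) \<bullet> b)\<^sup>2 * tent r a z) (at 0)" if b: "b \<in> Basis" for z b
  proof -
    have eq: "(z + h *\<^sub>R b - a) \<bullet> b = (z - a) \<bullet> b + h" for h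
      using b by (simp add: inner_diff_left inner_add_left)
    have l: "((\<lambda>h. - 6 * ((z - a) \<bullet> b + h)) has_real_derivative - 6) (at 0)"
      by (auto intro!: derivative_eq_intros)
    show ?thesis unfolding eq
      by (rule DERIV_cong[OF DERIV_mult[OF l pw[OF b, of z 0, unfolded numeral_2_eq_2[symmetric]]]])
        (simp add: power2_eq_square algebra_simps)
  qed
  show ?thesis
    unfolding C2_with_def using d1 d2
    by (auto simp: has_real_derivative_iff_has_vector_derivative[symmetric] intro!: continuous_intros continuous_tent)
qed

lemma laplacian_tent_cube:
  fixes a z :: "'a::euclidean_space"
  shows "(\<Sum>b\<in>Basis. - 6 * tent r a z ^ 2 + 24 * ((z - a) \<bullet> b)\<^sup>2 * tent r a z)
    = 24 * r\<^sup>2 * tent r a z - (6 * real DIM('a) + 24) * tent r a z ^ 2"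
proof -
  have "(\<Sum>b\<in>Basis. - 6 * tent r a z ^ 2 + 24 * ((z - a) \<bullet> b)\<^sup>2 * tent r a z)
     = - 6 * real DIM('a) * tent r a z ^ 2 + 24 * (\<Sum>b\<in>Basis. ((z - a) \<bullet> b)\<^sup>2) * tent r a z"
    by (simp add: sum.distrib sum_subtractf sum_distrib_left sum_distrib_right)
  also have "\<dots> = - 6 * real DIM('a) * tent r a z ^ 2 + 24 * ((norm (z - a))\<^sup>2 * tent r a z)"
    unfolding sum_inner_Basis_sq by simp
  \<comment> \<open>Where the tent does not vanish, \<open>|z - a|\<^sup>2 = r\<^sup>2 - tent\<close>.\<close>
  also have "(norm (z - a))\<^sup>2 * tent r a z = (r\<^sup>2 - tent r a z) * tent r a z"
    by (auto simp: tent_def max_def)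
  finally show ?thesis by (simp add: algebra_simps power2_eq_square)
qed

text \<open>For the cube \<open>u\<close> of the tent, \<open>l u - \<Delta>u\<close> splits by \<open>laplacian_tent_cube\<close> into a nonnegative part with \<open>tent\<^sup>3\<close>
  and \<open>tent\<^sup>2\<close> and a nonpositive part with \<open>tent\<close>.\<close>

lemma resolvent_tent_le:
  fixes x a :: "'a::euclidean_space"
  assumes l: "0 < l" and r: "0 < r"
  shows "(\<integral>\<^sup>+z. resolvent_kernel l (x - z) * ennreal (l * tent r a z ^ 3 + (6 * real DIM('a) + 24) * tent r a z ^ 2) \<partial>lborel)
    \<le> ennreal (tent r a x ^ 3) + (\<integral>\<^sup>+z. resolvent_kernel l (x - z) * ennreal (24 * r\<^sup>2 * tent r a z) \<partial>lborel)"
proof (rule resolvent_pos_part_le[OF C2_tent_cube, where K="cball a r"])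
  show "l * tent r a z ^ 3 - (\<Sum>b\<in>Basis. - 6 * tent r a z ^ 2 + 24 * ((z - a) \<bullet> b)\<^sup>2 * tent r a z)
    = l * tent r a z ^ 3 + (6 * real DIM('a) + 24) * tent r a z ^ 2 - 24 * r\<^sup>2 * tent r a z" for z
    unfolding laplacian_tent_cube by simp
qed (use l r in \<open>auto simp: tent_eq_0 intro!: continuous_intros\<close>)

section \<open>The Green function of a bounded potential\<close>

lemma ennreal_liminf_superadditive:
  fixes u v :: "nat \<Rightarrow> ennreal"
  shows "liminf u + liminf v \<le> liminf (\<lambda>n. u n + v n)"
proof -
  have inc: "incseq (\<lambda>n. INF m\<in>{n..}. w m)" for w :: "nat \<Rightarrow> ennreal"
    by (auto simp: incseq_def intro!: INF_superset_mono)
  have "liminf u + liminf v = (SUP n. (INF m\<in>{n..}. u m) + (INF m\<in>{n..}. v m))"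
    unfolding liminf_SUP_INF by (rule ennreal_SUP_add[symmetric]) (rule inc)+
  also have "\<dots> \<le> (SUP n. INF m\<in>{n..}. u m + v m)"
    by (intro SUP_mono' INF_greatest add_mono INF_lower)
  finally show ?thesis unfolding liminf_SUP_INF .
qed

lemma ennreal_mult_liminf_le:
  fixes c :: ennreal and f :: "nat \<Rightarrow> ennreal"
  shows "c * liminf f \<le> liminf (\<lambda>i. c * f i)"
proof -
  have "c * liminf f = (SUP n. c * (INF m\<in>{n..}. f m))"
    unfolding liminf_SUP_INF by (rule SUP_mult_left_ennreal)
  also have "\<dots> \<le> (SUP n. INF m\<in>{n..}. c * f m)"
    by (intro SUP_mono' INF_greatest mult_left_mono INF_lower) auto
  finally show ?thesis unfolding liminf_SUP_INF .
qed

text \<open>For a potential \<open>0 \<le> V \<le> k\<close> one has \<open>-\<Delta> + V + d = (k + d - \<Delta>) - (k - V)\<close>, the perturbation of a resolvent by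
  multiplication with the nonnegative function \<open>W = k - V\<close>. All terms of the resulting Neumann series are
  nonnegative, and \<open>d > 0\<close> makes it converge geometrically: the resolvent kernel \<open>G\<close> has mass \<open>1 / (k + d)\<close>,
  while \<open>W \<le> k\<close>.\<close>

locale bounded_potential =
  fixes V :: "'a::euclidean_space \<Rightarrow> real" and k d :: real
  assumes V_measurable [measurable]: "V \<in> borel_measurable borel"
    and V_nonneg: "0 \<le> V x" and V_le: "V x \<le> k" and d_pos: "0 < d"
begin

lemma k_nonneg: "0 \<le> k" using V_nonneg[of 0] V_le[of 0] by simp

lemma l_pos: "0 < k + d" using k_nonneg d_pos by simp

abbreviation G where "G \<equiv> resolvent_kernel (k + d) :: 'a \<Rightarrow> ennreal"

definition W where "W x = ennreal (k - V x)"

lemma W_measurable [measurable]: "W \<in> borel_measurable borel"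
  unfolding W_def by measurable

lemma W_le: "W x \<le> ennreal k"
  unfolding W_def using V_nonneg by (intro ennreal_leI) simp

lemma W_plus: "W x + ennreal (d + V x) = ennreal (k + d)"
  unfolding W_def using V_nonneg V_le d_pos by (subst ennreal_plus[symmetric]) (auto simp del: ennreal_plus simp: add_nonneg_nonneg less_imp_le)

primrec green_iter :: "nat \<Rightarrow> 'a \<Rightarrow> 'a \<Rightarrow> ennreal" where
  "green_iter 0 = (\<lambda>x y. G (x - y))"
| "green_iter (Suc j) = (\<lambda>x y. \<integral>\<^sup>+z. G (x - z) * W z * green_iter j z y \<partial>lborel)"

text \<open>The Green function of \<open>-\<Delta> + V + d\<close>.\<close>

definition green :: "'a \<Rightarrow> 'a \<Rightarrow> ennreal" where
  "green x y = (\<Sum>j. green_iter j x y)"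

lemma green_iter_pair_measurable: "(\<lambda>(x, y). green_iter j x y) \<in> borel_measurable (borel \<Otimes>\<^sub>M borel)"
proof (induction j)
  case 0
  show ?case unfolding green_iter.simps case_prod_unfold by measurable
next
  case (Suc j)
  have 1: "(\<lambda>q. (\<lambda>(x, y). green_iter j x y) (snd q, snd (fst q))) \<in> borel_measurable ((borel \<Otimes>\<^sub>M borel) \<Otimes>\<^sub>M lborel)"
    by (rule measurable_compose[OF _ Suc]) measurable
  have [measurable]: "(\<lambda>q. green_iter j (snd q) (snd (fst q))) \<in> borel_measurable ((borel \<Otimes>\<^sub>M borel) \<Otimes>\<^sub>M lborel)"
    using 1 by (simp add: case_prod_unfold)
  show ?case unfolding green_iter.simps case_prod_unfold
    by (rule lborel.borel_measurable_nn_integral) (unfold case_prod_unfold, measurable)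
qed

lemma green_iter_measurable [measurable (raw)]:
  assumes "f \<in> borel_measurable M" "g \<in> borel_measurable M"
  shows "(\<lambda>x. green_iter j (f x) (g x)) \<in> borel_measurable M"
  using measurable_compose[OF measurable_Pair[OF assms] green_iter_pair_measurable[of j]] by simp

lemma green_measurable [measurable (raw)]:
  assumes [measurable]: "f \<in> borel_measurable M" "g \<in> borel_measurable M"
  shows "(\<lambda>x. green (f x) (g x)) \<in> borel_measurable M"
  unfolding green_def by measurable

text \<open>The recursion adds factors on the left; adding them on the right gives the same product, and the symmetry of
  the Green function follows.\<close>

lemma green_iter_Suc_right:
  "green_iter (Suc j) x y = (\<integral>\<^sup>+z. green_iter j x z * W z * G (z - y) \<partial>lborel)"
proof (induction j arbitrary: x y)
  case 0
  show ?case by simp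
next
  case (Suc j)
  have "green_iter (Suc (Suc j)) x y = (\<integral>\<^sup>+z. G (x - z) * W z * green_iter (Suc j) z y \<partial>lborel)" by simp
  also have "\<dots> = (\<integral>\<^sup>+z. \<integral>\<^sup>+w. G (x - z) * W z * (green_iter j z w * W w * G (w - y)) \<partial>lborel \<partial>lborel)"
    unfolding Suc.IH by (simp add: nn_integral_cmult)
  also have "\<dots> = (\<integral>\<^sup>+w. \<integral>\<^sup>+z. G (x - z) * W z * (green_iter j z w * W w * G (w - y)) \<partial>lborel \<partial>lborel)"
    by (rule lborel_pair.Fubini') measurable
  also have "\<dots> = (\<integral>\<^sup>+w. (\<integral>\<^sup>+z. G (x - z) * W z * green_iter j z w \<partial>lborel) * (W w * G (w - y)) \<partial>lborel)"
    by (simp add: nn_integral_multc mult.assoc flip: nn_integral_multc)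
  also have "\<dots> = (\<integral>\<^sup>+w. green_iter (Suc j) x w * W w * G (w - y) \<partial>lborel)"
    by (simp add: mult.assoc)
  finally show ?case .
qed

lemma green_iter_sym: "green_iter j x y = green_iter j y x"
proof (induction j arbitrary: x y)
  case 0
  show ?case by (simp add: resolvent_kernel_minus[of _ x y])
next
  case (Suc j)
  have "green_iter (Suc j) x y = (\<integral>\<^sup>+z. G (x - z) * W z * green_iter j z y \<partial>lborel)" by simp
  also have "\<dots> = (\<integral>\<^sup>+z. green_iter j y z * W z * G (z - x) \<partial>lborel)"
    unfolding Suc.IH[of _ y] resolvent_kernel_minus[of _ x] by (simp add: mult_ac)
  finally show ?case unfolding green_iter_Suc_right .
qed

lemma green_sym: "green x y = green y x"
  unfolding green_def by (simp add: green_iter_sym[of _ x y])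

lemma green_fixed_point: "green x y = G (x - y) + (\<integral>\<^sup>+z. G (x - z) * (W z * green z y) \<partial>lborel)"
proof -
  have "green x y = (\<Sum>j. green_iter (Suc j) x y) + green_iter 0 x y"
    unfolding green_def using suminf_offset[of "\<lambda>j. green_iter j x y" 1] by simp
  also have "(\<Sum>j. green_iter (Suc j) x y) = (\<integral>\<^sup>+z. (\<Sum>j. G (x - z) * W z * green_iter j z y) \<partial>lborel)"
    unfolding green_iter.simps by (subst nn_integral_suminf) auto
  also have "\<dots> = (\<integral>\<^sup>+z. G (x - z) * (W z * green z y) \<partial>lborel)"
    unfolding green_def by (simp add: mult.assoc)
  finally show ?thesis by (simp add: add.commute)
qed

lemma nn_integral_G: "(\<integral>\<^sup>+z. G (x - z) \<partial>lborel) = ennreal (1 / (k + d))"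
  by (rule nn_integral_resolvent_kernel_shift[OF l_pos])

text \<open>The potential, together with the killing rate \<open>d\<close>, absorbs at most the whole mass. Since \<open>W + (d + V) = k + d\<close>
  and the mass of \<open>G\<close> is \<open>1 / (k + d)\<close>, the partial sums of the Neumann series and the part \<open>R\<close> not absorbed so
  far always add up to 1.\<close>

lemma green_mass: "(\<integral>\<^sup>+y. green x y * ennreal (d + V y) \<partial>lborel) \<le> 1"
proof -
  define I where "I j x = (\<integral>\<^sup>+y. green_iter j x y * ennreal (d + V y) \<partial>lborel)" for j x
  define R where "R = rec_nat (\<lambda>x. 1::ennreal) (\<lambda>_ f x. \<integral>\<^sup>+z. G (x - z) * (W z * f z) \<partial>lborel)"
  have R0: "R 0 x = 1" and RS: "R (Suc j) x = (\<integral>\<^sup>+z. G (x - z) * (W z * R j z) \<partial>lborel)" for j x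
    by (auto simp: R_def)
  have mI [measurable]: "I j \<in> borel_measurable borel" for j unfolding I_def by measurable
  have mR [measurable]: "R j \<in> borel_measurable borel" for j
  proof (induction j)
    case 0 then show ?case by (simp add: R_def)
  next
    case (Suc j)
    then have "(\<lambda>x. \<integral>\<^sup>+z. G (x - z) * (W z * R j z) \<partial>lborel) \<in> borel_measurable borel" by measurable
    then show ?case by (simp add: RS[abs_def])
  qed
  have IS: "I (Suc j) x = (\<integral>\<^sup>+z. G (x - z) * (W z * I j z) \<partial>lborel)" for j x
  proof -
    have "I (Suc j) x = (\<integral>\<^sup>+y. \<integral>\<^sup>+z. G (x - z) * W z * green_iter j z y * ennreal (d + V y) \<partial>lborel \<partial>lborel)"
      unfolding I_def by (simp add: nn_integral_multc)
    also have "\<dots> = (\<integral>\<^sup>+z. \<integral>\<^sup>+y. G (x - z) * W z * green_iter j z y * ennreal (d + V y) \<partial>lborel \<partial>lborel)"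
      by (rule lborel_pair.Fubini') measurable
    also have "\<dots> = (\<integral>\<^sup>+z. G (x - z) * (W z * I j z) \<partial>lborel)"
      unfolding I_def by (simp add: mult.assoc nn_integral_cmult)
    finally show ?thesis .
  qed
  have I0: "I 0 x = (\<integral>\<^sup>+z. G (x - z) * ennreal (d + V z) \<partial>lborel)" for x
    by (simp add: I_def)
  have step: "(\<Sum>i<J. I i x) + R J x = 1" for J x
  proof (induction J arbitrary: x)
    case 0 then show ?case by (simp add: R0)
  next
    case (Suc J)
    have "(\<Sum>i<Suc J. I i x) + R (Suc J) x = I 0 x + ((\<Sum>i<J. I (Suc i) x) + R (Suc J) x)"
      by (simp add: sum.lessThan_Suc_shift add.assoc del: sum.lessThan_Suc)
    also have "(\<Sum>i<J. I (Suc i) x) + R (Suc J) x = (\<integral>\<^sup>+z. (\<Sum>i<J. G (x - z) * (W z * I i z)) + G (x - z) * (W z * R J z) \<partial>lborel)"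
      unfolding IS RS by (simp add: nn_integral_add nn_integral_sum)
    also have "\<dots> = (\<integral>\<^sup>+z. G (x - z) * (W z * ((\<Sum>i<J. I i z) + R J z)) \<partial>lborel)"
      by (simp add: distrib_left sum_distrib_left)
    also have "I 0 x + \<dots> = (\<integral>\<^sup>+z. G (x - z) * ennreal (d + V z) + G (x - z) * W z \<partial>lborel)"
      unfolding Suc I0 mult_1_right by (subst nn_integral_add) auto
    also have "\<dots> = (\<integral>\<^sup>+z. G (x - z) * ennreal (k + d) \<partial>lborel)"
      unfolding distrib_left[symmetric] add.commute[of _ "W _"] W_plus ..
    also have "\<dots> = 1"
      using l_pos by (simp add: nn_integral_multc nn_integral_G ennreal_mult[symmetric])
    finally show ?case .
  qed
  have "(\<integral>\<^sup>+y. green x y * ennreal (d + V y) \<partial>lborel) = (\<Sum>j. I j x)"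
    unfolding green_def I_def by (simp add: nn_integral_suminf[symmetric])
  also have "\<dots> \<le> 1"
    using step[of x] by (intro suminf_le_const summableI) (metis le_iff_add)
  finally show ?thesis .
qed

text \<open>Iterating the hypothesis on \<open>h\<close> produces the partial sums of the Neumann series applied to \<open>g\<close>, with a
  remainder that is at most \<open>M\<close> times a power of \<open>k / (k + d)\<close>.\<close>

lemma green_dominates:
  assumes [measurable]: "h \<in> borel_measurable borel" "g \<in> borel_measurable borel"
    and M: "\<And>x. h x \<le> ennreal M"
    and h: "\<And>x. h x \<le> (\<integral>\<^sup>+z. G (x - z) * (W z * h z + g z) \<partial>lborel)"
  shows "h x \<le> (\<integral>\<^sup>+y. green x y * g y \<partial>lborel)"
proof -
  define A where "A j x = (\<integral>\<^sup>+y. green_iter j x y * g y \<partial>lborel)" for j x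
  define c where "c = k / (k + d)"
  have c: "0 \<le> c" "c < 1" using k_nonneg d_pos l_pos by (auto simp: c_def)
  have [measurable]: "A j \<in> borel_measurable borel" for j unfolding A_def by measurable
  have M0: "h x \<le> ennreal (max 0 M)" for x by (rule order_trans[OF M ennreal_leI]) simp
  have AS: "A (Suc j) x = (\<integral>\<^sup>+z. G (x - z) * (W z * A j z) \<partial>lborel)" for j x
  proof -
    have "A (Suc j) x = (\<integral>\<^sup>+y. \<integral>\<^sup>+z. G (x - z) * W z * green_iter j z y * g y \<partial>lborel \<partial>lborel)"
      unfolding A_def by (simp add: nn_integral_multc)
    also have "\<dots> = (\<integral>\<^sup>+z. \<integral>\<^sup>+y. G (x - z) * W z * green_iter j z y * g y \<partial>lborel \<partial>lborel)"
      by (rule lborel_pair.Fubini') measurable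
    also have "\<dots> = (\<integral>\<^sup>+z. G (x - z) * (W z * A j z) \<partial>lborel)"
      unfolding A_def by (simp add: mult.assoc nn_integral_cmult)
    finally show ?thesis .
  qed
  have step: "h x \<le> (\<Sum>i<J. A i x) + ennreal (c ^ J * max 0 M)" for J x
  proof (induction J arbitrary: x)
    case 0 then show ?case using M0 by simp
  next
    case (Suc J)
    have "h x \<le> (\<integral>\<^sup>+z. G (x - z) * (W z * h z + g z) \<partial>lborel)" by (rule h)
    also have "\<dots> \<le> (\<integral>\<^sup>+z. G (x - z) * (W z * ((\<Sum>i<J. A i z) + ennreal (c ^ J * max 0 M)) + g z) \<partial>lborel)"
      by (intro nn_integral_mono mult_left_mono add_right_mono Suc) auto
    also have "\<dots> \<le> (\<integral>\<^sup>+z. (\<Sum>i<J. G (x - z) * (W z * A i z)) + (G (x - z) * (ennreal k * ennreal (c ^ J * max 0 M)) + G (x - z) * g z) \<partial>lborel)"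
      by (intro nn_integral_mono) (auto simp: distrib_left sum_distrib_left add.assoc intro!: add_left_mono add_right_mono mult_left_mono mult_right_mono W_le)
    also have "\<dots> = (\<Sum>i<J. A (Suc i) x) + (ennreal (1 / (k + d)) * (ennreal k * ennreal (c ^ J * max 0 M)) + A 0 x)"
      unfolding AS by (simp add: nn_integral_add nn_integral_sum nn_integral_multc nn_integral_G A_def)
    also have "ennreal (1 / (k + d)) * (ennreal k * ennreal (c ^ J * max 0 M)) = ennreal (c ^ Suc J * max 0 M)"
      using k_nonneg l_pos c by (simp add: ennreal_mult[symmetric] c_def)
    also have "(\<Sum>i<J. A (Suc i) x) + (ennreal (c ^ Suc J * max 0 M) + A 0 x) = (\<Sum>i<Suc J. A i x) + ennreal (c ^ Suc J * max 0 M)"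
      by (simp add: sum.lessThan_Suc_shift add_ac del: sum.lessThan_Suc)
    finally show ?case .
  qed
  have eq: "(\<integral>\<^sup>+y. green x y * g y \<partial>lborel) = (\<Sum>j. A j x)"
    unfolding green_def A_def by (simp add: nn_integral_suminf[symmetric])
  show ?thesis
  proof (rule LIMSEQ_le_const)
    have "(\<lambda>J. c ^ J * max 0 M) \<longlonglongrightarrow> 0 * max 0 M"
      by (intro tendsto_intros LIMSEQ_power_zero) (use c in auto)
    then have "(\<lambda>J. ennreal (c ^ J * max 0 M)) \<longlonglongrightarrow> ennreal 0" by (intro tendsto_ennrealI) simp
    then show "(\<lambda>J. (\<Sum>i<J. A i x) + ennreal (c ^ J * max 0 M)) \<longlonglongrightarrow> (\<integral>\<^sup>+y. green x y * g y \<partial>lborel)"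
      using tendsto_add[OF summable_LIMSEQ[OF summableI[of "\<lambda>j. A j x"]]] by (fastforce simp: eq)
  qed (use step in auto)
qed

end

text \<open>The derivative of \<open>tent\<^sup>2 / t\<^sup>N\<close> in the radius \<open>t\<close> is a difference of two nonnegative terms, which are kept on
  opposite sides of the equation.\<close>

lemma tent_time_identity:
  fixes a z :: "'a::euclidean_space" and N :: nat
  assumes e: "0 < e" "e \<le> r"
  defines "h \<equiv> \<lambda>t. tent t a z ^ 2 / t ^ N"
  shows "ennreal (h r) + (\<integral>\<^sup>+t. indicator {e..r} t * ennreal (real N * tent t a z ^ 2 / t ^ Suc N) \<partial>lborel)
    = ennreal (h e) + (\<integral>\<^sup>+t. indicator {e..r} t * ennreal (4 * t\<^sup>2 * tent t a z / t ^ Suc N) \<partial>lborel)"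
proof -
  define A where "A t = real N * tent t a z ^ 2 / t ^ Suc N" for t
  define B where "B t = 4 * t\<^sup>2 * tent t a z / t ^ Suc N" for t
  have ct: "continuous_on {e..r} (\<lambda>t. tent t a z)"
    unfolding tent_def by (intro continuous_intros)
  have cA: "continuous_on {e..r} A" unfolding A_def by (intro continuous_intros ct) (use e in auto)
  have cB: "continuous_on {e..r} B" unfolding B_def by (intro continuous_intros ct) (use e in auto)
  have iA: "integrable lborel (\<lambda>t. indicator {e..r} t *\<^sub>R A t)" by (rule borel_integrable_compact[OF _ cA]) simp
  have iB: "integrable lborel (\<lambda>t. indicator {e..r} t *\<^sub>R B t)" by (rule borel_integrable_compact[OF _ cB]) simp
  have nA: "0 \<le> indicator {e..r} t *\<^sub>R A t" and nB: "0 \<le> indicator {e..r} t *\<^sub>R B t" for t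
    using e by (auto simp: indicator_def A_def B_def intro!: divide_nonneg_pos mult_nonneg_nonneg)
  have "(\<integral>t. indicator {e..r} t *\<^sub>R (B t - A t) \<partial>lborel) = h r - h e"
  proof (rule integral_FTC_Icc[OF e(2)])
    fix t assume "e \<le> t" "t \<le> r"
    then have t: "0 < t" using e by simp
    have "((\<lambda>t. tent t a z ^ 2) has_real_derivative 2 * tent t a z * (2 * t)) (at t)"
    proof -
      have "((\<lambda>t. t\<^sup>2 - (norm (z - a))\<^sup>2) has_real_derivative 2 * t) (at t)"
        by (auto intro!: derivative_eq_intros)
      from DERIV_chain'[OF this DERIV_pos_part_power[of 0]] show ?thesis
        by (simp add: tent_def numeral_2_eq_2)
    qed
    from DERIV_divide[OF this DERIV_pow[of N t]] t
    have "(h has_real_derivative (2 * tent t a z * (2 * t) * t ^ N - tent t a z ^ 2 * (real N * t ^ (N - 1))) / (t ^ N * t ^ N)) (at t)"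
      by (simp add: h_def)
    also have "(2 * tent t a z * (2 * t) * t ^ N - tent t a z ^ 2 * (real N * t ^ (N - 1))) / (t ^ N * t ^ N) = B t - A t"
    proof (cases N)
      case 0
      then show ?thesis using t by (simp add: A_def B_def power2_eq_square)
    next
      case (Suc m)
      then show ?thesis using t by (simp add: A_def B_def divide_simps power2_eq_square) (simp add: algebra_simps)
    qed
    finally show "(h has_vector_derivative B t - A t) (at t within {e..r})"
      by (auto simp: has_real_derivative_iff_has_vector_derivative intro: has_vector_derivative_at_within)
  qed (intro continuous_intros cA cB)
  then have "h r + (\<integral>t. indicator {e..r} t *\<^sub>R A t \<partial>lborel) = h e + (\<integral>t. indicator {e..r} t *\<^sub>R B t \<partial>lborel)"
    using iA iB by (simp add: right_diff_distrib)
  moreover have "0 \<le> h r" "0 \<le> h e" using e by (auto simp: h_def)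
  ultimately have "ennreal (h r) + ennreal (\<integral>t. indicator {e..r} t *\<^sub>R A t \<partial>lborel) = ennreal (h e) + ennreal (\<integral>t. indicator {e..r} t *\<^sub>R B t \<partial>lborel)"
    using nA nB by (subst (1 2) ennreal_plus[symmetric]) (auto intro!: integral_nonneg_AE simp del: ennreal_plus)
  moreover have "ennreal (\<integral>t. indicator {e..r} t *\<^sub>R A t \<partial>lborel) = (\<integral>\<^sup>+t. indicator {e..r} t * ennreal (A t) \<partial>lborel)"
    by (subst nn_integral_eq_integral[OF iA AE_I2[OF nA], symmetric]) (auto intro!: nn_integral_cong simp: indicator_def)
  moreover have "ennreal (\<integral>t. indicator {e..r} t *\<^sub>R B t \<partial>lborel) = (\<integral>\<^sup>+t. indicator {e..r} t * ennreal (B t) \<partial>lborel)"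
    by (subst nn_integral_eq_integral[OF iB AE_I2[OF nB], symmetric]) (auto intro!: nn_integral_cong simp: indicator_def)
  ultimately show ?thesis by (simp add: A_def B_def)
qed

context bounded_potential
begin

lemma green_mass_left: "(\<integral>\<^sup>+x. green x y * ennreal (d + V x) \<partial>lborel) \<le> 1"
  using green_mass[of y] by (simp add: green_sym[of y])

lemma nn_integral_green: "(\<integral>\<^sup>+x. green x y \<partial>lborel) \<le> ennreal (1 / d)"
proof -
  have "ennreal d * (\<integral>\<^sup>+x. green x y \<partial>lborel) = (\<integral>\<^sup>+x. green x y * ennreal d \<partial>lborel)"
    by (subst nn_integral_cmult[symmetric]) (auto simp: mult.commute)
  also have "\<dots> \<le> (\<integral>\<^sup>+x. green x y * ennreal (d + V x) \<partial>lborel)"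
    by (intro nn_integral_mono mult_left_mono ennreal_leI) (auto simp: V_nonneg)
  also have "\<dots> \<le> 1" by (rule green_mass_left)
  finally have "ennreal (1 / d) * (ennreal d * (\<integral>\<^sup>+x. green x y \<partial>lborel)) \<le> ennreal (1 / d) * 1"
    by (rule mult_left_mono) simp
  then show ?thesis using d_pos by (simp add: mult.assoc[symmetric] ennreal_mult[symmetric])
qed

text \<open>Semicontinuity is inherited from the resolvent kernel through the fixed point equation.\<close>

lemma green_lsc:
  assumes "x' \<longlonglongrightarrow> x"
  shows "green x y \<le> liminf (\<lambda>i. green (x' i) y)"
proof -
  have G: "G (x - z) \<le> liminf (\<lambda>i. G (x' i - z))" for z
    by (intro resolvent_kernel_lsc tendsto_intros assms)
  have "green x y = G (x - y) + (\<integral>\<^sup>+z. W z * green z y * G (x - z) \<partial>lborel)"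
    by (subst green_fixed_point) (simp add: mult_ac)
  also have "\<dots> \<le> liminf (\<lambda>i. G (x' i - y)) + (\<integral>\<^sup>+z. liminf (\<lambda>i. W z * green z y * G (x' i - z)) \<partial>lborel)"
    by (intro add_mono G nn_integral_mono order_trans[OF _ ennreal_mult_liminf_le] mult_left_mono) auto
  also have "\<dots> \<le> liminf (\<lambda>i. G (x' i - y)) + liminf (\<lambda>i. \<integral>\<^sup>+z. W z * green z y * G (x' i - z) \<partial>lborel)"
    by (intro add_left_mono nn_integral_liminf) measurable
  also have "\<dots> \<le> liminf (\<lambda>i. G (x' i - y) + (\<integral>\<^sup>+z. W z * green z y * G (x' i - z) \<partial>lborel))"
    by (rule ennreal_liminf_superadditive)
  also have "\<dots> = liminf (\<lambda>i. green (x' i) y)"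
    by (subst (2) green_fixed_point) (simp add: mult_ac)
  finally show ?thesis .
qed

text \<open>Off its pole the Green function satisfies \<open>\<Delta>u = (V + d) u \<ge> 0\<close>; here \<open>\<Delta>u \<ge> 0\<close> is tested against the cube of a
  tent that vanishes at the pole, and the two terms of the Laplacian of that cube stand on opposite sides.\<close>

lemma green_weakly_subharmonic:
  assumes r: "0 < r" and a: "tent r a y = 0"
  shows "(\<integral>\<^sup>+x. green x y * ennreal ((6 * real DIM('a) + 24) * tent r a x ^ 2) \<partial>lborel)
    \<le> (\<integral>\<^sup>+x. green x y * ennreal (24 * r\<^sup>2 * tent r a x) \<partial>lborel)"
proof -
  define A where "A x = ennreal ((k + d) * tent r a x ^ 3 + (6 * real DIM('a) + 24) * tent r a x ^ 2)" for x
  define B where "B x = ennreal (24 * r\<^sup>2 * tent r a x)" for x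
  have [measurable]: "A \<in> borel_measurable borel" "B \<in> borel_measurable borel"
    by (auto simp: A_def[abs_def] B_def[abs_def])
  \<comment> \<open>The fixed point equation integrated against \<open>f\<close>, with the roles of the two points of \<open>G\<close> exchanged.\<close>
  have swap: "(\<integral>\<^sup>+x. green x y * f x \<partial>lborel)
     = (\<integral>\<^sup>+x. G (y - x) * f x \<partial>lborel) + (\<integral>\<^sup>+z. W z * green z y * (\<integral>\<^sup>+x. G (z - x) * f x \<partial>lborel) \<partial>lborel)"
    if [measurable]: "f \<in> borel_measurable borel" for f
  proof -
    have "(\<integral>\<^sup>+x. green x y * f x \<partial>lborel)
      = (\<integral>\<^sup>+x. G (y - x) * f x + (\<integral>\<^sup>+z. W z * green z y * (G (z - x) * f x) \<partial>lborel) \<partial>lborel)"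
    proof (intro nn_integral_cong)
      fix x
      have 1: "green x y = G (y - x) + (\<integral>\<^sup>+z. W z * green z y * G (z - x) \<partial>lborel)"
        by (subst green_fixed_point) (simp add: resolvent_kernel_minus[of _ x] mult_ac)
      have 2: "(\<integral>\<^sup>+z. W z * green z y * G (z - x) \<partial>lborel) * f x = (\<integral>\<^sup>+z. W z * green z y * G (z - x) * f x \<partial>lborel)"
        by (rule nn_integral_multc[symmetric]) measurable
      show "green x y * f x = G (y - x) * f x + (\<integral>\<^sup>+z. W z * green z y * (G (z - x) * f x) \<partial>lborel)"
        unfolding 1 distrib_right 2 by (simp only: mult.assoc)
    qed
    also have "\<dots> = (\<integral>\<^sup>+x. G (y - x) * f x \<partial>lborel) + (\<integral>\<^sup>+x. \<integral>\<^sup>+z. W z * green z y * (G (z - x) * f x) \<partial>lborel \<partial>lborel)"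
      by (rule nn_integral_add) measurable
    also have "(\<integral>\<^sup>+x. \<integral>\<^sup>+z. W z * green z y * (G (z - x) * f x) \<partial>lborel \<partial>lborel) = (\<integral>\<^sup>+z. \<integral>\<^sup>+x. W z * green z y * (G (z - x) * f x) \<partial>lborel \<partial>lborel)"
      by (rule lborel_pair.Fubini') measurable
    also have "\<dots> = (\<integral>\<^sup>+z. W z * green z y * (\<integral>\<^sup>+x. G (z - x) * f x \<partial>lborel) \<partial>lborel)"
      by (simp add: nn_integral_cmult)
    finally show ?thesis .
  qed
  have main: "(\<integral>\<^sup>+x. green x y * A x \<partial>lborel) \<le> (\<integral>\<^sup>+x. W x * green x y * ennreal (tent r a x ^ 3) \<partial>lborel) + (\<integral>\<^sup>+x. green x y * B x \<partial>lborel)"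
  proof -
    have R: "(\<integral>\<^sup>+x. G (z - x) * A x \<partial>lborel) \<le> ennreal (tent r a z ^ 3) + (\<integral>\<^sup>+x. G (z - x) * B x \<partial>lborel)" for z
      unfolding A_def B_def by (rule resolvent_tent_le[OF l_pos r])
    have "(\<integral>\<^sup>+x. green x y * A x \<partial>lborel)
       \<le> (\<integral>\<^sup>+x. G (y - x) * B x \<partial>lborel) + (\<integral>\<^sup>+z. W z * green z y * (ennreal (tent r a z ^ 3) + (\<integral>\<^sup>+x. G (z - x) * B x \<partial>lborel)) \<partial>lborel)"
      using R[of y] a by (subst swap) (auto intro!: add_mono nn_integral_mono mult_left_mono R)
    also have "\<dots> = (\<integral>\<^sup>+x. W x * green x y * ennreal (tent r a x ^ 3) \<partial>lborel) + (\<integral>\<^sup>+x. green x y * B x \<partial>lborel)"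
      by (subst swap[of B]) (auto simp: distrib_left nn_integral_add add_ac)
    finally show ?thesis .
  qed
  \<comment> \<open>The term common to both sides is finite, so it can be cancelled.\<close>
  have fin: "(\<integral>\<^sup>+x. W x * green x y * ennreal (tent r a x ^ 3) \<partial>lborel) \<noteq> \<infinity>"
  proof -
    have t: "tent r a x ^ 3 \<le> (r\<^sup>2) ^ 3" for x
      by (intro power_mono) (auto simp: tent_def)
    have "(\<integral>\<^sup>+x. W x * green x y * ennreal (tent r a x ^ 3) \<partial>lborel) \<le> (\<integral>\<^sup>+x. (ennreal k * ennreal ((r\<^sup>2) ^ 3)) * green x y \<partial>lborel)"
    proof (intro nn_integral_mono)
      fix x
      have "W x * ennreal (tent r a x ^ 3) * green x y \<le> (ennreal k * ennreal ((r\<^sup>2) ^ 3)) * green x y"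
        by (intro mult_right_mono mult_mono W_le ennreal_leI t) auto
      then show "W x * green x y * ennreal (tent r a x ^ 3) \<le> (ennreal k * ennreal ((r\<^sup>2) ^ 3)) * green x y"
        by (simp add: mult_ac)
    qed
    also have "\<dots> \<le> (ennreal k * ennreal ((r\<^sup>2) ^ 3)) * ennreal (1 / d)"
      by (subst nn_integral_cmult) (auto intro!: mult_left_mono nn_integral_green)
    also have "\<dots> < \<infinity>" by (auto simp: ennreal_mult_less_top)
    finally show ?thesis by simp
  qed
  have "(\<integral>\<^sup>+x. W x * green x y * ennreal (tent r a x ^ 3) \<partial>lborel) + (\<integral>\<^sup>+x. green x y * ennreal ((6 * real DIM('a) + 24) * tent r a x ^ 2) \<partial>lborel)
      = (\<integral>\<^sup>+x. W x * green x y * ennreal (tent r a x ^ 3) + green x y * ennreal ((6 * real DIM('a) + 24) * tent r a x ^ 2) \<partial>lborel)"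
    by (rule nn_integral_add[symmetric]) measurable
  also have "\<dots> \<le> (\<integral>\<^sup>+x. green x y * A x \<partial>lborel)"
  proof (intro nn_integral_mono)
    fix x
    have "W x \<le> ennreal (k + d)" using W_le[of x] d_pos by (rule_tac order_trans[OF _ ennreal_leI, of _ k]) auto
    then have "green x y * (W x * ennreal (tent r a x ^ 3)) \<le> green x y * (ennreal (k + d) * ennreal (tent r a x ^ 3))"
      by (intro mult_left_mono mult_right_mono) auto
    moreover have "A x = ennreal (k + d) * ennreal (tent r a x ^ 3) + ennreal ((6 * real DIM('a) + 24) * tent r a x ^ 2)"
      unfolding A_def using l_pos by (subst ennreal_plus) (auto simp: ennreal_mult)
    ultimately show "W x * green x y * ennreal (tent r a x ^ 3) + green x y * ennreal ((6 * real DIM('a) + 24) * tent r a x ^ 2) \<le> green x y * A x"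
      by (simp add: distrib_left mult_ac add_right_mono)
  qed
  also note main
  finally show ?thesis using fin unfolding B_def by (simp add: ennreal_add_left_cancel_le)
qed

text \<open>For \<open>N = n + 4\<close> in dimension \<open>n\<close>, the two integrals over the radius in \<open>tent_time_identity\<close> are, radius by
  radius, the two sides of \<open>green_weakly_subharmonic\<close> up to a common factor, since \<open>6 n + 24 = 6 N\<close>. Hence the
  averages of the Green function against \<open>tent\<^sup>2 / t\<^sup>N\<close> grow with the radius.\<close>

lemma green_tent_monotone:
  assumes e: "0 < e" "e \<le> r" and r: "r < dist a y"
  shows "(\<integral>\<^sup>+x. green x y * ennreal (tent e a x ^ 2 / e ^ (DIM('a) + 4)) \<partial>lborel)
    \<le> (\<integral>\<^sup>+x. green x y * ennreal (tent r a x ^ 2 / r ^ (DIM('a) + 4)) \<partial>lborel)"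
proof -
  define N where "N = DIM('a) + 4"
  define A where "A t x = ennreal (real N * tent t a x ^ 2 / t ^ Suc N)" for t x
  define B where "B t x = ennreal (4 * t\<^sup>2 * tent t a x / t ^ Suc N)" for t x
  define H where "H t = (\<integral>\<^sup>+x. green x y * ennreal (tent t a x ^ 2 / t ^ N) \<partial>lborel)" for t
  define IA where "IA = (\<integral>\<^sup>+x. green x y * (\<integral>\<^sup>+t. indicator {e..r} t * A t x \<partial>lborel) \<partial>lborel)"
  define IB where "IB = (\<integral>\<^sup>+x. green x y * (\<integral>\<^sup>+t. indicator {e..r} t * B t x \<partial>lborel) \<partial>lborel)"
  have [measurable]: "(\<lambda>p. tent (fst p) a (snd p)) \<in> borel_measurable (borel \<Otimes>\<^sub>M borel)"
    "(\<lambda>p. tent (snd p) a (fst p)) \<in> borel_measurable (borel \<Otimes>\<^sub>M borel)"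
    unfolding tent_def by measurable
  have mA [measurable]: "(\<lambda>p. A (fst p) (snd p)) \<in> borel_measurable (borel \<Otimes>\<^sub>M borel)" "(\<lambda>p. A (snd p) (fst p)) \<in> borel_measurable (borel \<Otimes>\<^sub>M borel)"
    unfolding A_def by measurable
  have mB [measurable]: "(\<lambda>p. B (fst p) (snd p)) \<in> borel_measurable (borel \<Otimes>\<^sub>M borel)" "(\<lambda>p. B (snd p) (fst p)) \<in> borel_measurable (borel \<Otimes>\<^sub>M borel)"
    unfolding B_def by measurable
  have mAt: "(\<lambda>t. A t x) \<in> borel_measurable borel" "(\<lambda>t. B t x) \<in> borel_measurable borel" for x
    unfolding A_def B_def tent_def by measurable
  have mAx: "A t \<in> borel_measurable borel" "B t \<in> borel_measurable borel" for t
    unfolding A_def B_def by measurable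
  note [measurable] = mAt mAx
  have eq: "H r + IA = H e + IB"
  proof -
    have "H r + IA = (\<integral>\<^sup>+x. green x y * (ennreal (tent r a x ^ 2 / r ^ N) + (\<integral>\<^sup>+t. indicator {e..r} t * A t x \<partial>lborel)) \<partial>lborel)"
      unfolding H_def IA_def distrib_left by (rule nn_integral_add[symmetric]) measurable
    also have "\<dots> = (\<integral>\<^sup>+x. green x y * (ennreal (tent e a x ^ 2 / e ^ N) + (\<integral>\<^sup>+t. indicator {e..r} t * B t x \<partial>lborel)) \<partial>lborel)"
      unfolding A_def B_def tent_time_identity[OF e, of a _ N] ..
    also have "\<dots> = H e + IB"
      unfolding H_def IB_def distrib_left by (rule nn_integral_add) measurable
    finally show ?thesis .
  qed
  have IA_eq: "IA = (\<integral>\<^sup>+t. indicator {e..r} t * (\<integral>\<^sup>+x. green x y * A t x \<partial>lborel) \<partial>lborel)"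
  proof -
    have "IA = (\<integral>\<^sup>+x. \<integral>\<^sup>+t. green x y * (indicator {e..r} t * A t x) \<partial>lborel \<partial>lborel)"
      unfolding IA_def by (simp add: nn_integral_cmult)
    also have "\<dots> = (\<integral>\<^sup>+t. \<integral>\<^sup>+x. green x y * (indicator {e..r} t * A t x) \<partial>lborel \<partial>lborel)"
      by (rule lborel_pair.Fubini') (unfold case_prod_unfold, measurable)
    also have "\<dots> = (\<integral>\<^sup>+t. indicator {e..r} t * (\<integral>\<^sup>+x. green x y * A t x \<partial>lborel) \<partial>lborel)"
      by (simp add: mult.left_commute[of "green _ _"] nn_integral_cmult)
    finally show ?thesis .
  qed
  have IB_eq: "IB = (\<integral>\<^sup>+t. indicator {e..r} t * (\<integral>\<^sup>+x. green x y * B t x \<partial>lborel) \<partial>lborel)"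
  proof -
    have "IB = (\<integral>\<^sup>+x. \<integral>\<^sup>+t. green x y * (indicator {e..r} t * B t x) \<partial>lborel \<partial>lborel)"
      unfolding IB_def by (simp add: nn_integral_cmult)
    also have "\<dots> = (\<integral>\<^sup>+t. \<integral>\<^sup>+x. green x y * (indicator {e..r} t * B t x) \<partial>lborel \<partial>lborel)"
      by (rule lborel_pair.Fubini') (unfold case_prod_unfold, measurable)
    also have "\<dots> = (\<integral>\<^sup>+t. indicator {e..r} t * (\<integral>\<^sup>+x. green x y * B t x \<partial>lborel) \<partial>lborel)"
      by (simp add: mult.left_commute[of "green _ _"] nn_integral_cmult)
    finally show ?thesis .
  qed
  have sub: "(\<integral>\<^sup>+x. green x y * A t x \<partial>lborel) \<le> (\<integral>\<^sup>+x. green x y * B t x \<partial>lborel)" if t: "e \<le> t" "t \<le> r" for t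
  proof -
    have t0: "0 < t" using e t by simp
    have "tent t a y = 0" by (rule tent_eq_0) (use t0 t r in auto)
    from green_weakly_subharmonic[OF t0 this]
    have "ennreal (1 / (6 * t ^ Suc N)) * (\<integral>\<^sup>+x. green x y * ennreal ((6 * real DIM('a) + 24) * tent t a x ^ 2) \<partial>lborel)
      \<le> ennreal (1 / (6 * t ^ Suc N)) * (\<integral>\<^sup>+x. green x y * ennreal (24 * t\<^sup>2 * tent t a x) \<partial>lborel)"
      by (rule mult_left_mono) simp
    moreover have sc: "ennreal (1 / (6 * t ^ Suc N)) * (\<integral>\<^sup>+x. green x y * ennreal (f x) \<partial>lborel)
        = (\<integral>\<^sup>+x. green x y * ennreal (1 / (6 * t ^ Suc N) * f x) \<partial>lborel)"
      if [measurable]: "f \<in> borel_measurable borel" for f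
    proof -
      have "0 \<le> 1 / (6 * t ^ Suc N)" using t0 by simp
      then show ?thesis
        by (subst nn_integral_cmult[symmetric], simp)
          (simp only: mult.left_commute[of "ennreal (1 / _)"] ennreal_mult'[symmetric])
    qed
    moreover have "1 / (6 * t ^ Suc N) * ((6 * real DIM('a) + 24) * tent t a x ^ 2) = real N * tent t a x ^ 2 / t ^ Suc N" for x
    proof -
      have "6 * real DIM('a) + 24 = 6 * real N" by (simp add: N_def)
      then show ?thesis using t0 by simp
    qed
    moreover have "1 / (6 * t ^ Suc N) * (24 * t\<^sup>2 * tent t a x) = 4 * t\<^sup>2 * tent t a x / t ^ Suc N" for x
      using t0 by simp
    ultimately have "(\<integral>\<^sup>+x. green x y * ennreal (real N * tent t a x ^ 2 / t ^ Suc N) \<partial>lborel)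
        \<le> (\<integral>\<^sup>+x. green x y * ennreal (4 * t\<^sup>2 * tent t a x / t ^ Suc N) \<partial>lborel)"
      by (simp add: mult_ac del: power_Suc)
    then show ?thesis unfolding A_def B_def .
  qed
  have le: "IA \<le> IB"
    unfolding IA_eq IB_eq by (intro nn_integral_mono) (auto simp: indicator_def sub)
  have fin: "IA \<noteq> \<infinity>"
  proof -
    have bd: "A t x \<le> ennreal (real N * (r\<^sup>2)\<^sup>2 / e ^ Suc N)" if "e \<le> t" "t \<le> r" for t x
    proof -
      have "tent t a x \<le> t\<^sup>2" by (auto simp: tent_def)
      also have "t\<^sup>2 \<le> r\<^sup>2" using that e by (intro power_mono) auto
      finally have "tent t a x ^ 2 \<le> (r\<^sup>2)\<^sup>2" by (intro power_mono) auto
      moreover have "e ^ Suc N \<le> t ^ Suc N" using that e by (intro power_mono) auto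
      moreover have "0 < e ^ Suc N" using e by simp
      ultimately show ?thesis unfolding A_def
        by (intro ennreal_leI frac_le mult_left_mono mult_nonneg_nonneg) (auto simp del: power_Suc)
    qed
    have "IA \<le> (\<integral>\<^sup>+x. green x y * (\<integral>\<^sup>+t. indicator {e..r} t * ennreal (real N * (r\<^sup>2)\<^sup>2 / e ^ Suc N) \<partial>lborel) \<partial>lborel)"
      unfolding IA_def
    proof (rule nn_integral_mono, rule mult_left_mono)
      show "(\<integral>\<^sup>+t. indicator {e..r} t * A t x \<partial>lborel) \<le> (\<integral>\<^sup>+t. indicator {e..r} t * ennreal (real N * (r\<^sup>2)\<^sup>2 / e ^ Suc N) \<partial>lborel)" for x
        by (rule nn_integral_mono) (use bd in \<open>auto simp: indicator_def simp del: power_Suc\<close>)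
    qed simp
    also have "\<dots> = (\<integral>\<^sup>+x. green x y \<partial>lborel) * (ennreal (r - e) * ennreal (real N * (r\<^sup>2)\<^sup>2 / e ^ Suc N))"
      using e by (simp add: nn_integral_multc)
    also have "\<dots> < \<infinity>" using le_less_trans[OF nn_integral_green[of y]] by (auto simp: ennreal_mult_less_top)
    finally show ?thesis by simp
  qed
  have "IA + H e \<le> IB + H e" using le by (rule add_right_mono)
  also have "\<dots> = IA + H r" using eq by (simp add: add.commute)
  finally have "H e \<le> H r" using fin by (simp add: ennreal_add_left_cancel_le)
  then show ?thesis unfolding H_def N_def .
qed

text \<open>Letting the smaller radius in \<open>green_tent_monotone\<close> tend to zero, lower semicontinuity gives the sub-mean value
  property at every point, not only almost everywhere.\<close>

lemma green_submean:
  assumes r: "0 < r" "r < dist a y"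
  shows "tent_mass TYPE('a) * green a y \<le> (\<integral>\<^sup>+x. green x y * ennreal (tent r a x ^ 2 / r ^ (DIM('a) + 4)) \<partial>lborel)"
    (is "_ \<le> ?R")
proof -
  define e where "e i = r / real (Suc i)" for i
  have e: "0 < e i" "e i \<le> r" for i using r by (auto simp: e_def field_simps)
  have e0: "e \<longlonglongrightarrow> 0"
    unfolding e_def using tendsto_mult[OF tendsto_const[of r] LIMSEQ_inverse_real_of_nat] by (simp add: divide_inverse)
  have scale: "(\<integral>\<^sup>+x. green x y * ennreal (tent (e i) a x ^ 2 / e i ^ (DIM('a) + 4)) \<partial>lborel)
     = (\<integral>\<^sup>+z. ennreal (tent 1 0 z ^ 2) * green (a + e i *\<^sub>R z) y \<partial>lborel)" for i
  proof -
    have t: "tent (e i) a (a + e i *\<^sub>R z) = (e i)\<^sup>2 * tent 1 0 z" for z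
      using e(1)[of i] by (auto simp: tent_def max_mult_distrib_left power_mult_distrib algebra_simps)
    have "(\<integral>\<^sup>+x. green x y * ennreal (tent (e i) a x ^ 2 / e i ^ (DIM('a) + 4)) \<partial>lborel)
      = ennreal (\<bar>e i\<bar> ^ DIM('a)) * (\<integral>\<^sup>+z. green (a + e i *\<^sub>R z) y * ennreal (tent (e i) a (a + e i *\<^sub>R z) ^ 2 / e i ^ (DIM('a) + 4)) \<partial>lborel)"
      by (rule nn_integral_lborel_affine) (use e(1)[of i] in auto)
    also have "\<dots> = (\<integral>\<^sup>+z. ennreal (e i ^ DIM('a)) * (green (a + e i *\<^sub>R z) y * ennreal (((e i)\<^sup>2 * tent 1 0 z) ^ 2 / e i ^ (DIM('a) + 4))) \<partial>lborel)"
      unfolding t using e(1)[of i] by (subst nn_integral_cmult) auto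
    also have "\<dots> = (\<integral>\<^sup>+z. ennreal (tent 1 0 z ^ 2) * green (a + e i *\<^sub>R z) y \<partial>lborel)"
    proof (intro nn_integral_cong)
      fix z :: 'a
      have "e i ^ DIM('a) * (((e i)\<^sup>2 * tent 1 0 z) ^ 2 / e i ^ (DIM('a) + 4)) = tent 1 0 z ^ 2"
        using e(1)[of i] by (simp add: power_mult_distrib power_add)
      then show "ennreal (e i ^ DIM('a)) * (green (a + e i *\<^sub>R z) y * ennreal (((e i)\<^sup>2 * tent 1 0 z) ^ 2 / e i ^ (DIM('a) + 4))) = ennreal (tent 1 0 z ^ 2) * green (a + e i *\<^sub>R z) y"
        using e(1)[of i] by (simp only: mult.left_commute[of "ennreal (e i ^ _)"] ennreal_mult[symmetric] mult.commute[of "ennreal (tent _ _ _ ^ _)"])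
          (subst ennreal_mult[symmetric], auto)
    qed
    finally show ?thesis .
  qed
  have "tent_mass TYPE('a) * green a y = (\<integral>\<^sup>+z. ennreal (tent 1 (0::'a) z ^ 2) * green a y \<partial>lborel)"
    unfolding tent_mass_def by (rule nn_integral_multc[symmetric]) measurable
  also have "\<dots> \<le> (\<integral>\<^sup>+z. liminf (\<lambda>i. ennreal (tent 1 (0::'a) z ^ 2) * green (a + e i *\<^sub>R z) y) \<partial>lborel)"
  proof (intro nn_integral_mono order_trans[OF mult_left_mono ennreal_mult_liminf_le])
    fix z :: 'a
    have "(\<lambda>i. a + e i *\<^sub>R z) \<longlonglongrightarrow> a + 0 *\<^sub>R z" by (intro tendsto_intros e0)
    then show "green a y \<le> liminf (\<lambda>i. green (a + e i *\<^sub>R z) y)" by (intro green_lsc) simp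
  qed simp
  also have "\<dots> \<le> liminf (\<lambda>i. \<integral>\<^sup>+z. ennreal (tent 1 (0::'a) z ^ 2) * green (a + e i *\<^sub>R z) y \<partial>lborel)"
    by (rule nn_integral_liminf) measurable
  also have "\<dots> \<le> liminf (\<lambda>i. ?R)"
    unfolding scale[symmetric] by (intro Liminf_mono always_eventually allI green_tent_monotone e r)
  finally show ?thesis by (simp add: Liminf_const)
qed

end

section \<open>Reverse Hoelder weights on cubes\<close>

text \<open>Cubes are given by centre and half the side length; a cube of radius \<open>r\<close> has measure \<open>(2 * r)\<^sup>n\<close>.\<close>

definition cube :: "'a::euclidean_space \<Rightarrow> real \<Rightarrow> 'a set" where
  "cube x r = cbox (x - r *\<^sub>R One) (x + r *\<^sub>R One)"

lemma mem_cube: "z \<in> cube x r \<longleftrightarrow> (\<forall>b\<in>Basis. \<bar>(z - x) \<bullet> b\<bar> \<le> r)"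
  by (auto simp: cube_def mem_box inner_diff_left inner_add_left abs_le_iff)

lemma cube_sets [measurable, simp]: "cube x r \<in> sets borel"
  by (simp add: cube_def)

lemma measure_cube: "0 \<le> r \<Longrightarrow> measure lborel (cube (x::'a::euclidean_space) r) = (2 * r) ^ DIM('a)"
  unfolding cube_def by (subst measure_lborel_cbox_eq) (auto simp: inner_diff_left inner_add_left)

lemma emeasure_cube_finite: "emeasure lborel (cube x r) < \<infinity>"
  unfolding cube_def by (intro emeasure_bounded_finite bounded_cbox)

lemma fmeasurable_cube [simp]: "cube x r \<in> fmeasurable lborel"
  using emeasure_cube_finite[of x r] by (auto simp: fmeasurable_def)

lemma cube_mono: "r \<le> s \<Longrightarrow> cube x r \<subseteq> cube x s"
  by (force simp: mem_cube)

lemma cube_subset: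
  assumes "norm (x - y) + r \<le> s"
  shows "cube x r \<subseteq> cube y s"
proof
  fix z assume z: "z \<in> cube x r"
  show "z \<in> cube y s" unfolding mem_cube
  proof
    fix b :: 'a assume b: "b \<in> Basis"
    have "(z - y) \<bullet> b = (z - x) \<bullet> b + (x - y) \<bullet> b" by (simp add: inner_diff_left)
    moreover have "\<bar>(x - y) \<bullet> b\<bar> \<le> norm (x - y)" using Basis_le_norm[OF b] .
    ultimately show "\<bar>(z - y) \<bullet> b\<bar> \<le> s" using z b assms unfolding mem_cube by (smt (verit))
  qed
qed

lemma ball_subset_cube: "ball x r \<subseteq> cube x r"
proof
  fix z assume "z \<in> ball x r"
  then have "norm (z - x) \<le> r" by (simp add: dist_norm norm_minus_commute)
  then show "z \<in> cube x r" unfolding mem_cube using Basis_le_norm order_trans by blast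
qed

text \<open>The reverse Hoelder inequality as a bound for the mean of \<open>V\<^sup>p\<close> by the \<open>p\<close>th power of the mean of \<open>V\<close>,
  multiplied by the measure of the cube.\<close>

definition RH :: "real \<Rightarrow> real \<Rightarrow> ('a::euclidean_space \<Rightarrow> real) \<Rightarrow> bool" where
  "RH p C V \<longleftrightarrow> V \<in> borel_measurable borel \<and> (\<forall>x. 0 \<le> V x) \<and> (AE x in lborel. 0 < V x) \<and>
     (\<forall>x r. set_integrable lborel (cube x r) V \<and> set_integrable lborel (cube x r) (\<lambda>x. V x powr p)) \<and>
     (\<forall>x r. 0 < r \<longrightarrow> (LINT z:cube x r|lborel. V z powr p)
        \<le> C * (2 * r) ^ DIM('a) * ((LINT z:cube x r|lborel. V z) / (2 * r) ^ DIM('a)) powr p)"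

lemma RH_D:
  assumes "RH p C (V :: 'a::euclidean_space \<Rightarrow> real)"
  shows "V \<in> borel_measurable borel" "0 \<le> V x" "AE x in lborel. 0 < V x"
    "set_integrable lborel (cube x r) V" "set_integrable lborel (cube x r) (\<lambda>x. V x powr p)"
    "0 < r \<Longrightarrow> (LINT z:cube x r|lborel. V z powr p)
        \<le> C * (2 * r) ^ DIM('a) * ((LINT z:cube x r|lborel. V z) / (2 * r) ^ DIM('a)) powr p"
  using assms unfolding RH_def by blast+

text \<open>Integrated with a well chosen level \<open>t\<close>, this elementary form of Young's inequality takes the place of
  Hoelder's inequality in all that follows.\<close>

lemma powr_split_le:
  fixes v t p q :: real
  assumes "0 \<le> v" "0 < t" "0 \<le> p" "p \<le> q"
  shows "v powr p \<le> t powr p + t powr (p - q) * v powr q"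
proof (cases "v \<le> t")
  case True
  then have "v powr p \<le> t powr p" using assms by (intro powr_mono2) auto
  then show ?thesis by (simp add: add_increasing2)
next
  case False
  then have "v powr (p - q) \<le> t powr (p - q)" using assms by (intro powr_mono2') auto
  then have "v powr (p - q) * v powr q \<le> t powr (p - q) * v powr q" by (intro mult_right_mono) auto
  then show ?thesis using False assms by (simp add: powr_add[symmetric] add_increasing)
qed

lemma power_split_le:
  fixes v t p :: real
  assumes "0 \<le> v" "0 < t" "1 \<le> p"
  shows "v \<le> t + t powr (1 - p) * v powr p"
  using powr_split_le[of v t 1 p] assms by simp

lemma set_integral_mono_set:
  fixes f :: "'a \<Rightarrow> real"
  assumes "set_integrable M B f" "A \<in> sets M" "A \<subseteq> B" "\<And>x. 0 \<le> f x"
  shows "(LINT x:A|M. f x) \<le> (LINT x:B|M. f x)"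
proof -
  have "set_integrable M A f" by (rule set_integrable_subset[OF assms(1,2,3)])
  then show ?thesis using assms unfolding set_lebesgue_integral_def set_integrable_def
    by (intro integral_mono) (auto simp: indicator_def)
qed

lemma RH_integral_pos:
  assumes V: "RH p C V" and r: "0 < r"
  shows "0 < (LINT z:cube x r|lborel. V z)"
proof -
  let ?f = "\<lambda>z. indicator (cube x r) z *\<^sub>R V z"
  have int: "integrable lborel ?f" using RH_D(4)[OF V] by (simp add: set_integrable_def)
  have nn: "0 \<le> ?f z" for z using RH_D(2)[OF V] by (auto simp: indicator_def)
  have "0 \<le> (LINT z:cube x r|lborel. V z)" unfolding set_lebesgue_integral_def by (intro integral_nonneg_AE AE_I2 nn)
  moreover have "(LINT z:cube x r|lborel. V z) \<noteq> 0"
  proof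
    assume "(LINT z:cube x r|lborel. V z) = 0"
    then have "AE z in lborel. ?f z = 0"
      unfolding set_lebesgue_integral_def using integral_nonneg_eq_0_iff_AE[OF int] nn by auto
    then have "AE z in lborel. z \<notin> cube x r"
      using RH_D(3)[OF V] by eventually_elim (auto simp: indicator_def split: if_splits)
    then have "emeasure lborel (cube x r) = 0"
      by (subst (asm) AE_iff_measurable[of "cube x r"]) auto
    then show False using measure_cube[of r x] r by (simp add: measure_def)
  qed
  ultimately show ?thesis by linarith
qed

text \<open>The \<open>A\<^sub>\<infinity>\<close> property with a single pair of constants, one half being the fraction of the weight.\<close>

definition half_on_small_sets :: "real \<Rightarrow> ('a::euclidean_space \<Rightarrow> real) \<Rightarrow> bool" where
  "half_on_small_sets \<alpha> V \<longleftrightarrow> (\<forall>x r E. 0 < r \<longrightarrow> E \<in> sets borel \<longrightarrow> E \<subseteq> cube x r \<longrightarrow>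
     measure lborel E \<le> \<alpha> * (2 * r) ^ DIM('a) \<longrightarrow>
     (LINT z:E|lborel. V z) \<le> (1/2) * (LINT z:cube x r|lborel. V z))"

lemma half_on_small_setsD:
  "half_on_small_sets \<alpha> (V :: 'a::euclidean_space \<Rightarrow> real) \<Longrightarrow> 0 < r \<Longrightarrow> E \<in> sets borel \<Longrightarrow> E \<subseteq> cube x r \<Longrightarrow>
    measure lborel E \<le> \<alpha> * (2 * r) ^ DIM('a) \<Longrightarrow> (LINT z:E|lborel. V z) \<le> (1/2) * (LINT z:cube x r|lborel. V z)"
  by (simp add: half_on_small_sets_def)

text \<open>Split \<open>V\<close> at the level \<open>t\<close> equal to \<open>K\<close> times its mean. The part below contributes at most \<open>t\<close> times the
  measure of the set, and the part above at most \<open>K\<^sup>1\<^sup>-\<^sup>p C\<close> times the weight of the cube; both are a quarter of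
  the weight if \<open>K\<close> is large and the set has relative measure \<open>1 / (4 K)\<close>.\<close>

lemma RH_small_set:
  assumes p: "1 < p"
  obtains \<alpha> where "0 < \<alpha>" "\<alpha> < 1" "\<And>V :: 'a::euclidean_space \<Rightarrow> real. RH p C V \<Longrightarrow> half_on_small_sets \<alpha> V"
proof -
  define K where "K = (4 * \<bar>C\<bar> + 1) powr (1 / (p - 1))"
  have K: "1 \<le> K" unfolding K_def using p by (intro ge_one_powr_ge_zero) auto
  have Kp: "K powr (1 - p) = 1 / (4 * \<bar>C\<bar> + 1)"
  proof -
    have "1 / (p - 1) * (1 - p) = - 1" using p by (simp add: field_simps)
    then show ?thesis unfolding K_def powr_powr by (simp add: powr_minus_divide)
  qed
  show thesis
  proof (rule that[of "1 / (4 * K)"])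
    show "0 < 1 / (4 * K)" "1 / (4 * K) < 1" using K by (auto simp: field_simps)
  next
    fix V :: "'a \<Rightarrow> real"
    assume V: "RH p C V"
    show "half_on_small_sets (1 / (4 * K)) V" unfolding half_on_small_sets_def
    proof (intro allI impI)
      fix x :: 'a and r E
      assume r: "0 < r" and E [measurable]: "E \<in> sets borel" and sub: "E \<subseteq> cube x r"
        and small: "measure lborel E \<le> 1 / (4 * K) * (2 * r) ^ DIM('a)"
      define n where "n = (2 * r) ^ DIM('a)"
      have n: "0 < n" using r by (simp add: n_def)
      define J where "J = (LINT z:cube x r|lborel. V z)"
      have J: "0 < J" unfolding J_def by (rule RH_integral_pos[OF V r])
      define t where "t = K * (J / n)"
      have t: "0 < t" using K J n by (simp add: t_def)
      have iE: "set_integrable lborel E V" "set_integrable lborel E (\<lambda>z. V z powr p)"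
        by (rule set_integrable_subset[OF RH_D(4)[OF V, of x r] _ sub], simp,
            rule set_integrable_subset[OF RH_D(5)[OF V, of x r] _ sub], simp)
      have fE: "emeasure lborel E < \<infinity>"
        using emeasure_mono[OF sub, of lborel] emeasure_cube_finite[of x r] by (auto intro: le_less_trans)
      have ic: "set_integrable lborel E (\<lambda>z. t)" using fE unfolding set_integrable_def by simp
      have "(LINT z:E|lborel. V z) \<le> (LINT z:E|lborel. t + t powr (1 - p) * V z powr p)"
        by (rule set_integral_mono[OF iE(1)])
          (use ic iE(2) p t RH_D(2)[OF V] in \<open>auto intro!: set_integral_add set_integrable_mult_right power_split_le\<close>)
      also have "\<dots> = t * measure lborel E + t powr (1 - p) * (LINT z:E|lborel. V z powr p)"
      proof -
        have "(LINT z:E|lborel. t + t powr (1 - p) * V z powr p) = (LINT z:E|lborel. t) + (LINT z:E|lborel. t powr (1 - p) * V z powr p)"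
          by (rule set_integral_add(2)) (use ic iE(2) in auto)
        moreover have "(LINT z:E|lborel. t) = t * measure lborel E"
          unfolding set_lebesgue_integral_def by simp
        ultimately show ?thesis by simp
      qed
      also have "\<dots> \<le> t * (1 / (4 * K) * n) + t powr (1 - p) * (C * n * (J / n) powr p)"
      proof (intro add_mono mult_left_mono)
        have "(LINT z:E|lborel. V z powr p) \<le> (LINT z:cube x r|lborel. V z powr p)"
          by (rule set_integral_mono_set[OF RH_D(5)[OF V] _ sub]) auto
        also have "\<dots> \<le> C * n * (J / n) powr p" unfolding n_def J_def by (rule RH_D(6)[OF V r])
        finally show "(LINT z:E|lborel. V z powr p) \<le> C * n * (J / n) powr p" .
      qed (use small t in \<open>auto simp: n_def\<close>)
      also have "t * (1 / (4 * K) * n) = J / 4" using n K by (simp add: t_def)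
      also have "t powr (1 - p) * (C * n * (J / n) powr p) = C / (4 * \<bar>C\<bar> + 1) * J"
      proof -
        have "t powr (1 - p) * (J / n) powr p = K powr (1 - p) * ((J / n) powr (1 - p) * (J / n) powr p)"
          unfolding t_def using K J n by (subst powr_mult) auto
        also have "(J / n) powr (1 - p) * (J / n) powr p = J / n"
          using J n by (simp add: powr_add[symmetric])
        finally have "t powr (1 - p) * (J / n) powr p = 1 / (4 * \<bar>C\<bar> + 1) * (J / n)" unfolding Kp .
        then have "C * n * (t powr (1 - p) * (J / n) powr p) = C / (4 * \<bar>C\<bar> + 1) * J" using n by simp
        then show ?thesis by (simp add: mult_ac)
      qed
      also have "J / 4 + C / (4 * \<bar>C\<bar> + 1) * J \<le> J / 4 + 1 / 4 * J"
        using J by (intro add_left_mono mult_right_mono) (auto simp: field_simps abs_if)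
      finally show "(LINT z:E|lborel. V z) \<le> (1/2) * (LINT z:cube x r|lborel. V z)"
        unfolding J_def by simp
    qed
  qed
qed

lemma RH_cube_mono:
  assumes "RH p C V" "cube x r \<subseteq> cube y s"
  shows "(LINT z:cube x r|lborel. V z) \<le> (LINT z:cube y s|lborel. V z)"
  by (rule set_integral_mono_set[OF RH_D(4)[OF assms(1)] _ assms(2) RH_D(2)[OF assms(1)]]) simp

text \<open>Shrinking a cube by a factor close to 1 removes a set of small measure, hence at most half of the weight; after
  finitely many such steps the radius is halved.\<close>

lemma RH_doubling:
  assumes p: "1 < p"
  obtains D :: nat where
    "\<And>(V :: 'a::euclidean_space \<Rightarrow> real) x r. RH p C V \<Longrightarrow> 0 < r \<Longrightarrow>
      (LINT z:cube x (2 * r)|lborel. V z) \<le> 2 ^ D * (LINT z:cube x r|lborel. V z)"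
proof -
  obtain \<alpha> where \<alpha>: "0 < \<alpha>" "\<alpha> < 1" and "\<And>V :: 'a \<Rightarrow> real. RH p C V \<Longrightarrow> half_on_small_sets \<alpha> V"
    by (rule RH_small_set[OF p, where C=C and 'a='a]) (rule that)
  note small = half_on_small_setsD[OF this(3)]
  \<comment> \<open>By Bernoulli's inequality the shell between the cubes of radii \<open>\<theta> r\<close> and \<open>r\<close> has relative measure at most \<open>\<alpha>\<close>.\<close>
  define \<theta> where "\<theta> = 1 - \<alpha> / real DIM('a)"
  have "\<alpha> / real DIM('a) < 1" using \<alpha> by (simp add: divide_less_eq) (metis DIM_ge_Suc0 less_le_trans of_nat_1 One_nat_def of_nat_mono)
  then have \<theta>: "0 < \<theta>" "\<theta> < 1" using \<alpha> by (auto simp: \<theta>_def)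
  have bern: "1 - \<alpha> \<le> \<theta> ^ DIM('a)"
  proof -
    have "1 + real DIM('a) * (- (\<alpha> / real DIM('a))) \<le> (1 + - (\<alpha> / real DIM('a))) ^ DIM('a)"
      by (rule Bernoulli_inequality) (use \<open>\<alpha> / real DIM('a) < 1\<close> in auto)
    then show ?thesis by (simp add: \<theta>_def)
  qed
  have step: "(LINT z:cube x r|lborel. V z) \<le> 2 * (LINT z:cube x (\<theta> * r)|lborel. V z)"
    if V: "RH p C V" and r: "0 < r" for V :: "'a \<Rightarrow> real" and x :: 'a and r
  proof -
    have sub: "cube x (\<theta> * r) \<subseteq> cube x r" by (rule cube_mono) (use \<theta> r in auto)
    have "measure lborel (cube x r - cube x (\<theta> * r)) = (2 * r) ^ DIM('a) - (2 * (\<theta> * r)) ^ DIM('a)"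
      using \<theta> r sub by (subst measurable_measure_Diff) (auto simp: measure_cube)
    also have "\<dots> = (1 - \<theta> ^ DIM('a)) * (2 * r) ^ DIM('a)"
      by (simp add: power_mult_distrib algebra_simps)
    also have "\<dots> \<le> \<alpha> * (2 * r) ^ DIM('a)"
      using bern r by (intro mult_right_mono) auto
    finally have "(LINT z:cube x r - cube x (\<theta> * r)|lborel. V z) \<le> (1/2) * (LINT z:cube x r|lborel. V z)"
      by (intro small V r) auto
    moreover have "(LINT z:cube x r|lborel. V z) = (LINT z:cube x (\<theta> * r)|lborel. V z) + (LINT z:cube x r - cube x (\<theta> * r)|lborel. V z)"
    proof -
      have "cube x r = cube x (\<theta> * r) \<union> (cube x r - cube x (\<theta> * r))" using sub by auto
      then show ?thesis
        by (metis (no_types, lifting) Diff_disjoint RH_D(4)[OF V] cube_sets set_integrable_subset set_integral_Un sets.Diff sets_lborel Diff_subset)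
    qed
    ultimately show ?thesis by simp
  qed
  have iter: "(LINT z:cube x r|lborel. V z) \<le> 2 ^ m * (LINT z:cube x (\<theta> ^ m * r)|lborel. V z)"
    if V: "RH p C V" and r: "0 < r" for V :: "'a \<Rightarrow> real" and x :: 'a and r m
  proof (induction m)
    case (Suc m)
    have "(LINT z:cube x (\<theta> ^ m * r)|lborel. V z) \<le> 2 * (LINT z:cube x (\<theta> * (\<theta> ^ m * r))|lborel. V z)"
      by (rule step[OF V]) (use r \<theta> in auto)
    then have "2 ^ m * (LINT z:cube x (\<theta> ^ m * r)|lborel. V z) \<le> 2 ^ m * (2 * (LINT z:cube x (\<theta> * (\<theta> ^ m * r))|lborel. V z))"
      by (rule mult_left_mono) simp
    from order_trans[OF Suc this] show ?case
      by (simp only: power_Suc mult.assoc mult.left_commute)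
  qed simp
  obtain m where m: "\<theta> ^ m < 1 / 2" using real_arch_pow_inv[of "1/2" \<theta>] \<theta> by auto
  show thesis
  proof (rule that[of m])
    fix V :: "'a \<Rightarrow> real" and x :: 'a and r :: real assume V: "RH p C V" and r: "0 < r"
    have "(LINT z:cube x (2 * r)|lborel. V z) \<le> 2 ^ m * (LINT z:cube x (\<theta> ^ m * (2 * r))|lborel. V z)"
      using r by (intro iter V) auto
    also have "\<dots> \<le> 2 ^ m * (LINT z:cube x r|lborel. V z)"
    proof (intro mult_left_mono RH_cube_mono[OF V] cube_mono)
      have "\<theta> ^ m * (2 * r) \<le> (1 / 2) * (2 * r)" using m r by (intro mult_right_mono) auto
      then show "\<theta> ^ m * (2 * r) \<le> r" by simp
    qed simp
    finally show "(LINT z:cube x (2 * r)|lborel. V z) \<le> 2 ^ m * (LINT z:cube x r|lborel. V z)" .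
  qed
qed

definition polynomial_doubling :: "real \<Rightarrow> nat \<Rightarrow> ('a::euclidean_space \<Rightarrow> real) \<Rightarrow> bool" where
  "polynomial_doubling D N V \<longleftrightarrow> (\<forall>x y r R. 0 < r \<longrightarrow> r \<le> R \<longrightarrow> norm (x - y) \<le> 4 * R \<longrightarrow>
     (LINT z:cube x R|lborel. V z) \<le> D * (R / r) ^ N * (LINT z:cube y r|lborel. V z))"

lemma polynomial_doublingD:
  "polynomial_doubling D N V \<Longrightarrow> 0 < r \<Longrightarrow> r \<le> R \<Longrightarrow> norm (x - y) \<le> 4 * R \<Longrightarrow>
    (LINT z:cube x R|lborel. V z) \<le> D * (R / r) ^ N * (LINT z:cube y r|lborel. V z)"
  by (simp add: polynomial_doubling_def)

text \<open>The cube about \<open>x\<close> lies in a cube about \<open>y\<close> whose radius is a power of two times \<open>r\<close> and lies between \<open>8 R\<close> and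
  \<open>16 R\<close>; iterated doubling brings that radius down to \<open>r\<close>.\<close>

lemma RH_compare_cubes:
  assumes p: "1 < p"
  obtains N :: nat and D :: real where "0 < D"
    "\<And>V :: 'a::euclidean_space \<Rightarrow> real. RH p C V \<Longrightarrow> polynomial_doubling D N V"
proof -
  obtain N :: nat where N: "\<And>(V :: 'a::euclidean_space \<Rightarrow> real) x r. RH p C V \<Longrightarrow> 0 < r \<Longrightarrow>
      (LINT z:cube x (2 * r)|lborel. V z) \<le> 2 ^ N * (LINT z:cube x r|lborel. V z)"
    using RH_doubling[OF p, where C=C and 'a='a] by blast
  have iter: "(LINT z:cube x (2 ^ m * r)|lborel. V z) \<le> (2 ^ m) ^ N * (LINT z:cube x r|lborel. V z)"
    if V: "RH p C V" and r: "0 < r" for V :: "'a \<Rightarrow> real" and x :: 'a and r m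
  proof (induction m)
    case (Suc m)
    have "(LINT z:cube x (2 * (2 ^ m * r))|lborel. V z) \<le> 2 ^ N * (LINT z:cube x (2 ^ m * r)|lborel. V z)"
      by (rule N[OF V]) (use r in auto)
    also have "\<dots> \<le> 2 ^ N * ((2 ^ m) ^ N * (LINT z:cube x r|lborel. V z))"
      by (intro mult_left_mono Suc) simp
    finally show ?case by (simp add: power_mult_distrib mult_ac)
  qed simp
  show thesis
  proof (rule that[of "16 ^ N" N], unfold polynomial_doubling_def, safe)
    fix V :: "'a \<Rightarrow> real" and x y :: 'a and r R
    assume V: "RH p C V" and r: "0 < r" "r \<le> R" and xy: "norm (x - y) \<le> 4 * R"
    define m where "m = (LEAST m. 8 * R \<le> 2 ^ m * r)"
    have ex: "\<exists>m. 8 * R \<le> 2 ^ m * r"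
    proof -
      obtain m where "8 * R / r < 2 ^ m" using real_arch_pow[of 2 "8 * R / r"] by auto
      then show ?thesis using r by (intro exI[of _ m]) (simp add: field_simps)
    qed
    then have m: "8 * R \<le> 2 ^ m * r" unfolding m_def by (rule LeastI_ex)
    have m2: "2 ^ m * r \<le> 16 * R"
    proof (cases m)
      case 0 then show ?thesis using m r by simp
    next
      case (Suc k)
      then have "\<not> 8 * R \<le> 2 ^ k * r" using not_less_Least[of k "\<lambda>m. 8 * R \<le> 2 ^ m * r"] unfolding m_def by simp
      then show ?thesis using Suc by (simp add: mult.commute)
    qed
    have "(LINT z:cube x R|lborel. V z) \<le> (LINT z:cube y (2 ^ m * r)|lborel. V z)"
      by (rule RH_cube_mono[OF V cube_subset]) (use xy m r in linarith)
    also have "\<dots> \<le> (2 ^ m) ^ N * (LINT z:cube y r|lborel. V z)" by (rule iter[OF V r(1)])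
    also have "\<dots> \<le> (16 * (R / r)) ^ N * (LINT z:cube y r|lborel. V z)"
      using m2 r RH_integral_pos[OF V r(1), of y] by (intro mult_right_mono power_mono) (auto simp: field_simps)
    finally show "(LINT z:cube x R|lborel. V z) \<le> 16 ^ N * (R / r) ^ N * (LINT z:cube y r|lborel. V z)"
      by (simp add: power_mult_distrib power_divide)
  qed simp
qed

text \<open>The normalised squares of tents all have the same mass, by scaling.\<close>

lemma tent_kernel_eq:
  fixes a :: "'a::euclidean_space"
  assumes r: "0 < r"
  shows "(\<integral>\<^sup>+x. ennreal (tent r a x ^ 2 / r ^ (DIM('a) + 4)) \<partial>lborel) = tent_mass TYPE('a)"
proof -
  have t: "tent r a (a + r *\<^sub>R z) = r\<^sup>2 * tent 1 0 z" for z
    using r by (auto simp: tent_def max_mult_distrib_left power_mult_distrib algebra_simps)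
  have "(\<integral>\<^sup>+x. ennreal (tent r a x ^ 2 / r ^ (DIM('a) + 4)) \<partial>lborel)
      = ennreal (\<bar>r\<bar> ^ DIM('a)) * (\<integral>\<^sup>+z. ennreal (tent r a (a + r *\<^sub>R z) ^ 2 / r ^ (DIM('a) + 4)) \<partial>lborel)"
    by (rule nn_integral_lborel_affine) (use r in auto)
  also have "\<dots> = (\<integral>\<^sup>+z. ennreal (r ^ DIM('a)) * ennreal ((r\<^sup>2 * tent 1 0 z) ^ 2 / r ^ (DIM('a) + 4)) \<partial>(lborel :: 'a measure))"
    unfolding t using r by (subst nn_integral_cmult) auto
  also have "\<dots> = (\<integral>\<^sup>+z. ennreal (tent 1 0 z ^ 2) \<partial>(lborel :: 'a measure))"
  proof (intro nn_integral_cong)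
    fix z :: 'a
    have "r ^ DIM('a) * ((r\<^sup>2 * tent 1 0 z) ^ 2 / r ^ (DIM('a) + 4)) = tent 1 0 z ^ 2"
      using r by (simp add: power_mult_distrib power_add)
    then show "ennreal (r ^ DIM('a)) * ennreal ((r\<^sup>2 * tent 1 0 z) ^ 2 / r ^ (DIM('a) + 4)) = ennreal (tent 1 0 z ^ 2)"
      using r by (subst ennreal_mult'[symmetric]) auto
  qed
  finally show ?thesis unfolding tent_mass_def .
qed

lemma tent_mass_finite_pos:
  obtains c where "0 < c" "tent_mass TYPE('a::euclidean_space) = ennreal c"
proof -
  have int: "integrable lborel (\<lambda>z::'a. tent 1 0 z ^ 2)"
    by (rule integrable_continuous_compact_support[where K="cball 0 1"])
      (auto intro!: continuous_intros tent_eq_0)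
  have pos: "0 < (\<integral>z. tent 1 (0::'a) z ^ 2 \<partial>lborel)"
  proof -
    have "(\<integral>z. tent 1 (0::'a) z ^ 2 \<partial>lborel) \<noteq> 0"
    proof
      assume "(\<integral>z. tent 1 (0::'a) z ^ 2 \<partial>lborel) = 0"
      then have "AE z in lborel. tent 1 (0::'a) z ^ 2 = 0"
        using integral_nonneg_eq_0_iff_AE[OF int] by auto
      then have "AE z in lborel. z \<notin> ball (0::'a) 1"
      proof eventually_elim
        fix z :: 'a assume "tent 1 0 z ^ 2 = 0"
        then have "1 \<le> (norm z)\<^sup>2" by (auto simp: tent_def max_def split: if_splits)
        then have "\<not> norm z < 1" using power_less_one_iff[of "norm z" 2] by auto
        then show "z \<notin> ball 0 1" by simp
      qed
      then have "emeasure lborel (ball (0::'a) 1) = 0"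
        by (subst (asm) AE_iff_measurable[of "ball 0 1"]) auto
      then have "ball (0::'a) 1 \<in> null_sets lborel" by auto
      then have "negligible (ball (0::'a) 1)" by (simp add: negligible_iff_null_sets null_sets_completionI)
      then show False using open_not_negligible[of "ball (0::'a) 1"] by auto
    qed
    moreover have "0 \<le> (\<integral>z. tent 1 (0::'a) z ^ 2 \<partial>lborel)" by (intro integral_nonneg_AE) auto
    ultimately show ?thesis by linarith
  qed
  show thesis
    by (rule that[OF pos]) (unfold tent_mass_def, rule nn_integral_eq_integral[OF int], simp)
qed

lemma cube_subset_ball_half:
  fixes y :: "'a::euclidean_space"
  assumes r: "0 < r" and z: "z \<in> cube y (r / (2 * sqrt (real DIM('a))))"
  shows "(norm (z - y))\<^sup>2 \<le> r\<^sup>2 / 4"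
proof -
  have "(norm (z - y))\<^sup>2 = (\<Sum>b\<in>Basis. ((z - y) \<bullet> b)\<^sup>2)" by (rule sum_inner_Basis_sq[symmetric])
  also have "\<dots> \<le> (\<Sum>b\<in>(Basis::'a set). (r / (2 * sqrt (real DIM('a))))\<^sup>2)"
  proof (rule sum_mono)
    fix b :: 'a assume "b \<in> Basis"
    then have "\<bar>(z - y) \<bullet> b\<bar> \<le> r / (2 * sqrt (real DIM('a)))" using z by (auto simp: mem_cube)
    then have "\<bar>(z - y) \<bullet> b\<bar>\<^sup>2 \<le> (r / (2 * sqrt (real DIM('a))))\<^sup>2" by (intro power_mono) auto
    then show "((z - y) \<bullet> b)\<^sup>2 \<le> (r / (2 * sqrt (real DIM('a))))\<^sup>2" by simp
  qed
  also have "\<dots> = r\<^sup>2 / 4" by (simp add: power_divide power_mult_distrib)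
  finally show ?thesis .
qed

section \<open>A mean value inequality for subharmonic functions and weights\<close>

text \<open>The value at \<open>z\<close> is at most the average over the ball of radius \<open>r\<close> about \<open>z\<close> with the weight \<open>tent\<^sup>2\<close>, the
  total mass being written on the left.\<close>

definition tent_submean :: "('a::euclidean_space \<Rightarrow> real) \<Rightarrow> 'a \<Rightarrow> real \<Rightarrow> bool" where
  "tent_submean s z r \<longleftrightarrow> tent_mass TYPE('a) * ennreal (s z)
     \<le> (\<integral>\<^sup>+w. ennreal (s w) * ennreal (tent r z w ^ 2 / r ^ (DIM('a) + 4)) \<partial>lborel)"

text \<open>If \<open>s\<close> nowhere exceeds \<open>s y\<close> by much in the ball, then its average can reach \<open>s y\<close> only if \<open>s\<close> is rarely below
  \<open>s y / 2\<close>. On the cube inside the ball of radius \<open>r / 2\<close> the averaging kernel is at least \<open>9 / 16\<close> of its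
  natural size \<open>1 / r\<^sup>n\<close>.\<close>

lemma submean_level_set_small:
  fixes s :: "'a::euclidean_space \<Rightarrow> real"
  assumes s [measurable]: "s \<in> borel_measurable borel" and s0: "\<And>z. 0 \<le> s z" and r: "0 < r"
    and c: "0 < c" "tent_mass TYPE('a) = ennreal c"
    and mean: "tent_submean s y r"
    and sy: "0 < s y" and \<eta>: "0 < \<eta>" and up: "\<And>z. z \<in> ball y r \<Longrightarrow> s z \<le> (1 + \<eta>) * s y"
  shows "measure lborel {z \<in> cube y (r / (2 * sqrt (real DIM('a)))). s z < s y / 2} \<le> 4 * \<eta> * c * r ^ DIM('a)"
proof -
  define Q where "Q = cube y (r / (2 * sqrt (real DIM('a))))"
  define E where "E = {z \<in> Q. s z < s y / 2}"
  define \<kappa> where "\<kappa> z = tent r y z ^ 2 / r ^ (DIM('a) + 4)" for z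
  have [measurable]: "Q \<in> sets borel" by (simp add: Q_def)
  have E [measurable]: "E \<in> sets borel" unfolding E_def by measurable
  have [measurable]: "\<kappa> \<in> borel_measurable borel" unfolding \<kappa>_def by measurable
  have \<kappa>0: "0 \<le> \<kappa> z" for z using r by (simp add: \<kappa>_def)
  have \<kappa>E: "9 / 16 / r ^ DIM('a) \<le> \<kappa> z" if "z \<in> E" for z
  proof -
    have "(norm (z - y))\<^sup>2 \<le> r\<^sup>2 / 4" using that cube_subset_ball_half[OF r] by (auto simp: E_def Q_def)
    then have "3 / 4 * r\<^sup>2 \<le> r\<^sup>2 - (norm (z - y))\<^sup>2" by simp
    then have "3 / 4 * r\<^sup>2 \<le> tent r y z" unfolding tent_def by (rule order_trans) simp
    then have "(3 / 4 * r\<^sup>2) ^ 2 \<le> tent r y z ^ 2" by (intro power_mono) auto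
    then have "(3 / 4 * r\<^sup>2) ^ 2 / r ^ (DIM('a) + 4) \<le> \<kappa> z" unfolding \<kappa>_def using r by (intro divide_right_mono) auto
    moreover have "(3 / 4 * r\<^sup>2) ^ 2 / r ^ (DIM('a) + 4) = 9 / 16 / r ^ DIM('a)"
      using r by (simp add: power_mult_distrib power_add power_divide)
    ultimately show ?thesis by simp
  qed
  \<comment> \<open>On \<open>E\<close> the function loses at least \<open>s y / 2\<close> against its upper bound.\<close>
  have pt: "s z * \<kappa> z + indicator E z * (s y / 2 * \<kappa> z) \<le> (1 + \<eta>) * s y * \<kappa> z" for z
  proof (cases "z \<in> ball y r")
    case True
    show ?thesis
    proof (cases "z \<in> E")
      case True
      then have "s z + s y / 2 \<le> (1 + \<eta>) * s y" using sy \<eta> by (auto simp: E_def algebra_simps add_increasing2)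
      then have "(s z + s y / 2) * \<kappa> z \<le> (1 + \<eta>) * s y * \<kappa> z" by (rule mult_right_mono[OF _ \<kappa>0])
      then show ?thesis using True by (simp add: algebra_simps)
    next
      case False
      then show ?thesis using up[OF True] \<kappa>0 by (simp add: mult_right_mono)
    qed
  next
    case False
    then have "tent r y z = 0" using r power_mono[of r "norm (z - y)" 2] by (auto simp: tent_def dist_norm norm_minus_commute)
    then show ?thesis by (simp add: \<kappa>_def)
  qed
  have km: "(\<integral>\<^sup>+z. ennreal (\<kappa> z) \<partial>lborel) = ennreal c" unfolding \<kappa>_def tent_kernel_eq[OF r] by (rule c)
  have fE: "emeasure lborel E < \<infinity>"
  proof -
    have "emeasure lborel E \<le> emeasure lborel Q" by (intro emeasure_mono) (auto simp: E_def)
    then show ?thesis using emeasure_cube_finite[of y] unfolding Q_def by (rule le_less_trans)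
  qed
  have "ennreal (c * s y) + ennreal (s y / 2 * (9 / 16 / r ^ DIM('a)) * measure lborel E)
    \<le> (\<integral>\<^sup>+z. ennreal (s z) * ennreal (\<kappa> z) \<partial>lborel) + (\<integral>\<^sup>+z. ennreal (indicator E z * (s y / 2 * \<kappa> z)) \<partial>lborel)"
  proof (rule add_mono)
    show "ennreal (c * s y) \<le> (\<integral>\<^sup>+z. ennreal (s z) * ennreal (\<kappa> z) \<partial>lborel)"
      using mean[unfolded tent_submean_def c(2)] c s0 by (simp add: ennreal_mult \<kappa>_def)
    have "ennreal (s y / 2 * (9 / 16 / r ^ DIM('a)) * measure lborel E) = (\<integral>\<^sup>+z. ennreal (s y / 2 * (9 / 16 / r ^ DIM('a))) * indicator E z \<partial>lborel)"
    proof -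
      have A: "0 \<le> s y / 2 * (9 / 16 / r ^ DIM('a))" using sy r by simp
      have "(\<integral>\<^sup>+z. ennreal (s y / 2 * (9 / 16 / r ^ DIM('a))) * indicator E z \<partial>lborel) = ennreal (s y / 2 * (9 / 16 / r ^ DIM('a))) * emeasure lborel E"
        by (rule nn_integral_cmult_indicator) simp
      also have "emeasure lborel E = ennreal (measure lborel E)" using fE by (intro emeasure_eq_ennreal_measure) auto
      finally show ?thesis using ennreal_mult'[OF A, of "measure lborel E"] by simp
    qed
    also have "\<dots> \<le> (\<integral>\<^sup>+z. ennreal (indicator E z * (s y / 2 * \<kappa> z)) \<partial>lborel)"
    proof (rule nn_integral_mono)
      fix z
      show "ennreal (s y / 2 * (9 / 16 / r ^ DIM('a))) * indicator E z \<le> ennreal (indicator E z * (s y / 2 * \<kappa> z))"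
      proof (cases "z \<in> E")
        case True
        have "s y / 2 * (9 / 16 / r ^ DIM('a)) \<le> s y / 2 * \<kappa> z" using sy by (intro mult_left_mono \<kappa>E True) auto
        from ennreal_leI[OF this] True show ?thesis by simp
      qed simp
    qed
    finally show "ennreal (s y / 2 * (9 / 16 / r ^ DIM('a)) * measure lborel E) \<le> (\<integral>\<^sup>+z. ennreal (indicator E z * (s y / 2 * \<kappa> z)) \<partial>lborel)" .
  qed
  also have "\<dots> = (\<integral>\<^sup>+z. ennreal (s z * \<kappa> z + indicator E z * (s y / 2 * \<kappa> z)) \<partial>lborel)"
  proof -
    have "(\<integral>\<^sup>+z. ennreal (s z * \<kappa> z + indicator E z * (s y / 2 * \<kappa> z)) \<partial>lborel) = (\<integral>\<^sup>+z. ennreal (s z) * ennreal (\<kappa> z) + ennreal (indicator E z * (s y / 2 * \<kappa> z)) \<partial>lborel)"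
      using sy s0 \<kappa>0 by (intro nn_integral_cong) (simp add: ennreal_mult[symmetric])
    then show ?thesis by (simp add: nn_integral_add)
  qed
  also have "\<dots> \<le> (\<integral>\<^sup>+z. ennreal ((1 + \<eta>) * s y) * ennreal (\<kappa> z) \<partial>lborel)"
    using sy \<eta> \<kappa>0 pt by (intro nn_integral_mono) (auto simp: ennreal_mult'[symmetric] intro!: ennreal_leI)
  also have "\<dots> = ennreal ((1 + \<eta>) * s y * c)"
    using sy \<eta> c by (simp add: nn_integral_cmult km ennreal_mult)
  finally have "ennreal (c * s y + s y / 2 * (9 / 16 / r ^ DIM('a)) * measure lborel E) \<le> ennreal ((1 + \<eta>) * s y * c)"
    using sy r c by (subst ennreal_plus) auto
  then have "c * s y + s y / 2 * (9 / 16 / r ^ DIM('a)) * measure lborel E \<le> (1 + \<eta>) * s y * c"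
    using sy \<eta> c by (subst (asm) ennreal_le_iff) auto
  then have "s y * (9 / 32 / r ^ DIM('a) * measure lborel E) \<le> s y * (\<eta> * c)" by (simp add: algebra_simps)
  then have "9 / 32 / r ^ DIM('a) * measure lborel E \<le> \<eta> * c" by (rule mult_left_le_imp_le[OF _ sy])
  then have "9 / 32 * measure lborel E \<le> \<eta> * c * r ^ DIM('a)" using r by (simp add: field_simps)
  moreover have "0 \<le> \<eta> * c * r ^ DIM('a)" using c \<eta> r by simp
  ultimately have "measure lborel E \<le> 4 * (\<eta> * c * r ^ DIM('a))" by linarith
  then show ?thesis unfolding E_def Q_def by (simp add: mult.assoc)
qed

lemma nn_set_integral_eq:
  fixes V :: "'a::euclidean_space \<Rightarrow> real"
  assumes "set_integrable lborel A V" "\<And>x. 0 \<le> V x"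
  shows "(\<integral>\<^sup>+z. indicator A z * ennreal (V z) \<partial>lborel) = ennreal (LINT z:A|lborel. V z)"
proof -
  have "(\<integral>\<^sup>+z. ennreal (indicator A z *\<^sub>R V z) \<partial>lborel) = ennreal (LINT z:A|lborel. V z)"
    unfolding set_lebesgue_integral_def using assms
    by (intro nn_integral_eq_integral) (auto simp: set_integrable_def)
  moreover have "(\<integral>\<^sup>+z. ennreal (indicator A z *\<^sub>R V z) \<partial>lborel) = (\<integral>\<^sup>+z. indicator A z * ennreal (V z) \<partial>lborel)"
    by (intro nn_integral_cong) (auto simp: indicator_def)
  ultimately show ?thesis by simp
qed

text \<open>A mean value inequality with respect to the measure \<open>V dx\<close>. Boundedness of \<open>s\<close> is a qualitative requirement:
  \<open>K\<close> is independent of \<open>B\<close>.\<close>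

definition weighted_mean_bound :: "real \<Rightarrow> ('a::euclidean_space \<Rightarrow> real) \<Rightarrow> bool" where
  "weighted_mean_bound K V \<longleftrightarrow> (\<forall>s x R B. 0 < R \<longrightarrow> s \<in> borel_measurable borel \<longrightarrow> (\<forall>z. 0 \<le> s z) \<longrightarrow>
     (\<forall>z\<in>ball x (2 * R). s z \<le> B) \<longrightarrow> (\<forall>z r. 0 < r \<longrightarrow> r + dist x z \<le> 2 * R \<longrightarrow> tent_submean s z r) \<longrightarrow>
     ennreal (s x * (LINT z:cube x R|lborel. V z))
       \<le> ennreal K * (\<integral>\<^sup>+z. indicator (ball x (2 * R)) z * (ennreal (s z) * ennreal (V z)) \<partial>lborel))"

text \<open>Let \<open>d\<close> be the distance to the boundary of the ball of radius \<open>2 R\<close>, and let \<open>y\<close> almost maximise \<open>s d\<^sup>N\<close>, where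
  \<open>N\<close> is the exponent in the comparison of cubes. Around \<open>y\<close> the function \<open>s\<close> exceeds \<open>s y\<close> only slightly, so by
  the sub-mean value property it is at least \<open>s y / 2\<close> outside a small set, which carries at most half of the
  weight of a small cube about \<open>y\<close>. This bounds the integral of \<open>s V\<close> from below by the weight of that cube. The
  passage from this cube to the cube about \<open>x\<close> costs a factor \<open>(R / d)\<^sup>N\<close>, which the choice of \<open>y\<close> makes up for.\<close>

lemma weighted_mean_value:
  assumes p: "1 < p"
  obtains K where "0 < K" "\<And>V :: 'a::euclidean_space \<Rightarrow> real. RH p C V \<Longrightarrow> weighted_mean_bound K V"
proof -
  obtain c where c: "0 < c" "tent_mass TYPE('a) = ennreal c"
    by (rule tent_mass_finite_pos)
  obtain \<alpha> where \<alpha>: "0 < \<alpha>" "\<alpha> < 1" and "\<And>V :: 'a \<Rightarrow> real. RH p C V \<Longrightarrow> half_on_small_sets \<alpha> V"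
    by (rule RH_small_set[OF p, where C=C and 'a='a]) (rule that)
  note small = half_on_small_setsD[OF this(3)]
  obtain N :: nat and D :: real where D: "0 < D" and comp: "\<And>V :: 'a \<Rightarrow> real. RH p C V \<Longrightarrow> polynomial_doubling D N V"
    by (rule RH_compare_cubes[OF p, where C=C and 'a='a]) (rule that)
  define n where "n = DIM('a)"
  define q where "q = sqrt (real n)"
  have n: "0 < n" by (simp add: n_def)
  have q: "1 \<le> q" using n by (simp add: q_def)
  \<comment> \<open>Small enough for the exceptional set of \<open>submean_level_set_small\<close> to have relative measure at most \<open>\<alpha>\<close>.\<close>
  define \<eta> where "\<eta> = min 1 (\<alpha> / (4 * c * q ^ n))"
  have \<eta>: "0 < \<eta>" "\<eta> \<le> 1" using \<alpha> c q by (auto simp: \<eta>_def)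
  have \<eta>\<alpha>: "4 * \<eta> * c \<le> \<alpha> / q ^ n"
  proof -
    have "\<eta> \<le> \<alpha> / (4 * c * q ^ n)" by (simp add: \<eta>_def)
    then show ?thesis using c q by (simp add: field_simps)
  qed
  \<comment> \<open>The defect in the maximality of \<open>y\<close>; it enters the bound for \<open>s\<close> near \<open>y\<close> twice.\<close>
  define \<tau> where "\<tau> = \<eta> / 4"
  have \<tau>: "0 < \<tau>" "\<tau> < 1" using \<eta> by (auto simp: \<tau>_def)
  have \<tau>\<eta>: "1 / (1 - \<tau>)\<^sup>2 \<le> 1 + \<eta>"
  proof -
    have "1 \<le> (1 + \<eta>) * (1 - \<eta> / 2)" using \<eta> by (simp add: algebra_simps)
    also have "\<dots> \<le> (1 + \<eta>) * (1 - \<tau>)\<^sup>2"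
      using \<eta> by (intro mult_left_mono) (auto simp: \<tau>_def power2_eq_square algebra_simps)
    finally show ?thesis using \<tau> by (simp add: divide_le_eq)
  qed
  \<comment> \<open>Within distance \<open>\<kappa> d\<close> of \<open>y\<close> the factor \<open>d\<^sup>N\<close> keeps at least the fraction \<open>1 - \<tau>\<close> of its value.\<close>
  define \<kappa> where "\<kappa> = \<tau> / real (N + 1)"
  have \<kappa>: "0 < \<kappa>" "\<kappa> < 1"
  proof -
    show "0 < \<kappa>" using \<tau> by (simp add: \<kappa>_def)
    have "\<kappa> \<le> \<tau>" using \<tau> by (simp add: \<kappa>_def divide_le_eq algebra_simps)
    then show "\<kappa> < 1" using \<tau> by simp
  qed
  have bern: "1 - \<tau> \<le> (1 - \<kappa>) ^ N"
  proof -
    have "real N * \<kappa> \<le> \<tau>" using \<tau> by (simp add: \<kappa>_def divide_le_eq algebra_simps)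
    moreover have "1 + real N * (- \<kappa>) \<le> (1 + - \<kappa>) ^ N" by (rule Bernoulli_inequality) (use \<kappa> in auto)
    ultimately show ?thesis by simp
  qed
  define K where "K = 4 * D * (2 * q / \<kappa>) ^ N / (1 - \<tau>)"
  have K: "0 < K" unfolding K_def using D q \<kappa> \<tau> by auto
  show thesis
  proof (rule that[OF K], unfold weighted_mean_bound_def, intro allI impI)
    fix V s :: "'a \<Rightarrow> real" and x :: 'a and R B :: real
    assume V: "RH p C V" and R: "0 < R" and s [measurable]: "s \<in> borel_measurable borel" and "\<forall>z. 0 \<le> s z"
      and "\<forall>z\<in>ball x (2 * R). s z \<le> B" and "\<forall>z r. 0 < r \<longrightarrow> r + dist x z \<le> 2 * R \<longrightarrow> tent_submean s z r"
    then have s0: "0 \<le> s z" and B: "z \<in> ball x (2 * R) \<Longrightarrow> s z \<le> B"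
      and mean: "0 < r \<Longrightarrow> r + dist x z \<le> 2 * R \<Longrightarrow> tent_submean s z r" for z r by auto
    have [measurable]: "V \<in> borel_measurable borel" using RH_D(1)[OF V] .
    have V0: "0 \<le> V z" for z by (rule RH_D(2)[OF V])
    show "ennreal (s x * (LINT z:cube x R|lborel. V z))
         \<le> ennreal K * (\<integral>\<^sup>+z. indicator (ball x (2 * R)) z * (ennreal (s z) * ennreal (V z)) \<partial>lborel)"
    proof (cases "s x = 0")
      case False
      define d where "d z = 2 * R - dist x z" for z
      define F where "F z = s z * d z ^ N" for z
      define S where "S = (SUP z\<in>ball x (2 * R). F z)"
      have bdd: "bdd_above (F ` ball x (2 * R))"
      proof (rule bdd_aboveI2)
        fix z assume z: "z \<in> ball x (2 * R)"
        have "F z \<le> B * (2 * R) ^ N" unfolding F_def using z B[OF z] s0[of z] R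
          by (intro mult_mono power_mono) (auto simp: d_def)
        then show "F z \<le> B * (2 * R) ^ N" .
      qed
      have xin: "x \<in> ball x (2 * R)" using R by simp
      have FS: "F z \<le> S" if "z \<in> ball x (2 * R)" for z unfolding S_def by (rule cSUP_upper[OF that bdd])
      have "0 < F x" using False s0[of x] R by (simp add: F_def d_def)
      then have S: "0 < S" using FS[OF xin] by simp
      then have "(1 - \<tau>) * S < S" using \<tau> by simp
      then obtain y where y: "y \<in> ball x (2 * R)" "(1 - \<tau>) * S < F y"
        unfolding S_def using less_cSUP_iff[OF _ bdd] xin by blast
      have dy: "0 < d y" "d y \<le> 2 * R" using y(1) by (auto simp: d_def)
      have "0 < F y" using y(2) S \<tau> by (smt (verit) mult_pos_pos)
      then have sy: "0 < s y" using dy s0[of y] unfolding F_def by (metis less_eq_real_def mult_zero_left less_irrefl)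
      define r where "r = \<kappa> * d y"
      have r: "0 < r" "r < d y" using \<kappa> dy by (auto simp: r_def)
      have sub: "ball y r \<subseteq> ball x (2 * R)"
      proof
        fix z assume "z \<in> ball y r"
        then have "dist y z < d y" using r by simp
        then show "z \<in> ball x (2 * R)" using dist_triangle[of x z y] by (simp add: d_def)
      qed
      have up: "s z \<le> (1 + \<eta>) * s y" if z: "z \<in> ball y r" for z
      proof -
        have "d y - r \<le> d z" using z dist_triangle[of x z y] by (simp add: d_def)
        then have dz: "(1 - \<kappa>) * d y \<le> d z" by (simp add: r_def algebra_simps)
        have "s z * ((1 - \<tau>) * d y ^ N) \<le> s z * ((1 - \<kappa>) ^ N * d y ^ N)"
          using bern dy s0[of z] by (intro mult_left_mono mult_right_mono) auto
        also have "\<dots> \<le> F z" unfolding F_def power_mult_distrib[symmetric]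
          using dz dy \<kappa> s0[of z] by (intro mult_left_mono power_mono) auto
        also have "\<dots> \<le> S" using sub z by (intro FS) auto
        also have "\<dots> \<le> F y / (1 - \<tau>)" using y(2) \<tau> by (simp add: field_simps)
        finally have "s z * (1 - \<tau>) * d y ^ N \<le> s y / (1 - \<tau>) * d y ^ N" by (simp add: F_def mult_ac)
        then have "s z * (1 - \<tau>) \<le> s y / (1 - \<tau>)" using dy by (intro mult_right_le_imp_le[of "s z * (1 - \<tau>)" "d y ^ N"]) auto
        then have "s z \<le> s y / (1 - \<tau>) / (1 - \<tau>)" using \<tau> by (subst pos_le_divide_eq) auto
        then have "s z \<le> s y * (1 / (1 - \<tau>)\<^sup>2)" by (simp add: power2_eq_square)
        also have "\<dots> \<le> s y * (1 + \<eta>)" using \<tau>\<eta> sy by (intro mult_left_mono) auto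
        finally show ?thesis by (simp add: mult.commute)
      qed
      define \<rho> where "\<rho> = r / (2 * q)"
      have \<rho>: "0 < \<rho>" using r q by (simp add: \<rho>_def)
      define E where "E = {z \<in> cube y \<rho>. s z < s y / 2}"
      have E [measurable]: "E \<in> sets borel" unfolding E_def by measurable
      have mE: "measure lborel E \<le> \<alpha> * (2 * \<rho>) ^ n"
      proof -
        have "measure lborel E \<le> 4 * \<eta> * c * r ^ n"
          unfolding E_def \<rho>_def q_def n_def
          by (rule submean_level_set_small[OF s s0 r(1) c _ sy \<eta>(1) up])
            (use mean[of r y] r in \<open>auto simp: c(2) d_def\<close>)
        also have "\<dots> \<le> \<alpha> / q ^ n * r ^ n" using \<eta>\<alpha> r by (intro mult_right_mono) auto
        also have "\<dots> = \<alpha> * (2 * \<rho>) ^ n" using q by (simp add: \<rho>_def power_divide)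
        finally show ?thesis .
      qed
      have half: "(LINT z:E|lborel. V z) \<le> (1/2) * (LINT z:cube y \<rho>|lborel. V z)"
        by (rule small[OF V \<rho>]) (use mE in \<open>auto simp: E_def n_def\<close>)
      have iQ: "set_integrable lborel (cube y \<rho>) V" by (rule RH_D(4)[OF V])
      have iE: "set_integrable lborel E V" "set_integrable lborel (cube y \<rho> - E) V"
        by (rule set_integrable_subset[OF iQ]; auto simp: E_def)+
      have split: "(LINT z:cube y \<rho>|lborel. V z) = (LINT z:E|lborel. V z) + (LINT z:cube y \<rho> - E|lborel. V z)"
      proof -
        have "E \<union> (cube y \<rho> - E) = cube y \<rho>" by (auto simp: E_def)
        then show ?thesis using set_integral_Un[OF _ iE] by auto
      qed
      have qsub: "cube y \<rho> \<subseteq> ball x (2 * R)"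
      proof
        fix z assume "z \<in> cube y \<rho>"
        then have "(norm (z - y))\<^sup>2 \<le> r\<^sup>2 / 4" unfolding \<rho>_def q_def n_def by (rule cube_subset_ball_half[OF r(1)])
        also have "\<dots> < r\<^sup>2" using r by simp
        finally have "norm (z - y) < r" using r by (simp add: power2_less_imp_less)
        then show "z \<in> ball x (2 * R)" using sub by (auto simp: dist_norm norm_minus_commute)
      qed
      have "ennreal (s y / 4 * (LINT z:cube y \<rho>|lborel. V z)) \<le> ennreal (s y / 2 * (LINT z:cube y \<rho> - E|lborel. V z))"
      proof (rule ennreal_leI)
        have "(LINT z:cube y \<rho>|lborel. V z) \<le> 2 * (LINT z:cube y \<rho> - E|lborel. V z)" using half split by simp
        from mult_left_mono[OF this, of "s y / 4"] sy
        show "s y / 4 * (LINT z:cube y \<rho>|lborel. V z) \<le> s y / 2 * (LINT z:cube y \<rho> - E|lborel. V z)" by simp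
      qed
      also have "\<dots> = ennreal (s y / 2) * (\<integral>\<^sup>+z. indicator (cube y \<rho> - E) z * ennreal (V z) \<partial>lborel)"
        unfolding nn_set_integral_eq[OF iE(2) V0] using sy by (intro ennreal_mult') simp
      also have "\<dots> = (\<integral>\<^sup>+z. ennreal (s y / 2) * (indicator (cube y \<rho> - E) z * ennreal (V z)) \<partial>lborel)"
        by (rule nn_integral_cmult[symmetric]) measurable
      also have "\<dots> \<le> (\<integral>\<^sup>+z. indicator (ball x (2 * R)) z * (ennreal (s z) * ennreal (V z)) \<partial>lborel)"
      proof (intro nn_integral_mono)
        fix z
        show "ennreal (s y / 2) * (indicator (cube y \<rho> - E) z * ennreal (V z)) \<le> indicator (ball x (2 * R)) z * (ennreal (s z) * ennreal (V z))"
        proof (cases "z \<in> cube y \<rho> - E")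
          case True
          then have "s y / 2 \<le> s z" "z \<in> ball x (2 * R)" using qsub by (auto simp: E_def)
          then show ?thesis using True by (auto intro!: mult_right_mono ennreal_leI)
        qed simp
      qed
      finally have low: "ennreal (s y / 4 * (LINT z:cube y \<rho>|lborel. V z)) \<le> (\<integral>\<^sup>+z. indicator (ball x (2 * R)) z * (ennreal (s z) * ennreal (V z)) \<partial>lborel)" .
      have \<rho>R: "\<rho> \<le> R"
      proof -
        have "\<rho> \<le> r / 2" using q r unfolding \<rho>_def by (intro frac_le) auto
        then show ?thesis using r dy by simp
      qed
      have "s x * (LINT z:cube x R|lborel. V z) \<le> K * (s y / 4 * (LINT z:cube y \<rho>|lborel. V z))"
      proof -
        have 1: "(LINT z:cube x R|lborel. V z) \<le> D * (R / \<rho>) ^ N * (LINT z:cube y \<rho>|lborel. V z)"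
          by (rule polynomial_doublingD[OF comp[OF V] \<rho> \<rho>R]) (use y R in \<open>auto simp: dist_norm\<close>)
        have "s x * (2 * R) ^ N = F x" by (simp add: F_def d_def)
        also have "\<dots> \<le> S" by (rule FS[OF xin])
        also have "\<dots> \<le> s y * d y ^ N / (1 - \<tau>)" using y(2) \<tau> by (simp add: F_def field_simps)
        also have "\<dots> \<le> s y * (2 * d y) ^ N / (1 - \<tau>)" using \<tau> sy dy
          by (intro divide_right_mono mult_left_mono power_mono) auto
        finally have "s x * (2 * R) ^ N \<le> s y * (2 * d y) ^ N / (1 - \<tau>)" .
        then have "2 ^ N * (s x * R ^ N) \<le> 2 ^ N * (s y * d y ^ N / (1 - \<tau>))" by (simp add: power_mult_distrib mult_ac)
        then have 2: "s x * R ^ N \<le> s y * d y ^ N / (1 - \<tau>)" by (rule mult_left_le_imp_le) simp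
        have "s x * (LINT z:cube x R|lborel. V z) \<le> s x * (D * (R / \<rho>) ^ N * (LINT z:cube y \<rho>|lborel. V z))"
          by (rule mult_left_mono[OF 1 s0])
        also have "\<dots> = (s x * R ^ N) * (D / \<rho> ^ N * (LINT z:cube y \<rho>|lborel. V z))"
          by (simp add: power_divide)
        also have "\<dots> \<le> (s y * d y ^ N / (1 - \<tau>)) * (D / \<rho> ^ N * (LINT z:cube y \<rho>|lborel. V z))"
          using D \<rho> RH_integral_pos[OF V \<rho>, of y] by (intro mult_right_mono[OF 2]) auto
        also have "\<dots> = K * (s y / 4 * (LINT z:cube y \<rho>|lborel. V z))"
          using dy \<kappa> q by (simp add: K_def \<rho>_def r_def power_divide power_mult_distrib) (simp add: mult_ac)
        finally show ?thesis .
      qed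
      then have "ennreal (s x * (LINT z:cube x R|lborel. V z)) \<le> ennreal (K * (s y / 4 * (LINT z:cube y \<rho>|lborel. V z)))"
        by (rule ennreal_leI)
      also have "\<dots> = ennreal K * ennreal (s y / 4 * (LINT z:cube y \<rho>|lborel. V z))" using K by (intro ennreal_mult') simp
      also have "\<dots> \<le> ennreal K * (\<integral>\<^sup>+z. indicator (ball x (2 * R)) z * (ennreal (s z) * ennreal (V z)) \<partial>lborel)"
        by (rule mult_left_mono[OF low]) simp
      finally show ?thesis .
    qed simp
  qed
qed

section \<open>Schur test for the Green function\<close>

lemma pred_ball [measurable]: "Measurable.pred borel (\<lambda>z. z \<in> ball (x :: 'a::euclidean_space) r)"
  unfolding pred_def by simp

text \<open>A bounded potential together with the constants that the reverse Hoelder inequality provides. The integral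
  bounds below are expressed in \<open>p, C, K, D, N\<close> and the dimension only, so they are uniform in \<open>k\<close> and \<open>d\<close>.\<close>

locale RH_potential = bounded_potential V k d for V :: "'a::euclidean_space \<Rightarrow> real" and k d +
  fixes p C K D :: real and N :: nat
  assumes p: "1 < p" and RH: "RH p C V" and K: "0 < K" and D: "0 < D"
    and mean: "weighted_mean_bound K V" and comp: "polynomial_doubling D N V"
begin

definition \<mu> :: "'a \<Rightarrow> real \<Rightarrow> real" where "\<mu> x r = (LINT z:cube x r|lborel. V z)"

lemma \<mu>_pos: "0 < r \<Longrightarrow> 0 < \<mu> x r" unfolding \<mu>_def by (rule RH_integral_pos[OF RH])

lemma \<mu>_comp: "0 < r \<Longrightarrow> r \<le> R \<Longrightarrow> norm (x - y) \<le> 4 * R \<Longrightarrow> \<mu> x R \<le> D * (R / r) ^ N * \<mu> y r"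
  unfolding \<mu>_def by (rule polynomial_doublingD[OF comp])

text \<open>The bound degenerates as \<open>d\<close> tends to \<open>0\<close>; it only serves to know that the Green function is finite and locally
  bounded off its pole, as the weighted mean value inequality demands.\<close>

lemma green_bounded_off_diagonal:
  assumes r: "0 < r" "r < dist z y" and c: "0 < c" "tent_mass TYPE('a) = ennreal c"
  shows "green z y \<le> ennreal (1 / (c * d * r ^ DIM('a)))"
proof -
  have t: "tent r z x ^ 2 / r ^ (DIM('a) + 4) \<le> 1 / r ^ DIM('a)" for x
  proof -
    have "tent r z x \<le> r\<^sup>2" by (auto simp: tent_def)
    then have "tent r z x ^ 2 \<le> (r\<^sup>2) ^ 2" by (intro power_mono) auto
    then have "tent r z x ^ 2 / r ^ (DIM('a) + 4) \<le> (r\<^sup>2) ^ 2 / r ^ (DIM('a) + 4)" using r by (intro divide_right_mono) auto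
    also have "\<dots> = 1 / r ^ DIM('a)" using r by (simp add: power_add)
    finally show ?thesis .
  qed
  have "ennreal c * green z y \<le> (\<integral>\<^sup>+x. green x y * ennreal (tent r z x ^ 2 / r ^ (DIM('a) + 4)) \<partial>lborel)"
    using green_submean[OF r] by (simp add: c)
  also have "\<dots> \<le> (\<integral>\<^sup>+x. green x y * ennreal (1 / r ^ DIM('a)) \<partial>lborel)"
    by (intro nn_integral_mono mult_left_mono ennreal_leI t) auto
  also have "\<dots> = (\<integral>\<^sup>+x. green x y \<partial>lborel) * ennreal (1 / r ^ DIM('a))"
    by (rule nn_integral_multc) measurable
  also have "\<dots> \<le> ennreal (1 / d) * ennreal (1 / r ^ DIM('a))"
    by (intro mult_right_mono nn_integral_green) auto
  finally have "ennreal (1 / c) * (ennreal c * green z y) \<le> ennreal (1 / c) * (ennreal (1 / d) * ennreal (1 / r ^ DIM('a)))"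
    by (rule mult_left_mono) simp
  moreover have "ennreal (1 / c) * (ennreal c * green z y) = green z y"
    using c by (simp add: mult.assoc[symmetric] ennreal_mult'[symmetric])
  moreover have "ennreal (1 / c) * (ennreal (1 / d) * ennreal (1 / r ^ DIM('a))) = ennreal (1 / (c * d * r ^ DIM('a)))"
    using c r d_pos by (simp add: ennreal_mult'[symmetric])
  ultimately show ?thesis by simp
qed

text \<open>The Green function has the sub-mean value property in every ball that avoids its pole.\<close>

lemma green_weighted_mean:
  assumes xy: "x \<noteq> y"
  shows "green x y * ennreal (\<mu> x (dist x y / 4))
    \<le> ennreal K * (\<integral>\<^sup>+z. indicator (ball x (dist x y / 2)) z * (green z y * ennreal (V z)) \<partial>lborel)"
proof -
  obtain c where c: "0 < c" "tent_mass TYPE('a) = ennreal c"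
    by (rule tent_mass_finite_pos)
  define R where "R = dist x y / 4"
  have R: "0 < R" using xy by (simp add: R_def)
  define s where "s z = enn2real (green z y)" for z
  have [measurable]: "s \<in> borel_measurable borel" unfolding s_def by measurable
  have sg: "ennreal (s z) = green z y" if "z \<noteq> y" for z
  proof -
    have "0 < dist z y / 2" "dist z y / 2 < dist z y" using that by auto
    from green_bounded_off_diagonal[OF this c] show ?thesis
      unfolding s_def by (metis ennreal_enn2real ennreal_less_top le_less_trans)
  qed
  have AEy: "AE z in lborel. z \<noteq> y" by (rule AE_lborel_singleton)
  have far: "R < dist z y" if "z \<in> ball x (2 * R)" for z
  proof -
    have "dist x z < 2 * R" using that by simp
    moreover have "4 * R \<le> dist x z + dist z y" using dist_triangle[of x y z] by (simp add: R_def)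
    ultimately show ?thesis using R by linarith
  qed
  have "ennreal (s x * (LINT z:cube x R|lborel. V z))
         \<le> ennreal K * (\<integral>\<^sup>+z. indicator (ball x (2 * R)) z * (ennreal (s z) * ennreal (V z)) \<partial>lborel)"
  proof (rule mean[unfolded weighted_mean_bound_def, rule_format, OF R])
    show "0 \<le> s z" for z by (simp add: s_def)
    show "s z \<le> 1 / (c * d * R ^ DIM('a))" if "z \<in> ball x (2 * R)" for z
    proof -
      have "z \<noteq> y" using far[OF that] R by auto
      have "ennreal (s z) \<le> ennreal (1 / (c * d * R ^ DIM('a)))"
        unfolding sg[OF \<open>z \<noteq> y\<close>] by (rule green_bounded_off_diagonal[OF R far[OF that] c])
      then show ?thesis using c d_pos R by (subst (asm) ennreal_le_iff) auto
    qed
    fix z r assume r: "0 < r" "r + dist x z \<le> 2 * R"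
    have "4 * R \<le> dist x z + dist z y" using dist_triangle[of x y z] by (simp add: R_def)
    then have rz: "r < dist z y" using r R by linarith
    then have "z \<noteq> y" using r by auto
    have "tent_mass TYPE('a) * ennreal (s z)
       \<le> (\<integral>\<^sup>+w. green w y * ennreal (tent r z w ^ 2 / r ^ (DIM('a) + 4)) \<partial>lborel)"
      using green_submean[OF r(1) rz] unfolding sg[OF \<open>z \<noteq> y\<close>] .
    also have "\<dots> = (\<integral>\<^sup>+w. ennreal (s w) * ennreal (tent r z w ^ 2 / r ^ (DIM('a) + 4)) \<partial>lborel)"
      by (rule nn_integral_cong_AE) (use AEy in \<open>eventually_elim, simp add: sg\<close>)
    finally show "tent_submean s z r" unfolding tent_submean_def .
  qed measurable
  also have "(\<integral>\<^sup>+z. indicator (ball x (2 * R)) z * (ennreal (s z) * ennreal (V z)) \<partial>lborel)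
    = (\<integral>\<^sup>+z. indicator (ball x (2 * R)) z * (green z y * ennreal (V z)) \<partial>lborel)"
    by (rule nn_integral_cong_AE) (use AEy in \<open>eventually_elim, simp add: sg\<close>)
  also have "ennreal (s x * (LINT z:cube x R|lborel. V z)) = green x y * ennreal (\<mu> x R)"
    unfolding sg[OF xy, symmetric] \<mu>_def using \<mu>_pos[OF R, of x] by (intro ennreal_mult) (auto simp: \<mu>_def s_def)
  finally show ?thesis unfolding R_def by simp
qed

text \<open>Up to a factor \<open>2\<^sup>n\<close> the mean of \<open>V\<close> over the cube about \<open>x\<close> of size comparable to the distance from \<open>y\<close>: the
  weight for the Schur test.\<close>

definition mean_V :: "'a \<Rightarrow> 'a \<Rightarrow> real" where
  "mean_V x y = \<mu> x (dist x y / 4) / (dist x y / 4) ^ DIM('a)"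

lemma mean_V_pos: "x \<noteq> y \<Longrightarrow> 0 < mean_V x y"
  unfolding mean_V_def by (intro divide_pos_pos \<mu>_pos) auto

lemma mean_V_nonneg [simp]: "0 \<le> mean_V x y"
  unfolding mean_V_def \<mu>_def set_lebesgue_integral_def
  by (intro divide_nonneg_nonneg integral_nonneg_AE AE_I2 zero_le_power) (auto simp: V_nonneg)

lemma mean_V_measurable [measurable (raw)]:
  assumes [measurable]: "f \<in> borel_measurable M" "g \<in> borel_measurable M"
  shows "(\<lambda>x. mean_V (f x) (g x)) \<in> borel_measurable M"
proof -
  have 1: "(\<lambda>q. \<integral>\<^sup>+z. indicator (cube (fst q) (snd q)) z * ennreal (V z) \<partial>lborel) \<in> borel_measurable (borel \<Otimes>\<^sub>M borel)"
  proof (rule lborel.borel_measurable_nn_integral)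
    have "{w \<in> space ((borel \<Otimes>\<^sub>M borel) \<Otimes>\<^sub>M lborel). \<forall>b\<in>Basis. \<bar>(snd w - fst (fst w)) \<bullet> b\<bar> \<le> snd (fst w)} \<in> sets (((borel :: 'a measure) \<Otimes>\<^sub>M (borel :: real measure)) \<Otimes>\<^sub>M lborel)"
      by measurable
    then have "(\<lambda>w. indicator {w \<in> space ((borel \<Otimes>\<^sub>M borel) \<Otimes>\<^sub>M lborel). \<forall>b\<in>Basis. \<bar>(snd w - fst (fst w)) \<bullet> b\<bar> \<le> snd (fst w)} w * ennreal (V (snd w))) \<in> borel_measurable (((borel :: 'a measure) \<Otimes>\<^sub>M (borel :: real measure)) \<Otimes>\<^sub>M lborel)"
      by measurable
    also have "(\<lambda>w. indicator {w \<in> space ((borel \<Otimes>\<^sub>M borel) \<Otimes>\<^sub>M lborel). \<forall>b\<in>Basis. \<bar>(snd w - fst (fst w)) \<bullet> b\<bar> \<le> snd (fst w)} w * ennreal (V (snd w)))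
       = (\<lambda>(q, z). indicator (cube (fst q) (snd q)) z * ennreal (V z))"
      by (auto simp: fun_eq_iff indicator_def mem_cube space_pair_measure)
    finally show "(\<lambda>(q, z). indicator (cube (fst q) (snd q)) z * ennreal (V z)) \<in> borel_measurable (((borel :: 'a measure) \<Otimes>\<^sub>M (borel :: real measure)) \<Otimes>\<^sub>M lborel)" .
  qed
  \<comment> \<open>The integral over a variable cube is measurable as a nonnegative integral, and equals \<open>\<mu>\<close> after conversion.\<close>
  have eq: "\<mu> x r = enn2real (\<integral>\<^sup>+z. indicator (cube x r) z * ennreal (V z) \<partial>lborel)" for x r
    unfolding \<mu>_def nn_set_integral_eq[OF RH_D(4)[OF RH] V_nonneg]
    by (subst enn2real_ennreal) (auto simp: set_lebesgue_integral_def V_nonneg intro!: integral_nonneg_AE)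
  have "(\<lambda>x. (f x, dist (f x) (g x) / 4)) \<in> M \<rightarrow>\<^sub>M borel \<Otimes>\<^sub>M borel" by measurable
  from measurable_compose[OF this 1]
  have [measurable]: "(\<lambda>x. \<integral>\<^sup>+z. indicator (cube (f x) (dist (f x) (g x) / 4)) z * ennreal (V z) \<partial>lborel) \<in> borel_measurable M"
    by simp
  have [measurable]: "(\<lambda>x. \<mu> (f x) (dist (f x) (g x) / 4)) \<in> borel_measurable M"
    unfolding eq by measurable
  show ?thesis unfolding mean_V_def by measurable
qed

end

context RH_potential
begin

lemma green_V_mass: "(\<integral>\<^sup>+z. green z y * ennreal (V z) \<partial>lborel) \<le> 1"
proof -
  have "(\<integral>\<^sup>+z. green z y * ennreal (V z) \<partial>lborel) \<le> (\<integral>\<^sup>+z. green z y * ennreal (d + V z) \<partial>lborel)"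
    by (intro nn_integral_mono mult_left_mono ennreal_leI) (use d_pos in auto)
  also have "\<dots> \<le> 1" by (rule green_mass_left)
  finally show ?thesis .
qed

lemma nn_integral_ball_le:
  assumes "0 \<le> \<rho>"
  shows "(\<integral>\<^sup>+y. indicator (ball (z::'a) \<rho>) y \<partial>lborel) \<le> ennreal ((2 * \<rho>) ^ DIM('a))"
proof -
  have "(\<integral>\<^sup>+y. indicator (ball z \<rho>) y \<partial>lborel) = emeasure lborel (ball z \<rho>)" by simp
  also have "\<dots> \<le> emeasure lborel (cube z \<rho>)" by (intro emeasure_mono ball_subset_cube) auto
  also have "\<dots> = ennreal ((2 * \<rho>) ^ DIM('a))"
    using measure_cube[OF assms, of z] emeasure_cube_finite[of z \<rho>] by (subst emeasure_eq_ennreal_measure) auto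
  finally show ?thesis .
qed

lemma measurable_ball_pair [measurable]:
  "(\<lambda>p. indicator (ball (fst p) (dist a (fst p))) (snd p) :: ennreal) \<in> borel_measurable (borel \<Otimes>\<^sub>M (borel :: 'a measure))"
  "(\<lambda>p. indicator (ball (snd p) (dist a (snd p))) (fst p) :: ennreal) \<in> borel_measurable (borel \<Otimes>\<^sub>M (borel :: 'a measure))"
proof -
  have 1: "{p \<in> space (borel \<Otimes>\<^sub>M (borel :: 'a measure)). dist (fst p) (snd p) < dist a (fst p)} \<in> sets (borel \<Otimes>\<^sub>M borel)"
    "{p \<in> space (borel \<Otimes>\<^sub>M (borel :: 'a measure)). dist (snd p) (fst p) < dist a (snd p)} \<in> sets (borel \<Otimes>\<^sub>M borel)"
    by measurable
  have 2: "(\<lambda>p. indicator (ball (fst p) (dist a (fst p))) (snd p) :: ennreal) = indicator {p \<in> space (borel \<Otimes>\<^sub>M (borel :: 'a measure)). dist (fst p) (snd p) < dist a (fst p)}"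
    "(\<lambda>p. indicator (ball (snd p) (dist a (snd p))) (fst p) :: ennreal) = indicator {p \<in> space (borel \<Otimes>\<^sub>M (borel :: 'a measure)). dist (snd p) (fst p) < dist a (snd p)}"
    by (auto simp: fun_eq_iff indicator_def space_pair_measure)
  show "(\<lambda>p. indicator (ball (fst p) (dist a (fst p))) (snd p) :: ennreal) \<in> borel_measurable (borel \<Otimes>\<^sub>M (borel :: 'a measure))"
  "(\<lambda>p. indicator (ball (snd p) (dist a (snd p))) (fst p) :: ennreal) \<in> borel_measurable (borel \<Otimes>\<^sub>M (borel :: 'a measure))"
    unfolding 2 using 1 by measurable
qed

text \<open>By \<open>green_weighted_mean\<close> with pole \<open>x\<close>, the integrand at \<open>y\<close> is at most an average of \<open>\<Gamma>(z, x) V(z)\<close> over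
  points \<open>z\<close> near \<open>y\<close>. Exchanging the integrals, the points \<open>y\<close> admitted by a given \<open>z\<close> fill a ball of radius
  comparable to \<open>|x - z|\<close>, which cancels the normalisation, and what remains is the mass bound for \<open>\<Gamma> V\<close>.\<close>

lemma schur_first: "(\<integral>\<^sup>+y. green x y * ennreal (mean_V x y) \<partial>lborel) \<le> ennreal (D * K * 12 ^ DIM('a))"
proof -
  define n where "n = DIM('a)"
  \<comment> \<open>For \<open>z\<close> closer to \<open>y\<close> than \<open>|x - y| / 2\<close>, one has \<open>|x - z| \<le> 6 R\<close> and \<open>|y - z| < |x - z|\<close>, where \<open>R = |x - y| / 4\<close>.\<close>
  have pt: "green x y * ennreal (mean_V x y) \<le> (\<integral>\<^sup>+z. indicator (ball z (dist x z)) y * (ennreal (D * K * (6 / dist x z) ^ n) * (green z x * ennreal (V z))) \<partial>lborel)"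
    if "y \<noteq> x" for y
  proof -
    define R where "R = dist y x / 4"
    have R: "0 < R" using that by (simp add: R_def)
    have "mean_V x y = \<mu> x R / R ^ n" by (simp add: mean_V_def R_def n_def dist_commute)
    also have "\<mu> x R \<le> D * (R / R) ^ N * \<mu> y R"
      by (rule \<mu>_comp) (use R in \<open>auto simp: R_def dist_norm norm_minus_commute\<close>)
    finally have m1: "mean_V x y \<le> D / R ^ n * \<mu> y R" using R by (simp add: divide_right_mono)
    have "green x y * ennreal (mean_V x y) \<le> green y x * ennreal (D / R ^ n * \<mu> y R)"
      unfolding green_sym[of x y] by (intro mult_left_mono ennreal_leI m1) auto
    also have "\<dots> = ennreal (D / R ^ n) * (green y x * ennreal (\<mu> y R))"
      using D R by (subst ennreal_mult') (auto simp: mult_ac)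
    also have "\<dots> \<le> ennreal (D / R ^ n) * (ennreal K * (\<integral>\<^sup>+z. indicator (ball y (dist y x / 2)) z * (green z x * ennreal (V z)) \<partial>lborel))"
      unfolding R_def by (intro mult_left_mono green_weighted_mean that) auto
    also have "\<dots> = (\<integral>\<^sup>+z. ennreal (D * K / R ^ n) * (indicator (ball y (dist y x / 2)) z * (green z x * ennreal (V z))) \<partial>lborel)"
      by (subst nn_integral_cmult, measurable) (use D K R in \<open>simp add: mult.assoc[symmetric] ennreal_mult'[symmetric]\<close>)
    also have "\<dots> \<le> (\<integral>\<^sup>+z. indicator (ball z (dist x z)) y * (ennreal (D * K * (6 / dist x z) ^ n) * (green z x * ennreal (V z))) \<partial>lborel)"
    proof (intro nn_integral_mono)
      fix z
      show "ennreal (D * K / R ^ n) * (indicator (ball y (dist y x / 2)) z * (green z x * ennreal (V z))) \<le> indicator (ball z (dist x z)) y * (ennreal (D * K * (6 / dist x z) ^ n) * (green z x * ennreal (V z)))"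
      proof (cases "z \<in> ball y (dist y x / 2)")
        case True
        then have zy: "dist y z < dist y x / 2" by simp
        have t: "dist y x \<le> dist y z + dist x z" "dist x z \<le> dist y x + dist y z"
          using dist_triangle[of y x z] dist_triangle[of x z y] by (auto simp: dist_commute)
        then have "dist z y < dist x z" using zy by (simp add: dist_commute)
        moreover have "0 < dist x z" using t zy zero_le_dist[of y z] by linarith
        moreover have "1 / R \<le> 6 / dist x z" using t zy R \<open>0 < dist x z\<close> by (auto simp: R_def field_simps)
        then have "(1 / R) ^ n \<le> (6 / dist x z) ^ n" using R by (intro power_mono) auto
        then have "D * K * (1 / R) ^ n \<le> D * K * (6 / dist x z) ^ n" using D K by (intro mult_left_mono) auto
        then have "D * K / R ^ n \<le> D * K * (6 / dist x z) ^ n" by (simp add: power_divide)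
        ultimately show ?thesis using True by (auto intro!: mult_right_mono ennreal_leI)
      qed simp
    qed
    finally show ?thesis .
  qed
  have "(\<integral>\<^sup>+y. green x y * ennreal (mean_V x y) \<partial>lborel) \<le> (\<integral>\<^sup>+y. \<integral>\<^sup>+z. indicator (ball z (dist x z)) y * (ennreal (D * K * (6 / dist x z) ^ n) * (green z x * ennreal (V z))) \<partial>lborel \<partial>lborel)"
    using pt by (intro nn_integral_mono_AE) (use AE_lborel_singleton[of x] in \<open>eventually_elim, auto\<close>)
  also have "\<dots> = (\<integral>\<^sup>+z. \<integral>\<^sup>+y. indicator (ball z (dist x z)) y * (ennreal (D * K * (6 / dist x z) ^ n) * (green z x * ennreal (V z))) \<partial>lborel \<partial>lborel)"
    by (rule lborel_pair.Fubini') (unfold case_prod_unfold, measurable)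
  also have "\<dots> = (\<integral>\<^sup>+z. (\<integral>\<^sup>+y. indicator (ball z (dist x z)) y \<partial>lborel) * (ennreal (D * K * (6 / dist x z) ^ n) * (green z x * ennreal (V z))) \<partial>lborel)"
    by (intro nn_integral_cong nn_integral_multc) simp
  also have "\<dots> \<le> (\<integral>\<^sup>+z. ennreal (D * K * 12 ^ n) * (green z x * ennreal (V z)) \<partial>lborel)"
  proof (intro nn_integral_mono)
    fix z
    have "(\<integral>\<^sup>+y. indicator (ball z (dist x z)) y \<partial>lborel) * ennreal (D * K * (6 / dist x z) ^ n) \<le> ennreal ((2 * dist x z) ^ n) * ennreal (D * K * (6 / dist x z) ^ n)"
      unfolding n_def by (intro mult_right_mono nn_integral_ball_le) auto
    also have "\<dots> \<le> ennreal (D * K * 12 ^ n)"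
    proof (cases "x = z")
      case True
      then show ?thesis by (simp add: n_def zero_power)
    next
      case False
      then have "(2 * dist x z) ^ n * (D * K * (6 / dist x z) ^ n) = D * K * (2 * dist x z * (6 / dist x z)) ^ n"
        unfolding power_mult_distrib by simp
      also have "\<dots> = D * K * 12 ^ n" using False by simp
      finally show ?thesis using D K by (subst ennreal_mult'[symmetric]) auto
    qed
    finally show "(\<integral>\<^sup>+y. indicator (ball z (dist x z)) y \<partial>lborel) * (ennreal (D * K * (6 / dist x z) ^ n) * (green z x * ennreal (V z))) \<le> ennreal (D * K * 12 ^ n) * (green z x * ennreal (V z))"
      unfolding mult.assoc[symmetric] by (intro mult_right_mono) auto
  qed
  also have "\<dots> = ennreal (D * K * 12 ^ n) * (\<integral>\<^sup>+z. green z x * ennreal (V z) \<partial>lborel)"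
    by (rule nn_integral_cmult) measurable
  also have "\<dots> \<le> ennreal (D * K * 12 ^ n) * 1"
    by (intro mult_left_mono green_V_mass) auto
  finally show ?thesis by (simp add: n_def)
qed

text \<open>The same exchange of integrals, now with pole \<open>y\<close> and integrating over \<open>x\<close>. For \<open>x\<close> near \<open>z\<close> the weight \<open>mean_V
  x y\<close> is comparable to \<open>A z\<close>, and the inner integral is one of \<open>V\<^sup>p\<close> over a ball about \<open>z\<close>, which the reverse
  Hoelder inequality bounds by a multiple of \<open>(A z)\<^sup>p\<close>.\<close>

lemma schur_second: "(\<integral>\<^sup>+x. green x y * ennreal (V x powr p * mean_V x y powr (1 - p)) \<partial>lborel)
    \<le> ennreal (K * \<bar>C\<bar> * 12 ^ DIM('a) * (D * 6 ^ N) powr p)"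
proof -
  define n where "n = DIM('a)"
  define A where "A z = \<mu> z (dist y z) / (dist y z) ^ n" for z
  \<comment> \<open>The bound for the factor \<open>K m\<^sup>-\<^sup>p / R\<^sup>n\<close>, with \<open>m = mean_V x y\<close>, that depends on \<open>x\<close> only through the admissible ball.\<close>
  define B where "B z = K * (6 / dist y z) ^ n * (A z / (D * 6 ^ N)) powr (- p)" for z
  have Apos: "0 < A z" if "z \<noteq> y" for z using that unfolding A_def by (intro divide_pos_pos \<mu>_pos) auto
  have B0: "0 \<le> B z" for z using K by (simp add: B_def)
  have [measurable]: "A \<in> borel_measurable borel"
  proof -
    \<comment> \<open>Written through \<open>mean_V\<close>, whose measurability is known: a point at distance \<open>4 |y - z|\<close> from \<open>z\<close> is needed, and a unit
vector supplies one.\<close>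
    have "A z = mean_V z (z + (4 * dist y z / 1) *\<^sub>R (SOME b. b \<in> Basis))" for z
    proof -
      have "(SOME b::'a. b \<in> Basis) \<in> Basis" using SOME_Basis by blast
      then have "norm (SOME b::'a. b \<in> Basis) = 1" by simp
      then show ?thesis unfolding mean_V_def A_def n_def by (simp add: dist_norm)
    qed
    then have "A = (\<lambda>z. mean_V z (z + (4 * dist y z / 1) *\<^sub>R (SOME b. b \<in> Basis)))" by auto
    then show ?thesis by simp
  qed
  have [measurable]: "B \<in> borel_measurable borel" unfolding B_def by measurable
  have pt: "green x y * ennreal (V x powr p * mean_V x y powr (1 - p)) \<le> (\<integral>\<^sup>+z. indicator (ball z (dist y z)) x * (ennreal (V x powr p) * (ennreal (B z) * (green z y * ennreal (V z)))) \<partial>lborel)"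
    if "x \<noteq> y" for x
  proof -
    define R where "R = dist x y / 4"
    have R: "0 < R" using that by (simp add: R_def)
    have mR: "mean_V x y = \<mu> x R / R ^ n" by (simp add: mean_V_def R_def n_def)
    have mp: "0 < mean_V x y" by (rule mean_V_pos[OF that])
    have "mean_V x y powr (1 - p) = mean_V x y * mean_V x y powr (- p)"
      using mp by (simp add: powr_diff powr_minus divide_inverse)
    then have eq: "V x powr p * mean_V x y powr (1 - p) = V x powr p * mean_V x y powr (- p) / R ^ n * \<mu> x R"
      by (simp add: mR)
    have c0: "0 \<le> V x powr p * mean_V x y powr (- p) / R ^ n" using R by simp
    have "green x y * ennreal (V x powr p * mean_V x y powr (1 - p)) = ennreal (V x powr p * mean_V x y powr (- p) / R ^ n) * (green x y * ennreal (\<mu> x R))"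
      unfolding eq ennreal_mult'[OF c0] by (simp add: mult_ac)
    also have "\<dots> \<le> ennreal (V x powr p * mean_V x y powr (- p) / R ^ n) * (ennreal K * (\<integral>\<^sup>+z. indicator (ball x (dist x y / 2)) z * (green z y * ennreal (V z)) \<partial>lborel))"
      unfolding R_def by (intro mult_left_mono green_weighted_mean that) auto
    also have "\<dots> = (\<integral>\<^sup>+z. ennreal (V x powr p * mean_V x y powr (- p) / R ^ n * K) * (indicator (ball x (dist x y / 2)) z * (green z y * ennreal (V z))) \<partial>lborel)"
      by (subst nn_integral_cmult, measurable) (simp add: mult.assoc[symmetric] ennreal_mult'[OF c0, symmetric])
    also have "\<dots> \<le> (\<integral>\<^sup>+z. indicator (ball z (dist y z)) x * (ennreal (V x powr p) * (ennreal (B z) * (green z y * ennreal (V z)))) \<partial>lborel)"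
    proof (intro nn_integral_mono)
      fix z
      show "ennreal (V x powr p * mean_V x y powr (- p) / R ^ n * K) * (indicator (ball x (dist x y / 2)) z * (green z y * ennreal (V z))) \<le> indicator (ball z (dist y z)) x * (ennreal (V x powr p) * (ennreal (B z) * (green z y * ennreal (V z))))"
      proof (cases "z \<in> ball x (dist x y / 2)")
        case True
        then have zx: "dist x z < dist x y / 2" by simp
        have t: "dist x y \<le> dist x z + dist y z" "dist y z \<le> dist x y + dist x z"
          using dist_triangle[of x y z] dist_triangle[of y z x] by (auto simp: dist_commute)
        then have xin: "x \<in> ball z (dist y z)" using zx by (simp add: dist_commute)
        define \<rho> where "\<rho> = dist y z"
        have \<rho>: "0 < \<rho>" using t zx zero_le_dist[of x z] unfolding \<rho>_def by linarith
        then have zy: "z \<noteq> y" by (auto simp: \<rho>_def)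
        have R\<rho>: "R \<le> \<rho>" "\<rho> \<le> 6 * R" using t zx by (auto simp: R_def \<rho>_def)
        have "\<mu> z \<rho> \<le> D * (\<rho> / R) ^ N * \<mu> x R"
          by (rule \<mu>_comp[OF R R\<rho>(1)]) (use t zx in \<open>auto simp: \<rho>_def dist_norm norm_minus_commute\<close>)
        also have "\<dots> \<le> D * 6 ^ N * \<mu> x R"
          using D R R\<rho> \<rho> \<mu>_pos[OF R, of x] by (intro mult_right_mono mult_left_mono power_mono) (auto simp: divide_le_eq)
        finally have "\<mu> z \<rho> / (D * 6 ^ N) \<le> \<mu> x R" using D by (simp add: divide_le_eq mult.commute)
        then have "\<mu> z \<rho> / (D * 6 ^ N) / \<rho> ^ n \<le> \<mu> x R / R ^ n"
          using R R\<rho> \<rho> \<mu>_pos[OF \<rho>, of z] \<mu>_pos[OF R, of x] D by (intro frac_le power_mono) auto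
        then have Am: "A z / (D * 6 ^ N) \<le> mean_V x y" unfolding A_def mR \<rho>_def by (simp add: mult_ac)
        have "mean_V x y powr (- p) \<le> (A z / (D * 6 ^ N)) powr (- p)"
          using Am p D Apos[OF zy] by (intro powr_mono2') auto
        moreover have "(1 / R) ^ n \<le> (6 / \<rho>) ^ n" using R R\<rho> \<rho> by (intro power_mono) (auto simp: field_simps)
        ultimately have "mean_V x y powr (- p) * (1 / R) ^ n \<le> (A z / (D * 6 ^ N)) powr (- p) * (6 / \<rho>) ^ n"
          using R by (intro mult_mono) auto
        then have "V x powr p * K * (mean_V x y powr (- p) * (1 / R) ^ n) \<le> V x powr p * K * ((A z / (D * 6 ^ N)) powr (- p) * (6 / \<rho>) ^ n)"
          using K by (intro mult_left_mono) auto
        then have "V x powr p * mean_V x y powr (- p) / R ^ n * K \<le> V x powr p * B z"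
          unfolding B_def \<rho>_def by (simp add: power_divide mult_ac)
        then have "ennreal (V x powr p * mean_V x y powr (- p) / R ^ n * K) \<le> ennreal (V x powr p) * ennreal (B z)"
          by (subst ennreal_mult'[symmetric]) (auto intro: ennreal_leI)
        then have "ennreal (V x powr p * mean_V x y powr (- p) / R ^ n * K) * (green z y * ennreal (V z)) \<le> ennreal (V x powr p) * ennreal (B z) * (green z y * ennreal (V z))"
          by (rule mult_right_mono) simp
        then show ?thesis using True xin by (simp add: mult.assoc)
      qed simp
    qed
    finally show ?thesis .
  qed
  have "(\<integral>\<^sup>+x. green x y * ennreal (V x powr p * mean_V x y powr (1 - p)) \<partial>lborel) \<le> (\<integral>\<^sup>+x. \<integral>\<^sup>+z. indicator (ball z (dist y z)) x * (ennreal (V x powr p) * (ennreal (B z) * (green z y * ennreal (V z)))) \<partial>lborel \<partial>lborel)"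
    using pt by (intro nn_integral_mono_AE) (use AE_lborel_singleton[of y] in \<open>eventually_elim, auto\<close>)
  also have "\<dots> = (\<integral>\<^sup>+z. \<integral>\<^sup>+x. indicator (ball z (dist y z)) x * (ennreal (V x powr p) * (ennreal (B z) * (green z y * ennreal (V z)))) \<partial>lborel \<partial>lborel)"
    by (rule lborel_pair.Fubini') (unfold case_prod_unfold, measurable)
  also have "\<dots> = (\<integral>\<^sup>+z. (\<integral>\<^sup>+x. indicator (ball z (dist y z)) x * ennreal (V x powr p) \<partial>lborel) * (ennreal (B z) * (green z y * ennreal (V z))) \<partial>lborel)"
    by (intro nn_integral_cong) (subst nn_integral_multc[symmetric], auto simp: mult.assoc)
  also have "\<dots> \<le> (\<integral>\<^sup>+z. ennreal (K * \<bar>C\<bar> * 12 ^ n * (D * 6 ^ N) powr p) * (green z y * ennreal (V z)) \<partial>lborel)"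
  proof (rule nn_integral_mono_AE, use AE_lborel_singleton[of y] in eventually_elim)
    fix z assume "z \<noteq> y"
    then have \<rho>: "0 < dist y z" by auto
    define \<rho> where "\<rho> = dist y z"
    have \<rho>: "0 < \<rho>" using \<open>z \<noteq> y\<close> by (auto simp: \<rho>_def)
    have Ap: "0 < A z" by (rule Apos) fact
    have "(\<integral>\<^sup>+x. indicator (ball z \<rho>) x * ennreal (V x powr p) \<partial>lborel) \<le> (\<integral>\<^sup>+x. indicator (cube z \<rho>) x * ennreal (V x powr p) \<partial>lborel)"
      using ball_subset_cube[of z \<rho>] by (intro nn_integral_mono mult_right_mono) (auto simp: indicator_def)
    also have "\<dots> = ennreal (LINT x:cube z \<rho>|lborel. V x powr p)"
      by (rule nn_set_integral_eq[OF RH_D(5)[OF RH]]) simp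
    also have "(LINT x:cube z \<rho>|lborel. V x powr p) \<le> C * (2 * \<rho>) ^ n * (\<mu> z \<rho> / (2 * \<rho>) ^ n) powr p"
      unfolding n_def \<mu>_def by (rule RH_D(6)[OF RH \<rho>])
    also have "\<dots> \<le> \<bar>C\<bar> * (2 * \<rho>) ^ n * A z powr p"
    proof (rule mult_mono[OF mult_right_mono powr_mono2])
      show "\<mu> z \<rho> / (2 * \<rho>) ^ n \<le> A z"
        unfolding A_def \<rho>_def[symmetric] using \<rho> \<mu>_pos[OF \<rho>, of z] by (intro divide_left_mono power_mono) auto
    qed (use \<rho> p \<mu>_pos[OF \<rho>, of z] in auto)
    finally have I: "(\<integral>\<^sup>+x. indicator (ball z \<rho>) x * ennreal (V x powr p) \<partial>lborel) \<le> ennreal (\<bar>C\<bar> * (2 * \<rho>) ^ n * A z powr p)"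
      by (simp add: ennreal_leI)
    have eq: "\<bar>C\<bar> * (2 * \<rho>) ^ n * A z powr p * B z = K * \<bar>C\<bar> * 12 ^ n * (D * 6 ^ N) powr p"
    proof -
      have "(2 * \<rho>) ^ n * (6 / \<rho>) ^ n = 12 ^ n" unfolding power_mult_distrib[symmetric] using \<rho> by simp
      moreover have "A z powr p * (A z / (D * 6 ^ N)) powr (- p) = (D * 6 ^ N) powr p"
        using Ap D by (simp add: powr_divide powr_minus field_simps)
      moreover have "\<bar>C\<bar> * (2 * \<rho>) ^ n * A z powr p * B z = K * \<bar>C\<bar> * ((2 * \<rho>) ^ n * (6 / \<rho>) ^ n) * (A z powr p * (A z / (D * 6 ^ N)) powr (- p))"
        unfolding B_def \<rho>_def[symmetric] by (simp only: mult_ac)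
      ultimately show ?thesis by simp
    qed
    have "(\<integral>\<^sup>+x. indicator (ball z \<rho>) x * ennreal (V x powr p) \<partial>lborel) * ennreal (B z) \<le> ennreal (\<bar>C\<bar> * (2 * \<rho>) ^ n * A z powr p) * ennreal (B z)"
      by (rule mult_right_mono[OF I]) simp
    also have "\<dots> = ennreal (\<bar>C\<bar> * (2 * \<rho>) ^ n * A z powr p * B z)"
      using \<rho> B0 by (intro ennreal_mult[symmetric]) auto
    also note eq
    finally have "(\<integral>\<^sup>+x. indicator (ball z \<rho>) x * ennreal (V x powr p) \<partial>lborel) * ennreal (B z) \<le> ennreal (K * \<bar>C\<bar> * 12 ^ n * (D * 6 ^ N) powr p)" .
    then have "(\<integral>\<^sup>+x. indicator (ball z \<rho>) x * ennreal (V x powr p) \<partial>lborel) * ennreal (B z) * (green z y * ennreal (V z)) \<le> ennreal (K * \<bar>C\<bar> * 12 ^ n * (D * 6 ^ N) powr p) * (green z y * ennreal (V z))"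
      by (rule mult_right_mono) simp
    then show "(\<integral>\<^sup>+x. indicator (ball z (dist y z)) x * ennreal (V x powr p) \<partial>lborel) * (ennreal (B z) * (green z y * ennreal (V z))) \<le> ennreal (K * \<bar>C\<bar> * 12 ^ n * (D * 6 ^ N) powr p) * (green z y * ennreal (V z))"
      by (simp add: \<rho>_def mult.assoc)
  qed
  also have "\<dots> = ennreal (K * \<bar>C\<bar> * 12 ^ n * (D * 6 ^ N) powr p) * (\<integral>\<^sup>+z. green z y * ennreal (V z) \<partial>lborel)"
    by (rule nn_integral_cmult) measurable
  also have "\<dots> \<le> ennreal (K * \<bar>C\<bar> * 12 ^ n * (D * 6 ^ N) powr p) * 1"
    by (intro mult_left_mono green_V_mass) auto
  finally show ?thesis by (simp add: n_def)
qed

end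

context RH_potential
begin

text \<open>Hoelder's inequality for the measure \<open>\<Gamma>(x, y) mean_V(x, y) dy\<close>, whose mass is bounded by \<open>schur_first\<close>, applied
  to the quotient of \<open>g\<close> by the weight. It is obtained from \<open>power_split_le\<close> by choosing the level \<open>t\<close>.\<close>

lemma green_average_power_le:
  fixes g :: "'a \<Rightarrow> real" and h :: real
  assumes [measurable]: "g \<in> borel_measurable borel" and g0: "\<And>y. 0 \<le> g y" and h0: "0 \<le> h"
    and h: "ennreal h \<le> (\<integral>\<^sup>+y. green x y * ennreal (g y) \<partial>lborel)"
  defines "c1 \<equiv> D * K * 12 ^ DIM('a)"
  shows "ennreal (h powr p) \<le> ennreal ((c1 + 1) powr p) * (\<integral>\<^sup>+y. green x y * ennreal (mean_V x y powr (1 - p) * g y powr p) \<partial>lborel)"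
    (is "_ \<le> _ * ?B")
proof -
  have c1: "0 < c1" using D K by (simp add: c1_def)
  have young: "ennreal h \<le> ennreal (t * c1) + ennreal (t powr (1 - p)) * ?B" if t: "0 < t" for t
  proof -
    have "ennreal h \<le> (\<integral>\<^sup>+y. green x y * ennreal (g y) \<partial>lborel)" by (rule h)
    also have "\<dots> \<le> (\<integral>\<^sup>+y. ennreal t * (green x y * ennreal (mean_V x y)) + ennreal (t powr (1 - p)) * (green x y * ennreal (mean_V x y powr (1 - p) * g y powr p)) \<partial>lborel)"
    proof (rule nn_integral_mono_AE, use AE_lborel_singleton[of x] in eventually_elim)
      fix y assume "y \<noteq> x"
      then have mp: "0 < mean_V x y" using mean_V_pos[of x y] by auto
      have "g y / mean_V x y \<le> t + t powr (1 - p) * (g y / mean_V x y) powr p"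
        by (rule power_split_le) (use g0[of y] mp t p in auto)
      then have "mean_V x y * (g y / mean_V x y) \<le> mean_V x y * (t + t powr (1 - p) * (g y / mean_V x y) powr p)"
        using mp by (intro mult_left_mono) auto
      also have "mean_V x y * (g y / mean_V x y) = g y" using mp by simp
      also have "mean_V x y * (t + t powr (1 - p) * (g y / mean_V x y) powr p) = t * mean_V x y + t powr (1 - p) * (mean_V x y powr (1 - p) * g y powr p)"
      proof -
        have "mean_V x y * (g y / mean_V x y) powr p = mean_V x y powr (1 - p) * g y powr p"
          using mp g0[of y] by (simp add: powr_divide powr_diff)
        then have "t powr (1 - p) * (mean_V x y * (g y / mean_V x y) powr p) = t powr (1 - p) * (mean_V x y powr (1 - p) * g y powr p)" by simp
        then show ?thesis by (simp add: algebra_simps)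
      qed
      finally have "ennreal (g y) \<le> ennreal (t * mean_V x y + t powr (1 - p) * (mean_V x y powr (1 - p) * g y powr p))" by (rule ennreal_leI)
      also have "\<dots> = ennreal t * ennreal (mean_V x y) + ennreal (t powr (1 - p)) * ennreal (mean_V x y powr (1 - p) * g y powr p)"
        using t mp by (subst ennreal_plus) (auto simp: ennreal_mult)
      finally have "green x y * ennreal (g y) \<le> green x y * (ennreal t * ennreal (mean_V x y) + ennreal (t powr (1 - p)) * ennreal (mean_V x y powr (1 - p) * g y powr p))"
        by (rule mult_left_mono) simp
      then show "green x y * ennreal (g y) \<le> ennreal t * (green x y * ennreal (mean_V x y)) + ennreal (t powr (1 - p)) * (green x y * ennreal (mean_V x y powr (1 - p) * g y powr p))"
        by (simp add: distrib_left mult.left_commute)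
    qed
    also have "\<dots> = ennreal t * (\<integral>\<^sup>+y. green x y * ennreal (mean_V x y) \<partial>lborel) + ennreal (t powr (1 - p)) * ?B"
      by (simp add: nn_integral_add nn_integral_cmult)
    also have "\<dots> \<le> ennreal t * ennreal c1 + ennreal (t powr (1 - p)) * ?B"
      unfolding c1_def by (intro add_right_mono mult_left_mono schur_first) auto
    also have "ennreal t * ennreal c1 = ennreal (t * c1)" using t by (subst ennreal_mult') auto
    finally show ?thesis .
  qed
  show ?thesis
  proof (cases "?B")
    case (real b)
    show ?thesis
    proof (cases "b = 0")
      case True
      have "h \<le> t * c1" if "0 < t" for t
        using young[OF that] c1 that unfolding real True by (simp add: ennreal_le_iff)
      then have "h / (2 * c1) * c1 \<ge> h" if "h > 0" using that c1 by (metis divide_pos_pos mult_pos_pos zero_less_numeral)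
      then have "h = 0" using h0 c1 by (cases "h > 0") auto
      then show ?thesis by simp
    next
      case False
      then have b: "0 < b" using real by simp
      \<comment> \<open>The level at which the two terms of Young's inequality have the same power of \<open>b\<close>.\<close>
      define t where "t = b powr (1 / p)"
      have t: "0 < t" using b by (simp add: t_def)
      have "t powr (1 - p) * b = t"
      proof -
        have "b = t powr p" using b p by (simp add: t_def powr_powr)
        then have "t powr (1 - p) * b = t powr (1 - p) * t powr p" by simp
        also have "\<dots> = t" using t by (simp add: powr_add[symmetric])
        finally show ?thesis .
      qed
      then have "ennreal h \<le> ennreal (t * c1) + ennreal t"
        using young[OF t] b unfolding real by (simp add: ennreal_mult[symmetric])
      then have "h \<le> (c1 + 1) * t" using t c1 by (simp add: ennreal_plus[symmetric] algebra_simps del: ennreal_plus)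
      then have "h powr p \<le> ((c1 + 1) * t) powr p" using h0 p by (intro powr_mono2) auto
      also have "\<dots> = (c1 + 1) powr p * b" using c1 t b p by (simp add: powr_mult t_def powr_powr)
      finally show ?thesis unfolding real using b by (simp add: ennreal_mult[symmetric] ennreal_leI)
    qed
  next
    case top
    then show ?thesis using c1 by (simp add: ennreal_mult_top)
  qed
qed

text \<open>The Schur test: integrate the previous bound against \<open>V\<^sup>p\<close>, exchange the integrals and apply \<open>schur_second\<close>.\<close>

lemma green_power_integral_le:
  fixes g h :: "'a \<Rightarrow> real"
  assumes [measurable]: "g \<in> borel_measurable borel" "h \<in> borel_measurable borel"
    and g0: "\<And>y. 0 \<le> g y" and h0: "\<And>x. 0 \<le> h x"
    and h: "\<And>x. ennreal (h x) \<le> (\<integral>\<^sup>+y. green x y * ennreal (g y) \<partial>lborel)"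
  shows "(\<integral>\<^sup>+x. ennreal (V x powr p * h x powr p) \<partial>lborel)
    \<le> ennreal ((D * K * 12 ^ DIM('a) + 1) powr p * (K * \<bar>C\<bar> * 12 ^ DIM('a) * (D * 6 ^ N) powr p)) * (\<integral>\<^sup>+y. ennreal (g y powr p) \<partial>lborel)"
proof -
  define c1 where "c1 = (D * K * 12 ^ DIM('a) + 1) powr p"
  define c2 where "c2 = K * \<bar>C\<bar> * 12 ^ DIM('a) * (D * 6 ^ N) powr p"
  have c: "0 \<le> c1" "0 \<le> c2" using K by (auto simp: c1_def c2_def)
  have "(\<integral>\<^sup>+x. ennreal (V x powr p * h x powr p) \<partial>lborel)
    \<le> (\<integral>\<^sup>+x. ennreal c1 * (\<integral>\<^sup>+y. green x y * ennreal (V x powr p * mean_V x y powr (1 - p)) * ennreal (g y powr p) \<partial>lborel) \<partial>lborel)"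
  proof (intro nn_integral_mono)
    fix x
    have "ennreal (V x powr p * h x powr p) = ennreal (V x powr p) * ennreal (h x powr p)" by (simp add: ennreal_mult)
    also have "\<dots> \<le> ennreal (V x powr p) * (ennreal c1 * (\<integral>\<^sup>+y. green x y * ennreal (mean_V x y powr (1 - p) * g y powr p) \<partial>lborel))"
      unfolding c1_def by (intro mult_left_mono green_average_power_le g0 h0 h) auto
    also have "\<dots> = ennreal c1 * (\<integral>\<^sup>+y. ennreal (V x powr p) * (green x y * ennreal (mean_V x y powr (1 - p) * g y powr p)) \<partial>lborel)"
      by (simp add: nn_integral_cmult mult_ac)
    also have "\<dots> = ennreal c1 * (\<integral>\<^sup>+y. green x y * ennreal (V x powr p * mean_V x y powr (1 - p)) * ennreal (g y powr p) \<partial>lborel)"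
      by (simp add: ennreal_mult mult_ac)
    finally show "ennreal (V x powr p * h x powr p) \<le> ennreal c1 * (\<integral>\<^sup>+y. green x y * ennreal (V x powr p * mean_V x y powr (1 - p)) * ennreal (g y powr p) \<partial>lborel)" .
  qed
  also have "\<dots> = ennreal c1 * (\<integral>\<^sup>+x. \<integral>\<^sup>+y. green x y * ennreal (V x powr p * mean_V x y powr (1 - p)) * ennreal (g y powr p) \<partial>lborel \<partial>lborel)"
    by (rule nn_integral_cmult) measurable
  also have "(\<integral>\<^sup>+x. \<integral>\<^sup>+y. green x y * ennreal (V x powr p * mean_V x y powr (1 - p)) * ennreal (g y powr p) \<partial>lborel \<partial>lborel)
     = (\<integral>\<^sup>+y. \<integral>\<^sup>+x. green x y * ennreal (V x powr p * mean_V x y powr (1 - p)) * ennreal (g y powr p) \<partial>lborel \<partial>lborel)"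
    by (rule lborel_pair.Fubini') measurable
  also have "\<dots> = (\<integral>\<^sup>+y. (\<integral>\<^sup>+x. green x y * ennreal (V x powr p * mean_V x y powr (1 - p)) \<partial>lborel) * ennreal (g y powr p) \<partial>lborel)"
    by (intro nn_integral_cong nn_integral_multc) measurable
  also have "\<dots> \<le> (\<integral>\<^sup>+y. ennreal c2 * ennreal (g y powr p) \<partial>lborel)"
    unfolding c2_def by (intro nn_integral_mono mult_right_mono schur_second) auto
  also have "\<dots> = ennreal c2 * (\<integral>\<^sup>+y. ennreal (g y powr p) \<partial>lborel)"
    by (rule nn_integral_cmult) measurable
  finally have "(\<integral>\<^sup>+x. ennreal (V x powr p * h x powr p) \<partial>lborel) \<le> ennreal c1 * (ennreal c2 * (\<integral>\<^sup>+y. ennreal (g y powr p) \<partial>lborel))"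
    by (simp add: mult_left_mono)
  then show ?thesis unfolding c1_def[symmetric] c2_def[symmetric] ennreal_mult[OF c] by (simp add: mult.assoc)
qed

end

text \<open>A test function is dominated by its image under \<open>-\<Delta> + V + d\<close> through the Green function, because \<open>(k + d) u -
  \<Delta>u = (k - V) u + ((d + V) u - \<Delta>u)\<close> turns the bound by the resolvent into the hypothesis of \<open>green_dominates\<close>.
  The constant depends on the potential only through its reverse Hoelder constant.\<close>

lemma bounded_potential_estimate:
  assumes p: "1 < p"
  obtains c where "0 < c"
    "\<And>(V :: 'a::euclidean_space \<Rightarrow> real) k d (u :: 'a \<Rightarrow> 'b::{banach, second_countable_topology}) D1 D2 S. RH p C V \<Longrightarrow> (\<And>x. V x \<le> k) \<Longrightarrow> 0 < d \<Longrightarrow>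
       C2_with u D1 D2 \<Longrightarrow> compact S \<Longrightarrow> (\<And>x. x \<notin> S \<Longrightarrow> u x = 0) \<Longrightarrow>
       (\<integral>\<^sup>+x. ennreal (V x powr p * norm (u x) powr p) \<partial>lborel)
         \<le> ennreal c * (\<integral>\<^sup>+x. ennreal (norm ((d + V x) *\<^sub>R u x - (\<Sum>b\<in>Basis. D2 b x)) powr p) \<partial>lborel)"
proof -
  obtain K where K: "0 < K" and mean: "\<And>V :: 'a \<Rightarrow> real. RH p C V \<Longrightarrow> weighted_mean_bound K V"
    by (rule weighted_mean_value[OF p, where C=C and 'a='a]) (rule that)
  obtain N :: nat and D :: real where D: "0 < D" and comp: "\<And>V :: 'a \<Rightarrow> real. RH p C V \<Longrightarrow> polynomial_doubling D N V"
    by (rule RH_compare_cubes[OF p, where C=C and 'a='a]) (rule that)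
  define c where "c = (D * K * 12 ^ DIM('a) + 1) powr p * (K * \<bar>C\<bar> * 12 ^ DIM('a) * (D * 6 ^ N) powr p)"
  have c: "0 \<le> c" using K by (simp add: c_def)
  show thesis
  proof (rule that[of "c + 1"])
    show "0 < c + 1" using c by simp
    fix V :: "'a \<Rightarrow> real" and k d :: real and u :: "'a \<Rightarrow> 'b" and D1 D2 S
    assume V: "RH p C V" and k: "\<And>x. V x \<le> k" and d: "0 < d"
      and u: "C2_with u D1 D2" and S: "compact S" "\<And>x. x \<notin> S \<Longrightarrow> u x = 0"
    interpret RH_potential V k d p C K D N
    proof
      show "V \<in> borel_measurable borel" "0 \<le> V x" for x using RH_D(1,2)[OF V] by auto
      show "V x \<le> k" for x by (rule k)
    qed (fact d p V K D mean[OF V] comp[OF V])+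
    define th where "th x = (d + V x) *\<^sub>R u x - (\<Sum>b\<in>Basis. D2 b x)" for x
    have [measurable]: "u \<in> borel_measurable borel" "\<And>b. b \<in> Basis \<Longrightarrow> D2 b \<in> borel_measurable borel"
      using u by (auto simp: C2_with_def intro: borel_measurable_continuous_onI)
    have [measurable]: "th \<in> borel_measurable borel" unfolding th_def by measurable
    obtain M where M: "\<And>x. norm (u x) \<le> M" using C2_with_bounded[OF u S] by blast
    have low: "ennreal (norm (u x)) \<le> (\<integral>\<^sup>+y. green x y * ennreal (norm (th y)) \<partial>lborel)" for x
    proof (rule green_dominates[where h="\<lambda>x. ennreal (norm (u x))" and M=M])
      fix x
      have "ennreal (norm (u x)) \<le> (\<integral>\<^sup>+z. G (x - z) * ennreal (norm ((k + d) *\<^sub>R u z - (\<Sum>b\<in>Basis. D2 b z))) \<partial>lborel)"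
        by (rule norm_le_resolvent[OF u S l_pos])
      also have "\<dots> \<le> (\<integral>\<^sup>+z. G (x - z) * (W z * ennreal (norm (u z)) + ennreal (norm (th z))) \<partial>lborel)"
      proof (intro nn_integral_mono mult_left_mono)
        fix z
        have "(k + d) *\<^sub>R u z - (\<Sum>b\<in>Basis. D2 b z) = (k - V z) *\<^sub>R u z + th z"
          by (simp add: th_def algebra_simps)
        then have "norm ((k + d) *\<^sub>R u z - (\<Sum>b\<in>Basis. D2 b z)) \<le> (k - V z) * norm (u z) + norm (th z)"
          using norm_triangle_ineq[of "(k - V z) *\<^sub>R u z" "th z"] k[of z] by simp
        then have "ennreal (norm ((k + d) *\<^sub>R u z - (\<Sum>b\<in>Basis. D2 b z))) \<le> ennreal ((k - V z) * norm (u z) + norm (th z))"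
          by (rule ennreal_leI)
        also have "\<dots> = W z * ennreal (norm (u z)) + ennreal (norm (th z))"
          unfolding W_def using k[of z] by (subst ennreal_plus) (auto simp: ennreal_mult)
        finally show "ennreal (norm ((k + d) *\<^sub>R u z - (\<Sum>b\<in>Basis. D2 b z))) \<le> W z * ennreal (norm (u z)) + ennreal (norm (th z))" .
      qed simp
      finally show "ennreal (norm (u x)) \<le> (\<integral>\<^sup>+z. G (x - z) * (W z * ennreal (norm (u z)) + ennreal (norm (th z))) \<partial>lborel)" .
    qed (auto intro!: ennreal_leI M)
    have "(\<integral>\<^sup>+x. ennreal (V x powr p * norm (u x) powr p) \<partial>lborel) \<le> ennreal c * (\<integral>\<^sup>+x. ennreal (norm (th x) powr p) \<partial>lborel)"
      unfolding c_def by (rule green_power_integral_le) (use low in auto)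
    also have "\<dots> \<le> ennreal (c + 1) * (\<integral>\<^sup>+x. ennreal (norm (th x) powr p) \<partial>lborel)"
      by (intro mult_right_mono ennreal_leI) auto
    finally show "(\<integral>\<^sup>+x. ennreal (V x powr p * norm (u x) powr p) \<partial>lborel)
         \<le> ennreal (c + 1) * (\<integral>\<^sup>+x. ennreal (norm ((d + V x) *\<^sub>R u x - (\<Sum>b\<in>Basis. D2 b x)) powr p) \<partial>lborel)"
      unfolding th_def .
  qed
qed

section \<open>Self-improvement of reverse Hoelder inequalities\<close>

text \<open>Half-open cubes, which are partitioned by their dyadic children.\<close>

definition hcube :: "'a::euclidean_space \<Rightarrow> real \<Rightarrow> 'a set" where
  "hcube x r = {z. \<forall>b\<in>Basis. - r \<le> (z - x) \<bullet> b \<and> (z - x) \<bullet> b < r}"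

lemma hcube_sets [measurable, simp]: "hcube x r \<in> sets borel"
proof -
  have "{z \<in> space borel. \<forall>b\<in>Basis. - r \<le> (z - x) \<bullet> b \<and> (z - x) \<bullet> b < r} \<in> sets borel" by measurable
  then show ?thesis by (simp add: hcube_def)
qed

lemma hcube_subset_cube: "hcube x r \<subseteq> cube x r"
proof
  fix z assume z: "z \<in> hcube x r"
  show "z \<in> cube x r" unfolding mem_cube
  proof
    fix b :: 'a assume "b \<in> Basis"
    then have "- r \<le> (z - x) \<bullet> b" "(z - x) \<bullet> b < r" using z by (auto simp: hcube_def)
    then show "\<bar>(z - x) \<bullet> b\<bar> \<le> r" by linarith
  qed
qed

lemma AE_hcube_cube: "AE z in lborel. z \<in> hcube x r \<longleftrightarrow> z \<in> cube (x :: 'a::euclidean_space) r"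
proof -
  have "AE z in lborel. \<forall>b\<in>Basis. z \<bullet> b \<noteq> x \<bullet> b + r"
  proof (rule AE_finite_allI)
    fix b :: 'a assume b: "b \<in> Basis"
    have "negligible {z. z \<bullet> b = x \<bullet> b + r}" using b by (rule negligible_standard_hyperplane)
    moreover have "{z. z \<bullet> b = x \<bullet> b + r} \<in> sets lborel"
      by (intro lborelD borel_closed closed_Collect_eq) (auto intro!: continuous_intros)
    ultimately have "{z. z \<bullet> b = x \<bullet> b + r} \<in> null_sets lborel"
      by (simp add: negligible_iff_null_sets null_sets_completion_iff)
    then have "AE z in lborel. z \<notin> {z. z \<bullet> b = x \<bullet> b + r}" by (rule AE_not_in)
    then show "AE z in lborel. z \<bullet> b \<noteq> x \<bullet> b + r" by simp
  qed simp
  then show ?thesis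
  proof eventually_elim
    case (elim z)
    have "(- r \<le> (z - x) \<bullet> b \<and> (z - x) \<bullet> b < r) \<longleftrightarrow> \<bar>(z - x) \<bullet> b\<bar> \<le> r" if "b \<in> Basis" for b
    proof -
      have "(z - x) \<bullet> b \<noteq> r" using elim that by (auto simp: inner_diff_left)
      then show ?thesis by linarith
    qed
    then show ?case by (simp add: hcube_def mem_cube)
  qed
qed

lemma set_integral_hcube:
  fixes f :: "'a::euclidean_space \<Rightarrow> real"
  assumes [measurable]: "f \<in> borel_measurable borel"
  shows "(LINT z:hcube x r|lborel. f z) = (LINT z:cube x r|lborel. f z)"
  unfolding set_lebesgue_integral_def
  by (rule integral_cong_AE) (measurable, use AE_hcube_cube[of x r] in \<open>eventually_elim, simp add: indicator_def\<close>)

definition corner :: "'a::euclidean_space set \<Rightarrow> 'a" where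
  "corner S = (\<Sum>b\<in>Basis. (if b \<in> S then 1 else - 1) *\<^sub>R b)"

lemma corner_inner: "b \<in> Basis \<Longrightarrow> corner S \<bullet> b = (if b \<in> S then 1 else - 1)"
  unfolding corner_def by (simp add: inner_sum_left_Basis)

text \<open>The subcubes of half the radius are indexed by the set of axes along which they lie on the positive side.\<close>

definition child :: "'a::euclidean_space \<Rightarrow> real \<Rightarrow> 'a set \<Rightarrow> 'a" where
  "child x r S = x + (r / 2) *\<^sub>R corner S"

lemma mem_hcube_child:
  assumes r: "0 < r" and S: "S \<subseteq> Basis"
  shows "z \<in> hcube (child x r S) (r / 2) \<longleftrightarrow> z \<in> hcube x r \<and> S = {b \<in> Basis. 0 \<le> (z - x) \<bullet> b}"
proof -
  have e: "(z - child x r S) \<bullet> b = (z - x) \<bullet> b - (if b \<in> S then r / 2 else - (r / 2))" if "b \<in> Basis" for b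
    using that by (simp add: child_def inner_diff_left inner_add_left corner_inner)
  show ?thesis
  proof
    assume z: "z \<in> hcube (child x r S) (r / 2)"
    then have *: "- (r / 2) \<le> (z - x) \<bullet> b - (if b \<in> S then r / 2 else - (r / 2))" "(z - x) \<bullet> b - (if b \<in> S then r / 2 else - (r / 2)) < r / 2" if "b \<in> Basis" for b
      using e[OF that] that by (auto simp: hcube_def)
    have "- r \<le> (z - x) \<bullet> b \<and> (z - x) \<bullet> b < r" if "b \<in> Basis" for b
      using *[OF that] r by (cases "b \<in> S") auto
    moreover have "b \<in> S \<longleftrightarrow> 0 \<le> (z - x) \<bullet> b" if "b \<in> Basis" for b
      using *[OF that] r by (cases "b \<in> S") auto
    ultimately show "z \<in> hcube x r \<and> S = {b \<in> Basis. 0 \<le> (z - x) \<bullet> b}" using S by (auto simp: hcube_def)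
  next
    assume z: "z \<in> hcube x r \<and> S = {b \<in> Basis. 0 \<le> (z - x) \<bullet> b}"
    show "z \<in> hcube (child x r S) (r / 2)" unfolding hcube_def mem_Collect_eq
    proof
      fix b :: 'a assume b: "b \<in> Basis"
      have "- r \<le> (z - x) \<bullet> b" "(z - x) \<bullet> b < r" "b \<in> S \<longleftrightarrow> 0 \<le> (z - x) \<bullet> b" using z b by (auto simp: hcube_def)
      then show "- (r / 2) \<le> (z - child x r S) \<bullet> b \<and> (z - child x r S) \<bullet> b < r / 2"
        unfolding e[OF b] by auto
    qed
  qed
qed

lemma hcube_children_union: "0 < r \<Longrightarrow> hcube x r = (\<Union>S\<in>Pow Basis. hcube (child x r S) (r / 2))"
  by (auto simp: mem_hcube_child)

lemma hcube_children_disjoint: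
  "0 < r \<Longrightarrow> S \<in> Pow Basis \<Longrightarrow> T \<in> Pow Basis \<Longrightarrow> S \<noteq> T \<Longrightarrow> hcube (child x r S) (r / 2) \<inter> hcube (child x r T) (r / 2) = {}"
  by (auto simp: mem_hcube_child)

lemma set_integral_empty_set [simp]: "(LINT x:{}|M. f x) = 0"
  by (simp add: set_lebesgue_integral_def)

lemma set_integral_UN_disjoint:
  fixes f :: "'a \<Rightarrow> real"
  assumes "finite I" "\<And>i. i \<in> I \<Longrightarrow> set_integrable M (A i) f" "\<And>i j. i \<in> I \<Longrightarrow> j \<in> I \<Longrightarrow> i \<noteq> j \<Longrightarrow> A i \<inter> A j = {}"
  shows "(LINT x:(\<Union>i\<in>I. A i)|M. f x) = (\<Sum>i\<in>I. LINT x:A i|M. f x)"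
proof -
  have "indicator (\<Union>i\<in>I. A i) x *\<^sub>R f x = (\<Sum>i\<in>I. indicator (A i) x *\<^sub>R f x)" for x
  proof -
    have "indicator (\<Union>i\<in>I. A i) x = (\<Sum>i\<in>I. indicator (A i) x :: real)"
      by (rule indicator_UN_disjoint[OF assms(1)]) (auto simp: disjoint_family_on_def assms(3))
    then show ?thesis by (simp add: sum_distrib_right)
  qed
  then show ?thesis unfolding set_lebesgue_integral_def using assms(2)
    by (simp add: set_integrable_def)
qed

lemma set_integral_children:
  fixes f :: "'a::euclidean_space \<Rightarrow> real"
  assumes r: "0 < r" and f: "set_integrable lborel (hcube x r) f"
  shows "(LINT z:hcube x r|lborel. f z) = (\<Sum>S\<in>Pow Basis. LINT z:hcube (child x r S) (r / 2)|lborel. f z)"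
proof -
  have "hcube (child x r S) (r / 2) \<subseteq> hcube x r" if "S \<in> Pow Basis" for S
    using that r by (auto simp: mem_hcube_child)
  then show ?thesis
    unfolding hcube_children_union[OF r, of x]
    by (intro set_integral_UN_disjoint hcube_children_disjoint r)
       (auto intro!: set_integrable_subset[OF f] simp: mem_hcube_child r)
qed

text \<open>A bounded weight of which sets of relative measure \<open>\<alpha>\<close> carry at most the fraction \<open>\<beta>\<close>. Boundedness by \<open>M\<close> makes
  all powers integrable; the resulting inequality is uniform in \<open>M\<close>.\<close>

locale A_infinity_weight =
  fixes W :: "'a::euclidean_space \<Rightarrow> real" and M \<alpha> \<beta> :: real
  assumes W_measurable [measurable]: "W \<in> borel_measurable borel"
    and W_nonneg: "0 \<le> W x" and W_le: "W x \<le> M"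
    and W_pos: "0 < r \<Longrightarrow> 0 < (LINT z:hcube x r|lborel. W z)"
    and \<alpha>: "0 < \<alpha>" "\<alpha> < 1" and \<beta>: "1/2 \<le> \<beta>" "\<beta> < 1"
    and A_inf: "0 < r \<Longrightarrow> E \<in> sets borel \<Longrightarrow> E \<subseteq> hcube x r \<Longrightarrow> measure lborel E \<le> \<alpha> * (2 * r) ^ DIM('a) \<Longrightarrow>
      (LINT z:E|lborel. W z) \<le> \<beta> * (LINT z:hcube x r|lborel. W z)"
begin

definition avg where "avg x r = (LINT z:hcube x r|lborel. W z) / (2 * r) ^ DIM('a)"

lemma measure_hcube: "0 \<le> r \<Longrightarrow> measure lborel (hcube (x::'a) r) = (2 * r) ^ DIM('a)"
proof -
  assume r: "0 \<le> r"
  have "emeasure lborel (hcube x r) = emeasure lborel (cube x r)"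
    by (rule emeasure_eq_AE[OF AE_hcube_cube]) auto
  then show ?thesis using measure_cube[OF r, of x] by (simp add: measure_def)
qed

lemma set_integrable_bounded_subset:
  fixes f :: "'a \<Rightarrow> real"
  assumes [measurable]: "f \<in> borel_measurable borel" "E \<in> sets borel" and E: "E \<subseteq> hcube x r" and f: "\<And>z. \<bar>f z\<bar> \<le> B"
  shows "set_integrable lborel E f"
  unfolding set_integrable_def
proof (rule Bochner_Integration.integrable_bound[where f="\<lambda>z. indicator E z *\<^sub>R B"])
  have "emeasure lborel E \<le> emeasure lborel (cube x r)"
    using E hcube_subset_cube[of x r] by (intro emeasure_mono) auto
  then have "emeasure lborel E < \<infinity>" using emeasure_cube_finite[of x r] by (rule le_less_trans)
  then show "integrable lborel (\<lambda>z. indicator E z *\<^sub>R B)" by simp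
  show "AE z in lborel. norm (indicator E z *\<^sub>R f z) \<le> norm (indicator E z *\<^sub>R B)"
    using f by (intro AE_I2) (auto simp: indicator_def intro: order_trans[OF _ abs_ge_self])
qed measurable

lemma W_int: "E \<in> sets borel \<Longrightarrow> E \<subseteq> hcube x r \<Longrightarrow> set_integrable lborel E W"
  by (rule set_integrable_bounded_subset[of W _ _ _ M]) (auto simp: W_nonneg W_le)

lemma avg_pos: "0 < r \<Longrightarrow> 0 < avg x r"
  unfolding avg_def by (intro divide_pos_pos W_pos) auto

lemma avg_child: 
  assumes r: "0 < r" and S: "S \<subseteq> Basis"
  shows "avg (child x r S) (r / 2) \<le> 2 ^ DIM('a) * avg x r"
proof -
  have "(LINT z:hcube (child x r S) (r / 2)|lborel. W z) \<le> (LINT z:hcube x r|lborel. W z)"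
    by (rule set_integral_mono_set[OF W_int[of _ x r]]) (use r S in \<open>auto simp: W_nonneg mem_hcube_child\<close>)
  then have "avg (child x r S) (r / 2) \<le> (LINT z:hcube x r|lborel. W z) / (2 * (r / 2)) ^ DIM('a)"
    unfolding avg_def using r by (intro divide_right_mono) auto
  also have "\<dots> = 2 ^ DIM('a) * avg x r" using r by (simp add: avg_def power_mult_distrib)
  finally show ?thesis .
qed

text \<open>The integral of \<open>W\<^sup>1\<^sup>+\<^sup>\<delta>\<close> after one factor \<open>W\<^sup>\<delta>\<close> is replaced by a power of the mean of \<open>W\<close> over the dyadic
  subcubes of generation \<open>m\<close>.\<close>

fun dyadic_sum :: "real \<Rightarrow> nat \<Rightarrow> 'a \<Rightarrow> real \<Rightarrow> real" where
  "dyadic_sum \<delta> 0 x r = (LINT z:hcube x r|lborel. W z) * avg x r powr \<delta>"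
| "dyadic_sum \<delta> (Suc m) x r = (\<Sum>S\<in>Pow Basis. dyadic_sum \<delta> m (child x r S) (r / 2))"

text \<open>The union of the maximal dyadic subcubes, up to generation \<open>m\<close>, on which the mean of \<open>W\<close> exceeds \<open>\<tau>\<close>.\<close>

fun stop_set :: "real \<Rightarrow> nat \<Rightarrow> 'a \<Rightarrow> real \<Rightarrow> 'a set" where
  "stop_set \<tau> 0 x r = (if \<tau> < avg x r then hcube x r else {})"
| "stop_set \<tau> (Suc m) x r = (if \<tau> < avg x r then hcube x r else (\<Union>S\<in>Pow Basis. stop_set \<tau> m (child x r S) (r / 2)))"

lemma stop_set_sets [measurable, simp]: "stop_set \<tau> m x r \<in> sets borel"
  by (induction m arbitrary: x r) auto

lemma stop_set_subset: "0 < r \<Longrightarrow> stop_set \<tau> m x r \<subseteq> hcube x r"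
proof (induction m arbitrary: x r)
  case (Suc m)
  have "stop_set \<tau> m (child x r S) (r / 2) \<subseteq> hcube x r" if "S \<in> Pow Basis" for S
    using Suc.IH[of "r / 2" "child x r S"] Suc.prems that by (auto simp: mem_hcube_child)
  then show ?case by auto
qed auto

lemma stop_set_children_disjoint:
  assumes "0 < r" "S \<in> Pow Basis" "T \<in> Pow Basis" "S \<noteq> T"
  shows "stop_set \<tau> m (child x r S) (r / 2) \<inter> stop_set \<tau> m (child x r T) (r / 2) = {}"
  using stop_set_subset[of "r / 2" \<tau> m "child x r S"] stop_set_subset[of "r / 2" \<tau> m "child x r T"]
    hcube_children_disjoint[OF assms, of x] assms(1) by auto

lemma set_integral_stop_set_Suc:
  fixes f :: "'a \<Rightarrow> real"
  assumes r: "0 < r" and n: "\<not> \<tau> < avg x r" and f: "f \<in> borel_measurable borel" "\<And>z. \<bar>f z\<bar> \<le> B"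
  shows "(LINT z:stop_set \<tau> (Suc m) x r|lborel. f z) = (\<Sum>S\<in>Pow Basis. LINT z:stop_set \<tau> m (child x r S) (r / 2)|lborel. f z)"
proof -
  have "set_integrable lborel (stop_set \<tau> m (child x r S) (r / 2)) f" for S
    by (rule set_integrable_bounded_subset[OF f(1) _ stop_set_subset f(2)]) (use r in auto)
  then have "(LINT z:(\<Union>S\<in>Pow Basis. stop_set \<tau> m (child x r S) (r / 2))|lborel. f z) = (\<Sum>S\<in>Pow Basis. LINT z:stop_set \<tau> m (child x r S) (r / 2)|lborel. f z)"
    by (intro set_integral_UN_disjoint stop_set_children_disjoint r) auto
  then show ?thesis using n by simp
qed

lemma stop_set_measure:
  assumes \<tau>: "0 < \<tau>" and r: "0 < r"
  shows "\<tau> * measure lborel (stop_set \<tau> m x r) \<le> (LINT z:stop_set \<tau> m x r|lborel. W z)"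
  using r
proof (induction m arbitrary: x r)
  case 0
  then show ?case by (auto simp: measure_hcube avg_def field_simps)
next
  case (Suc m)
  show ?case
  proof (cases "\<tau> < avg x r")
    case True
    then show ?thesis using Suc.prems by (auto simp: measure_hcube avg_def field_simps)
  next
    case False
    have one: "(LINT z:E|lborel. (1::real)) = measure lborel E" for E :: "'a set"
      by (simp add: set_lebesgue_integral_def)
    have "measure lborel (stop_set \<tau> (Suc m) x r) = (\<Sum>S\<in>Pow Basis. measure lborel (stop_set \<tau> m (child x r S) (r / 2)))"
      using set_integral_stop_set_Suc[OF Suc.prems False, of "\<lambda>_. 1" 1 m] unfolding one by simp
    then have "\<tau> * measure lborel (stop_set \<tau> (Suc m) x r) = (\<Sum>S\<in>Pow Basis. \<tau> * measure lborel (stop_set \<tau> m (child x r S) (r / 2)))"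
      by (simp add: sum_distrib_left)
    also have "\<dots> \<le> (\<Sum>S\<in>Pow Basis. LINT z:stop_set \<tau> m (child x r S) (r / 2)|lborel. W z)"
      using Suc.prems by (intro sum_mono Suc.IH) auto
    also have "\<dots> = (LINT z:stop_set \<tau> (Suc m) x r|lborel. W z)"
      by (rule set_integral_stop_set_Suc[OF Suc.prems False _ , symmetric, of _ M]) (auto simp: W_nonneg W_le)
    finally show ?thesis .
  qed
qed

text \<open>Cubes of the last generation outside the stopping set have mean at most \<open>\<tau>\<close>, which gives the first term. A
  stopping cube has mean at most \<open>2\<^sup>n \<tau>\<close>, by hypothesis or because its parent was not stopped, and the assumed
  bound applies inside it.\<close>

lemma dyadic_sum_stopped:
  assumes IH: "\<And>j x r. j < m \<Longrightarrow> 0 < r \<Longrightarrow> dyadic_sum \<delta> j x r \<le> c * (LINT z:hcube x r|lborel. W z) * avg x r powr \<delta>"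
    and c: "0 \<le> c" and \<delta>: "0 < \<delta>" and \<tau>: "0 < \<tau>" and r: "0 < r" and j: "j < m" and a: "avg x r \<le> 2 ^ DIM('a) * \<tau>"
  shows "dyadic_sum \<delta> j x r \<le> \<tau> powr \<delta> * (LINT z:hcube x r|lborel. W z)
    + c * (2 ^ DIM('a) * \<tau>) powr \<delta> * (LINT z:stop_set \<tau> j x r|lborel. W z)"
  using r j a
proof (induction j arbitrary: x r)
  have stopped: "dyadic_sum \<delta> j x r \<le> \<tau> powr \<delta> * (LINT z:hcube x r|lborel. W z)
    + c * (2 ^ DIM('a) * \<tau>) powr \<delta> * (LINT z:stop_set \<tau> j x r|lborel. W z)"
    if r: "0 < r" and j: "j < m" and a: "avg x r \<le> 2 ^ DIM('a) * \<tau>" and s: "\<tau> < avg x r" for j x r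
  proof -
    have st: "stop_set \<tau> j x r = hcube x r" using s by (cases j) auto
    have "dyadic_sum \<delta> j x r \<le> c * (LINT z:hcube x r|lborel. W z) * avg x r powr \<delta>" by (rule IH[OF j r])
    also have "\<dots> \<le> c * (LINT z:hcube x r|lborel. W z) * (2 ^ DIM('a) * \<tau>) powr \<delta>"
      using a avg_pos[OF r, of x] W_pos[OF r, of x] c \<delta> by (intro mult_left_mono powr_mono2) auto
    also have "\<dots> = c * (2 ^ DIM('a) * \<tau>) powr \<delta> * (LINT z:stop_set \<tau> j x r|lborel. W z)" unfolding st by simp
    also have "\<dots> \<le> \<tau> powr \<delta> * (LINT z:hcube x r|lborel. W z) + \<dots>"
      using W_pos[OF r, of x] by (simp add: add_increasing less_imp_le)
    finally show ?thesis .
  qed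
  {
    case 0
    show ?case
    proof (cases "\<tau> < avg x r")
      case True
      then show ?thesis using stopped[of r 0 x] 0 by auto
    next
      case False
      then have "avg x r powr \<delta> \<le> \<tau> powr \<delta>" using avg_pos[OF \<open>0 < r\<close>, of x] \<delta> by (intro powr_mono2) auto
      then have "avg x r powr \<delta> * (LINT z:hcube x r|lborel. W z) \<le> \<tau> powr \<delta> * (LINT z:hcube x r|lborel. W z)"
        using W_pos[OF \<open>0 < r\<close>, of x] by (intro mult_right_mono) auto
      then show ?thesis using False by (simp add: mult.commute set_lebesgue_integral_def)
    qed
  next
    case (Suc j)
    show ?case
    proof (cases "\<tau> < avg x r")
      case True
      then show ?thesis using stopped[of r "Suc j" x] Suc.prems by blast
    next
      case False
      have "dyadic_sum \<delta> (Suc j) x r = (\<Sum>S\<in>Pow Basis. dyadic_sum \<delta> j (child x r S) (r / 2))" by simp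
      also have "\<dots> \<le> (\<Sum>S\<in>Pow Basis. \<tau> powr \<delta> * (LINT z:hcube (child x r S) (r / 2)|lborel. W z)
          + c * (2 ^ DIM('a) * \<tau>) powr \<delta> * (LINT z:stop_set \<tau> j (child x r S) (r / 2)|lborel. W z))"
      proof (rule sum_mono)
        fix S :: "'a set" assume S: "S \<in> Pow Basis"
        have "avg (child x r S) (r / 2) \<le> 2 ^ DIM('a) * avg x r" using S Suc.prems by (intro avg_child) auto
        also have "\<dots> \<le> 2 ^ DIM('a) * \<tau>" using False by (intro mult_left_mono) auto
        finally show "dyadic_sum \<delta> j (child x r S) (r / 2) \<le> \<tau> powr \<delta> * (LINT z:hcube (child x r S) (r / 2)|lborel. W z)
          + c * (2 ^ DIM('a) * \<tau>) powr \<delta> * (LINT z:stop_set \<tau> j (child x r S) (r / 2)|lborel. W z)"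
          using Suc.prems by (intro Suc.IH) auto
      qed
      also have "\<dots> = \<tau> powr \<delta> * (\<Sum>S\<in>Pow Basis. LINT z:hcube (child x r S) (r / 2)|lborel. W z)
          + c * (2 ^ DIM('a) * \<tau>) powr \<delta> * (\<Sum>S\<in>Pow Basis. LINT z:stop_set \<tau> j (child x r S) (r / 2)|lborel. W z)"
        by (simp add: sum.distrib sum_distrib_left)
      also have "(\<Sum>S\<in>Pow Basis. LINT z:hcube (child x r S) (r / 2)|lborel. W z) = (LINT z:hcube x r|lborel. W z)"
        by (rule set_integral_children[symmetric]) (use Suc.prems in \<open>auto intro: W_int\<close>)
      also have "(\<Sum>S\<in>Pow Basis. LINT z:stop_set \<tau> j (child x r S) (r / 2)|lborel. W z) = (LINT z:stop_set \<tau> (Suc j) x r|lborel. W z)"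
        by (rule set_integral_stop_set_Suc[OF Suc.prems(1) False, symmetric, of _ M]) (auto simp: W_nonneg W_le)
      finally show ?thesis .
    qed
  }
qed

text \<open>Stop at the level \<open>\<tau>\<close> equal to \<open>1 / \<alpha>\<close> times the mean. The stopping set then has relative measure at most \<open>\<alpha>\<close>,
  so it carries at most the fraction \<open>\<beta>\<close> of the weight, and the gain \<open>\<beta>\<close> beats the factor \<open>(2\<^sup>n / \<alpha>)\<^sup>\<delta>\<close> lost in
  the stopping cubes. The remaining fraction \<open>(1 - \<beta>) / 2\<close> of \<open>c\<close> pays for the cubes that are not stopped, which
  is how \<open>c\<close> is chosen.\<close>

lemma dyadic_sum_le:
  defines "a \<equiv> 1 / \<alpha>"
  assumes \<delta>: "0 < \<delta>" "(2 ^ DIM('a) * a) powr \<delta> * \<beta> \<le> (1 + \<beta>) / 2"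
  defines "c \<equiv> 2 * a powr \<delta> / (1 - \<beta>)"
  shows "0 < r \<Longrightarrow> dyadic_sum \<delta> m x r \<le> c * (LINT z:hcube x r|lborel. W z) * avg x r powr \<delta>"
proof (induction m arbitrary: x r rule: less_induct)
  case (less m)
  have a: "1 < a" using \<alpha> by (simp add: a_def)
  have c: "1 \<le> c"
  proof -
    have "1 \<le> a powr \<delta>" using a \<delta> by (intro ge_one_powr_ge_zero) auto
    then show ?thesis using \<beta> by (simp add: c_def le_divide_eq)
  qed
  define I where "I = (LINT z:hcube x r|lborel. W z)"
  have I: "0 < I" unfolding I_def by (rule W_pos[OF less.prems])
  have ap: "0 < avg x r" by (rule avg_pos[OF less.prems])
  show ?case
  proof (cases m)
    case 0
    have "1 * (I * avg x r powr \<delta>) \<le> c * (I * avg x r powr \<delta>)" using c I by (intro mult_right_mono) auto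
    then show ?thesis using 0 by (simp add: I_def[symmetric] mult.assoc)
  next
    case (Suc j)
    define \<tau> where "\<tau> = a * avg x r"
    have \<tau>: "0 < \<tau>" using a ap by (simp add: \<tau>_def)
    have ns: "\<not> \<tau> < avg x r" using a ap by (simp add: \<tau>_def)
    have "dyadic_sum \<delta> m x r = (\<Sum>S\<in>Pow Basis. dyadic_sum \<delta> j (child x r S) (r / 2))" using Suc by simp
    also have "\<dots> \<le> (\<Sum>S\<in>Pow Basis. \<tau> powr \<delta> * (LINT z:hcube (child x r S) (r / 2)|lborel. W z)
          + c * (2 ^ DIM('a) * \<tau>) powr \<delta> * (LINT z:stop_set \<tau> j (child x r S) (r / 2)|lborel. W z))"
    proof (rule sum_mono)
      fix S :: "'a set" assume S: "S \<in> Pow Basis"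
      have "avg (child x r S) (r / 2) \<le> 2 ^ DIM('a) * avg x r" using S less.prems by (intro avg_child) auto
      also have "\<dots> \<le> 2 ^ DIM('a) * \<tau>" using ns by (intro mult_left_mono) auto
      finally show "dyadic_sum \<delta> j (child x r S) (r / 2) \<le> \<tau> powr \<delta> * (LINT z:hcube (child x r S) (r / 2)|lborel. W z)
          + c * (2 ^ DIM('a) * \<tau>) powr \<delta> * (LINT z:stop_set \<tau> j (child x r S) (r / 2)|lborel. W z)"
        using less.prems Suc c \<tau> \<delta> by (intro dyadic_sum_stopped[where m=m] less.IH) auto
    qed
    also have "\<dots> = \<tau> powr \<delta> * (\<Sum>S\<in>Pow Basis. LINT z:hcube (child x r S) (r / 2)|lborel. W z)
          + c * (2 ^ DIM('a) * \<tau>) powr \<delta> * (\<Sum>S\<in>Pow Basis. LINT z:stop_set \<tau> j (child x r S) (r / 2)|lborel. W z)"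
      by (simp add: sum.distrib sum_distrib_left)
    also have "(\<Sum>S\<in>Pow Basis. LINT z:hcube (child x r S) (r / 2)|lborel. W z) = I"
      unfolding I_def by (rule set_integral_children[symmetric]) (use less.prems in \<open>auto intro: W_int\<close>)
    also have "(\<Sum>S\<in>Pow Basis. LINT z:stop_set \<tau> j (child x r S) (r / 2)|lborel. W z) = (LINT z:stop_set \<tau> m x r|lborel. W z)"
      unfolding Suc by (rule set_integral_stop_set_Suc[OF less.prems ns, symmetric, of _ M]) (auto simp: W_nonneg W_le)
    also have "\<tau> powr \<delta> * I + c * (2 ^ DIM('a) * \<tau>) powr \<delta> * (LINT z:stop_set \<tau> m x r|lborel. W z)
      \<le> \<tau> powr \<delta> * I + c * (2 ^ DIM('a) * \<tau>) powr \<delta> * (\<beta> * I)"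
    proof (intro add_left_mono mult_left_mono)
      have sub: "stop_set \<tau> m x r \<subseteq> hcube x r" by (rule stop_set_subset[OF less.prems])
      have "\<tau> * measure lborel (stop_set \<tau> m x r) \<le> (LINT z:stop_set \<tau> m x r|lborel. W z)" by (rule stop_set_measure[OF \<tau> less.prems])
      also have "\<dots> \<le> I" unfolding I_def by (rule set_integral_mono_set[OF W_int[of _ x r]]) (use sub in \<open>auto simp: W_nonneg\<close>)
      also have "I = \<tau> * (\<alpha> * (2 * r) ^ DIM('a))" using less.prems \<alpha> by (simp add: \<tau>_def avg_def I_def a_def)
      finally have "measure lborel (stop_set \<tau> m x r) \<le> \<alpha> * (2 * r) ^ DIM('a)" using \<tau> by (rule mult_left_le_imp_le)
      then show "(LINT z:stop_set \<tau> m x r|lborel. W z) \<le> \<beta> * I" unfolding I_def by (intro A_inf less.prems sub) auto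
    qed (use c in auto)
    also have "\<dots> \<le> c * I * avg x r powr \<delta>"
    proof -
      have t: "\<tau> powr \<delta> = a powr \<delta> * avg x r powr \<delta>" using a ap by (simp add: \<tau>_def powr_mult)
      have t2: "(2 ^ DIM('a) * \<tau>) powr \<delta> = (2 ^ DIM('a) * a) powr \<delta> * avg x r powr \<delta>"
        using a ap by (simp add: \<tau>_def powr_mult)
      have "c * ((2 ^ DIM('a) * a) powr \<delta> * \<beta>) \<le> c * ((1 + \<beta>) / 2)" using \<delta>(2) c by (intro mult_left_mono) auto
      moreover have "a powr \<delta> = c * ((1 - \<beta>) / 2)" using \<beta> by (simp add: c_def)
      ultimately have "a powr \<delta> + c * ((2 ^ DIM('a) * a) powr \<delta> * \<beta>) \<le> c * ((1 - \<beta>) / 2) + c * ((1 + \<beta>) / 2)" by linarith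
      also have "\<dots> = c" by (simp add: algebra_simps) (simp add: field_simps)
      finally have "(a powr \<delta> + c * ((2 ^ DIM('a) * a) powr \<delta> * \<beta>)) * (I * avg x r powr \<delta>) \<le> c * (I * avg x r powr \<delta>)"
        using I by (intro mult_right_mono) auto
      then show ?thesis unfolding t t2 by (simp add: algebra_simps)
    qed
    finally show ?thesis unfolding I_def .
  qed
qed

end

text \<open>A measurable function is an almost everywhere limit of continuous functions; clipping these to the range of \<open>W\<close>
  turns the limit into one in \<open>L\<^sup>1\<close> on every cube.\<close>

lemma bounded_measurable_approx_continuous:
  fixes W :: "'a::euclidean_space \<Rightarrow> real"
  assumes [measurable]: "W \<in> borel_measurable borel" and W: "\<And>x. 0 \<le> W x" "\<And>x. W x \<le> M" and e: "0 < e"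
  obtains g where "continuous_on UNIV g" "\<And>x. 0 \<le> g x" "\<And>x. g x \<le> M" "(LINT z:cube x r|lborel. \<bar>W z - g z\<bar>) < e"
proof -
  have "W \<in> borel_measurable lebesgue" by (simp add: measurable_completion)
  then have "W measurable_on UNIV" by (intro lebesgue_measurable_imp_measurable_on) auto
  then obtain N g where N: "negligible N" and g: "\<And>n. continuous_on UNIV (g n)"
    and lim: "\<And>x. x \<notin> N \<Longrightarrow> (\<lambda>n. g n x) \<longlonglongrightarrow> W x"
    unfolding measurable_on_def by auto
  define c where "c n x = max 0 (min M (g n x))" for n x
  have M: "0 \<le> M" using W[of 0] by linarith
  have cc: "continuous_on UNIV (c n)" for n unfolding c_def by (intro continuous_intros g)
  then have [measurable]: "c n \<in> borel_measurable borel" for n by (rule borel_measurable_continuous_onI)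
  have c: "0 \<le> c n x" "c n x \<le> M" for n x using M by (auto simp: c_def)
  have climAE: "AE x in lebesgue. (\<lambda>n. c n x) \<longlonglongrightarrow> W x"
  proof -
    have "AE x in lebesgue. x \<notin> N" using N by (intro AE_not_in) (simp add: negligible_iff_null_sets)
    then show ?thesis
    proof eventually_elim
      fix x assume "x \<notin> N"
      then have "(\<lambda>n. max 0 (min M (g n x))) \<longlonglongrightarrow> max 0 (min M (W x))" by (intro tendsto_intros lim)
      then show "(\<lambda>n. c n x) \<longlonglongrightarrow> W x" using W[of x] by (simp add: c_def)
    qed
  qed
  have "(\<lambda>n. \<integral>z. indicator (cube x r) z *\<^sub>R \<bar>W z - c n z\<bar> \<partial>lebesgue) \<longlonglongrightarrow> (\<integral>z. 0 \<partial>(lebesgue :: 'a measure))"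
  proof (rule integral_dominated_convergence[where w="\<lambda>z. indicator (cube x r) z *\<^sub>R M"
      and s="\<lambda>n z. indicator (cube x r) z *\<^sub>R \<bar>W z - c n z\<bar>" and f="\<lambda>z. 0"])
    show "AE z in lebesgue. (\<lambda>n. indicator (cube x r) z *\<^sub>R \<bar>W z - c n z\<bar>) \<longlonglongrightarrow> 0"
      using climAE
    proof eventually_elim
      fix z assume "(\<lambda>n. c n z) \<longlonglongrightarrow> W z"
      then have "(\<lambda>n. indicator (cube x r) z *\<^sub>R \<bar>W z - c n z\<bar>) \<longlonglongrightarrow> indicator (cube x r) z *\<^sub>R \<bar>W z - W z\<bar>"
        by (intro tendsto_intros)
      then show "(\<lambda>n. indicator (cube x r) z *\<^sub>R \<bar>W z - c n z\<bar>) \<longlonglongrightarrow> 0" by simp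
    qed
    have "integrable lborel (\<lambda>z. indicator (cube x r) z *\<^sub>R M)" using emeasure_cube_finite[of x r] by simp
    then show "integrable lebesgue (\<lambda>z. indicator (cube x r) z *\<^sub>R M)" by (simp add: integrable_completion)
    show "AE z in lebesgue. norm (indicator (cube x r) z *\<^sub>R \<bar>W z - c n z\<bar>) \<le> indicator (cube x r) z *\<^sub>R M" for n
    proof (rule AE_I2)
      fix z
      have "\<bar>W z - c n z\<bar> \<le> M" using W[of z] c[of n z] by linarith
      then show "norm (indicator (cube x r) z *\<^sub>R \<bar>W z - c n z\<bar>) \<le> indicator (cube x r) z *\<^sub>R M" by (auto simp: indicator_def)
    qed
  qed (auto intro: measurable_completion)
  moreover have "(\<integral>z. indicator (cube x r) z *\<^sub>R \<bar>W z - c n z\<bar> \<partial>lebesgue) = (LINT z:cube x r|lborel. \<bar>W z - c n z\<bar>)" for n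
    unfolding set_lebesgue_integral_def by (rule integral_completion) measurable
  ultimately have "(\<lambda>n. LINT z:cube x r|lborel. \<bar>W z - c n z\<bar>) \<longlonglongrightarrow> 0" by simp
  then have "eventually (\<lambda>n. (LINT z:cube x r|lborel. \<bar>W z - c n z\<bar>) < e) sequentially"
    using e by (rule order_tendstoD(2))
  then obtain n where "(LINT z:cube x r|lborel. \<bar>W z - c n z\<bar>) < e" by (auto simp: eventually_sequentially)
  then show thesis using that[of "c n"] cc c by blast
qed

lemma powr_lipschitz:
  fixes a b M s :: real
  assumes "1 \<le> s" "0 \<le> a" "a \<le> M" "0 \<le> b" "b \<le> M"
  shows "a powr s \<le> b powr s + s * M powr (s - 1) * \<bar>a - b\<bar>"
proof (cases "a \<le> b")
  case True
  then have "a powr s \<le> b powr s" using assms by (intro powr_mono2) auto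
  then show ?thesis using assms by (simp add: add_increasing2)
next
  case False
  then have ab: "b < a" by simp
  have der: "((\<lambda>z. z powr s) has_real_derivative s * z powr (s - 1)) (at z)" if "b < z" for z
    using that assms by (intro has_real_derivative_powr) auto
  have "\<exists>l z. b < z \<and> z < a \<and> ((\<lambda>z. z powr s) has_real_derivative l) (at z) \<and> a powr s - b powr s = (a - b) * l"
  proof (rule MVT[OF ab])
    show "continuous_on {b..a} (\<lambda>z. z powr s)"
      using assms by (intro continuous_on_powr' continuous_intros) auto
    show "(\<lambda>z. z powr s) differentiable (at z)" if "b < z" "z < a" for z
      using der[OF that(1)] real_differentiable_def by blast
  qed
  then obtain l z where z0: "b < z" "z < a" "((\<lambda>z. z powr s) has_real_derivative l) (at z)" "a powr s - b powr s = (a - b) * l" by blast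
  have z: "b < z" "z < a" "a powr s - b powr s = (a - b) * (s * z powr (s - 1))"
    using z0 DERIV_unique[OF z0(3) der[OF z0(1)]] by auto
  have "z powr (s - 1) \<le> M powr (s - 1)" using z assms by (intro powr_mono2) auto
  then have "(a - b) * (s * z powr (s - 1)) \<le> (a - b) * (s * M powr (s - 1))"
    using ab assms by (intro mult_left_mono) auto
  then show ?thesis using z(3) ab by (simp add: algebra_simps)
qed

context A_infinity_weight
begin

text \<open>Compare both \<open>W\<close> and its mean with the value of the approximant \<open>g\<close> at the centre.\<close>

lemma W_minus_avg_le:
  assumes r: "0 < r" and [measurable]: "g \<in> borel_measurable borel" and g: "\<And>z. 0 \<le> g z" "\<And>z. g z \<le> M"
    and osc: "\<And>z. z \<in> hcube x r \<Longrightarrow> \<bar>g z - g x\<bar> \<le> e"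
  shows "(LINT z:hcube x r|lborel. \<bar>W z - avg x r\<bar>) \<le> 2 * (LINT z:hcube x r|lborel. \<bar>W z - g z\<bar>) + 2 * e * (2 * r) ^ DIM('a)"
proof -
  define q where "q = (2 * r) ^ DIM('a)"
  have q: "0 < q" using r by (simp add: q_def)
  define J where "J = (LINT z:hcube x r|lborel. \<bar>W z - g z\<bar>)"
  have M: "0 \<le> M" using W_nonneg[of 0] W_le[of 0] by linarith
  have si: "set_integrable lborel (hcube x r) f" if "f \<in> borel_measurable borel" "\<And>z. \<bar>f z\<bar> \<le> B" for f :: "'a \<Rightarrow> real" and B
    by (rule set_integrable_bounded_subset[OF that(1) _ order_refl that(2)]) simp
  have cst: "(LINT z:hcube x r|lborel. (c::real)) = c * q" for c
    using measure_hcube[of r x] r by (simp add: set_lebesgue_integral_def q_def)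
  have iW: "set_integrable lborel (hcube x r) W" by (rule si[of _ M]) (auto simp: W_nonneg W_le)
  have iD: "set_integrable lborel (hcube x r) (\<lambda>z. \<bar>W z - g z\<bar>)"
  proof (rule si[of _ M])
    show "\<bar>\<bar>W z - g z\<bar>\<bar> \<le> M" for z using W_nonneg[of z] W_le[of z] g[of z] by linarith
  qed measurable
  have ic: "set_integrable lborel (hcube x r) (\<lambda>z. c :: real)" for c by (rule si[of _ "\<bar>c\<bar>"]) auto
  have "\<bar>avg x r - g x\<bar> * q = \<bar>(LINT z:hcube x r|lborel. W z - g x)\<bar>"
  proof -
    have "(LINT z:hcube x r|lborel. W z - g x) = (LINT z:hcube x r|lborel. W z) - g x * q"
      by (subst set_integral_diff(2)[OF iW ic]) (simp add: cst)
    also have "\<dots> = (avg x r - g x) * q" using q r by (simp add: avg_def q_def algebra_simps)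
    finally show ?thesis using q by (simp add: abs_mult)
  qed
  also have "\<dots> \<le> (LINT z:hcube x r|lborel. \<bar>W z - g x\<bar>)"
    using set_integral_diff(1)[OF iW ic] unfolding set_lebesgue_integral_def set_integrable_def
    by (rule_tac order_trans[OF integral_abs_bound]) (simp add: abs_mult)
  also have "\<dots> \<le> (LINT z:hcube x r|lborel. \<bar>W z - g z\<bar> + e)"
  proof (rule set_integral_mono)
    show "set_integrable lborel (hcube x r) (\<lambda>z. \<bar>W z - g x\<bar>)" 
    proof (rule si[of _ M])
      show "\<bar>\<bar>W z - g x\<bar>\<bar> \<le> M" for z using W_nonneg[of z] W_le[of z] g[of x] by linarith
    qed measurable
    show "set_integrable lborel (hcube x r) (\<lambda>z. \<bar>W z - g z\<bar> + e)" by (rule set_integral_add(1)[OF iD ic])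
    show "\<bar>W z - g x\<bar> \<le> \<bar>W z - g z\<bar> + e" if "z \<in> hcube x r" for z using osc[OF that] by linarith
  qed
  also have "\<dots> = J + e * q" by (subst set_integral_add(2)[OF iD ic]) (simp add: cst J_def)
  finally have 1: "\<bar>avg x r - g x\<bar> * q \<le> J + e * q" .
  have "(LINT z:hcube x r|lborel. \<bar>W z - avg x r\<bar>) \<le> (LINT z:hcube x r|lborel. \<bar>W z - g z\<bar> + (e + \<bar>avg x r - g x\<bar>))"
  proof (rule set_integral_mono)
    show "set_integrable lborel (hcube x r) (\<lambda>z. \<bar>W z - avg x r\<bar>)"
    proof (rule si[of _ "M + \<bar>avg x r\<bar>"])
      show "\<bar>\<bar>W z - avg x r\<bar>\<bar> \<le> M + \<bar>avg x r\<bar>" for z using W_nonneg[of z] W_le[of z] by linarith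
    qed measurable
    show "set_integrable lborel (hcube x r) (\<lambda>z. \<bar>W z - g z\<bar> + (e + \<bar>avg x r - g x\<bar>))" by (rule set_integral_add(1)[OF iD ic])
    show "\<bar>W z - avg x r\<bar> \<le> \<bar>W z - g z\<bar> + (e + \<bar>avg x r - g x\<bar>)" if "z \<in> hcube x r" for z using osc[OF that] by linarith
  qed
  also have "\<dots> = J + (e + \<bar>avg x r - g x\<bar>) * q" by (subst set_integral_add(2)[OF iD ic]) (simp add: cst J_def)
  finally show ?thesis using 1 unfolding J_def q_def[symmetric] by (simp add: algebra_simps)
qed

text \<open>On dyadic cubes small compared to the modulus of continuity of \<open>g\<close>, the weight is close in \<open>L\<^sup>1\<close> to its mean,
  and since it is bounded the same holds for its powers.\<close>

lemma power_integral_le_dyadic_sum: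
  assumes \<delta>: "0 < \<delta>" and e: "0 \<le> e" and [measurable]: "g \<in> borel_measurable borel" and g: "\<And>z. 0 \<le> g z" "\<And>z. g z \<le> M"
    and osc: "\<And>z w. z \<in> A \<Longrightarrow> w \<in> A \<Longrightarrow> norm (z - w) < \<zeta> \<Longrightarrow> \<bar>g z - g w\<bar> \<le> e"
  shows "0 < r \<Longrightarrow> hcube x r \<subseteq> A \<Longrightarrow> real DIM('a) * (r / 2 ^ m) < \<zeta> \<Longrightarrow>
    (LINT z:hcube x r|lborel. W z powr (1 + \<delta>)) \<le> dyadic_sum \<delta> m x r
      + (1 + \<delta>) * M powr \<delta> * (2 * (LINT z:hcube x r|lborel. \<bar>W z - g z\<bar>) + 2 * e * (2 * r) ^ DIM('a))"
proof (induction m arbitrary: x r)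
  case (0 x r)
  have M: "0 \<le> M" using W_nonneg[of 0] W_le[of 0] by linarith
  define q where "q = (2 * r) ^ DIM('a)"
  have q: "0 < q" using 0 by (simp add: q_def)
  have avM: "avg x r \<le> M"
  proof -
    have "(LINT z:hcube x r|lborel. W z) \<le> (LINT z:hcube x r|lborel. M)"
      by (rule set_integral_mono[OF W_int[of _ x r]])
        (auto simp: W_le M intro!: set_integrable_bounded_subset[of _ _ x r M])
    also have "\<dots> = M * q" using measure_hcube[of r x] 0 by (simp add: set_lebesgue_integral_def q_def)
    finally show ?thesis using q by (simp add: avg_def q_def divide_le_eq)
  qed
  have ap: "0 < avg x r" using 0 by (intro avg_pos)
  have si: "set_integrable lborel (hcube x r) f" if "f \<in> borel_measurable borel" "\<And>z. \<bar>f z\<bar> \<le> B" for f :: "'a \<Rightarrow> real" and B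
    by (rule set_integrable_bounded_subset[OF that(1) _ order_refl that(2)]) simp
  have cst: "(LINT z:hcube x r|lborel. (c::real)) = c * q" for c
    using measure_hcube[of r x] 0 by (simp add: set_lebesgue_integral_def q_def)
  have ic: "set_integrable lborel (hcube x r) (\<lambda>z. c :: real)" for c by (rule si[of _ "\<bar>c\<bar>"]) auto
  have iA: "set_integrable lborel (hcube x r) (\<lambda>z. \<bar>W z - avg x r\<bar>)"
  proof (rule si[of _ "M + \<bar>avg x r\<bar>"])
    show "\<bar>\<bar>W z - avg x r\<bar>\<bar> \<le> M + \<bar>avg x r\<bar>" for z using W_nonneg[of z] W_le[of z] by linarith
  qed measurable
  define L where "L = (1 + \<delta>) * M powr \<delta>"
  have L: "0 \<le> L" using \<delta> by (simp add: L_def)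
  have iL: "set_integrable lborel (hcube x r) (\<lambda>z. L * \<bar>W z - avg x r\<bar>)" using iA by simp
  have xin: "x \<in> hcube x r" using 0 by (simp add: hcube_def)
  have "(LINT z:hcube x r|lborel. W z powr (1 + \<delta>)) \<le> (LINT z:hcube x r|lborel. avg x r powr (1 + \<delta>) + L * \<bar>W z - avg x r\<bar>)"
  proof (rule set_integral_mono)
    show "set_integrable lborel (hcube x r) (\<lambda>z. W z powr (1 + \<delta>))"
      by (rule si[of _ "M powr (1 + \<delta>)"]) (use \<delta> in \<open>auto intro!: powr_mono2 W_nonneg W_le\<close>)
    show "set_integrable lborel (hcube x r) (\<lambda>z. avg x r powr (1 + \<delta>) + L * \<bar>W z - avg x r\<bar>)"
      by (rule set_integral_add(1)[OF ic iL])
    show "W z powr (1 + \<delta>) \<le> avg x r powr (1 + \<delta>) + L * \<bar>W z - avg x r\<bar>" for z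
      using powr_lipschitz[of "1 + \<delta>" "W z" M "avg x r"] \<delta> W_nonneg W_le avM ap by (simp add: L_def)
  qed
  also have "\<dots> = avg x r powr (1 + \<delta>) * q + L * (LINT z:hcube x r|lborel. \<bar>W z - avg x r\<bar>)"
    by (subst set_integral_add(2)[OF ic iL]) (simp add: cst)
  also have "avg x r powr (1 + \<delta>) * q = dyadic_sum \<delta> 0 x r"
  proof -
    have "avg x r powr (1 + \<delta>) = avg x r * avg x r powr \<delta>" using ap by (simp add: powr_add)
    moreover have "avg x r * q = (LINT z:hcube x r|lborel. W z)" unfolding avg_def q_def[symmetric] using q by simp
    ultimately have "avg x r powr (1 + \<delta>) * q = (LINT z:hcube x r|lborel. W z) * avg x r powr \<delta>"
      by (simp add: mult.commute mult.left_commute)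
    then show ?thesis by simp
  qed
  also have "L * (LINT z:hcube x r|lborel. \<bar>W z - avg x r\<bar>) \<le> L * (2 * (LINT z:hcube x r|lborel. \<bar>W z - g z\<bar>) + 2 * e * (2 * r) ^ DIM('a))"
  proof (intro mult_left_mono L W_minus_avg_le g)
    fix z assume z: "z \<in> hcube x r"
    have "norm (z - x) \<le> (\<Sum>b\<in>Basis. \<bar>(z - x) \<bullet> b\<bar>)" by (rule norm_le_l1)
    also have "\<dots> \<le> (\<Sum>b\<in>(Basis::'a set). r)"
      using z hcube_subset_cube[of x r] by (intro sum_mono) (auto simp: mem_cube subset_eq)
    also have "\<dots> < \<zeta>" using 0 by simp
    finally show "\<bar>g z - g x\<bar> \<le> e" using z xin 0 by (intro osc) auto
  qed (use 0 in auto)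
  finally show ?case unfolding L_def by simp
next
  case (Suc m x r)
  define L where "L = (1 + \<delta>) * M powr \<delta>"
  have si: "set_integrable lborel (hcube x r) f" if "f \<in> borel_measurable borel" "\<And>z. \<bar>f z\<bar> \<le> B" for f :: "'a \<Rightarrow> real" and B
    by (rule set_integrable_bounded_subset[OF that(1) _ order_refl that(2)]) simp
  have iD: "set_integrable lborel (hcube x r) (\<lambda>z. \<bar>W z - g z\<bar>)"
  proof (rule si[of _ M])
    show "\<bar>\<bar>W z - g z\<bar>\<bar> \<le> M" for z using W_nonneg[of z] W_le[of z] g[of z] by linarith
  qed measurable
  have iP: "set_integrable lborel (hcube x r) (\<lambda>z. W z powr (1 + \<delta>))"
    by (rule si[of _ "M powr (1 + \<delta>)"]) (use \<delta> in \<open>auto intro!: powr_mono2 W_nonneg W_le\<close>)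
  have "(LINT z:hcube x r|lborel. W z powr (1 + \<delta>)) = (\<Sum>S\<in>Pow Basis. LINT z:hcube (child x r S) (r / 2)|lborel. W z powr (1 + \<delta>))"
    by (rule set_integral_children[OF Suc.prems(1) iP])
  also have "\<dots> \<le> (\<Sum>S\<in>Pow Basis. dyadic_sum \<delta> m (child x r S) (r / 2)
      + L * (2 * (LINT z:hcube (child x r S) (r / 2)|lborel. \<bar>W z - g z\<bar>) + 2 * e * (2 * (r / 2)) ^ DIM('a)))"
  proof (rule sum_mono)
    fix S :: "'a set" assume S: "S \<in> Pow Basis"
    have sub: "hcube (child x r S) (r / 2) \<subseteq> A" using Suc.prems S by (auto simp: mem_hcube_child)
    show "(LINT z:hcube (child x r S) (r / 2)|lborel. W z powr (1 + \<delta>)) \<le> dyadic_sum \<delta> m (child x r S) (r / 2)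
      + L * (2 * (LINT z:hcube (child x r S) (r / 2)|lborel. \<bar>W z - g z\<bar>) + 2 * e * (2 * (r / 2)) ^ DIM('a))"
      unfolding L_def by (rule Suc.IH[OF _ sub]) (use Suc.prems in auto)
  qed
  also have "\<dots> = (\<Sum>S\<in>Pow Basis. dyadic_sum \<delta> m (child x r S) (r / 2))
      + L * (2 * (\<Sum>S\<in>Pow Basis. LINT z:hcube (child x r S) (r / 2)|lborel. \<bar>W z - g z\<bar>) + 2 * e * (\<Sum>S\<in>Pow (Basis::'a set). (2 * (r / 2)) ^ DIM('a)))"
    by (simp only: sum.distrib sum_distrib_left distrib_left)
  also have "(\<Sum>S\<in>Pow Basis. LINT z:hcube (child x r S) (r / 2)|lborel. \<bar>W z - g z\<bar>) = (LINT z:hcube x r|lborel. \<bar>W z - g z\<bar>)"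
    by (rule set_integral_children[OF Suc.prems(1) iD, symmetric])
  also have "(\<Sum>S\<in>Pow (Basis::'a set). (2 * (r / 2)) ^ DIM('a)) = (2 * r) ^ DIM('a)"
    by (simp add: card_Pow power_mult_distrib)
  finally show ?case unfolding L_def by simp
qed

text \<open>Up to an arbitrarily small error, the integral of \<open>W\<^sup>1\<^sup>+\<^sup>\<delta>\<close> is at most a dyadic sum of high generation, and
  \<open>dyadic_sum_le\<close> bounds these sums uniformly in the generation.\<close>

lemma reverse_Hoelder_improvement:
  assumes \<delta>: "0 < \<delta>" "(2 ^ DIM('a) * (1 / \<alpha>)) powr \<delta> * \<beta> \<le> (1 + \<beta>) / 2" and r: "0 < r"
  shows "(LINT z:hcube x r|lborel. W z powr (1 + \<delta>))
    \<le> 2 * (1 / \<alpha>) powr \<delta> / (1 - \<beta>) * (LINT z:hcube x r|lborel. W z) * avg x r powr \<delta>" (is "?L \<le> ?R")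
proof (rule field_le_epsilon)
  fix \<epsilon> :: real assume \<epsilon>: "0 < \<epsilon>"
  define L where "L = (1 + \<delta>) * M powr \<delta>"
  have L: "0 \<le> L" using \<delta> by (simp add: L_def)
  define q where "q = (2 * r) ^ DIM('a)"
  have q: "0 < q" using r by (simp add: q_def)
  define e where "e = \<epsilon> / (2 * (1 + L) * (1 + q))"
  have e: "0 < e" using \<epsilon> L q by (simp add: e_def)
  obtain g where g: "continuous_on UNIV g" "\<And>x. 0 \<le> g x" "\<And>x. g x \<le> M" "(LINT z:cube x r|lborel. \<bar>W z - g z\<bar>) < e"
    using bounded_measurable_approx_continuous[OF W_measurable W_nonneg W_le e, of x r] by blast
  have [measurable]: "g \<in> borel_measurable borel" using g(1) by (rule borel_measurable_continuous_onI)
  have "uniformly_continuous_on (cube x r) g"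
    by (rule compact_uniformly_continuous) (auto simp: cube_def intro: continuous_on_subset[OF g(1)])
  then obtain \<zeta> where \<zeta>: "0 < \<zeta>" "\<And>z w. z \<in> cube x r \<Longrightarrow> w \<in> cube x r \<Longrightarrow> dist w z < \<zeta> \<Longrightarrow> dist (g w) (g z) < e"
    unfolding uniformly_continuous_on_def using e by meson
  obtain m where m: "real DIM('a) * r / \<zeta> < 2 ^ m" using real_arch_pow[of 2 "real DIM('a) * r / \<zeta>"] by auto
  have "?L \<le> dyadic_sum \<delta> m x r + L * (2 * (LINT z:hcube x r|lborel. \<bar>W z - g z\<bar>) + 2 * e * q)"
    unfolding L_def q_def
  proof (rule power_integral_le_dyadic_sum[where A="cube x r" and \<zeta>=\<zeta>])
    show "\<bar>g z - g w\<bar> \<le> e" if "z \<in> cube x r" "w \<in> cube x r" "norm (z - w) < \<zeta>" for z w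
      using \<zeta>(2)[OF that(2,1)] that(3) by (simp add: dist_norm)
    show "real DIM('a) * (r / 2 ^ m) < \<zeta>" using m \<zeta> by (simp add: field_simps)
  qed (use \<delta> e g r in \<open>auto intro: subsetD[OF hcube_subset_cube]\<close>)
  also have "dyadic_sum \<delta> m x r \<le> ?R" by (rule dyadic_sum_le[OF \<delta> r])
  also have "L * (2 * (LINT z:hcube x r|lborel. \<bar>W z - g z\<bar>) + 2 * e * q) \<le> L * (2 * e + 2 * e * q)"
    using L g(4) by (subst set_integral_hcube) (auto intro!: mult_left_mono)
  also have "\<dots> = 2 * e * (1 + q) * L" by (simp add: algebra_simps)
  also have "\<dots> \<le> 2 * e * (1 + q) * (1 + L)" using e q by (intro mult_left_mono) auto
  also have "\<dots> = \<epsilon>"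
  proof -
    have "0 < 2 * (1 + L) * (1 + q)" using L q by simp
    then have "e * (2 * (1 + L) * (1 + q)) = \<epsilon>"
      using nonzero_eq_divide_eq[of "2 * (1 + L) * (1 + q)" e \<epsilon>] by (simp only: e_def) auto
    then show ?thesis by (simp only: mult_ac)
  qed
  finally show "?L \<le> ?R + \<epsilon>" by simp
qed

end

lemma set_integrable_cube_const [simp]: "set_integrable lborel (cube x r) (\<lambda>z. c :: real)"
  using emeasure_cube_finite[of x r] by (simp add: set_integrable_def)

lemma set_integral_cube_const: "0 \<le> r \<Longrightarrow> (LINT z:cube (x::'a::euclidean_space) r|lborel. (c::real)) = c * (2 * r) ^ DIM('a)"
  by (simp add: set_lebesgue_integral_def measure_cube)

text \<open>Young's inequality at the level of the mean of \<open>V\<close>.\<close>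

lemma RH_lower_exponent:
  assumes V: "RH q C (V :: 'a::euclidean_space \<Rightarrow> real)" and p: "0 < p" "p \<le> q"
  shows "RH p (1 + \<bar>C\<bar>) V"
  unfolding RH_def
proof (intro conjI allI impI)
  have [measurable]: "V \<in> borel_measurable borel" by (rule RH_D(1)[OF V])
  show "V \<in> borel_measurable borel" by measurable
  show "0 \<le> V x" for x by (rule RH_D(2)[OF V])
  show "AE x in lborel. 0 < V x" by (rule RH_D(3)[OF V])
  show "set_integrable lborel (cube x r) V" for x r by (rule RH_D(4)[OF V])
  show ip: "set_integrable lborel (cube x r) (\<lambda>x. V x powr p)" for x r
    unfolding set_integrable_def
  proof (rule Bochner_Integration.integrable_bound)
    show "integrable lborel (\<lambda>z. indicator (cube x r) z *\<^sub>R (1 + V z powr q))"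
      using set_integral_add(1)[OF set_integrable_cube_const RH_D(5)[OF V], of x r 1] unfolding set_integrable_def by simp
    show "AE z in lborel. norm (indicator (cube x r) z *\<^sub>R V z powr p) \<le> norm (indicator (cube x r) z *\<^sub>R (1 + V z powr q))"
      using powr_split_le[OF RH_D(2)[OF V], of 1 p q] p by (intro AE_I2) (auto simp: indicator_def)
  qed measurable
  fix x :: 'a and r :: real assume r: "0 < r"
  define n where "n = (2 * r) ^ DIM('a)"
  have n: "0 < n" using r by (simp add: n_def)
  define t where "t = (LINT z:cube x r|lborel. V z) / n"
  have t: "0 < t" unfolding t_def using RH_integral_pos[OF V r, of x] n by auto
  have iq: "set_integrable lborel (cube x r) (\<lambda>z. t powr (p - q) * V z powr q)" using RH_D(5)[OF V] by simp
  have "(LINT z:cube x r|lborel. V z powr p) \<le> (LINT z:cube x r|lborel. t powr p + t powr (p - q) * V z powr q)"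
    by (rule set_integral_mono[OF ip set_integral_add(1)[OF set_integrable_cube_const iq]]) (use powr_split_le[OF RH_D(2)[OF V] t] p in auto)
  also have "\<dots> = t powr p * n + t powr (p - q) * (LINT z:cube x r|lborel. V z powr q)"
    by (subst set_integral_add(2)[OF set_integrable_cube_const iq]) (use r in \<open>simp add: set_integral_cube_const n_def\<close>)
  also have "\<dots> \<le> t powr p * n + t powr (p - q) * (C * n * t powr q)"
    using RH_D(6)[OF V r, of x] by (intro add_left_mono mult_left_mono) (auto simp: n_def t_def)
  also have "t powr (p - q) * (C * n * t powr q) = C * n * (t powr (p - q) * t powr q)" by simp
  also have "t powr (p - q) * t powr q = t powr p" using t by (simp add: powr_add[symmetric])
  also have "t powr p * n + C * n * t powr p \<le> (1 + \<bar>C\<bar>) * n * t powr p"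
  proof -
    have "C * (n * t powr p) \<le> \<bar>C\<bar> * (n * t powr p)" using n by (intro mult_right_mono) auto
    then show ?thesis by (simp add: algebra_simps)
  qed
  finally show "(LINT z:cube x r|lborel. V z powr p) \<le> (1 + \<bar>C\<bar>) * (2 * r) ^ DIM('a) * ((LINT z:cube x r|lborel. V z) / (2 * r) ^ DIM('a)) powr p"
    unfolding n_def t_def .
qed

text \<open>With \<open>t\<close> a large multiple of the mean \<open>A\<close> of \<open>V\<close>, the function \<open>V - t\<^sup>1\<^sup>-\<^sup>p V\<^sup>p\<close> is at most \<open>V\<close> where \<open>V \<le> t\<close>
  and nonpositive elsewhere, and its mean is at least \<open>A / 2\<close>. Scaled by \<open>s = min 1 (k / t)\<close> it stays below \<open>min
  V k\<close>, whose mean is therefore comparable to \<open>min A k\<close>. The \<open>p\<close>th power of \<open>min V k\<close> has mean at most a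
  multiple of \<open>(min A k)\<^sup>p\<close>.\<close>

lemma RH_truncate:
  assumes p: "1 < p"
  obtains C' where "\<And>(V :: 'a::euclidean_space \<Rightarrow> real) k. RH p C V \<Longrightarrow> 0 < k \<Longrightarrow> RH p C' (\<lambda>x. min (V x) k)"
proof -
  define K where "K = (2 * \<bar>C\<bar> + 1) powr (1 / (p - 1))"
  have K: "1 \<le> K" unfolding K_def using p by (intro ge_one_powr_ge_zero) auto
  have Kp: "K powr (1 - p) = 1 / (2 * \<bar>C\<bar> + 1)"
  proof -
    have "1 / (p - 1) * (1 - p) = - 1" using p by (simp add: field_simps)
    then show ?thesis unfolding K_def powr_powr by (simp add: powr_minus_divide)
  qed
  show thesis
  proof (rule that[of "(1 + \<bar>C\<bar>) * (2 * K) powr p"])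
    fix V :: "'a \<Rightarrow> real" and k :: real
    assume V: "RH p C V" and k: "0 < k"
    have [measurable]: "V \<in> borel_measurable borel" by (rule RH_D(1)[OF V])
    define U where "U x = min (V x) k" for x
    have U0: "0 \<le> U x" and UV: "U x \<le> V x" and Uk: "U x \<le> k" for x using RH_D(2)[OF V, of x] k by (auto simp: U_def)
    have [measurable]: "U \<in> borel_measurable borel" unfolding U_def by measurable
    have iU: "set_integrable lborel (cube x r) U" for x r
      unfolding set_integrable_def
      by (rule Bochner_Integration.integrable_bound[OF RH_D(4)[OF V, of x r, unfolded set_integrable_def]])
        (use U0 UV RH_D(2)[OF V] in \<open>auto simp: indicator_def\<close>)
    have iUp: "set_integrable lborel (cube x r) (\<lambda>x. U x powr p)" for x r
      unfolding set_integrable_def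
      by (rule Bochner_Integration.integrable_bound[OF RH_D(5)[OF V, of x r, unfolded set_integrable_def]])
        (use U0 UV RH_D(2)[OF V] p in \<open>auto simp: indicator_def intro!: powr_mono2\<close>)
    show "RH p ((1 + \<bar>C\<bar>) * (2 * K) powr p) (\<lambda>x. min (V x) k)"
      unfolding U_def[symmetric] RH_def
    proof (intro conjI allI impI)
      show "AE x in lborel. 0 < U x" using RH_D(3)[OF V] by eventually_elim (use k in \<open>auto simp: U_def\<close>)
      fix x :: 'a and r :: real assume r: "0 < r"
      define n where "n = (2 * r) ^ DIM('a)"
      have n: "0 < n" using r by (simp add: n_def)
      define J where "J = (LINT z:cube x r|lborel. V z)"
      have J: "0 < J" unfolding J_def by (rule RH_integral_pos[OF V r])
      define A where "A = J / n"
      have A: "0 < A" using J n by (simp add: A_def)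
      define t where "t = K * A"
      have t: "0 < t" using K A by (simp add: t_def)
      define s where "s = min 1 (k / t)"
      have s: "0 < s" "s \<le> 1" "s * t \<le> k" using k t by (auto simp: s_def min_def field_simps)
      have pt: "s * (V z - t powr (1 - p) * V z powr p) \<le> U z" for z
      proof (cases "V z \<le> t")
        case True
        have "s * V z \<le> V z" using s RH_D(2)[OF V, of z] by (simp add: mult_left_le_one_le)
        moreover have "s * V z \<le> k" using s True by (meson mult_left_mono order_trans less_imp_le)
        ultimately have "s * V z \<le> U z" by (simp add: U_def)
        moreover have "0 \<le> s * (t powr (1 - p) * V z powr p)" using s by simp
        ultimately show ?thesis by (simp add: right_diff_distrib)
      next
        case False
        then have "V z powr (1 - p) \<le> t powr (1 - p)" using t p by (intro powr_mono2') auto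
        then have "V z powr (1 - p) * V z powr p \<le> t powr (1 - p) * V z powr p" by (intro mult_right_mono) auto
        moreover have "V z powr (1 - p) * V z powr p = V z" using False t by (simp add: powr_add[symmetric])
        ultimately have "s * (V z - t powr (1 - p) * V z powr p) \<le> 0" using s by (intro mult_nonneg_nonpos) auto
        then show ?thesis using U0[of z] by linarith
      qed
      have iq: "set_integrable lborel (cube x r) (\<lambda>z. t powr (1 - p) * V z powr p)" using RH_D(5)[OF V] by simp
      have id: "set_integrable lborel (cube x r) (\<lambda>z. s * (V z - t powr (1 - p) * V z powr p))"
        using set_integral_diff(1)[OF RH_D(4)[OF V] iq] by simp
      have tp: "t powr (1 - p) * (LINT z:cube x r|lborel. V z powr p) \<le> J / 2"
      proof -
        have "t powr (1 - p) * (LINT z:cube x r|lborel. V z powr p) \<le> t powr (1 - p) * (C * n * A powr p)"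
          using RH_D(6)[OF V r, of x] by (intro mult_left_mono) (auto simp: n_def A_def J_def)
        also have "\<dots> = C * n * (K powr (1 - p) * (A powr (1 - p) * A powr p))"
          unfolding t_def using K A by (simp add: powr_mult)
        also have "A powr (1 - p) * A powr p = A" using A by (simp add: powr_add[symmetric])
        also have "C * n * (K powr (1 - p) * A) = C / (2 * \<bar>C\<bar> + 1) * J" unfolding Kp A_def using n by simp
        also have "\<dots> \<le> 1 / 2 * J" using J by (intro mult_right_mono) (auto simp: field_simps abs_if)
        finally show ?thesis by simp
      qed
      have "s * (J / 2) \<le> s * (J - t powr (1 - p) * (LINT z:cube x r|lborel. V z powr p))"
        using tp s by (intro mult_left_mono) auto
      also have "\<dots> = (LINT z:cube x r|lborel. s * (V z - t powr (1 - p) * V z powr p))"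
        using set_integral_diff(2)[OF RH_D(4)[OF V] iq] by (simp add: J_def)
      also have "\<dots> \<le> (LINT z:cube x r|lborel. U z)" by (rule set_integral_mono[OF id iU]) (rule pt)
      finally have "s * (J / 2) / n \<le> (LINT z:cube x r|lborel. U z) / n" using n by (intro divide_right_mono) auto
      then have low: "s * A / 2 \<le> (LINT z:cube x r|lborel. U z) / n" by (simp add: A_def)
      have minA: "min A k \<le> 2 * K * (s * A / 2)"
      proof -
        have "min A k \<le> K * s * A"
        proof (cases "k / t \<le> 1")
          case True
          then have "K * s * A = k" using t K A by (simp add: s_def t_def min_def)
          then show ?thesis by simp
        next
          case False
          then have "s = 1" by (simp add: s_def)
          moreover have "1 * A \<le> K * A" using K A by (intro mult_right_mono) auto
          ultimately show ?thesis by simp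
        qed
        then show ?thesis by simp
      qed
      have "(LINT z:cube x r|lborel. U z powr p) \<le> (1 + \<bar>C\<bar>) * n * (min A k) powr p"
      proof (cases "A \<le> k")
        case True
        have "(LINT z:cube x r|lborel. U z powr p) \<le> (LINT z:cube x r|lborel. V z powr p)"
          by (rule set_integral_mono[OF iUp RH_D(5)[OF V]]) (use U0 UV p in \<open>auto intro!: powr_mono2\<close>)
        also have "\<dots> \<le> C * n * A powr p" using RH_D(6)[OF V r, of x] by (simp add: n_def A_def J_def)
        also have "\<dots> \<le> (1 + \<bar>C\<bar>) * n * A powr p" using n by (intro mult_right_mono) auto
        finally show ?thesis using True by (simp add: min_def)
      next
        case False
        have "(LINT z:cube x r|lborel. U z powr p) \<le> (LINT z:cube x r|lborel. k powr p)"
          by (rule set_integral_mono[OF iUp]) (use U0 Uk p in \<open>auto intro!: powr_mono2\<close>)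
        also have "\<dots> = 1 * n * k powr p" using r by (simp add: set_integral_cube_const n_def)
        also have "\<dots> \<le> (1 + \<bar>C\<bar>) * n * k powr p" using n by (intro mult_right_mono) auto
        finally show ?thesis using False by (simp add: min_def)
      qed
      also have "\<dots> \<le> (1 + \<bar>C\<bar>) * n * (2 * K * ((LINT z:cube x r|lborel. U z) / n)) powr p"
      proof (intro mult_left_mono powr_mono2)
        have "2 * K * (s * A / 2) \<le> 2 * K * ((LINT z:cube x r|lborel. U z) / n)" using low K by (intro mult_left_mono) auto
        then show "min A k \<le> 2 * K * ((LINT z:cube x r|lborel. U z) / n)" using minA by linarith
      qed (use A k p n in auto)
      also have "\<dots> = (1 + \<bar>C\<bar>) * (2 * K) powr p * n * ((LINT z:cube x r|lborel. U z) / n) powr p"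
      proof -
        have "(2 * K * ((LINT z:cube x r|lborel. U z) / n)) powr p = (2 * K) powr p * ((LINT z:cube x r|lborel. U z) / n) powr p"
          by (rule powr_mult)
        then show ?thesis by simp
      qed
      finally show "(LINT z:cube x r|lborel. U z powr p) \<le> (1 + \<bar>C\<bar>) * (2 * K) powr p * (2 * r) ^ DIM('a) * ((LINT z:cube x r|lborel. U z) / (2 * r) ^ DIM('a)) powr p"
        unfolding n_def .
    qed (use U0 iU iUp in \<open>auto\<close>)
  qed
qed

text \<open>Gehring's lemma for bounded weights. Sets small enough to carry at most half of \<open>V\<close> leave a fixed fraction of
  \<open>W = V\<^sup>q\<close> outside: the complement has half of \<open>V\<close>, and by Young's inequality, at the level of a quarter of the
  mean, the corresponding share of \<open>W\<close>. So \<open>W\<close> is an \<open>A\<^sub>\<infinity>\<close> weight and the dyadic argument raises its exponent to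
  \<open>1 + \<delta>\<close>.\<close>

lemma RH_self_improvement:
  assumes q: "1 < q" and C: "0 < C"
  obtains \<delta> C' where "0 < \<delta>"
    "\<And>(V :: 'a::euclidean_space \<Rightarrow> real) k. RH q C V \<Longrightarrow> (\<And>x. V x \<le> k) \<Longrightarrow> RH (q * (1 + \<delta>)) C' V"
proof -
  obtain \<alpha> where \<alpha>: "0 < \<alpha>" "\<alpha> < 1" and "\<And>V :: 'a \<Rightarrow> real. RH q C V \<Longrightarrow> half_on_small_sets \<alpha> V"
    by (rule RH_small_set[OF q, where C=C and 'a='a]) (rule that)
  note small = half_on_small_setsD[OF this(3)]
  define \<beta> where "\<beta> = max (1/2) (1 - 1 / (4 powr q * C))"
  have \<beta>: "1/2 \<le> \<beta>" "\<beta> < 1" using C by (auto simp: \<beta>_def)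
  define b where "b = (1 + \<beta>) / (2 * \<beta>)"
  have b: "1 < b" using \<beta> by (simp add: b_def field_simps)
  define a where "a = 2 ^ DIM('a) * (1 / \<alpha>)"
  have a: "1 < a"
  proof -
    have "1 < 1 / \<alpha>" using \<alpha> by simp
    moreover have "1 * (1 / \<alpha>) \<le> 2 ^ DIM('a) * (1 / \<alpha>)" using \<alpha> by (intro mult_right_mono) auto
    ultimately show ?thesis by (simp add: a_def)
  qed
  \<comment> \<open>Chosen so that \<open>a\<^sup>\<delta> = b\<close>, that is, \<open>a\<^sup>\<delta> \<beta> = (1 + \<beta>) / 2\<close>.\<close>
  define \<delta> where "\<delta> = ln b / ln a"
  have \<delta>: "0 < \<delta>" using a b by (simp add: \<delta>_def)
  have "a powr \<delta> = b" using a b by (simp add: \<delta>_def powr_def)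
  then have \<delta>2: "(2 ^ DIM('a) * (1 / \<alpha>)) powr \<delta> * \<beta> \<le> (1 + \<beta>) / 2" unfolding a_def[symmetric] using \<beta> by (simp add: b_def)
  define c where "c = 2 * (1 / \<alpha>) powr \<delta> / (1 - \<beta>)"
  have c: "0 \<le> c" using \<beta> by (simp add: c_def)
  show thesis
  proof (rule that[OF \<delta>, of "c * C powr (1 + \<delta>)"])
    fix V :: "'a \<Rightarrow> real" and k :: real assume V: "RH q C V" and k: "\<And>x. V x \<le> k"
    have [measurable]: "V \<in> borel_measurable borel" by (rule RH_D(1)[OF V])
    have V0: "0 \<le> V x" for x by (rule RH_D(2)[OF V])
    define W where "W x = V x powr q" for x
    have [measurable]: "W \<in> borel_measurable borel" unfolding W_def by measurable
    have iW: "set_integrable lborel (cube x r) W" for x r unfolding W_def by (rule RH_D(5)[OF V])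
    have W0: "0 \<le> W x" for x by (simp add: W_def)
    have A_inf: "(LINT z:E|lborel. W z) \<le> \<beta> * (LINT z:cube x r|lborel. W z)"
      if r: "0 < r" and E [measurable]: "E \<in> sets borel" and sub: "E \<subseteq> cube x r" and m: "measure lborel E \<le> \<alpha> * (2 * r) ^ DIM('a)" for x r E
    proof -
      define n where "n = (2 * r) ^ DIM('a)"
      have n: "0 < n" using r by (simp add: n_def)
      define J where "J = (LINT z:cube x r|lborel. V z)"
      have J: "0 < J" unfolding J_def by (rule RH_integral_pos[OF V r])
      define F where "F = cube x r - E"
      have F [measurable]: "F \<in> sets borel" "F \<subseteq> cube x r" by (auto simp: F_def)
      have iV: "set_integrable lborel (cube x r) V" by (rule RH_D(4)[OF V])
      have iE: "set_integrable lborel E V" "set_integrable lborel F V" "set_integrable lborel E W" "set_integrable lborel F W"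
        "set_integrable lborel F (\<lambda>z. c)" for c :: real
        using sub F by (auto intro: set_integrable_subset[OF iV] set_integrable_subset[OF iW] set_integrable_subset[OF set_integrable_cube_const])
      have EF: "E \<inter> F = {}" "E \<union> F = cube x r" using sub by (auto simp: F_def)
      have sV: "J = (LINT z:E|lborel. V z) + (LINT z:F|lborel. V z)"
        using set_integral_Un[OF EF(1) iE(1,2)] by (simp add: EF J_def)
      have sW: "(LINT z:cube x r|lborel. W z) = (LINT z:E|lborel. W z) + (LINT z:F|lborel. W z)"
        using set_integral_Un[OF EF(1) iE(3,4)] by (simp add: EF)
      have "(LINT z:E|lborel. V z) \<le> 1/2 * J" unfolding J_def by (rule small[OF V r E sub m])
      then have half: "J / 2 \<le> (LINT z:F|lborel. V z)" using sV by linarith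
      define t where "t = J / n / 4"
      have t: "0 < t" using J n by (simp add: t_def)
      have iqF: "set_integrable lborel F (\<lambda>z. t powr (1 - q) * W z)" using iE(4) by simp
      have "(LINT z:F|lborel. V z) \<le> (LINT z:F|lborel. t + t powr (1 - q) * W z)"
        by (rule set_integral_mono[OF iE(2) set_integral_add(1)[OF iE(5) iqF]]) (use power_split_le[OF V0 t, of q] q in \<open>auto simp: W_def\<close>)
      also have "\<dots> = t * measure lborel F + t powr (1 - q) * (LINT z:F|lborel. W z)"
        by (subst set_integral_add(2)[OF iE(5) iqF]) (simp add: set_lebesgue_integral_def)
      also have "t * measure lborel F \<le> t * n"
        using t measure_mono_fmeasurable[OF F(2) _ fmeasurable_cube] measure_cube[of r x] r by (intro mult_left_mono) (auto simp: n_def)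
      finally have "J / 4 \<le> t powr (1 - q) * (LINT z:F|lborel. W z)" using half n by (simp add: t_def)
      then have "t powr (q - 1) * (J / 4) \<le> t powr (q - 1) * (t powr (1 - q) * (LINT z:F|lborel. W z))"
        by (rule mult_left_mono) simp
      also have "\<dots> = (LINT z:F|lborel. W z)" using t by (simp add: mult.assoc[symmetric] powr_add[symmetric])
      finally have 1: "t powr (q - 1) * (J / 4) \<le> (LINT z:F|lborel. W z)" .
      have 2: "(LINT z:cube x r|lborel. W z) \<le> C * 4 powr q * (t powr (q - 1) * (J / 4))"
      proof -
        have "(LINT z:cube x r|lborel. W z) \<le> C * n * (J / n) powr q"
          unfolding W_def n_def J_def by (rule RH_D(6)[OF V r])
        also have "J / n = 4 * t" by (simp add: t_def)
        also have "(4 * t) powr q = 4 powr q * t powr q" using t by (simp add: powr_mult)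
        also have "t powr q = t powr (q - 1) * t" using t by (simp add: powr_diff)
        also have "C * n * (4 powr q * (t powr (q - 1) * t)) = C * 4 powr q * (t powr (q - 1) * (n * t))" by simp
        also have "n * t = J / 4" using n by (simp add: t_def)
        finally show ?thesis .
      qed
      have "(LINT z:cube x r|lborel. W z) \<le> C * 4 powr q * (LINT z:F|lborel. W z)"
        by (rule order_trans[OF 2 mult_left_mono[OF 1]]) (use C in auto)
      then have "1 / (4 powr q * C) * (LINT z:cube x r|lborel. W z) \<le> (LINT z:F|lborel. W z)"
        using C by (simp add: pos_divide_le_eq mult_ac)
      then have "(LINT z:E|lborel. W z) \<le> (1 - 1 / (4 powr q * C)) * (LINT z:cube x r|lborel. W z)"
        using sW by (simp add: algebra_simps)
      also have "\<dots> \<le> \<beta> * (LINT z:cube x r|lborel. W z)"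
        by (intro mult_right_mono) (auto simp: \<beta>_def set_lebesgue_integral_def W0 intro!: integral_nonneg_AE)
      finally show ?thesis .
    qed
    have Wpos: "0 < (LINT z:cube x r|lborel. W z)" if r: "0 < r" for x r
    proof -
      define n where "n = (2 * r) ^ DIM('a)"
      have n: "0 < n" using r by (simp add: n_def)
      have J: "0 < (LINT z:cube x r|lborel. V z)" by (rule RH_integral_pos[OF V r])
      define t where "t = (LINT z:cube x r|lborel. V z) / n / 2"
      have t: "0 < t" using J n by (simp add: t_def)
      have iq: "set_integrable lborel (cube x r) (\<lambda>z. t powr (1 - q) * W z)" using iW by simp
      have "(LINT z:cube x r|lborel. V z) \<le> (LINT z:cube x r|lborel. t + t powr (1 - q) * W z)"
        by (rule set_integral_mono[OF RH_D(4)[OF V] set_integral_add(1)[OF set_integrable_cube_const iq]])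
          (use power_split_le[OF V0 t, of q] q in \<open>auto simp: W_def\<close>)
      also have "\<dots> = t * n + t powr (1 - q) * (LINT z:cube x r|lborel. W z)"
        by (subst set_integral_add(2)[OF set_integrable_cube_const iq]) (use r in \<open>simp add: set_integral_cube_const n_def\<close>)
      finally have "0 < t powr (1 - q) * (LINT z:cube x r|lborel. W z)" using J n by (simp add: t_def)
      then show ?thesis using t by (simp add: zero_less_mult_iff)
    qed
    interpret A_infinity_weight W "k powr q" \<alpha> \<beta>
    proof
      show "W x \<le> k powr q" for x unfolding W_def using V0 k q by (intro powr_mono2) auto
      show "0 < (LINT z:hcube x r|lborel. W z)" if "0 < r" for x r using Wpos[OF that] by (simp add: set_integral_hcube)
      show "(LINT z:E|lborel. W z) \<le> \<beta> * (LINT z:hcube x r|lborel. W z)"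
        if "0 < r" "E \<in> sets borel" "E \<subseteq> hcube x r" "measure lborel E \<le> \<alpha> * (2 * r) ^ DIM('a)" for r x E
        using A_inf[OF that(1,2) order_trans[OF that(3) hcube_subset_cube] that(4)] by (simp add: set_integral_hcube)
    qed (use \<alpha> \<beta> W0 in auto)
    have Wd: "W z powr (1 + \<delta>) = V z powr (q * (1 + \<delta>))" for z by (simp add: W_def powr_powr)
    show "RH (q * (1 + \<delta>)) (c * C powr (1 + \<delta>)) V"
      unfolding RH_def
    proof (intro conjI allI impI)
      show "V \<in> borel_measurable borel" by measurable
      show "0 \<le> V x" for x by (rule V0)
      show "AE x in lborel. 0 < V x" by (rule RH_D(3)[OF V])
      show "set_integrable lborel (cube x r) V" for x r by (rule RH_D(4)[OF V])
      show "set_integrable lborel (cube x r) (\<lambda>x. V x powr (q * (1 + \<delta>)))" for x r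
        unfolding set_integrable_def
      proof (rule Bochner_Integration.integrable_bound[where f="\<lambda>z. indicator (cube x r) z *\<^sub>R (k powr (q * (1 + \<delta>)))"])
        show "integrable lborel (\<lambda>z. indicator (cube x r) z *\<^sub>R (k powr (q * (1 + \<delta>))))"
          using set_integrable_cube_const[of x r] unfolding set_integrable_def .
        show "AE z in lborel. norm (indicator (cube x r) z *\<^sub>R V z powr (q * (1 + \<delta>))) \<le> norm (indicator (cube x r) z *\<^sub>R (k powr (q * (1 + \<delta>))))"
          using V0 k q \<delta> by (intro AE_I2) (auto simp: indicator_def intro!: powr_mono2)
      qed measurable
      fix x :: 'a and r :: real assume r: "0 < r"
      define n where "n = (2 * r) ^ DIM('a)"
      have n: "0 < n" using r by (simp add: n_def)
      define A where "A = (LINT z:cube x r|lborel. V z) / n"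
      have A: "0 < A" using RH_integral_pos[OF V r, of x] n by (simp add: A_def)
      define I where "I = (LINT z:cube x r|lborel. W z)"
      have I: "0 < I" unfolding I_def by (rule Wpos[OF r])
      have In: "I / n \<le> C * A powr q"
        using RH_D(6)[OF V r, of x] n by (simp add: I_def W_def A_def n_def divide_le_eq mult_ac)
      have "(LINT z:cube x r|lborel. V z powr (q * (1 + \<delta>))) = (LINT z:hcube x r|lborel. W z powr (1 + \<delta>))"
        unfolding Wd by (rule set_integral_hcube[symmetric]) measurable
      also have "\<dots> \<le> c * (LINT z:hcube x r|lborel. W z) * avg x r powr \<delta>"
        unfolding c_def by (rule reverse_Hoelder_improvement[OF \<delta> \<delta>2 r])
      also have "\<dots> = c * n * (I / n * (I / n) powr \<delta>)"
        unfolding avg_def set_integral_hcube[OF W_measurable] n_def[symmetric] I_def[symmetric] using n by simp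
      also have "I / n * (I / n) powr \<delta> = (I / n) powr (1 + \<delta>)" using I n by (simp add: powr_add)
      also have "c * n * (I / n) powr (1 + \<delta>) \<le> c * n * (C * A powr q) powr (1 + \<delta>)"
        using In I n c \<delta> by (intro mult_left_mono powr_mono2) auto
      also have "(C * A powr q) powr (1 + \<delta>) = C powr (1 + \<delta>) * A powr (q * (1 + \<delta>))"
        using C A by (simp add: powr_mult powr_powr)
      finally show "(LINT z:cube x r|lborel. V z powr (q * (1 + \<delta>)))
        \<le> c * C powr (1 + \<delta>) * (2 * r) ^ DIM('a) * ((LINT z:cube x r|lborel. V z) / (2 * r) ^ DIM('a)) powr (q * (1 + \<delta>))"
        unfolding n_def A_def by (simp add: mult_ac)
    qed
  qed
qed

section \<open>Unbounded potentials\<close>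

lemma test_function_C2:
  fixes u :: "'a::euclidean_space \<Rightarrow> 'b::real_normed_vector"
  assumes u: "u \<in> test_functions"
  shows "C2_with u (\<lambda>b x. frechet_derivative u (at x) b)
    (\<lambda>b x. frechet_derivative (\<lambda>y. frechet_derivative u (at y) b) (at x) b)"
proof -
  have Ck: "Ck k u" for k using u by (auto simp: test_functions_def)
  have line: "((\<lambda>h. v (x + h *\<^sub>R b)) has_vector_derivative frechet_derivative v (at x) b) (at 0)"
    if "\<And>x. v differentiable (at x)" for v :: "'a \<Rightarrow> 'b" and x b
  proof -
    have d: "(v has_derivative frechet_derivative v (at x)) (at x)" using that frechet_derivative_works by blast
    have l: "((\<lambda>h. x + h *\<^sub>R b) has_derivative (\<lambda>h. h *\<^sub>R b)) (at 0)" by (auto intro!: derivative_eq_intros)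
    have "(v \<circ> (\<lambda>h. x + h *\<^sub>R b) has_derivative frechet_derivative v (at x) \<circ> (\<lambda>h. h *\<^sub>R b)) (at 0)"
      by (rule diff_chain_at[OF l]) (use d in simp)
    moreover have "frechet_derivative v (at x) \<circ> (\<lambda>h. h *\<^sub>R b) = (\<lambda>h. h *\<^sub>R frechet_derivative v (at x) b)"
      using linear_scale[OF has_derivative_linear[OF d]] by (auto simp: fun_eq_iff)
    ultimately show ?thesis by (simp add: has_vector_derivative_def o_def)
  qed
  have d1: "u differentiable (at x)" for x using Ck[of 1] by simp
  have d2: "(\<lambda>y. frechet_derivative u (at y) b) differentiable (at x)" for x b
    using Ck[of "Suc (Suc 0)"] by simp
  show ?thesis unfolding C2_with_def
  proof (intro conjI ballI allI)
    show "continuous_on UNIV u" using Ck[of 0] by simp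
    show "continuous_on UNIV (\<lambda>x. frechet_derivative u (at x) b)" for b using Ck[of "Suc 0"] by simp
    show "continuous_on UNIV (\<lambda>x. frechet_derivative (\<lambda>y. frechet_derivative u (at y) b) (at x) b)" for b
      using Ck[of "Suc (Suc 0)"] by simp
  qed (use line[OF d1] line[OF d2] in auto)
qed

lemma Lp_norm_le_of_nn_integral_le:
  assumes K: "0 < K" and p: "0 < p"
    and le: "(\<integral>\<^sup>+x. ennreal (norm (f x) powr p) \<partial>M) \<le> ennreal K * (\<integral>\<^sup>+x. ennreal (norm (g x) powr p) \<partial>M)"
  shows "Lp_norm M (ereal p) f \<le> ennreal (K powr (1 / p)) * Lp_norm M (ereal p) g"
proof -
  define I where "I = (\<integral>\<^sup>+x. ennreal (norm (f x) powr p) \<partial>M)"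
  define J where "J = (\<integral>\<^sup>+x. ennreal (norm (g x) powr p) \<partial>M)"
  have f: "Lp_norm M (ereal p) f = (if I = \<infinity> then \<infinity> else ennreal (enn2real I powr (1 / p)))"
    by (simp add: Lp_norm_def I_def Let_def)
  have g: "Lp_norm M (ereal p) g = (if J = \<infinity> then \<infinity> else ennreal (enn2real J powr (1 / p)))"
    by (simp add: Lp_norm_def J_def Let_def)
  show ?thesis
  proof (cases "J = \<infinity>")
    case True
    then show ?thesis unfolding g using K by (simp add: ennreal_mult_top)
  next
    case False
    then obtain j where j: "J = ennreal j" "0 \<le> j" by (cases J) auto
    have IJ: "I \<le> ennreal (K * j)" using le K j unfolding I_def[symmetric] J_def[symmetric] by (simp add: ennreal_mult')
    then have "I \<noteq> \<infinity>" by (auto simp: top_unique)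
    then obtain i where i: "I = ennreal i" "0 \<le> i" by (cases I) auto
    have "i \<le> K * j" using IJ K j i by (simp add: ennreal_le_iff)
    then have "i powr (1 / p) \<le> (K * j) powr (1 / p)" using i p by (intro powr_mono2) auto
    also have "\<dots> = K powr (1 / p) * j powr (1 / p)" using K j by (simp add: powr_mult)
    finally show ?thesis unfolding f g using i j by (simp add: ennreal_mult[symmetric] ennreal_leI)
  qed
qed

lemma powr_sum3_le:
  fixes a b c p :: real
  assumes "0 \<le> a" "0 \<le> b" "0 \<le> c" "0 < p"
  shows "(a + b + c) powr p \<le> 3 powr p * (a powr p + b powr p + c powr p)"
proof -
  define m where "m = max a (max b c)"
  have m: "0 \<le> m" "a + b + c \<le> 3 * m" using assms by (auto simp: m_def)
  have "(a + b + c) powr p \<le> (3 * m) powr p" using assms m by (intro powr_mono2) auto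
  also have "\<dots> = 3 powr p * m powr p" using m by (simp add: powr_mult)
  also have "m powr p \<le> a powr p + b powr p + c powr p"
    by (auto simp: m_def max_def)
  finally show ?thesis by simp
qed

text \<open>Apply \<open>bounded_potential_estimate\<close> to \<open>min V k\<close> with \<open>d = 1 / k\<close> and let \<open>k\<close> tend to infinity. The error terms
  are \<open>(V - min V k) u\<close> and \<open>d u\<close>, which tend to zero in \<open>L\<^sup>p\<close> because the uniform reverse Hoelder inequality
  makes \<open>V\<^sup>p\<close> integrable on the support of \<open>u\<close>; Fatou's lemma handles the left side.\<close>

lemma unbounded_potential_estimate:
  assumes p: "1 < p"
  obtains c where "0 < c"
    "\<And>(V :: 'a::euclidean_space \<Rightarrow> real) (u :: 'a \<Rightarrow> 'b::{banach, second_countable_topology}) D1 D2 S.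
       V \<in> borel_measurable borel \<Longrightarrow> (\<And>x. 0 \<le> V x) \<Longrightarrow> (\<And>x r. set_integrable lborel (cube x r) V) \<Longrightarrow>
       (\<And>k. 0 < k \<Longrightarrow> RH p C (\<lambda>x. min (V x) k)) \<Longrightarrow>
       C2_with u D1 D2 \<Longrightarrow> compact S \<Longrightarrow> (\<And>x. x \<notin> S \<Longrightarrow> u x = 0) \<Longrightarrow>
       (\<integral>\<^sup>+x. ennreal (norm (V x *\<^sub>R u x) powr p) \<partial>lborel)
         \<le> ennreal c * (\<integral>\<^sup>+x. ennreal (norm (V x *\<^sub>R u x - (\<Sum>b\<in>Basis. D2 b x)) powr p) \<partial>lborel)"
proof -
  obtain c where c: "0 < c" and est:
    "\<And>(V :: 'a \<Rightarrow> real) k d (u :: 'a \<Rightarrow> 'b) D1 D2 S. RH p C V \<Longrightarrow> (\<And>x. V x \<le> k) \<Longrightarrow> 0 < d \<Longrightarrow>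
       C2_with u D1 D2 \<Longrightarrow> compact S \<Longrightarrow> (\<And>x. x \<notin> S \<Longrightarrow> u x = 0) \<Longrightarrow>
       (\<integral>\<^sup>+x. ennreal (V x powr p * norm (u x) powr p) \<partial>lborel)
         \<le> ennreal c * (\<integral>\<^sup>+x. ennreal (norm ((d + V x) *\<^sub>R u x - (\<Sum>b\<in>Basis. D2 b x)) powr p) \<partial>lborel)"
  proof (rule bounded_potential_estimate[OF p, where C=C and 'a='a and 'b='b], goal_cases)
    case (1 c)
    show ?case by (rule 1(1)[OF 1(2,3)])
  qed
  show thesis
  proof (rule that[of "c * 3 powr p"])
    show "0 < c * 3 powr p" using c by simp
    fix V :: "'a \<Rightarrow> real" and u :: "'a \<Rightarrow> 'b" and D1 D2 S
    assume V [measurable]: "V \<in> borel_measurable borel" and V0: "\<And>x. 0 \<le> V x" and iV: "\<And>x r. set_integrable lborel (cube x r) V"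
      and RHk: "\<And>k. 0 < k \<Longrightarrow> RH p C (\<lambda>x. min (V x) k)"
      and u: "C2_with u D1 D2" and S: "compact S" "\<And>x. x \<notin> S \<Longrightarrow> u x = 0"
    have [measurable]: "u \<in> borel_measurable borel" "\<And>b. b \<in> Basis \<Longrightarrow> D2 b \<in> borel_measurable borel"
      using u by (auto simp: C2_with_def intro: borel_measurable_continuous_onI)
    obtain M where M: "\<And>x. norm (u x) \<le> M" using C2_with_bounded[OF u S] by blast
    have M0: "0 \<le> M" using M[of 0] norm_ge_zero order_trans by blast
    obtain R where R: "0 < R" "S \<subseteq> cube 0 R"
    proof -
      obtain R where "0 < R" "S \<subseteq> ball 0 R" using compact_imp_bounded[OF S(1)] bounded_subset_ballD[of S 0] by blast
      then show thesis using that[of R] ball_subset_cube[of 0 R] by blast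
    qed
    have u0: "u x = 0" if "x \<notin> cube 0 R" for x using S(2)[of x] R that by blast
    \<comment> \<open>Indexing by \<open>Suc i\<close> keeps both the truncation level and its reciprocal positive.\<close>
    define U where "U i x = min (V x) (real (Suc i))" for i x
    have [measurable]: "U i \<in> borel_measurable borel" for i unfolding U_def by measurable
    have U: "0 \<le> U i x" "U i x \<le> V x" "U i x \<le> real (Suc i)" for i x using V0[of x] by (auto simp: U_def)
    have Ulim: "(\<lambda>i. U i x) \<longlonglongrightarrow> V x" for x
    proof (rule tendsto_eventually)
      show "eventually (\<lambda>i. U i x = V x) sequentially"
        using eventually_ge_at_top[of "nat \<lceil>V x\<rceil>"]
      proof eventually_elim
        case (elim i)
        then have "V x \<le> real (Suc i)" by linarith
        then show ?case by (simp add: U_def)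
      qed
    qed
    define th where "th x = V x *\<^sub>R u x - (\<Sum>b\<in>Basis. D2 b x)" for x
    have [measurable]: "th \<in> borel_measurable borel" unfolding th_def by measurable
    define n where "n = (2 * R) ^ DIM('a)"
    have n: "0 < n" using R by (simp add: n_def)
    have Vp_fin: "(\<integral>\<^sup>+x. indicator (cube 0 R) x * ennreal (V x powr p) \<partial>lborel) < \<infinity>"
    proof -
      define B where "B = \<bar>C\<bar> * n * ((LINT x:cube 0 R|lborel. V x) / n) powr p"
      have bd: "(\<integral>\<^sup>+x. indicator (cube 0 R) x * ennreal (U i x powr p) \<partial>lborel) \<le> ennreal B" for i
      proof -
        have RHi: "RH p C (U i)" unfolding U_def by (rule RHk) simp
        have "(LINT x:cube 0 R|lborel. U i x powr p) \<le> C * n * ((LINT x:cube 0 R|lborel. U i x) / n) powr p"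
          unfolding n_def by (rule RH_D(6)[OF RHi R(1)])
        also have "\<dots> \<le> \<bar>C\<bar> * n * ((LINT x:cube 0 R|lborel. U i x) / n) powr p"
          using n by (intro mult_right_mono) auto
        also have "\<dots> \<le> B" unfolding B_def
        proof (intro mult_left_mono powr_mono2 divide_right_mono)
          show "(LINT x:cube 0 R|lborel. U i x) \<le> (LINT x:cube 0 R|lborel. V x)"
            by (rule set_integral_mono[OF RH_D(4)[OF RHi] iV]) (rule U)
        qed (use n p RH_integral_pos[OF RHi R(1), of 0] in auto)
        finally have "(LINT x:cube 0 R|lborel. U i x powr p) \<le> B" .
        then show ?thesis by (subst nn_set_integral_eq[OF RH_D(5)[OF RHi]]) (auto intro: ennreal_leI)
      qed
      have "(\<integral>\<^sup>+x. indicator (cube 0 R) x * ennreal (V x powr p) \<partial>lborel)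
        = (\<integral>\<^sup>+x. liminf (\<lambda>i. indicator (cube 0 R) x * ennreal (U i x powr p)) \<partial>lborel)"
      proof (intro nn_integral_cong lim_imp_Liminf[symmetric])
        fix x
        have "(\<lambda>i. U i x powr p) \<longlonglongrightarrow> V x powr p"
          using p by (intro tendsto_powr' Ulim tendsto_const) (auto simp: U)
        then show "(\<lambda>i. indicator (cube 0 R) x * ennreal (U i x powr p)) \<longlonglongrightarrow> indicator (cube 0 R) x * ennreal (V x powr p)"
          by (cases "x \<in> cube 0 R") (auto intro: tendsto_ennrealI)
      qed simp
      also have "\<dots> \<le> liminf (\<lambda>i. \<integral>\<^sup>+x. indicator (cube 0 R) x * ennreal (U i x powr p) \<partial>lborel)"
        by (rule nn_integral_liminf) measurable
      also have "\<dots> \<le> liminf (\<lambda>i. ennreal B)" by (intro Liminf_mono always_eventually allI bd)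
      also have "\<dots> = ennreal B" by (simp add: Liminf_const)
      finally show ?thesis by (simp add: le_less_trans)
    qed
    define e1 where "e1 i = (\<integral>\<^sup>+x. ennreal (((V x - U i x) * norm (u x)) powr p) \<partial>lborel)" for i
    define e2 where "e2 i = (\<integral>\<^sup>+x. ennreal ((1 / real (Suc i) * norm (u x)) powr p) \<partial>lborel)" for i
    have e1: "e1 \<longlonglongrightarrow> 0"
    proof -
      have "(\<lambda>i. \<integral>\<^sup>+x. ennreal (((V x - U i x) * norm (u x)) powr p) \<partial>lborel) \<longlonglongrightarrow> (\<integral>\<^sup>+x. 0 \<partial>(lborel :: 'a measure))"
      proof (rule nn_integral_dominated_convergence[where w="\<lambda>x. ennreal (M powr p) * (indicator (cube 0 R) x * ennreal (V x powr p))"])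
        show "AE x in lborel. ennreal (((V x - U i x) * norm (u x)) powr p) \<le> ennreal (M powr p) * (indicator (cube 0 R) x * ennreal (V x powr p))" for i
        proof (rule AE_I2)
          fix x
          show "ennreal (((V x - U i x) * norm (u x)) powr p) \<le> ennreal (M powr p) * (indicator (cube 0 R) x * ennreal (V x powr p))"
          proof (cases "x \<in> cube 0 R")
            case True
            have "((V x - U i x) * norm (u x)) powr p \<le> (V x * M) powr p"
              using U[of i x] V0[of x] M[of x] p by (intro powr_mono2 mult_mono) auto
            also have "\<dots> = M powr p * V x powr p" using V0[of x] M0 by (simp add: powr_mult mult.commute)
            finally show ?thesis using True by (simp add: ennreal_mult[symmetric] ennreal_leI)
          next
            case False
            then show ?thesis using u0 by simp
          qed
        qed
        show "(\<integral>\<^sup>+x. ennreal (M powr p) * (indicator (cube 0 R) x * ennreal (V x powr p)) \<partial>lborel) < \<infinity>"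
          using Vp_fin by (simp add: nn_integral_cmult ennreal_mult_less_top)
        show "AE x in lborel. (\<lambda>i. ennreal (((V x - U i x) * norm (u x)) powr p)) \<longlonglongrightarrow> 0"
        proof (rule AE_I2)
          fix x
          have "(\<lambda>i. ((V x - U i x) * norm (u x)) powr p) \<longlonglongrightarrow> ((V x - V x) * norm (u x)) powr p"
            using p U by (intro tendsto_powr' tendsto_mult tendsto_diff Ulim tendsto_const) auto
          then have "(\<lambda>i. ennreal (((V x - U i x) * norm (u x)) powr p)) \<longlonglongrightarrow> ennreal 0"
            using p by (intro tendsto_ennrealI) simp
          then show "(\<lambda>i. ennreal (((V x - U i x) * norm (u x)) powr p)) \<longlonglongrightarrow> 0" by simp
        qed
      qed measurable
      then show ?thesis by (simp add: e1_def[abs_def])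
    qed
    have e2: "e2 \<longlonglongrightarrow> 0"
    proof -
      have t0: "(\<lambda>i. 1 / real (Suc i)) \<longlonglongrightarrow> 0" using LIMSEQ_inverse_real_of_nat by (simp add: inverse_eq_divide)
      have "(\<lambda>i. \<integral>\<^sup>+x. ennreal ((1 / real (Suc i) * norm (u x)) powr p) \<partial>lborel) \<longlonglongrightarrow> (\<integral>\<^sup>+x. 0 \<partial>(lborel :: 'a measure))"
      proof (rule nn_integral_dominated_convergence[where w="\<lambda>x. ennreal (M powr p) * indicator (cube 0 R) x"])
        show "AE x in lborel. ennreal ((1 / real (Suc i) * norm (u x)) powr p) \<le> ennreal (M powr p) * indicator (cube 0 R) x" for i
        proof (rule AE_I2)
          fix x
          show "ennreal ((1 / real (Suc i) * norm (u x)) powr p) \<le> ennreal (M powr p) * indicator (cube 0 R) x"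
          proof (cases "x \<in> cube 0 R")
            case True
            have "1 / real (Suc i) * norm (u x) \<le> 1 * M" using M[of x] by (intro mult_mono) auto
            then have "(1 / real (Suc i) * norm (u x)) powr p \<le> M powr p" using p by (intro powr_mono2) auto
            then show ?thesis using True by (simp add: ennreal_leI)
          next
            case False
            then show ?thesis using u0 by simp
          qed
        qed
        show "(\<integral>\<^sup>+x. ennreal (M powr p) * indicator (cube 0 R) x \<partial>(lborel :: 'a measure)) < \<infinity>"
          using emeasure_cube_finite[of "0::'a" R] by (simp add: nn_integral_cmult_indicator ennreal_mult_less_top)
        show "AE x in lborel. (\<lambda>i. ennreal ((1 / real (Suc i) * norm (u x)) powr p)) \<longlonglongrightarrow> 0"
        proof (rule AE_I2)
          fix x
          have "(\<lambda>i. (1 / real (Suc i) * norm (u x)) powr p) \<longlonglongrightarrow> (0 * norm (u x)) powr p"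
            using p by (intro tendsto_powr' tendsto_mult t0 tendsto_const) auto
          then have "(\<lambda>i. ennreal ((1 / real (Suc i) * norm (u x)) powr p)) \<longlonglongrightarrow> ennreal 0"
            using p by (intro tendsto_ennrealI) simp
          then show "(\<lambda>i. ennreal ((1 / real (Suc i) * norm (u x)) powr p)) \<longlonglongrightarrow> 0" by simp
        qed
      qed measurable
      then show ?thesis by (simp add: e2_def[abs_def])
    qed
    define F where "F = (\<integral>\<^sup>+x. ennreal (norm (th x) powr p) \<partial>lborel)"
    have main: "(\<integral>\<^sup>+x. ennreal (U i x powr p * norm (u x) powr p) \<partial>lborel) \<le> ennreal (c * 3 powr p) * (F + e1 i + e2 i)" for i
    proof -
      have RHi: "RH p C (U i)" unfolding U_def by (rule RHk) simp
      have "(\<integral>\<^sup>+x. ennreal (U i x powr p * norm (u x) powr p) \<partial>lborel)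
        \<le> ennreal c * (\<integral>\<^sup>+x. ennreal (norm ((1 / real (Suc i) + U i x) *\<^sub>R u x - (\<Sum>b\<in>Basis. D2 b x)) powr p) \<partial>lborel)"
        by (rule est[OF RHi U(3) _ u S]) auto
      also have "\<dots> \<le> ennreal c * (\<integral>\<^sup>+x. ennreal (3 powr p) * (ennreal (norm (th x) powr p) + ennreal (((V x - U i x) * norm (u x)) powr p) + ennreal ((1 / real (Suc i) * norm (u x)) powr p)) \<partial>lborel)"
      proof (intro mult_left_mono nn_integral_mono)
        fix x
        have "(1 / real (Suc i) + U i x) *\<^sub>R u x - (\<Sum>b\<in>Basis. D2 b x) = th x + (- ((V x - U i x) *\<^sub>R u x)) + (1 / real (Suc i)) *\<^sub>R u x"
          by (simp add: th_def algebra_simps)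
        also have "norm \<dots> \<le> norm (th x) + norm (- ((V x - U i x) *\<^sub>R u x)) + norm ((1 / real (Suc i)) *\<^sub>R u x)"
          by (intro order_trans[OF norm_triangle_ineq] add_mono norm_triangle_ineq order_refl)
        also have "\<dots> = norm (th x) + (V x - U i x) * norm (u x) + 1 / real (Suc i) * norm (u x)"
          using U[of i x] by simp
        finally have "norm ((1 / real (Suc i) + U i x) *\<^sub>R u x - (\<Sum>b\<in>Basis. D2 b x)) powr p
           \<le> (norm (th x) + (V x - U i x) * norm (u x) + 1 / real (Suc i) * norm (u x)) powr p"
          using p by (intro powr_mono2) auto
        also have "\<dots> \<le> 3 powr p * (norm (th x) powr p + ((V x - U i x) * norm (u x)) powr p + (1 / real (Suc i) * norm (u x)) powr p)"
          using p U[of i x] by (intro powr_sum3_le) auto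
        finally have "ennreal (norm ((1 / real (Suc i) + U i x) *\<^sub>R u x - (\<Sum>b\<in>Basis. D2 b x)) powr p)
           \<le> ennreal (3 powr p * (norm (th x) powr p + ((V x - U i x) * norm (u x)) powr p + (1 / real (Suc i) * norm (u x)) powr p))"
          by (rule ennreal_leI)
        then show "ennreal (norm ((1 / real (Suc i) + U i x) *\<^sub>R u x - (\<Sum>b\<in>Basis. D2 b x)) powr p)
           \<le> ennreal (3 powr p) * (ennreal (norm (th x) powr p) + ennreal (((V x - U i x) * norm (u x)) powr p) + ennreal ((1 / real (Suc i) * norm (u x)) powr p))"
          by (simp add: ennreal_mult)
      qed simp
      also have "\<dots> = ennreal c * (ennreal (3 powr p) * (F + e1 i + e2 i))"
        unfolding F_def e1_def e2_def by (subst nn_integral_cmult, measurable) (simp add: nn_integral_add)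
      finally show ?thesis using c by (simp add: ennreal_mult' mult.assoc)
    qed
    have "(\<integral>\<^sup>+x. ennreal (norm (V x *\<^sub>R u x) powr p) \<partial>lborel) = (\<integral>\<^sup>+x. liminf (\<lambda>i. ennreal (U i x powr p * norm (u x) powr p)) \<partial>lborel)"
    proof (intro nn_integral_cong lim_imp_Liminf[symmetric])
      fix x
      have "(\<lambda>i. U i x powr p * norm (u x) powr p) \<longlonglongrightarrow> V x powr p * norm (u x) powr p"
        using p by (intro tendsto_mult tendsto_powr' Ulim tendsto_const) (auto simp: U)
      moreover have "V x powr p * norm (u x) powr p = norm (V x *\<^sub>R u x) powr p" using V0[of x] by (simp add: powr_mult)
      ultimately show "(\<lambda>i. ennreal (U i x powr p * norm (u x) powr p)) \<longlonglongrightarrow> ennreal (norm (V x *\<^sub>R u x) powr p)"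
        by (intro tendsto_ennrealI) simp
    qed simp
    also have "\<dots> \<le> liminf (\<lambda>i. \<integral>\<^sup>+x. ennreal (U i x powr p * norm (u x) powr p) \<partial>lborel)"
      by (rule nn_integral_liminf) measurable
    also have "\<dots> \<le> liminf (\<lambda>i. ennreal (c * 3 powr p) * (F + e1 i + e2 i))"
      by (intro Liminf_mono always_eventually allI main)
    also have "\<dots> = ennreal (c * 3 powr p) * (F + 0 + 0)"
      by (intro lim_imp_Liminf ennreal_tendsto_cmult tendsto_add tendsto_const e1 e2) auto
    finally show "(\<integral>\<^sup>+x. ennreal (norm (V x *\<^sub>R u x) powr p) \<partial>lborel)
         \<le> ennreal (c * 3 powr p) * (\<integral>\<^sup>+x. ennreal (norm (V x *\<^sub>R u x - (\<Sum>b\<in>Basis. D2 b x)) powr p) \<partial>lborel)"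
      by (simp add: F_def th_def)
  qed
qed

section \<open>The estimate for test functions\<close>

lemma is_cube_cube: "0 < r \<Longrightarrow> is_cube (cube x r)"
proof -
  assume r: "0 < r"
  have eq: "x - r *\<^sub>R One + (2 * r) *\<^sub>R One = x + r *\<^sub>R One"
    by (simp only: mult_2 scaleR_left_distrib) simp
  show ?thesis unfolding is_cube_def cube_def
  proof (intro exI conjI)
    show "0 < 2 * r" using r by simp
    show "cbox (x - r *\<^sub>R One) (x + r *\<^sub>R One) = cbox (x - r *\<^sub>R One) (x - r *\<^sub>R One + (2 * r) *\<^sub>R One)"
      unfolding eq ..
  qed
qed

lemma Lp_loc_finite_exponent:
  fixes V :: "'a::euclidean_space \<Rightarrow> real"
  assumes V: "V \<in> Lp_loc (ereal q)"
  shows "set_integrable lebesgue (cube x r) (\<lambda>x. \<bar>V x\<bar> powr q)"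
proof -
  have [measurable]: "V \<in> borel_measurable lebesgue" using V by (simp add: Lp_loc_def)
  have c [measurable]: "cube x r \<in> sets lebesgue" by simp
  have "Lp_norm (restrict_space lebesgue (cube x r)) (ereal q) V < \<infinity>"
    using V by (auto simp: Lp_loc_def cube_def)
  then have "(\<integral>\<^sup>+x. ennreal (norm (V x) powr q) \<partial>restrict_space lebesgue (cube x r)) \<noteq> \<infinity>"
    unfolding Lp_norm_def Let_def by (auto split: if_splits)
  also have "(\<integral>\<^sup>+x. ennreal (norm (V x) powr q) \<partial>restrict_space lebesgue (cube x r))
      = (\<integral>\<^sup>+z. ennreal (norm (V z) powr q) * indicator (cube x r) z \<partial>lebesgue)"
    using c by (subst nn_integral_restrict_space) auto
  also have "\<dots> = (\<integral>\<^sup>+z. ennreal (indicator (cube x r) z *\<^sub>R \<bar>V z\<bar> powr q) \<partial>lebesgue)"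
    by (intro nn_integral_cong) (auto simp: indicator_def)
  finally show ?thesis unfolding set_integrable_def
    by (intro integrableI_nonneg) (auto simp: less_top)
qed

lemma Lp_loc_bounded:
  fixes V :: "'a::euclidean_space \<Rightarrow> real"
  assumes V: "V \<in> Lp_loc \<infinity>"
  obtains B where "AE z in lebesgue. z \<in> cube x r \<longrightarrow> \<bar>V z\<bar> \<le> B"
proof -
  have "Lp_norm (restrict_space lebesgue (cube x r)) \<infinity> V < \<infinity>"
    using V by (auto simp: Lp_loc_def cube_def)
  then have fin: "esssup (restrict_space lebesgue (cube x r)) (\<lambda>x. ennreal (norm (V x))) < \<infinity>"
    by (simp add: Lp_norm_def)
  define E where "E = esssup (restrict_space lebesgue (cube x r)) (\<lambda>x. ennreal (norm (V x)))"
  have E: "E = ennreal (enn2real E)" using fin by (simp add: E_def)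
  have "AE z in restrict_space lebesgue (cube x r). ennreal (norm (V z)) \<le> E"
    unfolding E_def by (rule esssup_AE)
  then have "AE z in lebesgue. z \<in> cube x r \<longrightarrow> ennreal (norm (V z)) \<le> E"
    by (subst (asm) AE_restrict_space_iff) auto
  then have "AE z in lebesgue. z \<in> cube x r \<longrightarrow> \<bar>V z\<bar> \<le> enn2real E"
    by eventually_elim (subst (asm) E, simp)
  then show thesis by (rule that)
qed

text \<open>Weights in the reverse Hoelder class are Lebesgue measurable and positive almost everywhere. A Borel
  representative, with negative values cut off, changes no integral. For \<open>q = \<infinity>\<close> the essential bound on a cube
  yields every finite exponent.\<close>

lemma reverse_Hoelder_imp_RH:
  fixes V :: "'a::euclidean_space \<Rightarrow> real"
  assumes q: "1 < q" and V: "V \<in> reverse_Hoelder q"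
  obtains U where "AE x in lborel. V x = U x"
    "\<And>p. 1 < p \<Longrightarrow> ereal p \<le> q \<Longrightarrow> \<exists>C. RH p C U"
proof -
  have Vloc: "V \<in> Lp_loc q" and Vpos: "AE x in lebesgue. 0 < V x" using V by (auto simp: reverse_Hoelder_def)
  obtain C0 where C0: "\<And>Q. is_cube Q \<Longrightarrow> Lq_mean q Q V \<le> ennreal (C0 / measure lebesgue Q * (LINT x:Q|lebesgue. V x))"
    using V by (auto simp: reverse_Hoelder_def)
  have Vm [measurable]: "V \<in> borel_measurable lebesgue" using Vloc by (simp add: Lp_loc_def)
  obtain V' where V' [measurable]: "V' \<in> borel_measurable lborel" and VV': "AE x in lborel. V x = V' x"
    using completion_ex_borel_measurable_real[OF Vm] by auto
  define U where "U x = max 0 (V' x)" for x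
  have [measurable]: "U \<in> borel_measurable borel" unfolding U_def using V' by measurable
  have U0: "0 \<le> U x" for x by (simp add: U_def)
  have Upos_leb: "AE x in lebesgue. V x = U x \<and> 0 < U x"
    using Vpos AE_completion[OF VV'] by eventually_elim (auto simp: U_def)
  have AE_back: "AE x in lborel. P x" if "AE x in lebesgue. P x" for P :: "'a \<Rightarrow> bool"
    using that(1) by (simp add: AE_completion_iff)
  have Upos: "AE x in lborel. 0 < U x"
    by (rule AE_back) (use Upos_leb in \<open>auto elim: eventually_mono\<close>)
  have VU: "AE x in lborel. V x = U x"
    using VV' Upos by eventually_elim (auto simp: U_def max_def split: if_splits)
  have VUleb: "AE x in lebesgue. V x = U x" by (rule AE_completion[OF VU])
  have transfer: "(LINT z:cube x r|lebesgue. f (V z)) = (LINT z:cube x r|lborel. f (U z))"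
    if [measurable]: "f \<in> borel_measurable borel" for f :: "real \<Rightarrow> real" and x r
  proof -
    have m: "(\<lambda>z. indicator (cube x r) z *\<^sub>R f (U z)) \<in> borel_measurable lborel" by measurable
    have [measurable]: "cube x r \<in> sets lebesgue" by simp
    have [measurable]: "(\<lambda>z. f (V z)) \<in> borel_measurable lebesgue" by (rule measurable_compose[OF Vm that])
    have "(\<integral>z. indicator (cube x r) z *\<^sub>R f (V z) \<partial>lebesgue) = (\<integral>z. indicator (cube x r) z *\<^sub>R f (U z) \<partial>lebesgue)"
    proof (rule integral_cong_AE)
      show "(\<lambda>z. indicator (cube x r) z *\<^sub>R f (V z)) \<in> borel_measurable lebesgue" by measurable
      show "(\<lambda>z. indicator (cube x r) z *\<^sub>R f (U z)) \<in> borel_measurable lebesgue" using m by (rule measurable_completion)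
      show "AE z in lebesgue. indicator (cube x r) z *\<^sub>R f (V z) = indicator (cube x r) z *\<^sub>R f (U z)"
        using VUleb by eventually_elim simp
    qed
    also have "\<dots> = (\<integral>z. indicator (cube x r) z *\<^sub>R f (U z) \<partial>lborel)" by (rule integral_completion[OF m])
    finally show ?thesis unfolding set_lebesgue_integral_def .
  qed
  define n where "n r = (2 * r) ^ DIM('a)" for r :: real
  define A where "A x r = (LINT z:cube x r|lborel. U z) / n r" for x r
  have J0: "0 \<le> (LINT z:cube x r|lborel. U z)" for x r
    unfolding set_lebesgue_integral_def by (intro integral_nonneg_AE) (auto simp: U0)
  have rhs: "Lq_mean q (cube x r) V \<le> ennreal (\<bar>C0\<bar> * A x r)" if r: "0 < r" for x r
  proof -
    have "Lq_mean q (cube x r) V \<le> ennreal (C0 / n r * (LINT z:cube x r|lborel. U z))"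
      using C0[OF is_cube_cube[OF r, of x]] r transfer[of "\<lambda>x. x" x r] by (simp add: measure_cube n_def)
    also have "\<dots> \<le> ennreal (\<bar>C0\<bar> * A x r)"
    proof (rule ennreal_leI)
      have "C0 * A x r \<le> \<bar>C0\<bar> * A x r" using J0[of x r] r by (intro mult_right_mono) (auto simp: A_def n_def)
      then show "C0 / n r * (LINT z:cube x r|lborel. U z) \<le> \<bar>C0\<bar> * A x r" by (simp add: A_def)
    qed
    finally show ?thesis .
  qed
  have "\<exists>C. RH p C U" if p: "1 < p" "ereal p \<le> q" for p
  proof (cases q)
    case (real s)
    have s: "1 < s" "p \<le> s" using p q real by auto
    have int_s: "set_integrable lborel (cube x r) (\<lambda>z. U z powr s)" for x r
    proof -
      have "set_integrable lebesgue (cube x r) (\<lambda>z. \<bar>V z\<bar> powr s)" using Lp_loc_finite_exponent Vloc real by blast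
      then have "integrable lebesgue (\<lambda>z. indicator (cube x r) z *\<^sub>R U z powr s)"
        unfolding set_integrable_def
        by (rule integrable_cong_AE_imp)
          (use VUleb in \<open>auto intro!: measurable_completion elim!: eventually_mono simp: U0\<close>)
      then show ?thesis unfolding set_integrable_def by (subst (asm) integrable_completion) auto
    qed
    have int_1: "set_integrable lborel (cube x r) U" for x r
      unfolding set_integrable_def
    proof (rule Bochner_Integration.integrable_bound)
      show "integrable lborel (\<lambda>z. indicator (cube x r) z *\<^sub>R (1 + U z powr s))"
        using set_integral_add(1)[OF set_integrable_cube_const int_s, of x r 1] unfolding set_integrable_def by simp
      show "AE z in lborel. norm (indicator (cube x r) z *\<^sub>R U z) \<le> norm (indicator (cube x r) z *\<^sub>R (1 + U z powr s))"
        using power_split_le[OF U0, of 1 s] s U0 by (intro AE_I2) (auto simp: indicator_def)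
    qed measurable
    have "RH s (\<bar>C0\<bar> powr s) U" unfolding RH_def
    proof (intro conjI allI impI)
      fix x :: 'a and r :: real assume r: "0 < r"
      have n: "0 < n r" using r by (simp add: n_def)
      define I where "I = (LINT z:cube x r|lborel. U z powr s)"
      have I0: "0 \<le> I" unfolding I_def set_lebesgue_integral_def by (intro integral_nonneg_AE) auto
      have "Lq_mean q (cube x r) V = ennreal ((1 / n r * I) powr (1 / s))"
        unfolding Lq_mean_def I_def using real r transfer[of "\<lambda>v. v powr s" x r] by (simp add: measure_cube n_def)
      then have "ennreal ((1 / n r * I) powr (1 / s)) \<le> ennreal (\<bar>C0\<bar> * A x r)" using rhs[OF r, of x] by simp
      moreover have A0: "0 \<le> A x r" using J0[of x r] n by (simp add: A_def)
      ultimately have "(1 / n r * I) powr (1 / s) \<le> \<bar>C0\<bar> * A x r" by (subst (asm) ennreal_le_iff) auto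
      then have "((1 / n r * I) powr (1 / s)) powr s \<le> (\<bar>C0\<bar> * A x r) powr s" using s by (intro powr_mono2) auto
      then have "1 / n r * I \<le> \<bar>C0\<bar> powr s * A x r powr s"
        using s n I0 A0 by (simp add: powr_powr powr_mult)
      then show "(LINT z:cube x r|lborel. U z powr s) \<le> \<bar>C0\<bar> powr s * (2 * r) ^ DIM('a) * ((LINT z:cube x r|lborel. U z) / (2 * r) ^ DIM('a)) powr s"
        unfolding I_def[symmetric] A_def n_def[symmetric] using n by (simp add: divide_le_eq mult_ac)
    qed (use U0 Upos int_s int_1 in auto)
    from RH_lower_exponent[OF this, of p] p s show ?thesis by auto
  next
    case PInf
    have bd: "AE z in lborel. z \<in> cube x r \<longrightarrow> U z \<le> B" if "AE z in lebesgue. z \<in> cube x r \<longrightarrow> V z \<le> B" for x r B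
    proof (rule AE_back)
      show "AE z in lebesgue. z \<in> cube x r \<longrightarrow> U z \<le> B" using that VUleb by eventually_elim auto
    qed
    have locb: "\<exists>B. AE z in lborel. z \<in> cube x r \<longrightarrow> U z \<le> B" for x r
    proof -
      obtain B where "AE z in lebesgue. z \<in> cube x r \<longrightarrow> \<bar>V z\<bar> \<le> B" using Lp_loc_bounded Vloc PInf by blast
      then have "AE z in lebesgue. z \<in> cube x r \<longrightarrow> V z \<le> B" by eventually_elim auto
      then show ?thesis using bd by blast
    qed
    have int_t: "set_integrable lborel (cube x r) (\<lambda>z. U z powr t)" if "0 < t" for x r t
    proof -
      obtain B where B: "AE z in lborel. z \<in> cube x r \<longrightarrow> U z \<le> B" using locb by blast
      show ?thesis unfolding set_integrable_def
      proof (rule Bochner_Integration.integrable_bound)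
        show "integrable lborel (\<lambda>z. indicator (cube x r) z *\<^sub>R (\<bar>B\<bar> powr t))"
          using set_integrable_cube_const[of x r] unfolding set_integrable_def .
        show "AE z in lborel. norm (indicator (cube x r) z *\<^sub>R U z powr t) \<le> norm (indicator (cube x r) z *\<^sub>R (\<bar>B\<bar> powr t))"
          using B by eventually_elim (use that U0 in \<open>auto simp: indicator_def intro!: powr_mono2\<close>)
      qed measurable
    qed
    have int_1: "set_integrable lborel (cube x r) U" for x r using int_t[of 1 x r] by (simp add: U0)
    have "RH p (\<bar>C0\<bar> powr p) U" unfolding RH_def
    proof (intro conjI allI impI)
      fix x :: 'a and r :: real assume r: "0 < r"
      have n: "0 < n r" using r by (simp add: n_def)
      have A0: "0 \<le> A x r" using J0[of x r] n by (simp add: A_def)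
      have "AE z in restrict_space lebesgue (cube x r). ennreal (V z) \<le> Lq_mean q (cube x r) V"
        unfolding Lq_mean_def using PInf esssup_AE[of "\<lambda>z. ennreal (V z)" "restrict_space lebesgue (cube x r)"] by simp
      then have "AE z in lebesgue. z \<in> cube x r \<longrightarrow> ennreal (V z) \<le> Lq_mean q (cube x r) V"
        by (subst (asm) AE_restrict_space_iff) auto
      then have "AE z in lebesgue. z \<in> cube x r \<longrightarrow> V z \<le> \<bar>C0\<bar> * A x r"
      proof eventually_elim
        case (elim z)
        then have "z \<in> cube x r \<Longrightarrow> ennreal (V z) \<le> ennreal (\<bar>C0\<bar> * A x r)" using rhs[OF r, of x] by auto
        then show ?case using A0 by (auto simp: ennreal_le_iff)
      qed
      then have b: "AE z in lborel. z \<in> cube x r \<longrightarrow> U z \<le> \<bar>C0\<bar> * A x r" by (rule bd)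
      have "(LINT z:cube x r|lborel. U z powr p) \<le> (LINT z:cube x r|lborel. (\<bar>C0\<bar> * A x r) powr p)"
      proof (rule set_integral_mono_AE)
        show "set_integrable lborel (cube x r) (\<lambda>z. U z powr p)" using p by (intro int_t) simp
        show "AE z\<in>cube x r in lborel. U z powr p \<le> (\<bar>C0\<bar> * A x r) powr p"
          using b by eventually_elim (use p U0 in \<open>auto intro!: powr_mono2\<close>)
      qed simp
      also have "\<dots> = \<bar>C0\<bar> powr p * n r * A x r powr p"
        using r A0 by (simp add: set_integral_cube_const n_def powr_mult)
      finally show "(LINT z:cube x r|lborel. U z powr p) \<le> \<bar>C0\<bar> powr p * (2 * r) ^ DIM('a) * ((LINT z:cube x r|lborel. U z) / (2 * r) ^ DIM('a)) powr p"
        unfolding A_def n_def .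
    qed (use U0 Upos int_t p int_1 in auto)
    then show ?thesis by blast
  qed (use q in auto)
  then show thesis using that[OF VU] by blast
qed

lemma RH_mono_const:
  assumes "RH p C V" "C \<le> C'" shows "RH p C' (V :: 'a::euclidean_space \<Rightarrow> real)"
proof -
  have "C * (2 * r) ^ DIM('a) * ((LINT z:cube x r|lborel. V z) / (2 * r) ^ DIM('a)) powr p
    \<le> C' * (2 * r) ^ DIM('a) * ((LINT z:cube x r|lborel. V z) / (2 * r) ^ DIM('a)) powr p" if "0 < r" for x r
    using assms(2) that by (intro mult_right_mono) auto
  then show ?thesis using assms(1) unfolding RH_def by (meson order_trans)
qed

text \<open>For finite \<open>q\<close> the exponents beyond \<open>q\<close> come from Gehring's lemma, applied to the truncations, which are
  bounded and share one reverse Hoelder constant, so that \<open>\<epsilon>\<close> does not depend on the truncation.\<close>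

lemma reverse_Hoelder_truncations:
  fixes V :: "'a::euclidean_space \<Rightarrow> real"
  assumes q: "1 < q" and V: "V \<in> reverse_Hoelder q"
  obtains U \<epsilon> where "AE x in lborel. V x = U x" "U \<in> borel_measurable borel" "\<And>x. 0 \<le> U x"
    "\<And>x r. set_integrable lborel (cube x r) U" "0 < \<epsilon>"
    "\<And>p. 1 < p \<Longrightarrow> ereal p < q + ereal \<epsilon> \<Longrightarrow> \<exists>C. \<forall>k>0. RH p C (\<lambda>x. min (U x) k)"
proof -
  obtain U where VU: "AE x in lborel. V x = U x" and U: "\<And>p. 1 < p \<Longrightarrow> ereal p \<le> q \<Longrightarrow> \<exists>C. RH p C U"
    by (rule reverse_Hoelder_imp_RH[OF q V]) (rule that)
  have trunc: "\<exists>C. \<forall>k>0. RH p C (\<lambda>x. min (U x) k)" if p: "1 < p" "ereal p \<le> q" for p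
  proof -
    obtain C where C: "RH p C U" using U[OF p] by blast
    obtain C' where "\<And>(V :: 'a \<Rightarrow> real) k. RH p C V \<Longrightarrow> 0 < k \<Longrightarrow> RH p C' (\<lambda>x. min (V x) k)"
      by (rule RH_truncate[OF p(1), where C=C and 'a='a]) (rule that)
    then show ?thesis using C by blast
  qed
  obtain p0 where p0: "1 < p0" "ereal p0 \<le> q"
    using q by (cases q) (auto intro: that[of 2])
  obtain C where C: "RH p0 C U" using U p0 by blast
  note UD = RH_D(1,2,4)[OF C]
  show thesis
  proof (cases q)
    case PInf
    show ?thesis
      by (rule that[OF VU UD, of 1]) (use trunc PInf in auto)
  next
    case (real s)
    have s: "1 < s" using q real by simp
    obtain C1 where C1: "\<And>k. 0 < k \<Longrightarrow> RH s C1 (\<lambda>x. min (U x) k)" using trunc[of s] s real by auto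
    define C2 where "C2 = \<bar>C1\<bar> + 1"
    have C2p: "0 < C2" by (simp add: C2_def)
    have C2: "RH s C2 (\<lambda>x. min (U x) k)" if "0 < k" for k
      using RH_mono_const[OF C1[OF that], of C2] by (auto simp: C2_def)
    obtain \<delta> C' where \<delta>: "0 < \<delta>" and gehring: "\<And>(V :: 'a \<Rightarrow> real) k. RH s C2 V \<Longrightarrow> (\<And>x. V x \<le> k) \<Longrightarrow> RH (s * (1 + \<delta>)) C' V"
    proof (rule RH_self_improvement[OF s C2p, where 'a='a], goal_cases)
      case (1 \<delta> C')
      show ?case by (rule 1(1)[OF 1(2,3)])
    qed
    have g: "RH (s * (1 + \<delta>)) C' (\<lambda>x. min (U x) k)" if "0 < k" for k
      by (rule gehring[OF C2[OF that], of k]) simp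
    show ?thesis
    proof (rule that[OF VU UD, of "s * \<delta>"])
      show "0 < s * \<delta>" using s \<delta> by simp
      fix p :: real assume p: "1 < p" "ereal p < q + ereal (s * \<delta>)"
      then have "p \<le> s * (1 + \<delta>)" using real by (simp add: algebra_simps)
      then have "RH p (1 + \<bar>C'\<bar>) (\<lambda>x. min (U x) k)" if "0 < k" for k
        using RH_lower_exponent[OF g[OF that], of p] p by auto
      then show "\<exists>C. \<forall>k>0. RH p C (\<lambda>x. min (U x) k)" by blast
    qed
  qed (use q in auto)
qed

lemma powr_sum2_le:
  fixes a b p :: real
  assumes "0 \<le> a" "0 \<le> b" "0 < p"
  shows "(a + b) powr p \<le> 3 powr p * (a powr p + b powr p)"
  using powr_sum3_le[of a b 0 p] assms by simp

theorem theorem1p1: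
  fixes q :: ereal and V :: "real ^ 'n \<Rightarrow> real"
  assumes "1 < q" and "V \<in> reverse_Hoelder q"
  shows "\<exists>\<epsilon>::real. \<epsilon> > 0 \<and>
    (\<forall>p::real. 1 < p \<and> ereal p < q + ereal \<epsilon> \<longrightarrow>
      (\<exists>C::real. \<forall>u \<in> (test_functions :: (real ^ 'n \<Rightarrow> complex) set).
         Lp_norm lebesgue (ereal p) (laplacian u)
           + Lp_norm lebesgue (ereal p) (\<lambda>x. of_real (V x) * u x)
         \<le> ennreal C * Lp_norm lebesgue (ereal p) (\<lambda>x. - laplacian u x + of_real (V x) * u x)))"
proof -
  obtain U :: "real ^ 'n \<Rightarrow> real" and \<epsilon> where VU: "AE x in lborel. V x = U x" and Um [measurable]: "U \<in> borel_measurable borel"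
    and U0: "\<And>x. 0 \<le> U x" and iU: "\<And>x r. set_integrable lborel (cube x r) U" and \<epsilon>: "0 < \<epsilon>"
    and RHp: "\<And>p. 1 < p \<Longrightarrow> ereal p < q + ereal \<epsilon> \<Longrightarrow> \<exists>C. \<forall>k>0. RH p C (\<lambda>x. min (U x) k)"
    by (rule reverse_Hoelder_truncations[OF assms]) (rule that)
  show ?thesis
  proof (rule exI[of _ \<epsilon>], intro conjI allI impI \<epsilon>)
    fix p :: real assume "1 < p \<and> ereal p < q + ereal \<epsilon>"
    then have p: "1 < p" "ereal p < q + ereal \<epsilon>" by auto
    obtain C where C: "\<And>k. 0 < k \<Longrightarrow> RH p C (\<lambda>x. min (U x) k)" using RHp[OF p] by blast
    obtain c where c: "0 < c" and est: "\<And>(V :: real ^ 'n \<Rightarrow> real) (u :: real ^ 'n \<Rightarrow> complex) D1 D2 S.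
       V \<in> borel_measurable borel \<Longrightarrow> (\<And>x. 0 \<le> V x) \<Longrightarrow> (\<And>x r. set_integrable lborel (cube x r) V) \<Longrightarrow>
       (\<And>k. 0 < k \<Longrightarrow> RH p C (\<lambda>x. min (V x) k)) \<Longrightarrow>
       C2_with u D1 D2 \<Longrightarrow> compact S \<Longrightarrow> (\<And>x. x \<notin> S \<Longrightarrow> u x = 0) \<Longrightarrow>
       (\<integral>\<^sup>+x. ennreal (norm (V x *\<^sub>R u x) powr p) \<partial>lborel)
         \<le> ennreal c * (\<integral>\<^sup>+x. ennreal (norm (V x *\<^sub>R u x - (\<Sum>b\<in>Basis. D2 b x)) powr p) \<partial>lborel)"
    proof (rule unbounded_potential_estimate[OF p(1), where C=C and 'a="real ^ 'n" and 'b=complex], goal_cases)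
      case (1 c)
      show ?case by (rule 1(1)[OF 1(2,3)])
    qed
    define c' where "c' = 3 powr p * (c + 1)"
    have c': "0 < c'" using c by (simp add: c'_def)
    show "\<exists>C::real. \<forall>u \<in> (test_functions :: (real ^ 'n \<Rightarrow> complex) set).
         Lp_norm lebesgue (ereal p) (laplacian u)
           + Lp_norm lebesgue (ereal p) (\<lambda>x. of_real (V x) * u x)
         \<le> ennreal C * Lp_norm lebesgue (ereal p) (\<lambda>x. - laplacian u x + of_real (V x) * u x)"
    proof (intro exI[of _ "c' powr (1 / p) + c powr (1 / p)"] ballI)
      fix u :: "real ^ 'n \<Rightarrow> complex" assume u: "u \<in> test_functions"
      note C2 = test_function_C2[OF u]
      define S where "S = closure {x. u x \<noteq> 0}"
      have S: "compact S" "\<And>x. x \<notin> S \<Longrightarrow> u x = 0"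
        using u closure_subset[of "{x. u x \<noteq> 0}"] by (auto simp: S_def test_functions_def)
      define L where "L = laplacian u"
      have Lsum: "L x = (\<Sum>b\<in>Basis. frechet_derivative (\<lambda>y. frechet_derivative u (at y) b) (at x) b)" for x
        by (simp add: L_def laplacian_def)
      have cu: "continuous_on UNIV u" using C2 by (simp add: C2_with_def)
      have cL: "continuous_on UNIV L" unfolding Lsum[abs_def] using C2 by (intro continuous_on_sum) (auto simp: C2_with_def)
      have [measurable]: "u \<in> borel_measurable borel" "L \<in> borel_measurable borel"
        using cu cL by (auto intro: borel_measurable_continuous_onI)
      define I where "I f = (\<integral>\<^sup>+x. ennreal (norm (f x) powr p) \<partial>lborel)" for f :: "real ^ 'n \<Rightarrow> complex"
      \<comment> \<open>Passing to the completed measure and from \<open>V\<close> to its Borel representative changes no norm.\<close>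
      have leb: "(\<integral>\<^sup>+x. ennreal (norm (f (V x) x) powr p) \<partial>lebesgue) = I (\<lambda>x. f (U x) x)" for f :: "real \<Rightarrow> real ^ 'n \<Rightarrow> complex"
        unfolding I_def nn_integral_completion by (rule nn_integral_cong_AE) (use VU in \<open>eventually_elim, simp\<close>)
      define F where "F = I (\<lambda>x. - L x + of_real (U x) * u x)"
      have pot: "I (\<lambda>x. of_real (U x) * u x) \<le> ennreal c * F"
        using est[OF Um U0 iU C C2 S] unfolding I_def F_def Lsum[symmetric] by (simp add: scaleR_conv_of_real)
      \<comment> \<open>The Laplacian is the difference of \<open>U u\<close> and the right-hand side.\<close>
      have lap: "I L \<le> ennreal c' * F"
      proof -
        have "I L \<le> (\<integral>\<^sup>+x. ennreal (3 powr p) * (ennreal (norm (of_real (U x) * u x) powr p) + ennreal (norm (- L x + of_real (U x) * u x) powr p)) \<partial>lborel)"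
          unfolding I_def
        proof (intro nn_integral_mono)
          fix x
          have "L x = of_real (U x) * u x - (- L x + of_real (U x) * u x)" by simp
          also have "norm \<dots> \<le> norm (of_real (U x) * u x) + norm (- L x + of_real (U x) * u x)" by (rule norm_triangle_ineq4)
          finally have "norm (L x) powr p \<le> (norm (of_real (U x) * u x) + norm (- L x + of_real (U x) * u x)) powr p"
            using p by (intro powr_mono2) auto
          also have "\<dots> \<le> 3 powr p * (norm (of_real (U x) * u x) powr p + norm (- L x + of_real (U x) * u x) powr p)"
            using p by (intro powr_sum2_le) auto
          finally have "ennreal (norm (L x) powr p) \<le> ennreal (3 powr p * (norm (of_real (U x) * u x) powr p + norm (- L x + of_real (U x) * u x) powr p))"
            by (rule ennreal_leI)
          then show "ennreal (norm (L x) powr p) \<le> ennreal (3 powr p) * (ennreal (norm (of_real (U x) * u x) powr p) + ennreal (norm (- L x + of_real (U x) * u x) powr p))"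
            by (simp only: ennreal_mult'[of "3 powr p"] powr_ge_zero ennreal_plus)
        qed
        also have "\<dots> = ennreal (3 powr p) * (I (\<lambda>x. of_real (U x) * u x) + F)"
          unfolding I_def F_def by (subst nn_integral_cmult, measurable) (subst nn_integral_add, auto)
        also have "\<dots> \<le> ennreal (3 powr p) * (ennreal c * F + F)" by (intro mult_left_mono add_right_mono pot) auto
        also have "ennreal c * F + F = ennreal (c + 1) * F" using c by (simp add: distrib_right)
        finally show ?thesis unfolding c'_def using c by (simp add: ennreal_mult' mult.assoc)
      qed
      have N2: "Lp_norm lebesgue (ereal p) (\<lambda>x. of_real (V x) * u x) \<le> ennreal (c powr (1 / p)) * Lp_norm lebesgue (ereal p) (\<lambda>x. - laplacian u x + of_real (V x) * u x)"
        using pot p c leb[of "\<lambda>v x. of_real v * u x"] leb[of "\<lambda>v x. - L x + of_real v * u x"]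
        by (intro Lp_norm_le_of_nn_integral_le) (auto simp: F_def L_def)
      have N1: "Lp_norm lebesgue (ereal p) (laplacian u) \<le> ennreal (c' powr (1 / p)) * Lp_norm lebesgue (ereal p) (\<lambda>x. - laplacian u x + of_real (V x) * u x)"
        using lap p c' leb[of "\<lambda>v. L"] leb[of "\<lambda>v x. - L x + of_real v * u x"]
        by (intro Lp_norm_le_of_nn_integral_le) (auto simp: F_def L_def)
      show "Lp_norm lebesgue (ereal p) (laplacian u) + Lp_norm lebesgue (ereal p) (\<lambda>x. of_real (V x) * u x)
         \<le> ennreal (c' powr (1 / p) + c powr (1 / p)) * Lp_norm lebesgue (ereal p) (\<lambda>x. - laplacian u x + of_real (V x) * u x)"
        using add_mono[OF N1 N2] by (simp add: distrib_right)
    qed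
  qed
qed

end
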